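(* Let $\mathcal F=\{(S_\alpha,P_\alpha):\alpha\in\Lambda\}$ be a commuting family of $\Gamma$-isometries on a Hilbert space $\mathcal H$. Then: (1) There exists a commuting family $\mathcal G=\{(R_\alpha,U_\alpha):\alpha\in\Lambda\}$ of $\Gamma$-unitaries acting on a Hilbert space $\mathcal K$ containing $\mathcal H$ such that each pair $(R_\alpha,U_\alpha)$ is an extension of $(S_\alpha,P_\alpha)$ (i.e. $\mathcal H$ is invariant under $R_\alpha,U_\alpha$ and $R_\alpha|_{\mathcal H}=S_\alpha$, $U_\alpha|_{\mathcal H}=P_\alpha$). Moreover, $\mathcal G$ is the minimal extension of $\mathcal F$ in the sense that $\mathcal K$ is the smallest subspace containing $\mathcal H$ that is reducing for each $R_\alpha$ and $U_\alpha$. In fact, $$\mathcal K=\overline{\operatorname{span}}\{U_{\alpha_1}^{m_1}U_{\alpha_2}^{m_2}\cdots U_{\alpha_n}^{m_n}h: h\in\mathcal H,\ n\in\mathbb N,\ \alpha_j\in\Lambda,\ m_j\in\mathbb Z\text{ for }1\le j\le n\}.$$ Moreover, any $X\in\mathcal B(\mathcal H)$ commutes with $\mathcal F$ (i.e. with all $S_\alpha,P_\alpha$) if and only if $X$ has a unique norm preserving extension $Y$ acting on $\mathcal K$ commuting with $\mathcal G$ (i.e. with all $R_\alpha,U_\alpha$). (2) With $\mathcal G$ and $\mathcal K$ as in (1), an operator $X\in\mathcal B(\mathcal H)$ is in $\mathcal T(\mathcal F)$ if and only if there exists $Y\in\mathcal B(\mathcal K)$ in the commutant of the von Neumann algebra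 generated by $\{R_\alpha,U_\alpha:\alpha\in\Lambda\}$ such that $X=P_{\mathcal H}Y|_{\mathcal H}$, where $P_{\mathcal H}$ is the orthogonal projection of $\mathcal K$ onto $\mathcal H$. (3) With $\mathcal G$ and $\mathcal K$ as in (1), let $\mathcal C^*(\mathcal F)$ and $\mathcal C^*(\mathcal G)$ denote the unital $C^*$-algebras generated by $\{S_\alpha,P_\alpha:\alpha\in\Lambda\}$ and $\{R_\alpha,U_\alpha:\alpha\in\Lambda\}$, respectively, and let $\mathcal I(\mathcal F)$ denote the closed ideal of $\mathcal C^*(\mathcal F)$ generated by all the commutators $XY-YX$ with $X,Y\in\mathcal C^*(\mathcal F)\cap\mathcal T(\mathcal F)$. Then there exists a short exact sequence $$0\to\mathcal I(\mathcal F)\hookrightarrow\mathcal C^*(\mathcal F)\xrightarrow{\ \pi_0\ }\mathcal C^*(\mathcal G)\to0$$ with a completely isometric cross section, where $\pi_0:\mathcal C^*(\mathcal F)\to\mathcal C^*(\mathcal G)$ is the canonical unital $*$-homomorphism which satisfies $\pi_0(P_\alpha)=U_\alpha$ and $\pi_0(S_\alpha)=R_\alpha$ for all $\alpha\in\Lambda$.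
   Context: $\Gamma=\{(z_1+z_2,z_1z_2):|z_1|\le1,|z_2|\le1\}$ is the closed symmetrized bidisc, with distinguished boundary $b\Gamma=\{(z_1+z_2,z_1z_2):|z_1|=|z_2|=1\}$. A commuting pair $(R,U)$ of bounded operators is a $\Gamma$-unitary if $R$ and $U$ are normal and the joint spectrum $\sigma(R,U)$ is contained in $b\Gamma$. A commuting pair $(T,V)$ on a Hilbert space $\mathcal L$ is a $\Gamma$-isometry if there are a Hilbert space $\mathcal N\supseteq\mathcal L$ and a $\Gamma$-unitary $(R,U)$ on $\mathcal N$ leaving $\mathcal L$ invariant with $T=R|_{\mathcal L}$, $V=U|_{\mathcal L}$. A family $\{(S_\alpha,P_\alpha):\alpha\in\Lambda\}$ of $\Gamma$-isometries (in particular, of $\Gamma$-unitaries) on one Hilbert space is commuting if $\bigcup_{\alpha\in\Lambda}\{S_\alpha,P_\alpha\}$ is a commutative set of operators. For a commuting family $\mathcal F$ of $\Gamma$-isometries on $\mathcal H$, $\mathcal T(\mathcal F)$ is the set of all $X\in\mathcal B(\mathcal H)$ such that $S_\alpha^*XP_\alpha=XS_\alpha$ and $P_\alpha^*XP_\alpha=X$ for all $\alpha\in\Lambda$. A completely isometric cross section of $\pi_0$ is a completely isometric linear map $\rho_0:\mathcal C^*(\mathcal G)\to\mathcal C^*(\mathcal F)$ with $\pi_0\circ\rho_0=\mathrm{id}$. *)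

theory Defs
  imports
    "HOL-Analysis.Abstract_Metric_Spaces"
    "HOL-Algebra.Module"
    "HOL-Algebra.Subrings"
    "HOL-Algebra.Algebraic_Closure_Type"
begin

section \<open>Complex Hilbert spaces and their bounded operators\<close>

abbreviation complex_ring :: "complex ring" where
  "complex_ring \<equiv> ring_of_type_algebra"

text \<open>Hilbert spaces are carrier-based, so that Hilbert spaces can be quantified over inside a
  formula. The inherited ring fields \<open>mult\<close> and \<open>one\<close> carry no meaning, as usual for
  modules in \<open>HOL-Algebra\<close>. The inner product is linear in its first argument.\<close>

record 'a hilb = "(complex, 'a) module" +
  cinner :: "'a \<Rightarrow> 'a \<Rightarrow> complex"

definition hnorm :: "'a hilb \<Rightarrow> 'a \<Rightarrow> real" where
  "hnorm H x = sqrt (Re (cinner H x x))"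

text \<open>The locale \<open>Metric_space\<close> requires non-negativity and symmetry of the distance also off the
  carrier, hence the guard (likewise for \<open>op_dist\<close> below).\<close>

definition hdist :: "'a hilb \<Rightarrow> 'a \<Rightarrow> 'a \<Rightarrow> real" where
  "hdist H x y = (if x \<in> carrier H \<and> y \<in> carrier H then hnorm H (x \<ominus>\<^bsub>H\<^esub> y) else 0)"

definition norm_topology :: "'a hilb \<Rightarrow> 'a topology" where
  "norm_topology H = Metric_space.mtopology (carrier H) (hdist H)"

locale hilbert_space = Module.module complex_ring H for H :: "'a hilb" (structure) +
  assumes cinner_add_left:
      "\<lbrakk>x \<in> carrier H; y \<in> carrier H; z \<in> carrier H\<rbrakk>
        \<Longrightarrow> cinner H (x \<oplus> y) z = cinner H x z + cinner H y z"
    and cinner_smult_left: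
      "\<lbrakk>x \<in> carrier H; y \<in> carrier H\<rbrakk> \<Longrightarrow> cinner H (c \<odot> x) y = c * cinner H x y"
    and cinner_commute:
      "\<lbrakk>x \<in> carrier H; y \<in> carrier H\<rbrakk> \<Longrightarrow> cinner H x y = cnj (cinner H y x)"
    and cinner_positive:
      "\<lbrakk>x \<in> carrier H; x \<noteq> \<zero>\<rbrakk> \<Longrightarrow> 0 < Re (cinner H x x)"
    and complete: "Metric_space.mcomplete (carrier H) (hdist H)"

definition closed_subspace :: "'a hilb \<Rightarrow> 'a set \<Rightarrow> bool" where
  "closed_subspace H M \<longleftrightarrow> submodule M complex_ring H \<and> closedin (norm_topology H) M"

definition linear_span :: "'a hilb \<Rightarrow> 'a set \<Rightarrow> 'a set" where
  "linear_span H A = (\<lambda>M. submodule M complex_ring H) hull A"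

definition closed_linear_span :: "'a hilb \<Rightarrow> 'a set \<Rightarrow> 'a set" where
  "closed_linear_span H A = norm_topology H closure_of linear_span H A"

definition orth_proj :: "'a hilb \<Rightarrow> 'a set \<Rightarrow> 'a \<Rightarrow> 'a" where
  "orth_proj H M x = (THE y. y \<in> M \<and> (\<forall>z\<in>M. cinner H (x \<ominus>\<^bsub>H\<^esub> y) z = 0))"

text \<open>Operators are extensional functions on the carrier, so that equality of operators is
  equality of functions.\<close>

definition bounded_ops :: "'a hilb \<Rightarrow> ('a \<Rightarrow> 'a) set" where
  "bounded_ops H = {T \<in> carrier H \<rightarrow>\<^sub>E carrier H.
     (\<forall>x\<in>carrier H. \<forall>y\<in>carrier H. T (x \<oplus>\<^bsub>H\<^esub> y) = T x \<oplus>\<^bsub>H\<^esub> T y) \<and>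
     (\<forall>c. \<forall>x\<in>carrier H. T (c \<odot>\<^bsub>H\<^esub> x) = c \<odot>\<^bsub>H\<^esub> T x) \<and>
     (\<exists>b. \<forall>x\<in>carrier H. hnorm H (T x) \<le> b * hnorm H x)}"

definition BL :: "'a hilb \<Rightarrow> (complex, 'a \<Rightarrow> 'a) module" where
  "BL H = \<lparr>carrier = bounded_ops H,
     monoid.mult = compose (carrier H),
     one = (\<lambda>x\<in>carrier H. x),
     zero = (\<lambda>x\<in>carrier H. \<zero>\<^bsub>H\<^esub>),
     add = (\<lambda>S T. \<lambda>x\<in>carrier H. S x \<oplus>\<^bsub>H\<^esub> T x),
     module.smult = (\<lambda>c T. \<lambda>x\<in>carrier H. c \<odot>\<^bsub>H\<^esub> T x)\<rparr>"

definition op_norm :: "'a hilb \<Rightarrow> ('a \<Rightarrow> 'a) \<Rightarrow> real" where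
  "op_norm H T = (SUP x\<in>{x \<in> carrier H. hnorm H x \<le> 1}. hnorm H (T x))"

definition op_dist :: "'a hilb \<Rightarrow> ('a \<Rightarrow> 'a) \<Rightarrow> ('a \<Rightarrow> 'a) \<Rightarrow> real" where
  "op_dist H S T =
     (if S \<in> carrier (BL H) \<and> T \<in> carrier (BL H) then op_norm H (S \<ominus>\<^bsub>BL H\<^esub> T) else 0)"

definition op_norm_topology :: "'a hilb \<Rightarrow> ('a \<Rightarrow> 'a) topology" where
  "op_norm_topology H = Metric_space.mtopology (carrier (BL H)) (op_dist H)"

definition weak_op_topology :: "'a hilb \<Rightarrow> ('a \<Rightarrow> 'a) topology" where
  "weak_op_topology H = topology_generated_by
     {{T \<in> carrier (BL H). cinner H (T x) y \<in> W} |x y W.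
        x \<in> carrier H \<and> y \<in> carrier H \<and> open W}"

definition adj :: "'a hilb \<Rightarrow> ('a \<Rightarrow> 'a) \<Rightarrow> ('a \<Rightarrow> 'a)" where
  "adj H T = (THE A. A \<in> carrier (BL H) \<and>
     (\<forall>x\<in>carrier H. \<forall>y\<in>carrier H. cinner H (A x) y = cinner H x (T y)))"

definition commuting_ops :: "'a hilb \<Rightarrow> ('a \<Rightarrow> 'a) set \<Rightarrow> bool" where
  "commuting_ops H A \<longleftrightarrow> (\<forall>S\<in>A. \<forall>T\<in>A. S \<otimes>\<^bsub>BL H\<^esub> T = T \<otimes>\<^bsub>BL H\<^esub> S)"

definition normal_op :: "'a hilb \<Rightarrow> ('a \<Rightarrow> 'a) \<Rightarrow> bool" where
  "normal_op H T \<longleftrightarrow>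
     T \<in> carrier (BL H) \<and> adj H T \<otimes>\<^bsub>BL H\<^esub> T = T \<otimes>\<^bsub>BL H\<^esub> adj H T"

definition reducing :: "'a hilb \<Rightarrow> ('a \<Rightarrow> 'a) \<Rightarrow> 'a set \<Rightarrow> bool" where
  "reducing H T M \<longleftrightarrow> T ` M \<subseteq> M \<and> adj H T ` M \<subseteq> M"

definition isometric_embedding :: "'a hilb \<Rightarrow> 'b hilb \<Rightarrow> ('a \<Rightarrow> 'b) \<Rightarrow> bool" where
  "isometric_embedding H K J \<longleftrightarrow> J \<in> carrier H \<rightarrow> carrier K \<and>
     (\<forall>x\<in>carrier H. \<forall>y\<in>carrier H. J (x \<oplus>\<^bsub>H\<^esub> y) = J x \<oplus>\<^bsub>K\<^esub> J y) \<and>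
     (\<forall>c. \<forall>x\<in>carrier H. J (c \<odot>\<^bsub>H\<^esub> x) = c \<odot>\<^bsub>K\<^esub> J x) \<and>
     (\<forall>x\<in>carrier H. \<forall>y\<in>carrier H. cinner K (J x) (J y) = cinner H x y)"

text \<open>\<open>T\<close> extends \<open>S\<close> when \<open>H\<close> is regarded as a subspace of \<open>K\<close> by means of \<open>J\<close>; in particular
  \<open>J ` carrier H\<close> is then invariant under \<open>T\<close>.\<close>

definition extends_op :: "'a hilb \<Rightarrow> ('a \<Rightarrow> 'b) \<Rightarrow> ('b \<Rightarrow> 'b) \<Rightarrow> ('a \<Rightarrow> 'a) \<Rightarrow> bool" where
  "extends_op H J T S \<longleftrightarrow> (\<forall>h\<in>carrier H. T (J h) = J (S h))"


section \<open>Operator algebras\<close>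

definition unital_star_subalgebra :: "'a hilb \<Rightarrow> ('a \<Rightarrow> 'a) set \<Rightarrow> bool" where
  "unital_star_subalgebra H A \<longleftrightarrow> subring A (BL H) \<and>
     (\<forall>c. \<forall>T\<in>A. c \<odot>\<^bsub>BL H\<^esub> T \<in> A) \<and> (\<forall>T\<in>A. adj H T \<in> A)"

definition Cstar :: "'a hilb \<Rightarrow> ('a \<Rightarrow> 'a) set \<Rightarrow> ('a \<Rightarrow> 'a) set" where
  "Cstar H A =
     (\<lambda>B. unital_star_subalgebra H B \<and> closedin (op_norm_topology H) B) hull A"

definition vN_algebra :: "'a hilb \<Rightarrow> ('a \<Rightarrow> 'a) set \<Rightarrow> ('a \<Rightarrow> 'a) set" where
  "vN_algebra H A =
     (\<lambda>B. unital_star_subalgebra H B \<and> closedin (weak_op_topology H) B) hull A"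

definition commutant :: "'a hilb \<Rightarrow> ('a \<Rightarrow> 'a) set \<Rightarrow> ('a \<Rightarrow> 'a) set" where
  "commutant H A =
     {Y \<in> carrier (BL H). \<forall>T\<in>A. Y \<otimes>\<^bsub>BL H\<^esub> T = T \<otimes>\<^bsub>BL H\<^esub> Y}"

abbreviation subalg :: "'a hilb \<Rightarrow> ('a \<Rightarrow> 'a) set \<Rightarrow> (complex, 'a \<Rightarrow> 'a) module" where
  "subalg H A \<equiv> BL H\<lparr>carrier := A\<rparr>"

definition closed_ideal ::
    "'a hilb \<Rightarrow> ('a \<Rightarrow> 'a) set \<Rightarrow> ('a \<Rightarrow> 'a) set \<Rightarrow> ('a \<Rightarrow> 'a) set" where
  "closed_ideal H A C =
     (\<lambda>I. ideal I (subalg H A) \<and> closedin (op_norm_topology H) I) hull C"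

definition unital_star_hom ::
    "'a hilb \<Rightarrow> ('a \<Rightarrow> 'a) set \<Rightarrow> 'b hilb \<Rightarrow> ('b \<Rightarrow> 'b) set \<Rightarrow> (('a \<Rightarrow> 'a) \<Rightarrow> ('b \<Rightarrow> 'b)) \<Rightarrow> bool"
  where
  "unital_star_hom H A K B \<phi> \<longleftrightarrow>
     \<phi> \<in> ring_hom (subalg H A) (subalg K B) \<and>
     (\<forall>c. \<forall>T\<in>A. \<phi> (c \<odot>\<^bsub>BL H\<^esub> T) = c \<odot>\<^bsub>BL K\<^esub> \<phi> T) \<and>
     (\<forall>T\<in>A. \<phi> (adj H T) = adj K (\<phi> T))"

text \<open>The norm of the \<open>n\<close> by \<open>n\<close> operator matrix \<open>A\<close>, acting on the \<open>n\<close>-fold direct sum of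
  \<open>H\<close> with itself.\<close>

definition matrix_norm :: "'a hilb \<Rightarrow> nat \<Rightarrow> (nat \<Rightarrow> nat \<Rightarrow> 'a \<Rightarrow> 'a) \<Rightarrow> real" where
  "matrix_norm H n A =
     (SUP x\<in>{x \<in> {..<n} \<rightarrow>\<^sub>E carrier H. (\<Sum>j<n. (hnorm H (x j))\<^sup>2) \<le> 1}.
        sqrt (\<Sum>i<n. (hnorm H (finsum H (\<lambda>j. A i j (x j)) {..<n}))\<^sup>2))"

definition completely_isometric_linear ::
    "'a hilb \<Rightarrow> ('a \<Rightarrow> 'a) set \<Rightarrow> 'b hilb \<Rightarrow> ('b \<Rightarrow> 'b) set \<Rightarrow> (('a \<Rightarrow> 'a) \<Rightarrow> ('b \<Rightarrow> 'b)) \<Rightarrow> bool"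
  where
  "completely_isometric_linear H A K B \<rho> \<longleftrightarrow> \<rho> \<in> A \<rightarrow> B \<and>
     (\<forall>S\<in>A. \<forall>T\<in>A. \<rho> (S \<oplus>\<^bsub>BL H\<^esub> T) = \<rho> S \<oplus>\<^bsub>BL K\<^esub> \<rho> T) \<and>
     (\<forall>c. \<forall>T\<in>A. \<rho> (c \<odot>\<^bsub>BL H\<^esub> T) = c \<odot>\<^bsub>BL K\<^esub> \<rho> T) \<and>
     (\<forall>n M. (\<forall>i<n. \<forall>j<n. M i j \<in> A) \<longrightarrow>
        matrix_norm K n (\<lambda>i j. \<rho> (M i j)) = matrix_norm H n M)"


section \<open>Joint spectrum, \<open>\<Gamma>\<close>-unitaries and \<open>\<Gamma>\<close>-isometries\<close>

text \<open>Exactness of the Koszul complex of the commuting pair \<open>(A, B)\<close>, i.e. of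
  \<open>0 \<longrightarrow> H \<longrightarrow> H \<oplus> H \<longrightarrow> H \<longrightarrow> 0\<close> with the maps \<open>x \<mapsto> (A x, B x)\<close> and \<open>(y, z) \<mapsto> A z - B y\<close>.\<close>

definition koszul_exact :: "'a hilb \<Rightarrow> ('a \<Rightarrow> 'a) \<Rightarrow> ('a \<Rightarrow> 'a) \<Rightarrow> bool" where
  "koszul_exact H A B \<longleftrightarrow>
     (\<forall>x\<in>carrier H. A x = \<zero>\<^bsub>H\<^esub> \<and> B x = \<zero>\<^bsub>H\<^esub> \<longrightarrow> x = \<zero>\<^bsub>H\<^esub>) \<and>
     (\<forall>y\<in>carrier H. \<forall>z\<in>carrier H. A z \<ominus>\<^bsub>H\<^esub> B y = \<zero>\<^bsub>H\<^esub> \<longrightarrow>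
        (\<exists>x\<in>carrier H. y = A x \<and> z = B x)) \<and>
     (\<forall>w\<in>carrier H. \<exists>y\<in>carrier H. \<exists>z\<in>carrier H. w = A z \<ominus>\<^bsub>H\<^esub> B y)"

text \<open>The Taylor joint spectrum.\<close>

definition joint_spectrum :: "'a hilb \<Rightarrow> ('a \<Rightarrow> 'a) \<Rightarrow> ('a \<Rightarrow> 'a) \<Rightarrow> (complex \<times> complex) set" where
  "joint_spectrum H A B = {(l, m). \<not> koszul_exact H
     (A \<ominus>\<^bsub>BL H\<^esub> (l \<odot>\<^bsub>BL H\<^esub> \<one>\<^bsub>BL H\<^esub>)) (B \<ominus>\<^bsub>BL H\<^esub> (m \<odot>\<^bsub>BL H\<^esub> \<one>\<^bsub>BL H\<^esub>))}"

definition b\<Gamma> :: "(complex \<times> complex) set" where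
  "b\<Gamma> = {(z1 + z2, z1 * z2) |z1 z2. cmod z1 = 1 \<and> cmod z2 = 1}"

definition \<Gamma>_unitary :: "'a hilb \<Rightarrow> ('a \<Rightarrow> 'a) \<Rightarrow> ('a \<Rightarrow> 'a) \<Rightarrow> bool" where
  "\<Gamma>_unitary H R U \<longleftrightarrow> hilbert_space H \<and> commuting_ops H {R, U} \<and>
     normal_op H R \<and> normal_op H U \<and> joint_spectrum H R U \<subseteq> b\<Gamma>"

text \<open>The type argument says in which type the carrier of the Hilbert space \<open>N\<close> lives. When
  \<open>'n\<close> is a free type variable in an assumption of a theorem, the theorem covers all spaces \<open>N\<close>.\<close>

definition \<Gamma>_isometry ::
    "'n itself \<Rightarrow> 'a hilb \<Rightarrow> ('a \<Rightarrow> 'a) \<Rightarrow> ('a \<Rightarrow> 'a) \<Rightarrow> bool" where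
  "\<Gamma>_isometry (_ :: 'n itself) L T V \<longleftrightarrow> hilbert_space L \<and>
     T \<in> carrier (BL L) \<and> V \<in> carrier (BL L) \<and> commuting_ops L {T, V} \<and>
     (\<exists>(N :: 'n hilb) J R U. isometric_embedding L N J \<and> \<Gamma>_unitary N R U \<and>
        extends_op L J R T \<and> extends_op L J U V)"


section \<open>Families indexed by \<open>\<Lambda>\<close>\<close>

definition family_ops :: "'i set \<Rightarrow> ('i \<Rightarrow> 'a \<Rightarrow> 'a) \<Rightarrow> ('i \<Rightarrow> 'a \<Rightarrow> 'a) \<Rightarrow> ('a \<Rightarrow> 'a) set" where
  "family_ops \<Lambda> S P = (\<Union>\<alpha>\<in>\<Lambda>. {S \<alpha>, P \<alpha>})"

definition Toeplitz_ops ::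
    "'a hilb \<Rightarrow> 'i set \<Rightarrow> ('i \<Rightarrow> 'a \<Rightarrow> 'a) \<Rightarrow> ('i \<Rightarrow> 'a \<Rightarrow> 'a) \<Rightarrow> ('a \<Rightarrow> 'a) set" where
  "Toeplitz_ops H \<Lambda> S P = {T \<in> carrier (BL H). \<forall>\<alpha>\<in>\<Lambda>.
     adj H (S \<alpha>) \<otimes>\<^bsub>BL H\<^esub> T \<otimes>\<^bsub>BL H\<^esub> P \<alpha> = T \<otimes>\<^bsub>BL H\<^esub> S \<alpha> \<and>
     adj H (P \<alpha>) \<otimes>\<^bsub>BL H\<^esub> T \<otimes>\<^bsub>BL H\<^esub> P \<alpha> = T}"

definition commutator_ideal ::
    "'a hilb \<Rightarrow> 'i set \<Rightarrow> ('i \<Rightarrow> 'a \<Rightarrow> 'a) \<Rightarrow> ('i \<Rightarrow> 'a \<Rightarrow> 'a) \<Rightarrow> ('a \<Rightarrow> 'a) set" where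
  "commutator_ideal H \<Lambda> S P =
     (let C = Cstar H (family_ops \<Lambda> S P); \<T> = Toeplitz_ops H \<Lambda> S P
      in closed_ideal H C
           {A \<otimes>\<^bsub>BL H\<^esub> B \<ominus>\<^bsub>BL H\<^esub> B \<otimes>\<^bsub>BL H\<^esub> A |A B. A \<in> C \<inter> \<T> \<and> B \<in> C \<inter> \<T>})"

text \<open>The word \<open>[(\<alpha>\<^sub>1, m\<^sub>1), \<dots>, (\<alpha>\<^sub>n, m\<^sub>n)]\<close> stands for the product of the \<open>m\<^sub>j\<close>-th powers
  of the (invertible) operators \<open>U \<alpha>\<^sub>j\<close>; the empty word gives the identity.\<close>

definition word_op :: "'a hilb \<Rightarrow> ('i \<Rightarrow> 'a \<Rightarrow> 'a) \<Rightarrow> ('i \<times> int) list \<Rightarrow> 'a \<Rightarrow> 'a" where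
  "word_op K U w =
     foldr (\<lambda>(\<alpha>, m) T. (U \<alpha> [^]\<^bsub>BL K\<^esub> m) \<otimes>\<^bsub>BL K\<^esub> T) w \<one>\<^bsub>BL K\<^esub>"

text \<open>The space \<open>H\<close> sits in \<open>K\<close> through the isometric embedding \<open>J\<close>. Up to unitary equivalence the
  carrier of \<open>K\<close> can always be found in the type \<open>('i \<times> int) list \<Rightarrow> 'h\<close>: a vector \<open>k\<close> is determined
  by the function that sends a word \<open>w\<close> over \<open>\<Lambda>\<close> to the component in \<open>H\<close> of
  \<open>adj K (word_op K U w) k\<close>.\<close>

definition minimal_\<Gamma>_unitary_extension ::
    "'h hilb \<Rightarrow> 'i set \<Rightarrow> ('i \<Rightarrow> 'h \<Rightarrow> 'h) \<Rightarrow> ('i \<Rightarrow> 'h \<Rightarrow> 'h) \<Rightarrow>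
     'k hilb \<Rightarrow> ('h \<Rightarrow> 'k) \<Rightarrow> ('i \<Rightarrow> 'k \<Rightarrow> 'k) \<Rightarrow> ('i \<Rightarrow> 'k \<Rightarrow> 'k) \<Rightarrow> bool" where
  "minimal_\<Gamma>_unitary_extension H \<Lambda> S P K J R U \<longleftrightarrow>
     hilbert_space K \<and> isometric_embedding H K J \<and>
     (\<forall>\<alpha>\<in>\<Lambda>. \<Gamma>_unitary K (R \<alpha>) (U \<alpha>)) \<and> commuting_ops K (family_ops \<Lambda> R U) \<and>
     (\<forall>\<alpha>\<in>\<Lambda>. extends_op H J (R \<alpha>) (S \<alpha>) \<and> extends_op H J (U \<alpha>) (P \<alpha>)) \<and>
     (\<forall>M. closed_subspace K M \<and> J ` carrier H \<subseteq> M \<and>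
          (\<forall>T\<in>family_ops \<Lambda> R U. reducing K T M) \<longrightarrow> M = carrier K)"

end

theory Submission
  imports Defs
begin

text \<open>A commuting pair \<open>(R, U)\<close> is a \<open>\<Gamma>\<close>-unitary if and only if \<open>U\<close> is unitary, \<open>R = R\<^sup>* U\<close> and
  \<open>\<parallel>R\<parallel> \<le> 2\<close>; approximate joint eigenvectors give one direction, a coercivity estimate for the Koszul
  complex the other. Hence a \<open>\<Gamma>\<close>-isometry \<open>(S, P)\<close> satisfies \<open>P\<^sup>* P = 1\<close> and \<open>S = S\<^sup>* P\<close>, and the
  extension space consists of the bounded families \<open>F\<close> indexed by multi-exponents with
  \<open>F m = P\<^sub>\<alpha>\<^sup>* F (m + \<alpha>)\<close>. Conversely, minimality says that for every vector \<open>k\<close> of the extension space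
  and large \<open>m\<close> the vector \<open>U\<^sup>m k\<close> is close to \<open>H\<close>, so that operators on the two spaces can be
  compared by means of the strong limits of \<open>U\<^sup>-\<^sup>m J A J\<^sup>* U\<^sup>m\<close> along the multi-exponents: these lift
  Toeplitz operators to the commutant and define \<open>\<pi>\<^sub>0\<close>, for which compression to \<open>H\<close> is a completely
  isometric cross section. The kernel of \<open>\<pi>\<^sub>0\<close> is found by showing that the operators differing from
  the compression of their image by an element of the ideal form a closed left module over the
  generators.\<close>

text \<open>The two identities U^* U = 1 and R = R^* U carry the whole theory: they give R^* = U^*
  R, so commuting with R and U forces commuting with both adjoints. To extract them from the joint
  spectrum, let V be the operator that is to vanish. An approximate eigenvector of V^* V at the top
  of its numerical range is sought that is one for U as well, and also for R once U is known to be
  unitary; the value of V is then computed at a point of the distinguished boundary. Since \<Lambda>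
  may be uncountable, limits run along the directed set of finite multi-exponents. Compression to H
  is not multiplicative, and this shapes the last part. Left multiplication by U_a or R_a becomes
  right multiplication of the compression by P_a or S_a, while left multiplication by the adjoints
  remains left multiplication by P_a^* or S_a^*. Hence the failure of multiplicativity at a
  generator is a commutator of two Toeplitz operators, and at the adjoint of a generator it is
  zero.\<close>

abbreviation (input) \<B> :: "'a hilb \<Rightarrow> ('a \<Rightarrow> 'a) set" where
 "\<B> H \<equiv> carrier (BL H)"

section \<open>Complex Hilbert spaces\<close>

lemma complex_ring_simps [simp]:
 "carrier complex_ring = UNIV" "a \<otimes>\<^bsub>complex_ring\<^esub> b = a * b" "\<one>\<^bsub>complex_ring\<^esub> = 1"
 "\<zero>\<^bsub>complex_ring\<^esub> = 0" "a \<oplus>\<^bsub>complex_ring\<^esub> b = a + b"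
 by (simp_all add: ring_of_type_algebra_def)

lemma cring_complex_ring: "cring complex_ring"
 by (rule cring_from_type_algebra)

lemma uminus_complex_ring [simp]: "\<ominus>\<^bsub>complex_ring\<^esub> a = - a"
proof -
 interpret cring complex_ring by (rule cring_complex_ring)
 show ?thesis
  by (rule minus_equality) simp_all
qed

context hilbert_space
begin

lemma smult_simps [simp]:
 assumes "x \<in> carrier H"
 shows "1 \<odot> x = x" "0 \<odot> x = \<zero>" "a \<odot> (b \<odot> x) = (a * b) \<odot> x"
 using assms smult_one[of x] smult_l_null[of x] smult_assoc1[of a b x] by simp_all

lemma smult_zero_right [simp]: "c \<odot> \<zero> = \<zero>"
 using smult_r_null[of c] by simp

lemma minus_eq_add_smult: "x \<in> carrier H \<Longrightarrow> y \<in> carrier H \<Longrightarrow> x \<ominus> y = x \<oplus> (- 1) \<odot> y"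
 using smult_l_minus[of 1 y] by (simp add: a_minus_def)

lemma cinner_add_right [simp]:
 "x \<in> carrier H \<Longrightarrow> y \<in> carrier H \<Longrightarrow> z \<in> carrier H \<Longrightarrow>
  cinner H z (x \<oplus> y) = cinner H z x + cinner H z y"
 using cinner_commute[of z "x \<oplus> y"] cinner_commute[of z x] cinner_commute[of z y] cinner_add_left[of x y z]
 by simp

lemma cinner_smult_right [simp]:
 "x \<in> carrier H \<Longrightarrow> y \<in> carrier H \<Longrightarrow> cinner H x (c \<odot> y) = cnj c * cinner H x y"
 using cinner_commute[of x "c \<odot> y"] cinner_commute[of x y] cinner_smult_left[of y x c] by simp

lemmas cinner_left [simp] = cinner_add_left cinner_smult_left

lemma cinner_minus_left [simp]:
 "x \<in> carrier H \<Longrightarrow> y \<in> carrier H \<Longrightarrow> z \<in> carrier H \<Longrightarrow>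
  cinner H (x \<ominus> y) z = cinner H x z - cinner H y z"
 by (simp add: minus_eq_add_smult)

lemma cinner_minus_right [simp]:
 "x \<in> carrier H \<Longrightarrow> y \<in> carrier H \<Longrightarrow> z \<in> carrier H \<Longrightarrow>
  cinner H z (x \<ominus> y) = cinner H z x - cinner H z y"
 by (simp add: minus_eq_add_smult)

lemma cinner_zero_left [simp]: "z \<in> carrier H \<Longrightarrow> cinner H \<zero> z = 0"
 using cinner_smult_left[of \<zero> z 0] by simp

lemma cinner_zero_right [simp]: "z \<in> carrier H \<Longrightarrow> cinner H z \<zero> = 0"
 using cinner_smult_right[of z \<zero> 0] by simp

lemma cinner_a_inv_left [simp]:
 "x \<in> carrier H \<Longrightarrow> z \<in> carrier H \<Longrightarrow> cinner H (\<ominus> x) z = - cinner H x z"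
 using cinner_minus_left[of \<zero> x z] by (simp add: a_minus_def)

lemma cinner_a_inv_right [simp]:
 "x \<in> carrier H \<Longrightarrow> z \<in> carrier H \<Longrightarrow> cinner H z (\<ominus> x) = - cinner H z x"
 using cinner_minus_right[of \<zero> x z] by (simp add: a_minus_def)

lemma cinner_finsum_left:
 "f \<in> A \<rightarrow> carrier H \<Longrightarrow> z \<in> carrier H \<Longrightarrow> cinner H (finsum H f A) z = (\<Sum>a\<in>A. cinner H (f a) z)"
proof (induction A rule: infinite_finite_induct)
 case (insert a A)
 then show ?case by (subst finsum_insert) auto
qed auto

lemma cinner_self_nonneg: "x \<in> carrier H \<Longrightarrow> 0 \<le> Re (cinner H x x)"
 using cinner_positive[of x] by (cases "x = \<zero>") auto

lemma hnorm_nonneg [simp]: "x \<in> carrier H \<Longrightarrow> 0 \<le> hnorm H x"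
 by (simp add: hnorm_def cinner_self_nonneg)

lemma hnorm_sq: "x \<in> carrier H \<Longrightarrow> (hnorm H x)\<^sup>2 = Re (cinner H x x)"
 by (simp add: hnorm_def cinner_self_nonneg)

lemma cinner_self: "x \<in> carrier H \<Longrightarrow> cinner H x x = of_real ((hnorm H x)\<^sup>2)"
 using cinner_commute[of x x] by (auto simp: hnorm_sq complex_eq_iff)

lemma hnorm_zero [simp]: "hnorm H \<zero> = 0"
 by (simp add: hnorm_def)

lemma hnorm_eq_0 [simp]: "x \<in> carrier H \<Longrightarrow> hnorm H x = 0 \<longleftrightarrow> x = \<zero>"
 using cinner_positive[of x] by (cases "x = \<zero>") (auto simp: hnorm_def)

lemma hnorm_smult [simp]: "x \<in> carrier H \<Longrightarrow> hnorm H (c \<odot> x) = cmod c * hnorm H x"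
proof -
 assume x: "x \<in> carrier H"
 have "cinner H (c \<odot> x) (c \<odot> x) = of_real ((cmod c)\<^sup>2) * of_real ((hnorm H x)\<^sup>2)"
  using x cinner_self[OF x] unfolding complex_norm_square by simp
 then have "cinner H (c \<odot> x) (c \<odot> x) = of_real ((cmod c * hnorm H x)\<^sup>2)"
  by (simp add: power_mult_distrib)
 then have "(hnorm H (c \<odot> x))\<^sup>2 = (cmod c * hnorm H x)\<^sup>2"
  using x by (simp only: hnorm_sq smult_closed UNIV_I complex_ring_simps Re_complex_of_real)
 then show ?thesis
  by (rule power2_eq_imp_eq) (use x in auto)
qed

lemma hnorm_a_inv [simp]: "x \<in> carrier H \<Longrightarrow> hnorm H (\<ominus> x) = hnorm H x"
 by (simp add: hnorm_def)

lemma hnorm_add_sq: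
 "x \<in> carrier H \<Longrightarrow> y \<in> carrier H \<Longrightarrow>
  (hnorm H (x \<oplus> y))\<^sup>2 = (hnorm H x)\<^sup>2 + 2 * Re (cinner H x y) + (hnorm H y)\<^sup>2"
 using cinner_commute[of y x] by (simp add: hnorm_sq)

lemma hnorm_minus_sq:
 "x \<in> carrier H \<Longrightarrow> y \<in> carrier H \<Longrightarrow>
  (hnorm H (x \<ominus> y))\<^sup>2 = (hnorm H x)\<^sup>2 - 2 * Re (cinner H x y) + (hnorm H y)\<^sup>2"
 using cinner_commute[of y x] by (simp add: hnorm_sq)

lemma minus_eq_zero_iff [simp]:
 "x \<in> carrier H \<Longrightarrow> y \<in> carrier H \<Longrightarrow> x \<ominus> y = \<zero> \<longleftrightarrow> x = y"
 using minus_equality[of x "\<ominus> y"] by (auto simp: a_minus_def r_neg)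

lemma minus_self [simp]: "x \<in> carrier H \<Longrightarrow> x \<ominus> x = \<zero>"
 by (subst minus_eq_zero_iff) simp_all

text \<open>The usual route to vector identities below: after pairing with z both sides are complex
  expressions, which the simplifier can normalise.\<close>

lemma vec_eqI:
 assumes "x \<in> carrier H" "y \<in> carrier H" "\<And>z. z \<in> carrier H \<Longrightarrow> cinner H x z = cinner H y z"
 shows "x = y"
proof -
 have "(hnorm H (x \<ominus> y))\<^sup>2 = 0"
  using assms by (simp add: hnorm_sq)
 then have "x \<ominus> y = \<zero>" using assms by simp
 then show ?thesis using assms(1,2) by (simp only: minus_eq_zero_iff)
qed

lemma Cauchy_Schwarz:
 assumes x: "x \<in> carrier H" and y: "y \<in> carrier H"
 shows "cmod (cinner H x y) \<le> hnorm H x * hnorm H y"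
proof (cases "y = \<zero>")
 case False
 then have ny: "hnorm H y > 0" using hnorm_eq_0[OF y] hnorm_nonneg[OF y] by linarith
 \<comment> \<open>The coefficient of the projection of x onto y, which makes the square below as
   small as possible.\<close>
 define c where "c = cinner H x y / of_real ((hnorm H y)\<^sup>2)"
 have 1: "cnj c * cinner H x y = of_real ((cmod (cinner H x y))\<^sup>2 / (hnorm H y)\<^sup>2)"
  unfolding c_def using complex_norm_square[of "cinner H x y"] by (simp add: mult.commute)
 have 2: "cmod c = cmod (cinner H x y) / (hnorm H y)\<^sup>2"
  unfolding c_def by (simp add: norm_divide norm_power)
 have "0 \<le> (hnorm H (x \<ominus> c \<odot> y))\<^sup>2" by simp
 also have "\<dots> = (hnorm H x)\<^sup>2 - 2 * ((cmod (cinner H x y))\<^sup>2 / (hnorm H y)\<^sup>2) + (cmod c * hnorm H y)\<^sup>2"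
  using x y by (simp add: hnorm_minus_sq 1 del: of_real_divide)
 also have "\<dots> = (hnorm H x)\<^sup>2 - (cmod (cinner H x y))\<^sup>2 / (hnorm H y)\<^sup>2"
  unfolding 2 using ny by (simp add: field_simps power2_eq_square)
 finally have "(cmod (cinner H x y))\<^sup>2 \<le> (hnorm H x * hnorm H y)\<^sup>2"
  using ny by (simp add: field_simps power2_eq_square)
 then show ?thesis
  by (rule power2_le_imp_le) (use x y in auto)
qed (use x in auto)

lemma Re_cinner_le: "x \<in> carrier H \<Longrightarrow> y \<in> carrier H \<Longrightarrow> Re (cinner H x y) \<le> hnorm H x * hnorm H y"
 using Cauchy_Schwarz[of x y] complex_Re_le_cmod[of "cinner H x y"] by linarith

lemma hnorm_triangle:
 assumes x: "x \<in> carrier H" and y: "y \<in> carrier H"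
 shows "hnorm H (x \<oplus> y) \<le> hnorm H x + hnorm H y"
proof (rule power2_le_imp_le)
 show "(hnorm H (x \<oplus> y))\<^sup>2 \<le> (hnorm H x + hnorm H y)\<^sup>2"
  using Re_cinner_le[OF x y] by (simp add: hnorm_add_sq x y power2_sum)
qed (use x y in auto)

lemma hnorm_minus_commute: "x \<in> carrier H \<Longrightarrow> y \<in> carrier H \<Longrightarrow> hnorm H (x \<ominus> y) = hnorm H (y \<ominus> x)"
 by (rule power2_eq_imp_eq) (simp_all add: hnorm_sq algebra_simps)

lemma hnorm_triangle_minus:
 "x \<in> carrier H \<Longrightarrow> y \<in> carrier H \<Longrightarrow> hnorm H (x \<ominus> y) \<le> hnorm H x + hnorm H y"
 using hnorm_triangle[of x "\<ominus> y"] by (simp add: a_minus_def)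

lemma minus_add_minus:
 "x \<in> carrier H \<Longrightarrow> y \<in> carrier H \<Longrightarrow> z \<in> carrier H \<Longrightarrow> (x \<ominus> y) \<oplus> (y \<ominus> z) = x \<ominus> z"
 by (rule vec_eqI) auto

lemma hnorm_triangle_dist:
 "x \<in> carrier H \<Longrightarrow> y \<in> carrier H \<Longrightarrow> z \<in> carrier H \<Longrightarrow>
  hnorm H (x \<ominus> z) \<le> hnorm H (x \<ominus> y) + hnorm H (y \<ominus> z)"
 using hnorm_triangle[of "x \<ominus> y" "y \<ominus> z"] by (simp add: minus_add_minus)

lemma hnorm_triangle_diff:
 "x \<in> carrier H \<Longrightarrow> y \<in> carrier H \<Longrightarrow> hnorm H x \<le> hnorm H y + hnorm H (x \<ominus> y)"
 using hnorm_triangle[of y "x \<ominus> y"] minus_add_minus[of y \<zero> x]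
 by (metis M.add.inv_solve_right M.minus_closed M.minus_eq add.commute a_comm)

lemma abs_hnorm_diff_le:
 "x \<in> carrier H \<Longrightarrow> y \<in> carrier H \<Longrightarrow> \<bar>hnorm H x - hnorm H y\<bar> \<le> hnorm H (x \<ominus> y)"
 using hnorm_triangle_diff[of x y] hnorm_triangle_diff[of y x] by (simp add: hnorm_minus_commute)

lemma hnorm_finsum_le:
 "f \<in> A \<rightarrow> carrier H \<Longrightarrow> hnorm H (finsum H f A) \<le> (\<Sum>a\<in>A. hnorm H (f a))"
proof (induction A rule: infinite_finite_induct)
 case (insert a A)
 have "hnorm H (f a \<oplus> finsum H f A) \<le> hnorm H (f a) + hnorm H (finsum H f A)"
  by (rule hnorm_triangle) (use insert in auto)
 then show ?case using insert by (subst finsum_insert) auto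
qed auto

section \<open>Norm topology, closed sets by sequences, closed subspaces\<close>

lemma hilbert_metric: "Metric_space (carrier H) (hdist H)"
proof
 show "hdist H x y = hdist H y x" for x y
  by (auto simp: hdist_def hnorm_minus_commute)
 show "(hdist H x y = 0) = (x = y)" if "x \<in> carrier H" "y \<in> carrier H" for x y
  using that by (simp add: hdist_def)
 show "hdist H x z \<le> hdist H x y + hdist H y z"
  if "x \<in> carrier H" "y \<in> carrier H" "z \<in> carrier H" for x y z
  using that hnorm_triangle_dist[of x y z] by (simp add: hdist_def)
qed (simp add: hdist_def)

sublocale hm: Metric_space "carrier H" "hdist H" by (rule hilbert_metric)

lemma limitin_norm_iff:
 assumes "\<And>n. x n \<in> carrier H" "l \<in> carrier H"
 shows "limitin hm.mtopology x l sequentially \<longleftrightarrow> (\<lambda>n. hnorm H (x n \<ominus> l)) \<longlonglongrightarrow> 0"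
 using assms by (simp add: hm.limitin_metric_dist_null hdist_def)

lemma closedin_norm_iff:
 "closedin (norm_topology H) M \<longleftrightarrow> M \<subseteq> carrier H \<and>
  (\<forall>x l. (\<forall>n. x n \<in> M) \<longrightarrow> l \<in> carrier H \<longrightarrow> (\<lambda>n. hnorm H (x n \<ominus> l)) \<longlonglongrightarrow> 0 \<longrightarrow> l \<in> M)"
 (is "_ \<longleftrightarrow> _ \<and> ?R")
proof (cases "M \<subseteq> carrier H")
 case True
 have "(\<forall>\<sigma> l. range \<sigma> \<subseteq> M \<and> limitin hm.mtopology \<sigma> l sequentially \<longrightarrow> l \<in> M) \<longleftrightarrow> ?R"
 proof (intro iffI allI impI)
  fix x l
  assume *: "\<forall>\<sigma> l. range \<sigma> \<subseteq> M \<and> limitin hm.mtopology \<sigma> l sequentially \<longrightarrow> l \<in> M"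
   and x: "\<forall>n. x n \<in> M" "l \<in> carrier H" "(\<lambda>n. hnorm H (x n \<ominus> l)) \<longlonglongrightarrow> 0"
  have "limitin hm.mtopology x l sequentially"
   using x True by (subst limitin_norm_iff) auto
  then show "l \<in> M" using * x by blast
 next
  fix x l
  assume *: ?R and x: "range x \<subseteq> M \<and> limitin hm.mtopology x l sequentially"
  then have l: "l \<in> carrier H" using hm.limitin_mspace by blast
  then have "(\<lambda>n. hnorm H (x n \<ominus> l)) \<longlonglongrightarrow> 0"
   using x True by (subst limitin_norm_iff[symmetric]) auto
  then show "l \<in> M" using * x l by blast
 qed
 then show ?thesis
  unfolding norm_topology_def hm.metric_closedin_iff_sequentially_closed using True by blast
qed (auto simp: norm_topology_def hm.metric_closedin_iff_sequentially_closed)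

lemma Cauchy_convergent:
 assumes x: "\<And>n. x n \<in> carrier H"
  and C: "\<And>e. e > 0 \<Longrightarrow> \<exists>N. \<forall>m\<ge>N. \<forall>n\<ge>N. hnorm H (x m \<ominus> x n) < e"
 obtains l where "l \<in> carrier H" "(\<lambda>n. hnorm H (x n \<ominus> l)) \<longlonglongrightarrow> 0"
proof -
 have "hm.MCauchy x"
  unfolding hm.MCauchy_def using x C by (auto simp: hdist_def)
 then obtain l where l: "limitin hm.mtopology x l sequentially"
  using complete unfolding hm.mcomplete_def by blast
 then have "l \<in> carrier H" using hm.limitin_mspace by blast
 then show thesis using that[of l] l limitin_norm_iff[of x l] x by blast
qed

lemma closed_subspaceD:
 assumes "closed_subspace H M"
 shows "M \<subseteq> carrier H" "\<zero> \<in> M" "\<And>x y. x \<in> M \<Longrightarrow> y \<in> M \<Longrightarrow> x \<oplus> y \<in> M" "\<And>c x. x \<in> M \<Longrightarrow> c \<odot> x \<in> M"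
  "\<And>x l. (\<And>n. x n \<in> M) \<Longrightarrow> l \<in> carrier H \<Longrightarrow> (\<lambda>n. hnorm H (x n \<ominus> l)) \<longlonglongrightarrow> 0 \<Longrightarrow> l \<in> M"
proof -
 have sm: "submodule M complex_ring H" and cl: "closedin (norm_topology H) M"
  using assms by (auto simp: closed_subspace_def)
 note E = submoduleE[OF sm]
 show "M \<subseteq> carrier H" "\<And>x y. x \<in> M \<Longrightarrow> y \<in> M \<Longrightarrow> x \<oplus> y \<in> M" "\<And>c x. x \<in> M \<Longrightarrow> c \<odot> x \<in> M"
  using E by auto
 obtain x where "x \<in> M" using E(2) by blast
 then show "\<zero> \<in> M" using E(1,3,5) by (metis subsetD r_neg)
 show "\<And>x l. (\<And>n. x n \<in> M) \<Longrightarrow> l \<in> carrier H \<Longrightarrow> (\<lambda>n. hnorm H (x n \<ominus> l)) \<longlonglongrightarrow> 0 \<Longrightarrow> l \<in> M"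
  using cl unfolding closedin_norm_iff by blast
qed

lemma submoduleI':
 assumes "M \<subseteq> carrier H" "\<zero> \<in> M" "\<And>x y. x \<in> M \<Longrightarrow> y \<in> M \<Longrightarrow> x \<oplus> y \<in> M" "\<And>c x. x \<in> M \<Longrightarrow> c \<odot> x \<in> M"
 shows "submodule M complex_ring H"
proof (rule submoduleI)
 show "\<ominus> a \<in> M" if "a \<in> M" for a
  using assms(4)[OF that, of "-1"] that assms(1) smult_l_minus[of 1 a] by auto
qed (use assms in auto)

lemma closed_subspaceI:
 assumes "M \<subseteq> carrier H" "\<zero> \<in> M" "\<And>x y. x \<in> M \<Longrightarrow> y \<in> M \<Longrightarrow> x \<oplus> y \<in> M" "\<And>c x. x \<in> M \<Longrightarrow> c \<odot> x \<in> M"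
  "\<And>x l. (\<And>n. x n \<in> M) \<Longrightarrow> l \<in> carrier H \<Longrightarrow> (\<lambda>n. hnorm H (x n \<ominus> l)) \<longlonglongrightarrow> 0 \<Longrightarrow> l \<in> M"
 shows "closed_subspace H M"
 unfolding closed_subspace_def closedin_norm_iff
proof (intro conjI allI impI submoduleI')
 show "l \<in> M" if "\<forall>n. x n \<in> M" "l \<in> carrier H" "(\<lambda>n. hnorm H (x n \<ominus> l)) \<longlonglongrightarrow> 0" for x l
  using assms(5)[of x l] that by blast
qed (use assms in auto)

end

section \<open>Lax-Milgram, Riesz representation, surjectivity of coercive operators\<close>

context hilbert_space
begin

text \<open>The Lax--Milgram lemma for a symmetric form: minimise \<open>Re \<langle>D x, x\<rangle> - 2 Re f x\<close>; the parallelogram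
 identity makes every minimising sequence Cauchy.\<close>

lemma symmetric_Lax_Milgram:
 assumes D: "\<And>x. x \<in> carrier H \<Longrightarrow> D x \<in> carrier H"
   "\<And>x y. x \<in> carrier H \<Longrightarrow> y \<in> carrier H \<Longrightarrow> D (x \<oplus> y) = D x \<oplus> D y"
   "\<And>c x. x \<in> carrier H \<Longrightarrow> D (c \<odot> x) = c \<odot> D x"
   "\<And>x y. x \<in> carrier H \<Longrightarrow> y \<in> carrier H \<Longrightarrow> cinner H (D x) y = cinner H x (D y)"
  and Db: "\<And>x. x \<in> carrier H \<Longrightarrow> hnorm H (D x) \<le> B * hnorm H x"
  and e: "e > 0" and coerc: "\<And>x. x \<in> carrier H \<Longrightarrow> e * (hnorm H x)\<^sup>2 \<le> Re (cinner H (D x) x)"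
  and f: "\<And>x y. x \<in> carrier H \<Longrightarrow> y \<in> carrier H \<Longrightarrow> f (x \<oplus> y) = f x + f y"
   "\<And>c x. x \<in> carrier H \<Longrightarrow> f (c \<odot> x) = c * f x"
  and fb: "\<And>x. x \<in> carrier H \<Longrightarrow> cmod (f x) \<le> C * hnorm H x"
 shows "\<exists>y\<in>carrier H. \<forall>x\<in>carrier H. f x = cinner H (D x) y"
proof -
 note [simp] = D(1-3) f
 define q where "q x = Re (cinner H (D x) x) - 2 * Re (f x)" for x
 have Dsym: "Re (cinner H (D y) x) = Re (cinner H (D x) y)"
  if "x \<in> carrier H" "y \<in> carrier H" for x y
  using that D(4)[of y x] cinner_commute[of y "D x"] by simp
 have B: "0 \<le> B * hnorm H x" if "x \<in> carrier H" for x
  using Db[OF that] hnorm_nonneg[OF D(1)[OF that]] by linarith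
 have q_below: "q x \<ge> - (C\<^sup>2 / e)" if x: "x \<in> carrier H" for x
 proof -
  have "Re (f x) \<le> C * hnorm H x"
   using fb[OF x] complex_Re_le_cmod[of "f x"] by linarith
  \<comment> \<open>Multiplied by e, the expression is the square of e n - C.\<close>
  moreover have "e * n\<^sup>2 - 2 * C * n + C\<^sup>2 / e \<ge> 0" for n
  proof -
   have "e * (C\<^sup>2 / e) = C\<^sup>2" using e by simp
   then have "e * (e * n\<^sup>2 - 2 * C * n + C\<^sup>2 / e) = (e * n - C)\<^sup>2"
    by (simp only: distrib_left right_diff_distrib power2_diff) (simp add: power2_eq_square)
   then have "0 \<le> e * (e * n\<^sup>2 - 2 * C * n + C\<^sup>2 / e)" by simp
   then show ?thesis using e by (simp only: zero_le_mult_iff) linarith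
  qed
  note this[of "hnorm H x"]
  ultimately show ?thesis using coerc[OF x] unfolding q_def by linarith
 qed
 \<comment> \<open>The linear term Re f cancels, and the parallelogram identity leaves the quadratic
   form at x - y.\<close>
 have q_mid: "q x + q y - 2 * q ((1/2) \<odot> (x \<oplus> y)) \<ge> e / 2 * (hnorm H (x \<ominus> y))\<^sup>2"
  if x: "x \<in> carrier H" and y: "y \<in> carrier H" for x y
 proof -
  have "q x + q y - 2 * q ((1/2) \<odot> (x \<oplus> y)) = 1/2 * Re (cinner H (D (x \<ominus> y)) (x \<ominus> y))"
   using x y by (simp add: q_def minus_eq_add_smult algebra_simps)
  then show ?thesis using coerc[of "x \<ominus> y"] x y by simp
 qed
 define d where "d = (INF x\<in>carrier H. q x)"
 have bdd: "bdd_below (q ` carrier H)" using q_below by (auto intro!: bdd_belowI2)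
 have d_le: "d \<le> q x" if "x \<in> carrier H" for x
  unfolding d_def using bdd that by (rule cINF_lower)
 have "\<exists>x\<in>carrier H. q x < d + inverse (real (Suc n))" for n
 proof (rule ccontr)
  assume "\<not> ?thesis"
  then have "d + inverse (real (Suc n)) \<le> d"
   unfolding d_def by (intro cINF_greatest) (auto simp: d_def[symmetric] not_less)
  then show False by simp
 qed
 then obtain u where u: "\<And>n. u n \<in> carrier H" "\<And>n. q (u n) < d + inverse (real (Suc n))" by metis
 have dist: "e / 2 * (hnorm H (u m \<ominus> u n))\<^sup>2 \<le> 2 * inverse (real (Suc N))" if "N \<le> m" "N \<le> n" for m n N
 proof -
  have "inverse (real (Suc m)) \<le> inverse (real (Suc N))" "inverse (real (Suc n)) \<le> inverse (real (Suc N))"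
   using that by (auto simp: field_simps)
  moreover have "(1/2) \<odot> (u m \<oplus> u n) \<in> carrier H" using u(1) by simp
  note d_le[OF this]
  ultimately show ?thesis
   using q_mid[OF u(1)[of m] u(1)[of n]] u(2)[of m] u(2)[of n] by linarith
 qed
 obtain y where y: "y \<in> carrier H" "(\<lambda>n. hnorm H (u n \<ominus> y)) \<longlonglongrightarrow> 0"
 proof (rule Cauchy_convergent[of u])
  fix r :: real assume r: "r > 0"
  obtain N where N: "inverse (real (Suc N)) < e * r\<^sup>2 / 4"
   using reals_Archimedean[of "e * r\<^sup>2 / 4"] e r by auto
  have "hnorm H (u m \<ominus> u n) < r" if "N \<le> m" "N \<le> n" for m n
  proof -
   have "e / 2 * (hnorm H (u m \<ominus> u n))\<^sup>2 < e / 2 * r\<^sup>2"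
    using dist[OF that] N by simp
   then have "(hnorm H (u m \<ominus> u n))\<^sup>2 < r\<^sup>2" using e by simp
   then show ?thesis using r by (simp add: power_less_imp_less_base)
  qed
  then show "\<exists>N. \<forall>m\<ge>N. \<forall>n\<ge>N. hnorm H (u m \<ominus> u n) < r" by blast
 qed (use u in auto)
 \<comment> \<open>The difference q y - q (u n) is bounded by terms linear and quadratic in the
   distance of u n from y, hence by a null sequence.\<close>
 have qy: "q y \<le> d"
 proof (rule tendsto_lowerbound)
  let ?a = "\<lambda>n. hnorm H (u n \<ominus> y)"
  have "(\<lambda>n. d + inverse (real (Suc n)) + (B * ?a n * (hnorm H y * 2 + ?a n) + 2 * C * ?a n))
    \<longlonglongrightarrow> d + 0 + (B * 0 * (hnorm H y * 2 + 0) + 2 * C * 0)"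
   by (intro LIMSEQ_inverse_real_of_nat y(2) tendsto_add tendsto_mult tendsto_const)
  then show "(\<lambda>n. d + inverse (real (Suc n)) + (B * ?a n * (hnorm H y * 2 + ?a n) + 2 * C * ?a n)) \<longlonglongrightarrow> d"
   by simp
  show "\<forall>\<^sub>F n in sequentially. q y \<le> d + inverse (real (Suc n)) + (B * ?a n * (hnorm H y * 2 + ?a n) + 2 * C * ?a n)"
  proof (intro always_eventually allI)
   fix n
   let ?w = "y \<ominus> u n"
   have w: "?w \<in> carrier H" using y u by simp
   have nw: "hnorm H ?w = ?a n" using y u by (simp add: hnorm_minus_commute)
   have uw: "hnorm H (u n) \<le> hnorm H y + ?a n" using hnorm_triangle_diff[of "u n" y] y u by simp
   have "q y - q (u n) = Re (cinner H (D ?w) y) + Re (cinner H (D ?w) (u n)) - 2 * Re (f ?w)"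
    using y(1) u(1)[of n] Dsym[of y "u n"] by (simp add: q_def minus_eq_add_smult algebra_simps)
   moreover have "Re (cinner H (D ?w) y) \<le> B * ?a n * hnorm H y"
    using Re_cinner_le[of "D ?w" y] Db[OF w] w y(1) nw
    by (smt (verit) D(1) hnorm_nonneg mult_right_mono)
   moreover have "Re (cinner H (D ?w) (u n)) \<le> B * ?a n * hnorm H (u n)"
    using Re_cinner_le[of "D ?w" "u n"] Db[OF w] w u(1) nw
    by (smt (verit) D(1) hnorm_nonneg mult_right_mono)
   moreover have "B * ?a n * hnorm H (u n) \<le> B * ?a n * (hnorm H y + ?a n)"
    using uw B[OF w] nw by (intro mult_left_mono) auto
   moreover have "- Re (f ?w) \<le> C * ?a n"
    using fb[OF w] abs_Re_le_cmod[of "f ?w"] unfolding nw by linarith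
   ultimately show "q y \<le> d + inverse (real (Suc n)) + (B * ?a n * (hnorm H y * 2 + ?a n) + 2 * C * ?a n)"
    using u(2)[of n] by (simp add: algebra_simps)
  qed
 qed simp
 have re: "Re (f x) = Re (cinner H (D x) y)" if x: "x \<in> carrier H" for x
 proof -
  define a where "a = Re (cinner H (D x) x)"
  define b where "b = 2 * (Re (cinner H (D x) y) - Re (f x))"
  have *: "0 \<le> t * t * a + t * b" for t :: real
  proof -
   have "q (y \<oplus> complex_of_real t \<odot> x) = q y + t * t * a + t * b"
    using x y(1) Dsym[OF x y(1)] by (simp add: q_def a_def b_def algebra_simps)
   then show ?thesis using d_le[of "y \<oplus> complex_of_real t \<odot> x"] qy x y(1) by simp
  qed
  have a: "a \<ge> 0" using coerc[OF x] e unfolding a_def by (smt (verit) mult_nonneg_nonneg zero_le_power2)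
  \<comment> \<open>Close to the minimiser of t^2 a + t b, with a + 1 instead of a to allow a = 0.
    At this t the expression equals - (a + 2) t^2, which is nonnegative only for t = 0.\<close>
  define t where "t = - b / (2 * (a + 1))"
  have b: "b = - (2 * (a + 1) * t)" using a by (simp add: t_def)
  have "t * t * a + t * b = - (a + 2) * (t * t)" unfolding b by (simp add: algebra_simps)
  then have "0 \<le> - (a + 2) * (t * t)" using *[of t] by simp
  then have "t * t \<le> 0" using a by (simp add: mult_le_0_iff zero_le_mult_iff)
  then have "t = 0" by (metis linorder_not_le mult_eq_0_iff not_real_square_gt_zero)
  then have "b = 0" using b by simp
  then show ?thesis by (simp add: b_def)
 qed
 \<comment> \<open>The real statement at i x gives the equality of the imaginary parts.\<close>
 have "f x = cinner H (D x) y" if x: "x \<in> carrier H" for x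
  using re[OF x] re[of "\<i> \<odot> x"] x y(1) by (simp add: complex_eq_iff)
 then show ?thesis using y(1) by blast
qed

lemma Riesz:
 assumes "\<And>x y. x \<in> carrier H \<Longrightarrow> y \<in> carrier H \<Longrightarrow> f (x \<oplus> y) = f x + f y"
  "\<And>c x. x \<in> carrier H \<Longrightarrow> f (c \<odot> x) = c * f x"
  "\<And>x. x \<in> carrier H \<Longrightarrow> cmod (f x) \<le> C * hnorm H x"
 shows "\<exists>y\<in>carrier H. \<forall>x\<in>carrier H. f x = cinner H x y"
 by (rule symmetric_Lax_Milgram[where D = "\<lambda>x. x" and e = 1 and B = 1 and C = C])
   (use assms in \<open>auto simp: hnorm_sq\<close>)

text \<open>The functional x |-> <x, w> is represented as x |-> <D x, y>, and symmetry of D turns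
  this into D y = w.\<close>

lemma symmetric_coercive_surj:
 assumes "\<And>x. x \<in> carrier H \<Longrightarrow> D x \<in> carrier H"
   "\<And>x y. x \<in> carrier H \<Longrightarrow> y \<in> carrier H \<Longrightarrow> D (x \<oplus> y) = D x \<oplus> D y"
   "\<And>c x. x \<in> carrier H \<Longrightarrow> D (c \<odot> x) = c \<odot> D x"
   "\<And>x y. x \<in> carrier H \<Longrightarrow> y \<in> carrier H \<Longrightarrow> cinner H (D x) y = cinner H x (D y)"
   "\<And>x. x \<in> carrier H \<Longrightarrow> hnorm H (D x) \<le> B * hnorm H x"
   "e > 0" "\<And>x. x \<in> carrier H \<Longrightarrow> e * (hnorm H x)\<^sup>2 \<le> Re (cinner H (D x) x)"
  and w: "w \<in> carrier H"
 shows "\<exists>y\<in>carrier H. D y = w"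
proof -
 have "\<exists>y\<in>carrier H. \<forall>x\<in>carrier H. cinner H x w = cinner H (D x) y"
  by (rule symmetric_Lax_Milgram[where B = B and e = e and C = "hnorm H w"])
    (use assms Cauchy_Schwarz in \<open>auto simp: mult.commute\<close>)
 then obtain y where y: "y \<in> carrier H" "\<And>x. x \<in> carrier H \<Longrightarrow> cinner H x w = cinner H (D x) y" by blast
 have "D y = w"
 proof (rule vec_eqI)
  fix z assume z: "z \<in> carrier H"
  show "cinner H (D y) z = cinner H w z"
   using y(2)[OF z] assms(4)[OF z y(1)] cinner_commute[of z w] cinner_commute[of z "D y"] y(1) z w assms(1)
   by (metis complex_cnj_cnj)
 qed (use y w assms(1) in auto)
 then show ?thesis using y(1) by blast
qed

end

section \<open>Bounded operators\<close>

context hilbert_space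
begin

lemma bop_closed: "T \<in> \<B> H \<Longrightarrow> x \<in> carrier H \<Longrightarrow> T x \<in> carrier H"
 by (auto simp: BL_def bounded_ops_def)

lemma bop_add:
 "T \<in> \<B> H \<Longrightarrow> x \<in> carrier H \<Longrightarrow> y \<in> carrier H \<Longrightarrow> T (x \<oplus> y) = T x \<oplus> T y"
 by (auto simp: BL_def bounded_ops_def)

lemma bop_smult: "T \<in> \<B> H \<Longrightarrow> x \<in> carrier H \<Longrightarrow> T (c \<odot> x) = c \<odot> T x"
 by (auto simp: BL_def bounded_ops_def)

lemma bop_minus:
 "T \<in> \<B> H \<Longrightarrow> x \<in> carrier H \<Longrightarrow> y \<in> carrier H \<Longrightarrow> T (x \<ominus> y) = T x \<ominus> T y"
 by (simp add: minus_eq_add_smult bop_add[of T] bop_smult[of T] bop_closed[of T])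

lemma bop_zero: "T \<in> \<B> H \<Longrightarrow> T \<zero> = \<zero>"
proof -
 assume T: "T \<in> \<B> H"
 have "T \<zero> = T (0 \<odot> \<zero>)" by (simp only: smult_zero_right)
 also have "\<dots> = 0 \<odot> T \<zero>" by (rule bop_smult[OF T M.zero_closed])
 also have "\<dots> = \<zero>" by (rule smult_simps(2)[OF bop_closed[OF T M.zero_closed]])
 finally show ?thesis .
qed

text \<open>Not simp rules, because their left-hand sides are headed by a variable; they are instantiated
 with concrete operators instead.\<close>

lemmas bop_rules = bop_closed bop_add bop_smult bop_minus bop_zero

lemma bopI:
 assumes "T \<in> extensional (carrier H)" "\<And>x. x \<in> carrier H \<Longrightarrow> T x \<in> carrier H"
  "\<And>x y. x \<in> carrier H \<Longrightarrow> y \<in> carrier H \<Longrightarrow> T (x \<oplus> y) = T x \<oplus> T y"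
  "\<And>c x. x \<in> carrier H \<Longrightarrow> T (c \<odot> x) = c \<odot> T x"
  "\<And>x. x \<in> carrier H \<Longrightarrow> hnorm H (T x) \<le> b * hnorm H x"
 shows "T \<in> \<B> H"
 using assms by (auto simp: BL_def bounded_ops_def PiE_def intro!: exI[of _ b])

lemma bop_restrictI:
 assumes "\<And>x. x \<in> carrier H \<Longrightarrow> T x \<in> carrier H"
  "\<And>x y. x \<in> carrier H \<Longrightarrow> y \<in> carrier H \<Longrightarrow> T (x \<oplus> y) = T x \<oplus> T y"
  "\<And>c x. x \<in> carrier H \<Longrightarrow> T (c \<odot> x) = c \<odot> T x"
  "\<And>x. x \<in> carrier H \<Longrightarrow> hnorm H (T x) \<le> b * hnorm H x"
 shows "(\<lambda>x\<in>carrier H. T x) \<in> \<B> H"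
 by (rule bopI[where b = b]) (use assms in auto)

lemma bop_eqI:
 assumes "S \<in> \<B> H" "T \<in> \<B> H" "\<And>x. x \<in> carrier H \<Longrightarrow> S x = T x"
 shows "S = T"
proof (rule extensionalityI)
 show "S \<in> extensional (carrier H)" "T \<in> extensional (carrier H)"
  using assms by (auto simp: BL_def bounded_ops_def PiE_def intro!: exI[of _ b])
qed (rule assms)

lemma bop_cinner_eqI:
 assumes "S \<in> \<B> H" "T \<in> \<B> H"
  "\<And>x y. x \<in> carrier H \<Longrightarrow> y \<in> carrier H \<Longrightarrow> cinner H (S x) y = cinner H (T x) y"
 shows "S = T"
 by (rule bop_eqI[OF assms(1,2)], rule vec_eqI) (use assms in \<open>auto intro: bop_closed\<close>)

lemma bop_bound:
 assumes "T \<in> \<B> H"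
 obtains b where "b > 0" "\<And>x. x \<in> carrier H \<Longrightarrow> hnorm H (T x) \<le> b * hnorm H x"
proof -
 have "\<exists>b. \<forall>x\<in>carrier H. hnorm H (T x) \<le> b * hnorm H x"
  using assms by (simp add: BL_def bounded_ops_def)
 then obtain b where b: "\<And>x. x \<in> carrier H \<Longrightarrow> hnorm H (T x) \<le> b * hnorm H x" by blast
 have "hnorm H (T x) \<le> (\<bar>b\<bar> + 1) * hnorm H x" if "x \<in> carrier H" for x
  using order_trans[OF b[OF that] mult_right_mono[of b "\<bar>b\<bar> + 1" "hnorm H x"]] that by simp
 then show thesis by (intro that[of "\<bar>b\<bar> + 1"]) auto
qed

lemma op_norm_le:
 assumes "0 \<le> b" "\<And>x. x \<in> carrier H \<Longrightarrow> hnorm H (T x) \<le> b * hnorm H x"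
 shows "op_norm H T \<le> b"
 unfolding op_norm_def
proof (rule cSUP_least)
 show "{x \<in> carrier H. hnorm H x \<le> 1} \<noteq> {}" using hnorm_zero by force
 show "hnorm H (T x) \<le> b" if "x \<in> {x \<in> carrier H. hnorm H x \<le> 1}" for x
  using that assms(2)[of x] mult_left_mono[of "hnorm H x" 1 b] assms(1) by simp
qed

lemma hnorm_le_op_norm:
 assumes T: "T \<in> \<B> H" and x: "x \<in> carrier H" "hnorm H x \<le> 1"
 shows "hnorm H (T x) \<le> op_norm H T"
proof -
 obtain b where b: "b > 0" "\<And>x. x \<in> carrier H \<Longrightarrow> hnorm H (T x) \<le> b * hnorm H x"
  using bop_bound[OF T] by blast
 have "hnorm H (T y) \<le> b" if "y \<in> carrier H" "hnorm H y \<le> 1" for y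
  using order_trans[OF b(2)[OF that(1)] mult_left_mono[OF that(2), of b]] b(1) by simp
 then have "bdd_above ((\<lambda>x. hnorm H (T x)) ` {x \<in> carrier H. hnorm H x \<le> 1})"
  by (intro bdd_aboveI2[of _ _ b]) auto
 then show ?thesis
  unfolding op_norm_def using x by (intro cSUP_upper) auto
qed

lemma op_norm_nonneg [simp]: "T \<in> \<B> H \<Longrightarrow> 0 \<le> op_norm H T"
 using hnorm_le_op_norm[of T \<zero>] by (simp add: bop_zero[of T])

lemma op_norm_bound:
 assumes T: "T \<in> \<B> H" and x: "x \<in> carrier H"
 shows "hnorm H (T x) \<le> op_norm H T * hnorm H x"
proof (cases "x = \<zero>")
 note [simp] = bop_rules[OF T]
 case False
 then have nx: "hnorm H x > 0" using hnorm_eq_0[OF x] hnorm_nonneg[OF x] by linarith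
 let ?y = "complex_of_real (1 / hnorm H x) \<odot> x"
 have "hnorm H (T ?y) \<le> op_norm H T"
  by (rule hnorm_le_op_norm[OF T]) (use x nx in \<open>simp_all del: of_real_divide\<close>)
 then show ?thesis using x T nx by (simp add: pos_divide_le_eq del: of_real_divide)
qed (simp add: bop_zero[OF T])

section \<open>The ring of bounded operators and its norm\<close>

lemma BL_apply [simp]:
 assumes "x \<in> carrier H"
 shows "(S \<otimes>\<^bsub>BL H\<^esub> T) x = S (T x)" "(S \<oplus>\<^bsub>BL H\<^esub> T) x = S x \<oplus> T x"
  "(c \<odot>\<^bsub>BL H\<^esub> T) x = c \<odot> T x" "\<one>\<^bsub>BL H\<^esub> x = x" "\<zero>\<^bsub>BL H\<^esub> x = \<zero>"
 using assms by (simp_all add: BL_def compose_def)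

lemma BL_extensional [simp]:
 "S \<otimes>\<^bsub>BL H\<^esub> T \<in> extensional (carrier H)" "S \<oplus>\<^bsub>BL H\<^esub> T \<in> extensional (carrier H)"
  "c \<odot>\<^bsub>BL H\<^esub> T \<in> extensional (carrier H)" "\<one>\<^bsub>BL H\<^esub> \<in> extensional (carrier H)"
  "\<zero>\<^bsub>BL H\<^esub> \<in> extensional (carrier H)"
 by (simp_all add: BL_def compose_def)

lemma BL_mult_closed [simp, intro]:
 assumes S: "S \<in> \<B> H" and T: "T \<in> \<B> H"
 shows "S \<otimes>\<^bsub>BL H\<^esub> T \<in> \<B> H"
 supply [simp] = bop_rules[OF S] bop_rules[OF T]
proof (rule bopI[where b = "op_norm H S * op_norm H T"])
 show "hnorm H ((S \<otimes>\<^bsub>BL H\<^esub> T) x) \<le> op_norm H S * op_norm H T * hnorm H x" if x: "x \<in> carrier H" for x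
  using op_norm_bound[OF S bop_closed[OF T x]] mult_left_mono[OF op_norm_bound[OF T x] op_norm_nonneg[OF S]] x
  by (simp add: mult.assoc)
qed (use assms in auto)

lemma BL_add_closed [simp, intro]:
 assumes S: "S \<in> \<B> H" and T: "T \<in> \<B> H"
 shows "S \<oplus>\<^bsub>BL H\<^esub> T \<in> \<B> H"
 supply [simp] = bop_rules[OF S] bop_rules[OF T]
proof (rule bopI[where b = "op_norm H S + op_norm H T"])
 show "hnorm H ((S \<oplus>\<^bsub>BL H\<^esub> T) x) \<le> (op_norm H S + op_norm H T) * hnorm H x" if x: "x \<in> carrier H" for x
  using hnorm_triangle[of "S x" "T x"] op_norm_bound[OF S x] op_norm_bound[OF T x] x S T
  by (simp add: distrib_right)
 show "(S \<oplus>\<^bsub>BL H\<^esub> T) (x \<oplus> y) = (S \<oplus>\<^bsub>BL H\<^esub> T) x \<oplus> (S \<oplus>\<^bsub>BL H\<^esub> T) y"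
  if "x \<in> carrier H" "y \<in> carrier H" for x y
  by (rule vec_eqI) (use that S T in auto)
 show "(S \<oplus>\<^bsub>BL H\<^esub> T) (c \<odot> x) = c \<odot> (S \<oplus>\<^bsub>BL H\<^esub> T) x" if "x \<in> carrier H" for c x
  by (rule vec_eqI) (use that S T in \<open>auto simp: distrib_left\<close>)
qed (use assms in auto)

lemma BL_smult_closed [simp, intro]:
 assumes T: "T \<in> \<B> H"
 shows "c \<odot>\<^bsub>BL H\<^esub> T \<in> \<B> H"
 supply [simp] = bop_rules[OF T]
proof (rule bopI[where b = "cmod c * op_norm H T"])
 show "hnorm H ((c \<odot>\<^bsub>BL H\<^esub> T) x) \<le> cmod c * op_norm H T * hnorm H x" if x: "x \<in> carrier H" for x
  using mult_left_mono[OF op_norm_bound[OF T x], of "cmod c"] x T by (simp add: mult.assoc)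
 show "(c \<odot>\<^bsub>BL H\<^esub> T) (x \<oplus> y) = (c \<odot>\<^bsub>BL H\<^esub> T) x \<oplus> (c \<odot>\<^bsub>BL H\<^esub> T) y"
  if "x \<in> carrier H" "y \<in> carrier H" for x y
  by (rule vec_eqI) (use that T in \<open>auto simp: distrib_left\<close>)
qed (use assms in \<open>auto simp: mult.commute\<close>)

lemma BL_one_closed [simp, intro]: "\<one>\<^bsub>BL H\<^esub> \<in> \<B> H"
 by (rule bopI[where b = 1]) auto

lemma BL_zero_closed [simp, intro]: "\<zero>\<^bsub>BL H\<^esub> \<in> \<B> H"
 by (rule bopI[where b = 0]) auto

lemma BL_abelian_group: "abelian_group (BL H)"
proof (rule abelian_groupI)
 show "\<exists>S\<in>\<B> H. S \<oplus>\<^bsub>BL H\<^esub> T = \<zero>\<^bsub>BL H\<^esub>" if "T \<in> \<B> H" for T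
  by (rule bexI[of _ "(- 1) \<odot>\<^bsub>BL H\<^esub> T"], rule bop_cinner_eqI) (use that in \<open>auto simp: bop_rules[of T]\<close>)
qed (auto intro!: bop_cinner_eqI bop_closed simp: add_ac bop_closed)

lemma BL_ring: "ring (BL H)"
proof (rule ringI)
 show "abelian_group (BL H)" by (rule BL_abelian_group)
 show "Group.monoid (BL H)" by (rule monoidI) (auto intro!: bop_eqI simp: bop_closed)
qed (auto intro!: bop_eqI simp: bop_closed bop_add)

sublocale BL: ring "BL H" by (rule BL_ring)

lemma BL_minus: "S \<in> \<B> H \<Longrightarrow> T \<in> \<B> H \<Longrightarrow> S \<ominus>\<^bsub>BL H\<^esub> T = S \<oplus>\<^bsub>BL H\<^esub> (- 1) \<odot>\<^bsub>BL H\<^esub> T"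
proof -
 assume S: "S \<in> \<B> H" and T: "T \<in> \<B> H"
 have "\<ominus>\<^bsub>BL H\<^esub> T = (- 1) \<odot>\<^bsub>BL H\<^esub> T"
  by (rule BL.minus_equality, rule bop_cinner_eqI) (use T in \<open>auto simp: bop_closed\<close>)
 then show ?thesis by (simp add: a_minus_def)
qed

lemma BL_minus_apply [simp]:
 "S \<in> \<B> H \<Longrightarrow> T \<in> \<B> H \<Longrightarrow> x \<in> carrier H \<Longrightarrow> (S \<ominus>\<^bsub>BL H\<^esub> T) x = S x \<ominus> T x"
 by (simp add: BL_minus minus_eq_add_smult bop_closed[of S] bop_closed[of T])

lemma op_norm_mult_le:
 assumes S: "S \<in> \<B> H" and T: "T \<in> \<B> H"
 shows "op_norm H (S \<otimes>\<^bsub>BL H\<^esub> T) \<le> op_norm H S * op_norm H T"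
 supply [simp] = bop_rules[OF S] bop_rules[OF T]
proof (rule op_norm_le)
 show "hnorm H ((S \<otimes>\<^bsub>BL H\<^esub> T) x) \<le> op_norm H S * op_norm H T * hnorm H x" if x: "x \<in> carrier H" for x
  using op_norm_bound[OF S bop_closed[OF T x]] mult_left_mono[OF op_norm_bound[OF T x] op_norm_nonneg[OF S]] x
  by (simp add: mult.assoc)
qed (use assms in auto)

lemma op_norm_add_le:
 assumes "S \<in> \<B> H" "T \<in> \<B> H"
 shows "op_norm H (S \<oplus>\<^bsub>BL H\<^esub> T) \<le> op_norm H S + op_norm H T"
 supply [simp] = bop_rules[OF assms(1)] bop_rules[OF assms(2)]
proof (rule op_norm_le)
 show "hnorm H ((S \<oplus>\<^bsub>BL H\<^esub> T) x) \<le> (op_norm H S + op_norm H T) * hnorm H x" if x: "x \<in> carrier H" for x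
  using hnorm_triangle[of "S x" "T x"] op_norm_bound[OF assms(1) x] op_norm_bound[OF assms(2) x] x assms
  by (simp add: distrib_right)
qed (use assms in auto)

lemma op_norm_smult_le:
 assumes "T \<in> \<B> H"
 shows "op_norm H (c \<odot>\<^bsub>BL H\<^esub> T) \<le> cmod c * op_norm H T"
 supply [simp] = bop_rules[OF assms(1)]
proof (rule op_norm_le)
 show "hnorm H ((c \<odot>\<^bsub>BL H\<^esub> T) x) \<le> cmod c * op_norm H T * hnorm H x" if x: "x \<in> carrier H" for x
  using mult_left_mono[OF op_norm_bound[OF assms x], of "cmod c"] x assms by (simp add: mult.assoc)
qed (use assms in auto)

lemma op_norm_one_le: "op_norm H \<one>\<^bsub>BL H\<^esub> \<le> 1"
 by (rule op_norm_le) auto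

lemma op_norm_zero [simp]: "op_norm H \<zero>\<^bsub>BL H\<^esub> = 0"
 by (rule antisym[OF op_norm_le op_norm_nonneg]) auto

lemma op_norm_eq_0:
 assumes "T \<in> \<B> H" "op_norm H T = 0"
 shows "T = \<zero>\<^bsub>BL H\<^esub>"
 supply [simp] = bop_rules[OF assms(1)]
proof (rule bop_eqI)
 show "T x = \<zero>\<^bsub>BL H\<^esub> x" if x: "x \<in> carrier H" for x
 proof -
  have "hnorm H (T x) = 0"
   using op_norm_bound[OF assms(1) x] assms(2) hnorm_nonneg[OF bop_closed[OF assms(1) x]] by simp
  then show ?thesis using x assms by simp
 qed
qed (use assms in auto)

lemma op_norm_minus_commute:
 "S \<in> \<B> H \<Longrightarrow> T \<in> \<B> H \<Longrightarrow> op_norm H (S \<ominus>\<^bsub>BL H\<^esub> T) = op_norm H (T \<ominus>\<^bsub>BL H\<^esub> S)"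
 unfolding op_norm_def by (rule SUP_cong) (auto simp: hnorm_minus_commute bop_closed[of S] bop_closed[of T])

lemma op_norm_triangle_dist:
 assumes "S \<in> \<B> H" "T \<in> \<B> H" "V \<in> \<B> H"
 shows "op_norm H (S \<ominus>\<^bsub>BL H\<^esub> V) \<le> op_norm H (S \<ominus>\<^bsub>BL H\<^esub> T) + op_norm H (T \<ominus>\<^bsub>BL H\<^esub> V)"
proof -
 have "(S \<ominus>\<^bsub>BL H\<^esub> T) \<oplus>\<^bsub>BL H\<^esub> (T \<ominus>\<^bsub>BL H\<^esub> V) = S \<ominus>\<^bsub>BL H\<^esub> V"
  by (rule bop_eqI) (use assms in \<open>auto simp: minus_add_minus bop_closed\<close>)
 then show ?thesis using op_norm_add_le[of "S \<ominus>\<^bsub>BL H\<^esub> T" "T \<ominus>\<^bsub>BL H\<^esub> V"] assms by simp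
qed

section \<open>Operator norm topology and completeness\<close>

lemma BL_metric: "Metric_space (\<B> H) (op_dist H)"
proof
 show "(op_dist H S T = 0) = (S = T)" if "S \<in> \<B> H" "T \<in> \<B> H" for S T
  using that op_norm_eq_0[of "S \<ominus>\<^bsub>BL H\<^esub> T"] BL.r_right_minus_eq[of S T] op_norm_zero
  by (metis BL.minus_closed op_dist_def)
 show "op_dist H S T = op_dist H T S" for S T
  by (auto simp: op_dist_def op_norm_minus_commute)
 show "op_dist H S V \<le> op_dist H S T + op_dist H T V"
  if "S \<in> \<B> H" "T \<in> \<B> H" "V \<in> \<B> H" for S T V
  using that op_norm_triangle_dist[of S T V] by (simp add: op_dist_def)
qed (simp add: op_dist_def)

sublocale om: Metric_space "\<B> H" "op_dist H" by (rule BL_metric)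

lemma limitin_op_norm_iff:
 assumes "\<And>n. A n \<in> \<B> H" "L \<in> \<B> H"
 shows "limitin om.mtopology A L sequentially \<longleftrightarrow> (\<lambda>n. op_norm H (A n \<ominus>\<^bsub>BL H\<^esub> L)) \<longlonglongrightarrow> 0"
 using assms by (simp add: om.limitin_metric_dist_null op_dist_def)

lemma closedin_op_norm_iff:
 "closedin (op_norm_topology H) M \<longleftrightarrow> M \<subseteq> \<B> H \<and>
  (\<forall>A L. (\<forall>n. A n \<in> M) \<longrightarrow> L \<in> \<B> H \<longrightarrow> (\<lambda>n. op_norm H (A n \<ominus>\<^bsub>BL H\<^esub> L)) \<longlonglongrightarrow> 0 \<longrightarrow> L \<in> M)"
 (is "_ \<longleftrightarrow> _ \<and> ?R")
proof (cases "M \<subseteq> \<B> H")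
 case True
 have "(\<forall>\<sigma> l. range \<sigma> \<subseteq> M \<and> limitin om.mtopology \<sigma> l sequentially \<longrightarrow> l \<in> M) \<longleftrightarrow> ?R"
 proof (intro iffI allI impI)
  fix x l
  assume *: "\<forall>\<sigma> l. range \<sigma> \<subseteq> M \<and> limitin om.mtopology \<sigma> l sequentially \<longrightarrow> l \<in> M"
   and x: "\<forall>n. x n \<in> M" "l \<in> \<B> H" "(\<lambda>n. op_norm H (x n \<ominus>\<^bsub>BL H\<^esub> l)) \<longlonglongrightarrow> 0"
  have "limitin om.mtopology x l sequentially"
   using x True by (subst limitin_op_norm_iff) auto
  then show "l \<in> M" using * x by blast
 next
  fix x l
  assume *: ?R and x: "range x \<subseteq> M \<and> limitin om.mtopology x l sequentially"
  then have l: "l \<in> \<B> H" using om.limitin_mspace by blast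
  then have "(\<lambda>n. op_norm H (x n \<ominus>\<^bsub>BL H\<^esub> l)) \<longlonglongrightarrow> 0"
   using x True by (subst limitin_op_norm_iff[symmetric]) auto
  then show "l \<in> M" using * x l by blast
 qed
 then show ?thesis
  unfolding op_norm_topology_def om.metric_closedin_iff_sequentially_closed using True by blast
qed (auto simp: op_norm_topology_def om.metric_closedin_iff_sequentially_closed)

lemma norm_limit_unique:
 assumes "a \<in> carrier H" "b \<in> carrier H" "(\<lambda>n. hnorm H (z n \<ominus> a)) \<longlonglongrightarrow> 0"
  "(\<lambda>n. hnorm H (z n \<ominus> b)) \<longlonglongrightarrow> 0" "\<And>n. z n \<in> carrier H"
 shows "a = b"
 using assms hm.limitin_metric_unique[of z a sequentially b] limitin_norm_iff[of z] by auto

lemma op_Cauchy_convergent: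
 assumes A: "\<And>n. A n \<in> \<B> H"
  and C: "\<And>e. e > 0 \<Longrightarrow> \<exists>N. \<forall>m\<ge>N. \<forall>n\<ge>N. op_norm H (A m \<ominus>\<^bsub>BL H\<^esub> A n) < e"
 obtains L where "L \<in> \<B> H" "(\<lambda>n. op_norm H (A n \<ominus>\<^bsub>BL H\<^esub> L)) \<longlonglongrightarrow> 0"
proof -
 note [simp] = bop_rules[OF A]
 have Cx: "\<exists>N. \<forall>m\<ge>N. \<forall>n\<ge>N. hnorm H (A m x \<ominus> A n x) < e" if x: "x \<in> carrier H" and e: "e > 0" for x e
 proof -
  have p: "0 < e / (hnorm H x + 1)" using e hnorm_nonneg[OF x] by simp
  obtain N where N: "\<forall>m\<ge>N. \<forall>n\<ge>N. op_norm H (A m \<ominus>\<^bsub>BL H\<^esub> A n) < e / (hnorm H x + 1)"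
   using C[OF p] by blast
  have "hnorm H (A m x \<ominus> A n x) < e" if "m \<ge> N" "n \<ge> N" for m n
  proof -
   have "hnorm H (A m x \<ominus> A n x) \<le> op_norm H (A m \<ominus>\<^bsub>BL H\<^esub> A n) * hnorm H x"
    using op_norm_bound[of "A m \<ominus>\<^bsub>BL H\<^esub> A n" x] A x by simp
   also have "\<dots> \<le> e / (hnorm H x + 1) * hnorm H x"
    using N that x by (intro mult_right_mono) (auto intro: less_imp_le)
   also have "\<dots> < e / (hnorm H x + 1) * (hnorm H x + 1)"
    using p by (intro mult_strict_left_mono) auto
   also have "\<dots> = e" using hnorm_nonneg[OF x] by simp
   finally show ?thesis .
  qed
  then show ?thesis by blast
 qed
 have "\<exists>l. l \<in> carrier H \<and> (\<lambda>n. hnorm H (A n x \<ominus> l)) \<longlonglongrightarrow> 0" if x: "x \<in> carrier H" for x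
 proof (rule Cauchy_convergent[of "\<lambda>n. A n x"])
  show "\<exists>l. l \<in> carrier H \<and> (\<lambda>n. hnorm H (A n x \<ominus> l)) \<longlonglongrightarrow> 0"
   if "l \<in> carrier H" "(\<lambda>n. hnorm H (A n x \<ominus> l)) \<longlonglongrightarrow> 0" for l
   using that by (intro exI conjI)
 qed (use x Cx[OF x] in simp_all)
 then obtain L0 where L0: "\<And>x. x \<in> carrier H \<Longrightarrow> L0 x \<in> carrier H"
  "\<And>x. x \<in> carrier H \<Longrightarrow> (\<lambda>n. hnorm H (A n x \<ominus> L0 x)) \<longlonglongrightarrow> 0" by metis
 \<comment> \<open>Letting m tend to infinity in the Cauchy estimate gives a bound uniform over x.
   It yields both boundedness of the limit and convergence in operator norm.\<close>
 have unif: "hnorm H (A n x \<ominus> L0 x) \<le> e * hnorm H x"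
  if N: "\<forall>m\<ge>N. op_norm H (A n \<ominus>\<^bsub>BL H\<^esub> A m) < e" and x: "x \<in> carrier H" for n N e x
 proof (rule tendsto_lowerbound)
  show "(\<lambda>m. e * hnorm H x + hnorm H (A m x \<ominus> L0 x)) \<longlonglongrightarrow> e * hnorm H x"
   using tendsto_add[OF tendsto_const L0(2)[OF x], of "e * hnorm H x"] by simp
  show "\<forall>\<^sub>F m in sequentially. hnorm H (A n x \<ominus> L0 x) \<le> e * hnorm H x + hnorm H (A m x \<ominus> L0 x)"
  proof (rule eventually_sequentiallyI[of N])
   fix m assume "N \<le> m"
   then have "op_norm H (A n \<ominus>\<^bsub>BL H\<^esub> A m) * hnorm H x \<le> e * hnorm H x"
    using N x by (intro mult_right_mono) (auto intro: less_imp_le)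
   then have "hnorm H (A n x \<ominus> A m x) \<le> e * hnorm H x"
    using op_norm_bound[of "A n \<ominus>\<^bsub>BL H\<^esub> A m" x] A x by simp
   then show "hnorm H (A n x \<ominus> L0 x) \<le> e * hnorm H x + hnorm H (A m x \<ominus> L0 x)"
    using hnorm_triangle_dist[of "A n x" "A m x" "L0 x"] A x L0(1) by auto
  qed
 qed simp
 obtain N1 where N1: "\<forall>m\<ge>N1. op_norm H (A N1 \<ominus>\<^bsub>BL H\<^esub> A m) < 1" using C[of 1] by force
 define L where "L = (\<lambda>x\<in>carrier H. L0 x)"
 have L: "L \<in> \<B> H"
  unfolding L_def
 proof (rule bop_restrictI[where b = "op_norm H (A N1) + 1"])
  fix x y assume x: "x \<in> carrier H" and y: "y \<in> carrier H"
  show "L0 (x \<oplus> y) = L0 x \<oplus> L0 y"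
  proof (rule norm_limit_unique[of _ _ "\<lambda>n. A n (x \<oplus> y)"])
   show "(\<lambda>n. hnorm H (A n (x \<oplus> y) \<ominus> L0 (x \<oplus> y))) \<longlonglongrightarrow> 0" by (rule L0(2)) (use x y in simp)
   have le: "hnorm H (A n (x \<oplus> y) \<ominus> (L0 x \<oplus> L0 y)) \<le> hnorm H (A n x \<ominus> L0 x) + hnorm H (A n y \<ominus> L0 y)" for n
   proof -
    have "A n (x \<oplus> y) \<ominus> (L0 x \<oplus> L0 y) = (A n x \<ominus> L0 x) \<oplus> (A n y \<ominus> L0 y)"
     by (rule vec_eqI) (use A x y L0 in auto)
    then show ?thesis using hnorm_triangle[of "A n x \<ominus> L0 x" "A n y \<ominus> L0 y"] A x y L0 by auto
   qed
   have lim: "(\<lambda>n. hnorm H (A n x \<ominus> L0 x) + hnorm H (A n y \<ominus> L0 y)) \<longlonglongrightarrow> 0"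
    using tendsto_add[OF L0(2)[OF x] L0(2)[OF y]] by simp
   show "(\<lambda>n. hnorm H (A n (x \<oplus> y) \<ominus> (L0 x \<oplus> L0 y))) \<longlonglongrightarrow> 0"
    by (rule tendsto_sandwich[OF always_eventually always_eventually tendsto_const lim])
     (use le A x y L0 in \<open>auto simp del: bop_add[OF A]\<close>)
  qed (use A x y L0 in auto)
 next
  fix x c assume x: "x \<in> carrier H"
  show "L0 (c \<odot> x) = c \<odot> L0 x"
  proof (rule norm_limit_unique[of _ _ "\<lambda>n. A n (c \<odot> x)"])
   show "(\<lambda>n. hnorm H (A n (c \<odot> x) \<ominus> L0 (c \<odot> x))) \<longlonglongrightarrow> 0" by (rule L0(2)) (use x in simp)
   have "hnorm H (A n (c \<odot> x) \<ominus> c \<odot> L0 x) = cmod c * hnorm H (A n x \<ominus> L0 x)" for n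
   proof -
    have "A n (c \<odot> x) \<ominus> c \<odot> L0 x = c \<odot> (A n x \<ominus> L0 x)"
     by (rule vec_eqI) (use A x L0 in \<open>auto simp: right_diff_distrib\<close>)
    then show ?thesis using A x L0 by auto
   qed
   then show "(\<lambda>n. hnorm H (A n (c \<odot> x) \<ominus> c \<odot> L0 x)) \<longlonglongrightarrow> 0"
    using tendsto_mult[OF tendsto_const L0(2)[OF x], of "cmod c"] by simp
  qed (use A x L0 in auto)
 next
  fix x assume x: "x \<in> carrier H"
  have "hnorm H (L0 x) \<le> hnorm H (A N1 x) + hnorm H (A N1 x \<ominus> L0 x)"
   using hnorm_triangle_diff[of "L0 x" "A N1 x"] hnorm_minus_commute[of "L0 x" "A N1 x"] A x L0 by auto
  also have "\<dots> \<le> op_norm H (A N1) * hnorm H x + 1 * hnorm H x"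
   by (intro add_mono op_norm_bound unif[OF N1]) (use A x in auto)
  finally show "hnorm H (L0 x) \<le> (op_norm H (A N1) + 1) * hnorm H x" by (simp add: distrib_right)
 qed (use L0 in auto)
 note [simp] = bop_rules[OF L]
 have "(\<lambda>n. op_norm H (A n \<ominus>\<^bsub>BL H\<^esub> L)) \<longlonglongrightarrow> 0"
 proof (rule LIMSEQ_I)
  fix e :: real assume e: "e > 0"
  obtain N where N: "\<forall>m\<ge>N. \<forall>n\<ge>N. op_norm H (A m \<ominus>\<^bsub>BL H\<^esub> A n) < e / 2"
   using C[of "e / 2"] e by auto
  have "op_norm H (A n \<ominus>\<^bsub>BL H\<^esub> L) < e" if n: "n \<ge> N" for n
  proof -
   have "op_norm H (A n \<ominus>\<^bsub>BL H\<^esub> L) \<le> e / 2"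
   proof (rule op_norm_le)
    fix x assume x: "x \<in> carrier H"
    show "hnorm H ((A n \<ominus>\<^bsub>BL H\<^esub> L) x) \<le> e / 2 * hnorm H x"
     using unif[of N n "e/2" x] N n A L x by (simp add: L_def)
   qed (use e in simp)
   then show ?thesis using e by simp
  qed
  then show "\<exists>N. \<forall>n\<ge>N. norm (op_norm H (A n \<ominus>\<^bsub>BL H\<^esub> L) - 0) < e"
   using A L by auto
 qed
 then show thesis using that L by blast
qed

end

lemma squeeze_null:
 fixes f g :: "'x \<Rightarrow> real"
 assumes "(g \<longlongrightarrow> 0) F" "\<And>n. 0 \<le> f n" "\<And>n. f n \<le> g n"
 shows "(f \<longlongrightarrow> 0) F"
 by (rule tendsto_sandwich[OF always_eventually always_eventually tendsto_const assms(1)]) (use assms in auto)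

section \<open>Adjoints and operator algebras\<close>

context hilbert_space
begin

lemma adj_ex:
 assumes T: "T \<in> \<B> H"
 shows "\<exists>A. A \<in> \<B> H \<and> (\<forall>x\<in>carrier H. \<forall>y\<in>carrier H. cinner H (A x) y = cinner H x (T y))"
proof -
 note [simp] = bop_rules[OF T]
 \<comment> \<open>Riesz represents functionals that are linear in x by a vector in the second
   argument, so T is moved out of the first argument here; \<open>A2\<close> conjugates the result
   into the form that \<open>adj\<close> asks for.\<close>
 have "\<exists>z. z \<in> carrier H \<and> (\<forall>x\<in>carrier H. cinner H (T x) y = cinner H x z)" if y: "y \<in> carrier H" for y
 proof -
  have "\<exists>z\<in>carrier H. \<forall>x\<in>carrier H. cinner H (T x) y = cinner H x z"
  proof (rule Riesz[where C = "op_norm H T * hnorm H y"])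
   fix x assume x: "x \<in> carrier H"
   have "cmod (cinner H (T x) y) \<le> hnorm H (T x) * hnorm H y"
    by (rule Cauchy_Schwarz) (use x y in auto)
   also have "\<dots> \<le> (op_norm H T * hnorm H x) * hnorm H y"
    by (intro mult_right_mono op_norm_bound) (use x y T in auto)
   finally show "cmod (cinner H (T x) y) \<le> op_norm H T * hnorm H y * hnorm H x"
    by (simp add: mult_ac)
  qed (use y in auto)
  then show ?thesis by blast
 qed
 then obtain A where A: "\<And>y. y \<in> carrier H \<Longrightarrow> A y \<in> carrier H"
  "\<And>x y. x \<in> carrier H \<Longrightarrow> y \<in> carrier H \<Longrightarrow> cinner H (T x) y = cinner H x (A y)"
  by metis
 have A2: "cinner H (A x) y = cinner H x (T y)" if "x \<in> carrier H" "y \<in> carrier H" for x y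
  using A(2)[OF that(2,1)] cinner_commute[of "A x" y] cinner_commute[of x "T y"] that A(1) by simp
 have "(\<lambda>x\<in>carrier H. A x) \<in> \<B> H"
 proof (rule bop_restrictI[where b = "op_norm H T"])
  show "A (x \<oplus> y) = A x \<oplus> A y" if "x \<in> carrier H" "y \<in> carrier H" for x y
   by (rule vec_eqI) (use that A(1) A2 in auto)
  show "A (c \<odot> x) = c \<odot> A x" if "x \<in> carrier H" for c x
   by (rule vec_eqI) (use that A(1) A2 in auto)
  show "hnorm H (A x) \<le> op_norm H T * hnorm H x" if x: "x \<in> carrier H" for x
  proof (cases "A x = \<zero>")
   case False
   then have n: "hnorm H (A x) > 0" using hnorm_nonneg[OF A(1)[OF x]] hnorm_eq_0[OF A(1)[OF x]] by linarith
   have "(hnorm H (A x))\<^sup>2 = Re (cinner H x (T (A x)))"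
    using A2[OF x A(1)[OF x]] A(1)[OF x] by (simp add: hnorm_sq)
   also have "\<dots> \<le> hnorm H x * hnorm H (T (A x))"
    by (rule Re_cinner_le) (use x A in auto)
   also have "\<dots> \<le> hnorm H x * (op_norm H T * hnorm H (A x))"
    by (intro mult_left_mono op_norm_bound) (use x A T in auto)
   finally have "hnorm H (A x) * hnorm H (A x) \<le> op_norm H T * hnorm H x * hnorm H (A x)"
    by (simp add: power2_eq_square mult_ac)
   then show ?thesis using n by simp
  qed (use x T in simp)
 qed (use A in auto)
 then show ?thesis using A2 by (intro exI[of _ "\<lambda>x\<in>carrier H. A x"]) auto
qed

lemma adj_ex1:
 assumes T: "T \<in> \<B> H"
 shows "\<exists>!A. A \<in> \<B> H \<and> (\<forall>x\<in>carrier H. \<forall>y\<in>carrier H. cinner H (A x) y = cinner H x (T y))"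
 by (rule ex_ex1I[OF adj_ex[OF T]], rule bop_cinner_eqI) auto

lemma adj_closed [simp, intro]: "T \<in> \<B> H \<Longrightarrow> adj H T \<in> \<B> H"
 using theI'[OF adj_ex1[of T]] unfolding adj_def by blast

lemma cinner_adj_left [simp]:
 "T \<in> \<B> H \<Longrightarrow> x \<in> carrier H \<Longrightarrow> y \<in> carrier H \<Longrightarrow> cinner H (adj H T x) y = cinner H x (T y)"
 using theI'[OF adj_ex1[of T]] unfolding adj_def by blast

lemma cinner_adj_right [simp]:
 assumes "T \<in> \<B> H" "x \<in> carrier H" "y \<in> carrier H"
 shows "cinner H x (adj H T y) = cinner H (T x) y"
 using cinner_adj_left[OF assms(1,3,2)] cinner_commute[of x "adj H T y"] cinner_commute[of y "T x"] assms
 by (simp add: bop_closed)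

lemma adjI:
 assumes "T \<in> \<B> H" "A \<in> \<B> H"
  "\<And>x y. x \<in> carrier H \<Longrightarrow> y \<in> carrier H \<Longrightarrow> cinner H (A x) y = cinner H x (T y)"
 shows "adj H T = A"
 by (rule bop_cinner_eqI) (use assms in auto)

lemma adj_adj [simp]: "T \<in> \<B> H \<Longrightarrow> adj H (adj H T) = T"
 by (rule adjI) auto

lemma adj_mult:
 "S \<in> \<B> H \<Longrightarrow> T \<in> \<B> H \<Longrightarrow> adj H (S \<otimes>\<^bsub>BL H\<^esub> T) = adj H T \<otimes>\<^bsub>BL H\<^esub> adj H S"
 by (rule adjI) (auto simp: bop_closed)

lemma adj_add:
 "S \<in> \<B> H \<Longrightarrow> T \<in> \<B> H \<Longrightarrow> adj H (S \<oplus>\<^bsub>BL H\<^esub> T) = adj H S \<oplus>\<^bsub>BL H\<^esub> adj H T"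
 by (rule adjI) (auto simp: bop_closed)

lemma adj_minus:
 "S \<in> \<B> H \<Longrightarrow> T \<in> \<B> H \<Longrightarrow> adj H (S \<ominus>\<^bsub>BL H\<^esub> T) = adj H S \<ominus>\<^bsub>BL H\<^esub> adj H T"
 by (rule adjI) (auto simp: bop_closed)

lemma adj_smult: "T \<in> \<B> H \<Longrightarrow> adj H (c \<odot>\<^bsub>BL H\<^esub> T) = cnj c \<odot>\<^bsub>BL H\<^esub> adj H T"
 by (rule adjI) (auto simp: bop_closed)

lemma adj_one [simp]: "adj H \<one>\<^bsub>BL H\<^esub> = \<one>\<^bsub>BL H\<^esub>"
 by (rule adjI) auto

lemma adj_zero [simp]: "adj H \<zero>\<^bsub>BL H\<^esub> = \<zero>\<^bsub>BL H\<^esub>"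
 by (rule adjI) auto

lemma op_norm_adj_le:
 assumes T: "T \<in> \<B> H"
 shows "op_norm H (adj H T) \<le> op_norm H T"
proof (rule op_norm_le)
 note [simp] = bop_rules[OF T] bop_rules[OF adj_closed[OF T]]
 fix x assume x: "x \<in> carrier H"
 show "hnorm H (adj H T x) \<le> op_norm H T * hnorm H x"
 proof (cases "adj H T x = \<zero>")
  case False
  then have n: "hnorm H (adj H T x) > 0"
   using hnorm_nonneg[OF bop_closed[OF adj_closed[OF T] x]] hnorm_eq_0[OF bop_closed[OF adj_closed[OF T] x]]
   by linarith
  have "(hnorm H (adj H T x))\<^sup>2 = Re (cinner H x (T (adj H T x)))"
   using x T by (simp add: hnorm_sq del: cinner_adj_right)
  also have "\<dots> \<le> hnorm H x * hnorm H (T (adj H T x))"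
   by (rule Re_cinner_le) (use x in auto)
  also have "\<dots> \<le> hnorm H x * (op_norm H T * hnorm H (adj H T x))"
   by (intro mult_left_mono op_norm_bound) (use x T in auto)
  finally have "hnorm H (adj H T x) * hnorm H (adj H T x) \<le> op_norm H T * hnorm H x * hnorm H (adj H T x)"
   by (simp add: power2_eq_square mult_ac)
  then show ?thesis using n by simp
 qed (use x T in simp)
qed (use T in simp)

lemma op_norm_adj [simp]: "T \<in> \<B> H \<Longrightarrow> op_norm H (adj H T) = op_norm H T"
 using op_norm_adj_le[of T] op_norm_adj_le[of "adj H T"] by simp

lemma hnorm_adj_normal:
 assumes "normal_op H T" and x: "x \<in> carrier H"
 shows "hnorm H (adj H T x) = hnorm H (T x)"
proof (rule power2_eq_imp_eq)
 have T: "T \<in> \<B> H" and c: "adj H T \<otimes>\<^bsub>BL H\<^esub> T = T \<otimes>\<^bsub>BL H\<^esub> adj H T"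
  using assms by (auto simp: normal_op_def)
 note [simp] = bop_rules[OF T] bop_rules[OF adj_closed[OF T]]
 have "adj H T (T x) = T (adj H T x)" using fun_cong[OF c, of x] x by simp
 moreover have "cinner H (adj H T x) (adj H T x) = cinner H x (T (adj H T x))" using x T by (simp del: cinner_adj_right)
 moreover have "cinner H (T x) (T x) = cinner H x (adj H T (T x))" using x T by simp
 ultimately show "(hnorm H (adj H T x))\<^sup>2 = (hnorm H (T x))\<^sup>2" using x by (simp add: hnorm_sq)
qed (use assms in \<open>auto simp: normal_op_def bop_closed\<close>)

lemma op_norm_diff_mult_right:
 assumes "S \<in> \<B> H" "T \<in> \<B> H" "Y \<in> \<B> H"
 shows "op_norm H (S \<otimes>\<^bsub>BL H\<^esub> Y \<ominus>\<^bsub>BL H\<^esub> T \<otimes>\<^bsub>BL H\<^esub> Y) \<le> op_norm H (S \<ominus>\<^bsub>BL H\<^esub> T) * op_norm H Y"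
proof -
 have "S \<otimes>\<^bsub>BL H\<^esub> Y \<ominus>\<^bsub>BL H\<^esub> T \<otimes>\<^bsub>BL H\<^esub> Y = (S \<ominus>\<^bsub>BL H\<^esub> T) \<otimes>\<^bsub>BL H\<^esub> Y"
  by (rule bop_eqI) (use assms in \<open>auto simp: bop_closed\<close>)
 then show ?thesis using op_norm_mult_le[of "S \<ominus>\<^bsub>BL H\<^esub> T" Y] assms by simp
qed

lemma op_norm_diff_mult_left:
 assumes S: "S \<in> \<B> H" and T: "T \<in> \<B> H" and Y: "Y \<in> \<B> H"
 shows "op_norm H (Y \<otimes>\<^bsub>BL H\<^esub> S \<ominus>\<^bsub>BL H\<^esub> Y \<otimes>\<^bsub>BL H\<^esub> T) \<le> op_norm H Y * op_norm H (S \<ominus>\<^bsub>BL H\<^esub> T)"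
proof -
 have "Y \<otimes>\<^bsub>BL H\<^esub> S \<ominus>\<^bsub>BL H\<^esub> Y \<otimes>\<^bsub>BL H\<^esub> T = Y \<otimes>\<^bsub>BL H\<^esub> (S \<ominus>\<^bsub>BL H\<^esub> T)"
  by (rule bop_eqI) (use assms in \<open>auto simp: bop_closed[OF S] bop_closed[OF T] bop_rules[OF Y]\<close>)
 then show ?thesis using op_norm_mult_le[of Y "S \<ominus>\<^bsub>BL H\<^esub> T"] assms by simp
qed

lemma op_norm_diff_adj:
 assumes "S \<in> \<B> H" "T \<in> \<B> H"
 shows "op_norm H (adj H S \<ominus>\<^bsub>BL H\<^esub> adj H T) = op_norm H (S \<ominus>\<^bsub>BL H\<^esub> T)"
 using assms by (simp add: adj_minus[symmetric])

section \<open>Unital star-subalgebras; C*-algebras and von Neumann algebras as hulls\<close>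

lemma unital_star_subalgebraI:
 assumes "A \<subseteq> \<B> H" "\<one>\<^bsub>BL H\<^esub> \<in> A" "\<And>S T. S \<in> A \<Longrightarrow> T \<in> A \<Longrightarrow> S \<otimes>\<^bsub>BL H\<^esub> T \<in> A"
  "\<And>S T. S \<in> A \<Longrightarrow> T \<in> A \<Longrightarrow> S \<oplus>\<^bsub>BL H\<^esub> T \<in> A" "\<And>c T. T \<in> A \<Longrightarrow> c \<odot>\<^bsub>BL H\<^esub> T \<in> A"
  "\<And>T. T \<in> A \<Longrightarrow> adj H T \<in> A"
 shows "unital_star_subalgebra H A"
 unfolding unital_star_subalgebra_def
proof (intro conjI BL.subringI ballI allI)
 show "\<ominus>\<^bsub>BL H\<^esub> T \<in> A" if T: "T \<in> A" for T
 proof -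
  have "\<ominus>\<^bsub>BL H\<^esub> T = (- 1) \<odot>\<^bsub>BL H\<^esub> T"
   using BL_minus[of "\<zero>\<^bsub>BL H\<^esub>" T] T assms(1) by (auto simp: a_minus_def)
  then show ?thesis using assms(5)[OF T] by simp
 qed
qed (use assms in auto)

lemma unital_star_subalgebraD:
 assumes "unital_star_subalgebra H A"
 shows "A \<subseteq> \<B> H" "\<one>\<^bsub>BL H\<^esub> \<in> A" "\<And>S T. S \<in> A \<Longrightarrow> T \<in> A \<Longrightarrow> S \<otimes>\<^bsub>BL H\<^esub> T \<in> A"
  "\<And>S T. S \<in> A \<Longrightarrow> T \<in> A \<Longrightarrow> S \<oplus>\<^bsub>BL H\<^esub> T \<in> A" "\<And>c T. T \<in> A \<Longrightarrow> c \<odot>\<^bsub>BL H\<^esub> T \<in> A"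
  "\<And>T. T \<in> A \<Longrightarrow> adj H T \<in> A" "\<And>S T. S \<in> A \<Longrightarrow> T \<in> A \<Longrightarrow> S \<ominus>\<^bsub>BL H\<^esub> T \<in> A"
  "\<zero>\<^bsub>BL H\<^esub> \<in> A"
proof -
 have s: "subring A (BL H)" using assms by (simp add: unital_star_subalgebra_def)
 show 1: "A \<subseteq> \<B> H" "\<one>\<^bsub>BL H\<^esub> \<in> A" "\<And>S T. S \<in> A \<Longrightarrow> T \<in> A \<Longrightarrow> S \<otimes>\<^bsub>BL H\<^esub> T \<in> A"
  and 2: "\<And>S T. S \<in> A \<Longrightarrow> T \<in> A \<Longrightarrow> S \<oplus>\<^bsub>BL H\<^esub> T \<in> A" "\<zero>\<^bsub>BL H\<^esub> \<in> A"
  by (fact subringE[OF s])+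
 show 3: "\<And>c T. T \<in> A \<Longrightarrow> c \<odot>\<^bsub>BL H\<^esub> T \<in> A" "\<And>T. T \<in> A \<Longrightarrow> adj H T \<in> A"
  using assms unfolding unital_star_subalgebra_def by (blast, blast)
 show "S \<ominus>\<^bsub>BL H\<^esub> T \<in> A" if "S \<in> A" "T \<in> A" for S T
  unfolding BL_minus[OF subsetD[OF 1(1) that(1)] subsetD[OF 1(1) that(2)]]
  by (rule 2(1)[OF that(1) 3(1)[OF that(2)]])
qed

lemma unital_star_subalgebra_carrier: "unital_star_subalgebra H (\<B> H)"
 by (rule unital_star_subalgebraI) simp_all

lemma unital_star_subalgebra_Inter:
 assumes "\<A> \<noteq> {}" "\<And>A. A \<in> \<A> \<Longrightarrow> unital_star_subalgebra H A"
 shows "unital_star_subalgebra H (\<Inter>\<A>)"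
proof (rule unital_star_subalgebraI)
 note D = unital_star_subalgebraD[OF assms(2)]
 obtain A where "A \<in> \<A>" using assms(1) by blast
 then show "\<Inter>\<A> \<subseteq> \<B> H" using D(1)[of A] by (meson Inter_lower order_trans)
 show "\<one>\<^bsub>BL H\<^esub> \<in> \<Inter>\<A>" using D(2) by (rule InterI)
 show "S \<otimes>\<^bsub>BL H\<^esub> T \<in> \<Inter>\<A>" if "S \<in> \<Inter>\<A>" "T \<in> \<Inter>\<A>" for S T
  by (rule InterI, rule D(3), assumption) (use that in \<open>simp_all only: Inter_iff\<close>)
 show "S \<oplus>\<^bsub>BL H\<^esub> T \<in> \<Inter>\<A>" if "S \<in> \<Inter>\<A>" "T \<in> \<Inter>\<A>" for S T
  by (rule InterI, rule D(4), assumption) (use that in \<open>simp_all only: Inter_iff\<close>)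
 show "c \<odot>\<^bsub>BL H\<^esub> T \<in> \<Inter>\<A>" if "T \<in> \<Inter>\<A>" for c T
  by (rule InterI, rule D(5), assumption) (use that in \<open>simp_all only: Inter_iff\<close>)
 show "adj H T \<in> \<Inter>\<A>" if "T \<in> \<Inter>\<A>" for T
  by (rule InterI, rule D(6), assumption) (use that in \<open>simp_all only: Inter_iff\<close>)
qed

lemma closedin_op_norm_carrier: "closedin (op_norm_topology H) (\<B> H)"
 unfolding closedin_op_norm_iff by blast

lemma Cstar_star_subalgebra:
 assumes "A \<subseteq> \<B> H"
 shows "unital_star_subalgebra H (Cstar H A)"
 unfolding Cstar_def hull_def
 by (rule unital_star_subalgebra_Inter)
   (use assms unital_star_subalgebra_carrier closedin_op_norm_carrier in auto)

lemma Cstar_closed: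
 assumes "A \<subseteq> \<B> H"
 shows "closedin (op_norm_topology H) (Cstar H A)"
 unfolding Cstar_def hull_def
 by (rule closedin_Inter)
   (use assms unital_star_subalgebra_carrier closedin_op_norm_carrier in auto)

lemma Cstar_superset: "A \<subseteq> Cstar H A"
 unfolding Cstar_def by (rule hull_subset)

lemma Cstar_minimal:
 "A \<subseteq> B \<Longrightarrow> unital_star_subalgebra H B \<Longrightarrow> closedin (op_norm_topology H) B \<Longrightarrow> Cstar H A \<subseteq> B"
 unfolding Cstar_def by (rule hull_minimal) auto

lemma Cstar_subset: "A \<subseteq> \<B> H \<Longrightarrow> Cstar H A \<subseteq> \<B> H"
 using unital_star_subalgebraD(1)[OF Cstar_star_subalgebra] by blast

text \<open>The operators that, together with their adjoints, map \<open>Y\<close> into itself from the left form a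
 closed star-algebra.\<close>

lemma Cstar_left_induct:
 assumes A: "A \<subseteq> \<B> H" and Y: "Y \<subseteq> \<B> H" "closedin (op_norm_topology H) Y"
  and one: "\<one>\<^bsub>BL H\<^esub> \<in> Y" and add: "\<And>S T. S \<in> Y \<Longrightarrow> T \<in> Y \<Longrightarrow> S \<oplus>\<^bsub>BL H\<^esub> T \<in> Y"
  and smult: "\<And>c T. T \<in> Y \<Longrightarrow> c \<odot>\<^bsub>BL H\<^esub> T \<in> Y"
  and gen: "\<And>S T. S \<in> A \<Longrightarrow> T \<in> Y \<Longrightarrow> S \<otimes>\<^bsub>BL H\<^esub> T \<in> Y"
  and gen_adj: "\<And>S T. S \<in> A \<Longrightarrow> T \<in> Y \<Longrightarrow> adj H S \<otimes>\<^bsub>BL H\<^esub> T \<in> Y"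
 shows "Cstar H A \<subseteq> Y"
proof -
 define B where "B = {S \<in> \<B> H. \<forall>T\<in>Y. S \<otimes>\<^bsub>BL H\<^esub> T \<in> Y \<and> adj H S \<otimes>\<^bsub>BL H\<^esub> T \<in> Y}"
 have YD: "T \<in> \<B> H" if "T \<in> Y" for T using Y(1) that by blast
 have smult_left: "(c \<odot>\<^bsub>BL H\<^esub> S) \<otimes>\<^bsub>BL H\<^esub> T = c \<odot>\<^bsub>BL H\<^esub> (S \<otimes>\<^bsub>BL H\<^esub> T)"
  if "S \<in> \<B> H" "T \<in> \<B> H" for c S T
  by (rule bop_eqI) (use that in \<open>auto simp: bop_closed\<close>)
 have "Cstar H A \<subseteq> B"
 proof (rule Cstar_minimal)
  show "A \<subseteq> B" using A gen gen_adj by (auto simp: B_def)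
  show "unital_star_subalgebra H B"
  proof (rule unital_star_subalgebraI)
   show "S \<otimes>\<^bsub>BL H\<^esub> T \<in> B" if "S \<in> B" "T \<in> B" for S T
    using that YD by (auto simp: B_def adj_mult BL.m_assoc)
   show "S \<oplus>\<^bsub>BL H\<^esub> T \<in> B" if "S \<in> B" "T \<in> B" for S T
    using that YD add by (auto simp: B_def adj_add BL.l_distr)
   show "c \<odot>\<^bsub>BL H\<^esub> T \<in> B" if "T \<in> B" for c T
    using that YD smult by (auto simp: B_def adj_smult smult_left)
  qed (use YD in \<open>auto simp: B_def\<close>)
  show "closedin (op_norm_topology H) B"
   unfolding closedin_op_norm_iff
  proof (intro conjI allI impI)
   fix S L assume S: "\<forall>n. S n \<in> B" and L: "L \<in> \<B> H"
    and lim: "(\<lambda>n. op_norm H (S n \<ominus>\<^bsub>BL H\<^esub> L)) \<longlonglongrightarrow> 0"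
   have Sc: "S n \<in> \<B> H" for n using S by (auto simp: B_def)
   have "L \<otimes>\<^bsub>BL H\<^esub> T \<in> Y \<and> adj H L \<otimes>\<^bsub>BL H\<^esub> T \<in> Y" if T: "T \<in> Y" for T
   proof
    have lim2: "(\<lambda>n. op_norm H (S n \<ominus>\<^bsub>BL H\<^esub> L) * op_norm H T) \<longlonglongrightarrow> 0"
     using tendsto_mult[OF lim tendsto_const, of "op_norm H T"] by simp
    have "(\<lambda>n. op_norm H (S n \<otimes>\<^bsub>BL H\<^esub> T \<ominus>\<^bsub>BL H\<^esub> L \<otimes>\<^bsub>BL H\<^esub> T)) \<longlonglongrightarrow> 0"
     by (rule squeeze_null[OF lim2]) (use Sc L YD[OF T] op_norm_diff_mult_right in auto)
    moreover have "S n \<otimes>\<^bsub>BL H\<^esub> T \<in> Y" for n using S T by (auto simp: B_def)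
    ultimately show "L \<otimes>\<^bsub>BL H\<^esub> T \<in> Y"
     using Y(2) L YD[OF T] unfolding closedin_op_norm_iff by (metis BL_mult_closed)
    have "(\<lambda>n. op_norm H (adj H (S n) \<otimes>\<^bsub>BL H\<^esub> T \<ominus>\<^bsub>BL H\<^esub> adj H L \<otimes>\<^bsub>BL H\<^esub> T)) \<longlonglongrightarrow> 0"
    proof (rule squeeze_null[OF lim2])
     show "op_norm H (adj H (S n) \<otimes>\<^bsub>BL H\<^esub> T \<ominus>\<^bsub>BL H\<^esub> adj H L \<otimes>\<^bsub>BL H\<^esub> T)
       \<le> op_norm H (S n \<ominus>\<^bsub>BL H\<^esub> L) * op_norm H T" for n
      using op_norm_diff_mult_right[of "adj H (S n)" "adj H L" T] Sc L YD[OF T]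
      by (simp add: op_norm_diff_adj)
    qed (use Sc L YD[OF T] in auto)
    moreover have "adj H (S n) \<otimes>\<^bsub>BL H\<^esub> T \<in> Y" for n using S T by (auto simp: B_def)
    ultimately show "adj H L \<otimes>\<^bsub>BL H\<^esub> T \<in> Y"
     using Y(2) L YD[OF T] unfolding closedin_op_norm_iff by (metis BL_mult_closed adj_closed)
   qed
   then show "L \<in> B" using L by (auto simp: B_def)
  qed (auto simp: B_def)
 qed
 moreover have "B \<subseteq> Y"
 proof
  fix S assume S: "S \<in> B"
  then have "S \<in> \<B> H" "S \<otimes>\<^bsub>BL H\<^esub> \<one>\<^bsub>BL H\<^esub> \<in> Y" using one by (auto simp only: B_def)
  then show "S \<in> Y" by (simp only: BL.r_one)
 qed
 ultimately show ?thesis by blast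
qed

text \<open>The commutant of Y alone need not be closed under adjoints. It is therefore treated by
  \<open>Cstar_left_induct\<close>, which asks for left multiplication by the generators and their
  adjoints.\<close>

lemma Cstar_commutes:
 assumes A: "A \<subseteq> \<B> H" and Y: "Y \<in> \<B> H"
  and c: "\<And>T. T \<in> A \<Longrightarrow> Y \<otimes>\<^bsub>BL H\<^esub> T = T \<otimes>\<^bsub>BL H\<^esub> Y"
   "\<And>T. T \<in> A \<Longrightarrow> Y \<otimes>\<^bsub>BL H\<^esub> adj H T = adj H T \<otimes>\<^bsub>BL H\<^esub> Y"
  and T: "T \<in> Cstar H A"
 shows "Y \<otimes>\<^bsub>BL H\<^esub> T = T \<otimes>\<^bsub>BL H\<^esub> Y"
proof -
 let ?B = "{T \<in> \<B> H. Y \<otimes>\<^bsub>BL H\<^esub> T = T \<otimes>\<^bsub>BL H\<^esub> Y}"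
 note [simp] = bop_rules[OF Y]
 have ptw: "Y \<otimes>\<^bsub>BL H\<^esub> T = T \<otimes>\<^bsub>BL H\<^esub> Y \<longleftrightarrow> (\<forall>x\<in>carrier H. Y (T x) = T (Y x))"
  if T: "T \<in> \<B> H" for T
 proof
  assume e: "Y \<otimes>\<^bsub>BL H\<^esub> T = T \<otimes>\<^bsub>BL H\<^esub> Y"
  show "\<forall>x\<in>carrier H. Y (T x) = T (Y x)"
  proof
   fix x assume "x \<in> carrier H"
   then show "Y (T x) = T (Y x)" using fun_cong[OF e, of x] by simp
  qed
 next
  assume "\<forall>x\<in>carrier H. Y (T x) = T (Y x)"
  then show "Y \<otimes>\<^bsub>BL H\<^esub> T = T \<otimes>\<^bsub>BL H\<^esub> Y" by (intro bop_eqI) (use T Y in auto)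
 qed
 have cl: "closedin (op_norm_topology H) ?B"
  unfolding closedin_op_norm_iff
 proof (intro conjI allI impI)
  fix S L assume S: "\<forall>n. S n \<in> ?B" and L: "L \<in> \<B> H"
   and lim: "(\<lambda>n. op_norm H (S n \<ominus>\<^bsub>BL H\<^esub> L)) \<longlonglongrightarrow> 0"
  have Sc: "S n \<in> \<B> H" for n using S by auto
  have "(\<lambda>n. op_norm H Y * op_norm H (S n \<ominus>\<^bsub>BL H\<^esub> L)) \<longlonglongrightarrow> 0"
   using tendsto_mult[OF tendsto_const lim, of "op_norm H Y"] by simp
  then have l1: "(\<lambda>n. op_norm H (Y \<otimes>\<^bsub>BL H\<^esub> S n \<ominus>\<^bsub>BL H\<^esub> Y \<otimes>\<^bsub>BL H\<^esub> L)) \<longlonglongrightarrow> 0"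
   by (rule squeeze_null) (use Sc L Y op_norm_diff_mult_left in auto)
  have "(\<lambda>n. op_norm H (S n \<ominus>\<^bsub>BL H\<^esub> L) * op_norm H Y) \<longlonglongrightarrow> 0"
   using tendsto_mult[OF lim tendsto_const, of "op_norm H Y"] by simp
  then have l2: "(\<lambda>n. op_norm H (S n \<otimes>\<^bsub>BL H\<^esub> Y \<ominus>\<^bsub>BL H\<^esub> L \<otimes>\<^bsub>BL H\<^esub> Y)) \<longlonglongrightarrow> 0"
   by (rule squeeze_null) (use Sc L Y op_norm_diff_mult_right in auto)
  have "Y \<otimes>\<^bsub>BL H\<^esub> L = L \<otimes>\<^bsub>BL H\<^esub> Y"
  proof (rule om.limitin_metric_unique)
   show "limitin om.mtopology (\<lambda>n. Y \<otimes>\<^bsub>BL H\<^esub> S n) (Y \<otimes>\<^bsub>BL H\<^esub> L) sequentially"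
    by (subst limitin_op_norm_iff) (use Sc L Y l1 in auto)
   have eq: "(\<lambda>n. Y \<otimes>\<^bsub>BL H\<^esub> S n) = (\<lambda>n. S n \<otimes>\<^bsub>BL H\<^esub> Y)" using S by auto
   show "limitin om.mtopology (\<lambda>n. Y \<otimes>\<^bsub>BL H\<^esub> S n) (L \<otimes>\<^bsub>BL H\<^esub> Y) sequentially"
    unfolding eq by (subst limitin_op_norm_iff) (use Sc L Y l2 in auto)
  qed simp
  then show "L \<in> ?B" using L by simp
 qed auto
 have "Cstar H A \<subseteq> ?B"
 proof (rule Cstar_left_induct[OF A _ cl])
  fix S T assume S: "S \<in> A" and T: "T \<in> ?B"
  have Sc: "S \<in> \<B> H" using S A by blast
  show "S \<otimes>\<^bsub>BL H\<^esub> T \<in> ?B"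
   using T Y Sc c(1)[OF S] by (simp add: BL.m_assoc) (metis BL.m_assoc)
  show "adj H S \<otimes>\<^bsub>BL H\<^esub> T \<in> ?B"
   using T Y Sc c(2)[OF S] by (simp add: BL.m_assoc) (metis BL.m_assoc adj_closed)
 qed (use Y in \<open>auto simp: BL.r_distr BL.l_distr ptw bop_closed\<close>)
 then show ?thesis using T by blast
qed

lemma topspace_weak_op: "topspace (weak_op_topology H) = \<B> H"
 unfolding weak_op_topology_def topology_generated_by_topspace
proof
 show "\<B> H \<subseteq> \<Union> {{T \<in> \<B> H. cinner H (T x) y \<in> W} |x y W. x \<in> carrier H \<and> y \<in> carrier H \<and> open W}"
 proof
  fix T assume "T \<in> \<B> H"
  then have T: "T \<in> {T \<in> \<B> H. cinner H (T \<zero>) \<zero> \<in> UNIV}" by simp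
  show "T \<in> \<Union> {{T \<in> \<B> H. cinner H (T x) y \<in> W} |x y W. x \<in> carrier H \<and> y \<in> carrier H \<and> open W}"
   by (rule UnionI[OF _ T], rule CollectI, rule exI[of _ \<zero>], rule exI[of _ \<zero>], rule exI[of _ UNIV]) simp
 qed
 show "\<Union> {{T \<in> \<B> H. cinner H (T x) y \<in> W} |x y W. x \<in> carrier H \<and> y \<in> carrier H \<and> open W}
   \<subseteq> \<B> H"
  by (rule Union_least, elim CollectE exE conjE, simp only: Collect_restrict)
qed

lemma continuous_map_weak_op:
 assumes "x \<in> carrier H" "y \<in> carrier H"
 shows "continuous_map (weak_op_topology H) euclidean (\<lambda>T. cinner H (T x) y)"
 unfolding continuous_map_def topspace_weak_op
proof (intro conjI allI impI)
 fix W :: "complex set" assume W: "openin euclidean W"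
 show "openin (weak_op_topology H) {T \<in> \<B> H. cinner H (T x) y \<in> W}"
  unfolding weak_op_topology_def
  by (rule topology_generated_by_Basis, rule CollectI, rule exI[of _ x], rule exI[of _ y], rule exI[of _ W])
    (use W assms in simp)
qed simp

text \<open>The operators that commute with both Y and Y^* form a star-algebra. It is weakly closed,
  because Y T = T Y says that the weakly continuous functions T |-> <T x, Y^* y> and T |-> <T Y x,
  y> agree for all x and y.\<close>

lemma commutant_vN_algebra:
 assumes A: "A \<subseteq> \<B> H" and Y: "Y \<in> \<B> H"
  and c: "\<And>T. T \<in> A \<Longrightarrow> Y \<otimes>\<^bsub>BL H\<^esub> T = T \<otimes>\<^bsub>BL H\<^esub> Y"
   "\<And>T. T \<in> A \<Longrightarrow> Y \<otimes>\<^bsub>BL H\<^esub> adj H T = adj H T \<otimes>\<^bsub>BL H\<^esub> Y"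
 shows "Y \<in> commutant H (vN_algebra H A)"
proof -
 let ?C = "\<lambda>Y. {T \<in> \<B> H. Y \<otimes>\<^bsub>BL H\<^esub> T = T \<otimes>\<^bsub>BL H\<^esub> Y}"
 have adjc: "adj H Y \<otimes>\<^bsub>BL H\<^esub> adj H T = adj H T \<otimes>\<^bsub>BL H\<^esub> adj H Y"
  if "Y \<otimes>\<^bsub>BL H\<^esub> T = T \<otimes>\<^bsub>BL H\<^esub> Y" "T \<in> \<B> H" "Y \<in> \<B> H" for T Y
  using adj_mult[OF that(3,2)] adj_mult[OF that(2,3)] unfolding that(1) by simp
 have cl: "closedin (weak_op_topology H) (?C Y)" if Y: "Y \<in> \<B> H" for Y
 proof -
  note [simp] = bop_rules[OF Y] bop_rules[OF adj_closed[OF Y]]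
  have eq: "?C Y = (\<Inter>(x, y)\<in>carrier H \<times> carrier H.
   {T \<in> topspace (weak_op_topology H). cinner H (T x) (adj H Y y) = cinner H (T (Y x)) y})" (is "_ = ?R")
  proof
   show "?C Y \<subseteq> ?R"
   proof
    fix T assume T: "T \<in> ?C Y"
    then have e: "Y \<otimes>\<^bsub>BL H\<^esub> T = T \<otimes>\<^bsub>BL H\<^esub> Y" and Tc: "T \<in> \<B> H" by auto
    have "Y (T x) = T (Y x)" if "x \<in> carrier H" for x
     using fun_cong[OF e, of x] that by simp
    then show "T \<in> ?R" using Tc Y by (auto simp: topspace_weak_op bop_closed[OF Tc])
   qed
   show "?R \<subseteq> ?C Y"
   proof
    fix T assume T: "T \<in> ?R"
    \<comment> \<open>The index set of the intersection contains the pair of zero vectors. Being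
      nonempty, it forces T into the topspace.\<close>
    then have Tc: "T \<in> \<B> H" using M.zero_closed by (auto simp: topspace_weak_op)
    have "Y \<otimes>\<^bsub>BL H\<^esub> T = T \<otimes>\<^bsub>BL H\<^esub> Y"
     by (rule bop_cinner_eqI) (use T Tc Y in \<open>auto simp: bop_closed[OF Tc]\<close>)
    then show "T \<in> ?C Y" using Tc by simp
   qed
  qed
  show ?thesis
   unfolding eq
  proof (rule closedin_INT)
   show "closedin (weak_op_topology H) (case p of (x, y) \<Rightarrow>
    {T \<in> topspace (weak_op_topology H). cinner H (T x) (adj H Y y) = cinner H (T (Y x)) y})"
    if "p \<in> carrier H \<times> carrier H" for p
    using that by (auto split: prod.splits intro!: closedin_continuous_maps_eq[where Y = euclidean] continuous_map_weak_op)
  qed auto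
 qed
 have "vN_algebra H A \<subseteq> ?C Y \<inter> ?C (adj H Y)"
  unfolding vN_algebra_def
 proof (rule hull_minimal)
  show "A \<subseteq> ?C Y \<inter> ?C (adj H Y)"
  proof
   fix T assume T: "T \<in> A"
   then have Tc: "T \<in> \<B> H" using A by blast
   show "T \<in> ?C Y \<inter> ?C (adj H Y)" using adjc[OF c(2)[OF T] adj_closed[OF Tc] Y] c(1)[OF T] Tc by simp
  qed
  have "unital_star_subalgebra H (?C Y \<inter> ?C (adj H Y))"
  proof (rule unital_star_subalgebraI)
   fix S T assume S: "S \<in> ?C Y \<inter> ?C (adj H Y)" and T: "T \<in> ?C Y \<inter> ?C (adj H Y)"
   then have eqs: "Y \<otimes>\<^bsub>BL H\<^esub> S = S \<otimes>\<^bsub>BL H\<^esub> Y" "Y \<otimes>\<^bsub>BL H\<^esub> T = T \<otimes>\<^bsub>BL H\<^esub> Y"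
    "adj H Y \<otimes>\<^bsub>BL H\<^esub> S = S \<otimes>\<^bsub>BL H\<^esub> adj H Y" "adj H Y \<otimes>\<^bsub>BL H\<^esub> T = T \<otimes>\<^bsub>BL H\<^esub> adj H Y"
    and Sc: "S \<in> \<B> H" and Tc: "T \<in> \<B> H" by auto
   have "Z \<otimes>\<^bsub>BL H\<^esub> (S \<otimes>\<^bsub>BL H\<^esub> T) = S \<otimes>\<^bsub>BL H\<^esub> T \<otimes>\<^bsub>BL H\<^esub> Z"
    if "Z \<otimes>\<^bsub>BL H\<^esub> S = S \<otimes>\<^bsub>BL H\<^esub> Z" "Z \<otimes>\<^bsub>BL H\<^esub> T = T \<otimes>\<^bsub>BL H\<^esub> Z" "Z \<in> \<B> H" for Z
    using that Sc Tc by (metis BL.m_assoc)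
   from this[OF eqs(1,2)] this[OF eqs(3,4)] show "S \<otimes>\<^bsub>BL H\<^esub> T \<in> ?C Y \<inter> ?C (adj H Y)"
    using Sc Tc Y by simp
   show "S \<oplus>\<^bsub>BL H\<^esub> T \<in> ?C Y \<inter> ?C (adj H Y)" using eqs Sc Tc Y by (simp add: BL.l_distr BL.r_distr)
  next
   fix c T assume T: "T \<in> ?C Y \<inter> ?C (adj H Y)"
   then have eqs: "Y \<otimes>\<^bsub>BL H\<^esub> T = T \<otimes>\<^bsub>BL H\<^esub> Y" "adj H Y \<otimes>\<^bsub>BL H\<^esub> T = T \<otimes>\<^bsub>BL H\<^esub> adj H Y"
    and Tc: "T \<in> \<B> H" by auto
   have "Z \<otimes>\<^bsub>BL H\<^esub> (c \<odot>\<^bsub>BL H\<^esub> T) = (c \<odot>\<^bsub>BL H\<^esub> T) \<otimes>\<^bsub>BL H\<^esub> Z"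
    if e: "Z \<otimes>\<^bsub>BL H\<^esub> T = T \<otimes>\<^bsub>BL H\<^esub> Z" and Z: "Z \<in> \<B> H" for Z
   proof (rule bop_eqI)
    fix x assume x: "x \<in> carrier H"
    show "(Z \<otimes>\<^bsub>BL H\<^esub> (c \<odot>\<^bsub>BL H\<^esub> T)) x = ((c \<odot>\<^bsub>BL H\<^esub> T) \<otimes>\<^bsub>BL H\<^esub> Z) x"
     using fun_cong[OF e, of x] x Z Tc by (simp add: bop_rules[OF Z] bop_closed[OF Tc])
   qed (use Z Tc in auto)
   from this[OF eqs(1)] this[OF eqs(2)] show "c \<odot>\<^bsub>BL H\<^esub> T \<in> ?C Y \<inter> ?C (adj H Y)"
    using Tc Y by simp
   show "adj H T \<in> ?C Y \<inter> ?C (adj H Y)"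
    using adjc[OF eqs(1) Tc Y] adjc[OF eqs(2) Tc] Tc Y by simp
  qed (use Y in auto)
  moreover have "closedin (weak_op_topology H) (?C Y \<inter> ?C (adj H Y))"
   by (intro closedin_Int cl) (use Y in auto)
  ultimately show "unital_star_subalgebra H (?C Y \<inter> ?C (adj H Y)) \<and> closedin (weak_op_topology H) (?C Y \<inter> ?C (adj H Y))"
   by blast
 qed
 then show ?thesis using Y by (auto simp: commutant_def)
qed

end

section \<open>Joint approximate eigenvalues of commuting normal operators\<close>

context hilbert_space
begin

lemma commuteD:
 "S \<otimes>\<^bsub>BL H\<^esub> T = T \<otimes>\<^bsub>BL H\<^esub> S \<Longrightarrow> x \<in> carrier H \<Longrightarrow> S (T x) = T (S x)"
 by (metis BL_apply(1))

lemma commuteI: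
 assumes "S \<in> \<B> H" "T \<in> \<B> H" "\<And>x. x \<in> carrier H \<Longrightarrow> S (T x) = T (S x)"
 shows "S \<otimes>\<^bsub>BL H\<^esub> T = T \<otimes>\<^bsub>BL H\<^esub> S"
 by (rule bop_eqI) (use assms in simp_all)

text \<open>One step of the construction of joint approximate eigenvectors: \<open>a\<close> is the limit of the suprema
 of \<open>\<langle>A x, x\<rangle>\<close> over the unit vectors \<open>x\<close> with \<open>q x \<le> e\<close> as \<open>e\<close> tends to \<open>0\<close>. Comparing
 a nearly maximal \<open>x\<close> with \<open>x + t A x\<close> shows that \<open>\<parallel>A x\<parallel>\<^sup>2\<close> is nearly \<open>a\<^sup>2\<close>.\<close>

lemma approx_eigenvalue_step:
 fixes q :: "'a \<Rightarrow> real"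
 assumes A: "A \<in> \<B> H" and sa: "adj H A = A"
  and q_add: "\<And>x y. x \<in> carrier H \<Longrightarrow> y \<in> carrier H \<Longrightarrow> q (x \<oplus> y) \<le> q x + q y"
  and q_smult: "\<And>c x. x \<in> carrier H \<Longrightarrow> q (c \<odot> x) = cmod c * q x"
  and q_A: "\<And>x. x \<in> carrier H \<Longrightarrow> q (A x) \<le> M * q x" and M: "M \<ge> 0"
  and ne: "\<And>e. e > 0 \<Longrightarrow> \<exists>x\<in>carrier H. hnorm H x = 1 \<and> q x \<le> e"
 shows "\<exists>a::real. (\<forall>e>0. \<exists>x\<in>carrier H. hnorm H x = 1 \<and> q x \<le> e \<and> hnorm H (A x \<ominus> complex_of_real a \<odot> x) \<le> e)
  \<and> (\<forall>r. (\<forall>e>0. \<exists>x\<in>carrier H. hnorm H x = 1 \<and> q x \<le> e \<and> r \<le> Re (cinner H (A x) x)) \<longrightarrow> r \<le> a)"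
proof -
 note [simp] = bop_rules[OF A]
 define N where "N = op_norm H A"
 have N: "N \<ge> 0" using A by (simp add: N_def)
 have An: "hnorm H (A x) \<le> N * hnorm H x" if "x \<in> carrier H" for x
  unfolding N_def using op_norm_bound[OF A that] .
 have sym: "cinner H (A x) y = cinner H x (A y)" if "x \<in> carrier H" "y \<in> carrier H" for x y
  using cinner_adj_left[OF A that] sa by simp
 have ub: "\<bar>Re (cinner H (A x) x)\<bar> \<le> N" if "x \<in> carrier H" "hnorm H x = 1" for x
  using Cauchy_Schwarz[of "A x" x] An[of x] that abs_Re_le_cmod[of "cinner H (A x) x"] by simp
 define P where "P r \<longleftrightarrow> (\<forall>e>0. \<exists>x\<in>carrier H. hnorm H x = 1 \<and> q x \<le> e \<and> r \<le> Re (cinner H (A x) x))" for r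
 have P_le: "r \<le> N" if "P r" for r
  using that ub unfolding P_def by (meson abs_le_D1 order_trans zero_less_one)
 have P_N: "P (- N)"
  unfolding P_def
 proof (intro allI impI)
  fix e :: real assume "e > 0"
  then obtain x where "x \<in> carrier H" "hnorm H x = 1" "q x \<le> e" using ne by blast
  then show "\<exists>x\<in>carrier H. hnorm H x = 1 \<and> q x \<le> e \<and> - N \<le> Re (cinner H (A x) x)"
   using ub[of x] by (intro bexI[of _ x]) auto
 qed
 define a where "a = Sup {r. P r}"
 have bdd: "bdd_above {r. P r}" using P_le by (intro bdd_aboveI[of _ N]) auto
 have le_a: "r \<le> a" if "P r" for r
  unfolding a_def using that bdd by (intro cSup_upper) auto
 have a_le: "a \<le> N" unfolding a_def using P_N P_le by (intro cSup_least) auto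
 have a_ge: "- N \<le> a" using le_a[OF P_N] .
 have near: "\<exists>x\<in>carrier H. hnorm H x = 1 \<and> q x \<le> e \<and> a - d \<le> Re (cinner H (A x) x)" if "e > 0" "d > 0" for e d
 proof -
  have "\<exists>r\<in>{r. P r}. a - d < r"
   unfolding a_def using P_N \<open>d > 0\<close> bdd by (subst less_cSup_iff[symmetric]) auto
  then obtain r where r: "P r" "a - d < r" by blast
  then obtain x where "x \<in> carrier H" "hnorm H x = 1" "q x \<le> e" "r \<le> Re (cinner H (A x) x)"
   unfolding P_def using \<open>e > 0\<close> by blast
  then show ?thesis using r(2) by (intro bexI[of _ x]) auto
 qed
 have q0: "0 \<le> q x" if "x \<in> carrier H" for x
 proof -
  have "q \<zero> = 0" using q_smult[of \<zero> 0] by simp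
  moreover have "q (x \<oplus> (- 1) \<odot> x) \<le> q x + q ((- 1) \<odot> x)" using that by (intro q_add) auto
  moreover have "q ((- 1) \<odot> x) = q x" using q_smult[OF that, of "- 1"] by simp
  moreover have "x \<oplus> (- 1) \<odot> x = \<zero>"
   using minus_eq_add_smult[OF that that] minus_eq_zero_iff[OF that that] by metis
  ultimately show ?thesis by simp
 qed
 have main: "\<exists>x\<in>carrier H. hnorm H x = 1 \<and> q x \<le> e \<and> hnorm H (A x \<ominus> complex_of_real a \<odot> x) \<le> e"
  if e: "e > 0" for e
 proof -
  \<comment> \<open>C bounds the coefficient (a + d) \<beta> - \<gamma> of t^2 in the comparison
    below. The choice of t makes the norm of t A x at most 1/2 and t C at most e^2 / 2; the slack d
    is small compared with t e^2 and with e^2.\<close>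
  define C where "C = (N + 1) * N\<^sup>2 + N^3"
  have C: "C \<ge> 0" using N by (simp add: C_def)
  define t where "t = min (1 / (2 * (N + 1))) (e\<^sup>2 / (2 * (C + 1)))"
  have t0: "t > 0" using N C e by (simp add: t_def)
  have "t \<le> 1 / (2 * (N + 1))" by (simp add: t_def)
  then have "t * (N + 1) \<le> 1 / (2 * (N + 1)) * (N + 1)" using N by (intro mult_right_mono) auto
  also have "\<dots> = 1 / 2" using N by (simp add: divide_simps)
  finally have t1: "t * N \<le> 1 / 2" using t0 by (simp add: distrib_left)
  have "t \<le> e\<^sup>2 / (2 * (C + 1))" by (simp add: t_def)
  then have "t * (C + 1) \<le> e\<^sup>2 / (2 * (C + 1)) * (C + 1)" using C by (intro mult_right_mono) auto
  also have "\<dots> = e\<^sup>2 / 2" using C by (simp add: divide_simps)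
  finally have t2: "t * C \<le> e\<^sup>2 / 2" using t0 by (simp add: distrib_left)
  define d where "d = min 1 (min (t * e\<^sup>2 / 4) (e\<^sup>2 / (4 * (2 * N + 1))))"
  have d0: "d > 0" using N e t0 by (simp add: d_def)
  have d1: "d \<le> 1" by (simp add: d_def)
  have d2: "d \<le> t * e\<^sup>2 / 4" unfolding d_def by (meson min.cobounded1 min.cobounded2 order_trans)
  have "d \<le> e\<^sup>2 / (4 * (2 * N + 1))" unfolding d_def by (meson min.cobounded1 min.cobounded2 order_trans)
  then have "d * (2 * N + 1) \<le> e\<^sup>2 / (4 * (2 * N + 1)) * (2 * N + 1)" using N by (intro mult_right_mono) auto
  also have "\<dots> = e\<^sup>2 / 4" using N by (simp add: divide_simps)
  finally have d3: "d * (2 * N + 1) \<le> e\<^sup>2 / 4" .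
  \<comment> \<open>Beyond the supremum there is a threshold e0 such that no unit vector with q at
    most e0 reaches a + d. Homogeneity extends this bound to all vectors whose q is small relative
    to their norm.\<close>
  have "\<not> P (a + d)" using le_a[of "a + d"] d0 by auto
  then obtain e0 where e0: "e0 > 0"
   "\<And>x. x \<in> carrier H \<Longrightarrow> hnorm H x = 1 \<Longrightarrow> q x \<le> e0 \<Longrightarrow> Re (cinner H (A x) x) < a + d"
   unfolding P_def by (meson not_le)
  have hom: "Re (cinner H (A y) y) \<le> (a + d) * (hnorm H y)\<^sup>2"
   if y: "y \<in> carrier H" "hnorm H y > 0" "q y \<le> e0 * hnorm H y" for y
  proof -
   let ?z = "complex_of_real (1 / hnorm H y) \<odot> y"
   have "y \<noteq> \<zero>" using y(2) by auto
   have "Re (cinner H (A ?z) ?z) < a + d"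
   proof (rule e0(2))
    show "q ?z \<le> e0" using y by (subst q_smult) (simp_all add: pos_divide_le_eq norm_divide)
   qed (use y \<open>y \<noteq> \<zero>\<close> in \<open>simp_all add: norm_divide\<close>)
   moreover have "cinner H (A ?z) ?z = complex_of_real (1 / (hnorm H y)\<^sup>2) * cinner H (A y) y"
    using y by (simp add: power2_eq_square)
   ultimately have "Re (cinner H (A y) y) / (hnorm H y)\<^sup>2 < a + d" by (simp del: of_real_divide)
   then show ?thesis using y(2) by (simp add: pos_divide_less_eq)
  qed
  define e1 where "e1 = min e (min e0 (e0 / (2 * (1 + t * M))))"
  have tM: "1 + t * M > 0" using t0 M by (simp add: add_pos_nonneg)
  have e1: "e1 > 0" using e e0(1) tM by (simp add: e1_def)
  obtain x where x: "x \<in> carrier H" "hnorm H x = 1" "q x \<le> e1" "a - d \<le> Re (cinner H (A x) x)"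
   using near[OF e1 d0] by blast
  have qx: "q x \<le> e" "q x \<le> e0" "q x \<le> e0 / (2 * (1 + t * M))" using x(3) by (auto simp: e1_def)
  \<comment> \<open>The vector y still has small q relative to its norm, so <A y, y> \<le> (a + d)
    ||y||^2. Expanding both sides in t isolates ||A x||^2.\<close>
  define y where "y = x \<oplus> complex_of_real t \<odot> A x"
  have yc: "y \<in> carrier H" using x by (simp add: y_def)
  have "hnorm H (x \<ominus> y) = t * hnorm H (A x)"
  proof -
   have "x \<ominus> y = (- complex_of_real t) \<odot> A x"
    by (rule vec_eqI) (use x in \<open>auto simp: y_def\<close>)
   then show ?thesis using x t0 by simp
  qed
  also have "\<dots> \<le> t * N" using An[of x] x t0 by (intro mult_left_mono) auto
  finally have "hnorm H (x \<ominus> y) \<le> 1 / 2" using t1 by simp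
  then have ny: "hnorm H y \<ge> 1 / 2" using hnorm_triangle_diff[OF x(1) yc] x(2) by simp
  have "q y \<le> q x + t * (M * q x)"
  proof -
   have "q y \<le> q x + q (complex_of_real t \<odot> A x)" unfolding y_def by (rule q_add) (use x in auto)
   also have "q (complex_of_real t \<odot> A x) = t * q (A x)" using x t0 by (simp add: q_smult)
   also have "t * q (A x) \<le> t * (M * q x)" using q_A[OF x(1)] t0 by (intro mult_left_mono) auto
   finally show ?thesis by simp
  qed
  also have "\<dots> = (1 + t * M) * q x" by (simp add: algebra_simps)
  also have "\<dots> \<le> (1 + t * M) * (e0 / (2 * (1 + t * M)))"
   using qx(3) tM by (intro mult_left_mono) auto
  also have "\<dots> = e0 * (1 / 2)" using tM by (simp add: divide_simps)
  also have "\<dots> \<le> e0 * hnorm H y" using ny e0(1) by (intro mult_left_mono) auto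
  finally have "q y \<le> e0 * hnorm H y" .
  then have key: "Re (cinner H (A y) y) \<le> (a + d) * (hnorm H y)\<^sup>2"
   using ny yc by (intro hom) auto
  define \<alpha> where "\<alpha> = Re (cinner H (A x) x)"
  define \<beta> where "\<beta> = (hnorm H (A x))\<^sup>2"
  define \<gamma> where "\<gamma> = Re (cinner H (A (A x)) (A x))"
  have \<alpha>1: "Re (cinner H x (A x)) = \<alpha>" using sym[of x x] x by (simp add: \<alpha>_def)
  have \<beta>1: "Re (cinner H (A x) (A x)) = \<beta>" "Re (cinner H (A (A x)) x) = \<beta>"
   using sym[of "A x" x] x by (simp_all add: \<beta>_def hnorm_sq)
  have ay: "A y = A x \<oplus> complex_of_real t \<odot> A (A x)" using x by (simp add: y_def)
  have l: "Re (cinner H (A y) y) = \<alpha> + 2 * t * \<beta> + t * t * \<gamma>"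
   unfolding ay unfolding y_def using x \<beta>1 by (simp add: \<alpha>_def \<gamma>_def algebra_simps)
  have r: "(hnorm H y)\<^sup>2 = 1 + 2 * t * \<alpha> + t * t * \<beta>"
  proof -
   have "(hnorm H y)\<^sup>2 = (hnorm H x)\<^sup>2 + 2 * Re (cinner H x (complex_of_real t \<odot> A x))
     + (hnorm H (complex_of_real t \<odot> A x))\<^sup>2"
    unfolding y_def by (rule hnorm_add_sq) (use x in simp_all)
   then show ?thesis using x t0 \<alpha>1 by (simp add: \<beta>_def power2_eq_square algebra_simps)
  qed
  have ineq: "\<alpha> + 2 * t * \<beta> + t * t * \<gamma> \<le> (a + d) * (1 + 2 * t * \<alpha> + t * t * \<beta>)"
   using key unfolding l r .
  have \<alpha>: "a - d \<le> \<alpha>" "\<alpha> \<le> a + d" "\<bar>\<alpha>\<bar> \<le> N"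
   using x(4) e0(2)[OF x(1,2) qx(2)] ub[OF x(1,2)] by (auto simp: \<alpha>_def)
  have nAx: "hnorm H (A x) \<le> N" using An[of x] x by simp
  have \<beta>: "0 \<le> \<beta>" "\<beta> \<le> N\<^sup>2"
   unfolding \<beta>_def using nAx x by (auto intro!: power_mono)
  have "\<bar>\<gamma>\<bar> \<le> hnorm H (A (A x)) * hnorm H (A x)"
   unfolding \<gamma>_def using Cauchy_Schwarz[of "A (A x)" "A x"] abs_Re_le_cmod[of "cinner H (A (A x)) (A x)"] x by simp
  also have "\<dots> \<le> (N * hnorm H (A x)) * hnorm H (A x)"
   using An[of "A x"] x by (intro mult_right_mono) auto
  also have "\<dots> = N * \<beta>" by (simp add: \<beta>_def power2_eq_square)
  also have "\<dots> \<le> N * N\<^sup>2" using \<beta> N by (intro mult_left_mono) auto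
  finally have \<gamma>: "\<bar>\<gamma>\<bar> \<le> N^3" by (simp add: power3_eq_cube power2_eq_square)
  have "(a + d) * \<beta> \<le> (N + 1) * N\<^sup>2"
   using a_le d1 \<beta> N by (intro mult_mono) auto
  then have "(a + d) * \<beta> - \<gamma> \<le> C" using \<gamma> by (simp add: C_def)
  then have tt: "t * (t * ((a + d) * \<beta> - \<gamma>)) \<le> t * (t * C)" using t0 by (intro mult_left_mono) auto
  have "t * (2 * \<beta>) \<le> (a + d - \<alpha>) + t * (2 * (\<alpha> * (a + d))) + t * (t * ((a + d) * \<beta> - \<gamma>))"
   using ineq by (simp add: algebra_simps)
  also have "\<dots> \<le> 2 * (t * e\<^sup>2 / 4) + t * (2 * (\<alpha> * (a + d))) + t * (e\<^sup>2 / 2)"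
  proof -
   have "t * (t * C) \<le> t * (e\<^sup>2 / 2)" using t2 t0 by (intro mult_left_mono) auto
   then show ?thesis using \<alpha>(1) d2 tt by linarith
  qed
  also have "\<dots> = t * (e\<^sup>2 / 2 + 2 * (\<alpha> * (a + d)) + e\<^sup>2 / 2)" by (simp add: algebra_simps)
  finally have "2 * \<beta> \<le> e\<^sup>2 / 2 + 2 * (\<alpha> * (a + d)) + e\<^sup>2 / 2" using t0 by simp
  then have b: "\<beta> \<le> e\<^sup>2 / 2 + \<alpha> * (a + d)" by linarith
  have exp: "(hnorm H (A x \<ominus> complex_of_real a \<odot> x))\<^sup>2 = \<beta> - 2 * (a * \<alpha>) + a * a"
  proof -
   have "(hnorm H (A x \<ominus> complex_of_real a \<odot> x))\<^sup>2 = (hnorm H (A x))\<^sup>2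
     - 2 * Re (cinner H (A x) (complex_of_real a \<odot> x)) + (hnorm H (complex_of_real a \<odot> x))\<^sup>2"
    by (rule hnorm_minus_sq) (use x in simp_all)
   then show ?thesis using x by (simp add: \<beta>_def \<alpha>_def power2_eq_square)
  qed
  have "\<alpha> * d \<le> N * d" using \<alpha>(3) d0 by (intro mult_right_mono) auto
  have "a * (a - \<alpha>) \<le> N * d"
  proof -
   have "a * (a - \<alpha>) \<le> \<bar>a\<bar> * \<bar>a - \<alpha>\<bar>" by (metis abs_ge_self abs_mult)
   also have "\<dots> \<le> N * d" using a_le a_ge \<alpha> by (intro mult_mono) auto
   finally show ?thesis .
  qed
  have "\<beta> - 2 * (a * \<alpha>) + a * a \<le> e\<^sup>2 / 2 + d * (2 * N + 1)"
  proof -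
   have "\<alpha> * (a + d) = a * \<alpha> + \<alpha> * d" "a * (a - \<alpha>) = a * a - a * \<alpha>" "d * (2 * N + 1) = 2 * (N * d) + d"
    by (simp_all add: algebra_simps)
   then show ?thesis
    using b d0 \<open>\<alpha> * d \<le> N * d\<close> \<open>a * (a - \<alpha>) \<le> N * d\<close> by linarith
  qed
  also have "\<dots> \<le> e\<^sup>2" using d3 zero_le_power2[of e] by linarith
  finally have "(hnorm H (A x \<ominus> complex_of_real a \<odot> x))\<^sup>2 \<le> e\<^sup>2" unfolding exp .
  then have "hnorm H (A x \<ominus> complex_of_real a \<odot> x) \<le> e" by (rule power2_le_imp_le) (use e in simp)
  then show ?thesis using x(1,2) qx(1) by (intro bexI[of _ x] conjI)
 qed
 show ?thesis
  by (rule exI[of _ a]) (use main le_a in \<open>auto simp: P_def\<close>)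
qed

text \<open>Together with the next two lemmas this provides the assumptions on q in
  \<open>approx_eigenvalue_step\<close> for the seminorm q x = ||W x - b x||: near eigenvectors of W
  remain such under every T that commutes with W.\<close>

lemma hnorm_shift_commute:
 assumes W: "W \<in> \<B> H" and T: "T \<in> \<B> H" and c: "W \<otimes>\<^bsub>BL H\<^esub> T = T \<otimes>\<^bsub>BL H\<^esub> W"
  and x: "x \<in> carrier H"
 shows "hnorm H (W (T x) \<ominus> b \<odot> T x) \<le> op_norm H T * hnorm H (W x \<ominus> b \<odot> x)"
proof -
 note [simp] = bop_rules[OF W] bop_rules[OF T]
 have "W (T x) \<ominus> b \<odot> T x = T (W x \<ominus> b \<odot> x)" using commuteD[OF c x] x by simp
 then show ?thesis using op_norm_bound[OF T, of "W x \<ominus> b \<odot> x"] x by simp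
qed

lemma hnorm_shift_add:
 assumes W: "W \<in> \<B> H" and x: "x \<in> carrier H" and y: "y \<in> carrier H"
 shows "hnorm H (W (x \<oplus> y) \<ominus> b \<odot> (x \<oplus> y)) \<le> hnorm H (W x \<ominus> b \<odot> x) + hnorm H (W y \<ominus> b \<odot> y)"
proof -
 note [simp] = bop_rules[OF W]
 have "W (x \<oplus> y) \<ominus> b \<odot> (x \<oplus> y) = (W x \<ominus> b \<odot> x) \<oplus> (W y \<ominus> b \<odot> y)"
  by (rule vec_eqI) (use x y in \<open>auto simp: algebra_simps\<close>)
 then show ?thesis using hnorm_triangle[of "W x \<ominus> b \<odot> x" "W y \<ominus> b \<odot> y"] x y by simp
qed

lemma hnorm_shift_smult:
 assumes W: "W \<in> \<B> H" and x: "x \<in> carrier H"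
 shows "hnorm H (W (c \<odot> x) \<ominus> b \<odot> (c \<odot> x)) = cmod c * hnorm H (W x \<ominus> b \<odot> x)"
proof -
 note [simp] = bop_rules[OF W]
 have "W (c \<odot> x) \<ominus> b \<odot> (c \<odot> x) = c \<odot> (W x \<ominus> b \<odot> x)"
  by (rule vec_eqI) (use x in \<open>auto simp: algebra_simps\<close>)
 then show ?thesis using x by simp
qed

text \<open>In the expansions of the two squares the cross terms have the same real part, and ||T^*
  x|| = ||T x|| by normality. So an approximate eigenvector of T is one of T^* for the conjugate
  value.\<close>

lemma hnorm_adj_shift_normal:
 assumes N: "normal_op H T" and x: "x \<in> carrier H"
 shows "hnorm H (adj H T x \<ominus> cnj b \<odot> x) = hnorm H (T x \<ominus> b \<odot> x)"
proof (rule power2_eq_imp_eq)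
 have T: "T \<in> \<B> H" using N by (simp add: normal_op_def)
 note [simp] = bop_rules[OF T] bop_rules[OF adj_closed[OF T]]
 have "cinner H (T x) x = cnj (cinner H x (T x))" using cinner_commute[of "T x" x] x by simp
 then show "(hnorm H (adj H T x \<ominus> cnj b \<odot> x))\<^sup>2 = (hnorm H (T x \<ominus> b \<odot> x))\<^sup>2"
  using x T hnorm_adj_normal[OF N x] by (simp add: hnorm_minus_sq)
qed (use x assms in \<open>auto simp: normal_op_def bop_closed\<close>)

text \<open>The seminorm q records the approximate eigenvalue conditions imposed so far. T is split
  into real and imaginary parts A1 and A2; the defect of A1 at its value a is added to q before A2
  is treated, which works because A1 and A2 commute.\<close>

lemma approx_eigenvalue_normal:
 fixes q :: "'a \<Rightarrow> real"
 assumes N: "normal_op H T"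
  and q_add: "\<And>x y. x \<in> carrier H \<Longrightarrow> y \<in> carrier H \<Longrightarrow> q (x \<oplus> y) \<le> q x + q y"
  and q_smult: "\<And>c x. x \<in> carrier H \<Longrightarrow> q (c \<odot> x) = cmod c * q x"
  and q_T: "\<And>x. x \<in> carrier H \<Longrightarrow> q (T x) \<le> M * q x" "\<And>x. x \<in> carrier H \<Longrightarrow> q (adj H T x) \<le> M * q x"
  and M: "M \<ge> 0"
  and q0: "\<And>x. x \<in> carrier H \<Longrightarrow> 0 \<le> q x"
  and ne: "\<And>e. e > 0 \<Longrightarrow> \<exists>x\<in>carrier H. hnorm H x = 1 \<and> q x \<le> e"
 shows "\<exists>l. \<forall>e>0. \<exists>x\<in>carrier H. hnorm H x = 1 \<and> q x \<le> e \<and> hnorm H (T x \<ominus> l \<odot> x) \<le> e"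
proof -
 have T: "T \<in> \<B> H" using N by (simp add: normal_op_def)
 note [simp] = bop_rules[OF T] bop_rules[OF adj_closed[OF T]]
 have TT: "adj H T (T x) = T (adj H T x)" if "x \<in> carrier H" for x
  using N that by (intro commuteD) (auto simp: normal_op_def)
 define A1 where "A1 = (1/2) \<odot>\<^bsub>BL H\<^esub> (T \<oplus>\<^bsub>BL H\<^esub> adj H T)"
 define A2 where "A2 = (- \<i>/2) \<odot>\<^bsub>BL H\<^esub> (T \<ominus>\<^bsub>BL H\<^esub> adj H T)"
 have A1: "A1 \<in> \<B> H" and A2: "A2 \<in> \<B> H" using T by (auto simp: A1_def A2_def)
 have A1x: "A1 x = (1/2) \<odot> (T x \<oplus> adj H T x)" and A2x: "A2 x = (- \<i>/2) \<odot> (T x \<ominus> adj H T x)"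
  if "x \<in> carrier H" for x
  using that T by (simp_all add: A1_def A2_def)
 note [simp] = bop_rules[OF A1] bop_rules[OF A2]
 have s1: "adj H A1 = A1" and s2: "adj H A2 = A2"
  by (rule adjI; use A1 A2 T in \<open>simp add: A1x A2x algebra_simps\<close>)+
 have q1: "q (A1 x) \<le> M * q x" if x: "x \<in> carrier H" for x
  using x q_T[OF x] q_add[of "T x" "adj H T x"] by (simp add: A1x q_smult)
 have qm: "q (x \<ominus> y) \<le> q x + q y" if "x \<in> carrier H" "y \<in> carrier H" for x y
  using that q_add[of x "(- 1) \<odot> y"] by (simp add: minus_eq_add_smult q_smult)
 have q2: "q (A2 x) \<le> M * q x" if x: "x \<in> carrier H" for x
  using x q_T[OF x] qm[of "T x" "adj H T x"] by (simp add: A2x q_smult)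
 obtain a where a: "\<And>e. e > 0 \<Longrightarrow>
   \<exists>x\<in>carrier H. hnorm H x = 1 \<and> q x \<le> e \<and> hnorm H (A1 x \<ominus> complex_of_real a \<odot> x) \<le> e"
  using approx_eigenvalue_step[OF A1 s1 q_add q_smult q1 M ne] by blast
 define q' where "q' x = q x + hnorm H (A1 x \<ominus> complex_of_real a \<odot> x)" for x
 have c12: "A1 \<otimes>\<^bsub>BL H\<^esub> A2 = A2 \<otimes>\<^bsub>BL H\<^esub> A1"
 proof (rule commuteI[OF A1 A2])
  fix x assume x: "x \<in> carrier H"
  show "A1 (A2 x) = A2 (A1 x)"
   by (rule vec_eqI) (use x in \<open>simp_all add: A1x A2x TT algebra_simps\<close>)
 qed
 have "\<exists>b::real. (\<forall>e>0. \<exists>x\<in>carrier H. hnorm H x = 1 \<and> q' x \<le> e \<and> hnorm H (A2 x \<ominus> complex_of_real b \<odot> x) \<le> e)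
  \<and> (\<forall>r. (\<forall>e>0. \<exists>x\<in>carrier H. hnorm H x = 1 \<and> q' x \<le> e \<and> r \<le> Re (cinner H (A2 x) x)) \<longrightarrow> r \<le> b)"
 proof (rule approx_eigenvalue_step[OF A2 s2, where M = "M + op_norm H A2"])
  fix x y assume x: "x \<in> carrier H" and y: "y \<in> carrier H"
  show "q' (x \<oplus> y) \<le> q' x + q' y"
   using q_add[OF x y] hnorm_shift_add[OF A1 x y] unfolding q'_def by (smt (verit))
 next
  fix c x assume x: "x \<in> carrier H"
  show "q' (c \<odot> x) = cmod c * q' x"
   unfolding q'_def hnorm_shift_smult[OF A1 x] q_smult[OF x] by (simp add: distrib_left)
 next
  fix x assume x: "x \<in> carrier H"
  have "M * q x + op_norm H A2 * hnorm H (A1 x \<ominus> complex_of_real a \<odot> x) \<le> (M + op_norm H A2) * q' x"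
   unfolding q'_def using q0[OF x] M A2 x by (simp add: algebra_simps)
  then show "q' (A2 x) \<le> (M + op_norm H A2) * q' x"
   using q2[OF x] hnorm_shift_commute[OF A1 A2 c12 x, of "complex_of_real a"] unfolding q'_def by linarith
 next
  fix e :: real assume e: "e > 0"
  then obtain x where x: "x \<in> carrier H" "hnorm H x = 1" "q x \<le> e/2" "hnorm H (A1 x \<ominus> complex_of_real a \<odot> x) \<le> e/2"
   using a[of "e/2"] by auto
  then show "\<exists>x\<in>carrier H. hnorm H x = 1 \<and> q' x \<le> e" unfolding q'_def by (intro bexI[of _ x]) auto
 qed (use M A2 in auto)
 then obtain b where b: "\<And>e. e > 0 \<Longrightarrow>
   \<exists>x\<in>carrier H. hnorm H x = 1 \<and> q' x \<le> e \<and> hnorm H (A2 x \<ominus> complex_of_real b \<odot> x) \<le> e" by blast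
 show ?thesis
 proof (intro exI allI impI)
  fix e :: real assume e: "e > 0"
  then obtain x where x: "x \<in> carrier H" "hnorm H x = 1" "q' x \<le> e/2"
   "hnorm H (A2 x \<ominus> complex_of_real b \<odot> x) \<le> e/2" using b[of "e/2"] by auto
  have "0 \<le> hnorm H (A1 x \<ominus> complex_of_real a \<odot> x)" using x by simp
  then have "q x \<le> e/2" "hnorm H (A1 x \<ominus> complex_of_real a \<odot> x) \<le> e/2"
   using x(3) q0[OF x(1)] unfolding q'_def by linarith+
  have eq: "T x \<ominus> Complex a b \<odot> x = (A1 x \<ominus> complex_of_real a \<odot> x) \<oplus> \<i> \<odot> (A2 x \<ominus> complex_of_real b \<odot> x)"
   by (rule vec_eqI) (use x in \<open>simp_all add: A1x A2x Complex_eq algebra_simps\<close>)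
  have "hnorm H (T x \<ominus> Complex a b \<odot> x) \<le> e/2 + e/2"
   unfolding eq using x \<open>hnorm H (A1 x \<ominus> complex_of_real a \<odot> x) \<le> e/2\<close>
   by (intro order_trans[OF hnorm_triangle] add_mono) auto
  then show "\<exists>x\<in>carrier H. hnorm H x = 1 \<and> q x \<le> e \<and> hnorm H (T x \<ominus> Complex a b \<odot> x) \<le> e"
   using x \<open>q x \<le> e/2\<close> e by (intro bexI[of _ x]) auto
 qed
qed

end

section \<open>\<open>\<Gamma>\<close>-unitaries\<close>

context hilbert_space
begin

text \<open>A gliding hump: if the pair is not jointly bounded below, then some \<open>w\<close>, a sum of approximate
 eigenvectors with rapidly decreasing coefficients, is missed by the last map of the Koszul complex.\<close>

lemma approx_eigenvalue_imp_spectrum: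
 assumes R: "normal_op H R" and U: "normal_op H U"
  and ap: "\<And>e. e > 0 \<Longrightarrow> \<exists>x\<in>carrier H. hnorm H x = 1 \<and> hnorm H (R x \<ominus> l \<odot> x) \<le> e \<and> hnorm H (U x \<ominus> m \<odot> x) \<le> e"
 shows "(l, m) \<in> joint_spectrum H R U"
proof (rule ccontr)
 define A where "A = R \<ominus>\<^bsub>BL H\<^esub> (l \<odot>\<^bsub>BL H\<^esub> \<one>\<^bsub>BL H\<^esub>)"
 define B where "B = U \<ominus>\<^bsub>BL H\<^esub> (m \<odot>\<^bsub>BL H\<^esub> \<one>\<^bsub>BL H\<^esub>)"
 assume "(l, m) \<notin> joint_spectrum H R U"
 then have "koszul_exact H A B" by (simp add: joint_spectrum_def A_def B_def)
 then have onto: "\<exists>y\<in>carrier H. \<exists>z\<in>carrier H. w = A z \<ominus> B y" if "w \<in> carrier H" for w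
  using that unfolding koszul_exact_def by blast
 have Rc: "R \<in> \<B> H" and Uc: "U \<in> \<B> H" using R U by (auto simp: normal_op_def)
 note [simp] = bop_rules[OF Rc] bop_rules[OF Uc] bop_rules[OF adj_closed[OF Rc]] bop_rules[OF adj_closed[OF Uc]]
 have Ax: "A x = R x \<ominus> l \<odot> x" and Bx: "B x = U x \<ominus> m \<odot> x" if "x \<in> carrier H" for x
  using that Rc Uc by (simp_all add: A_def B_def)
 \<comment> \<open>The errors 8^-k decay faster than the coefficients 4^-k chosen below; their
   quotient produces the impossible bound 2^k \<le> K.\<close>
 have "\<exists>x\<in>carrier H. hnorm H x = 1 \<and> hnorm H (R x \<ominus> l \<odot> x) \<le> (1/8)^k \<and> hnorm H (U x \<ominus> m \<odot> x) \<le> (1/8)^k" for k :: nat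
  by (rule ap) simp
 then obtain u where u: "\<And>k. u k \<in> carrier H" "\<And>k. hnorm H (u k) = 1"
  "\<And>k. hnorm H (R (u k) \<ominus> l \<odot> u k) \<le> (1/8)^k" "\<And>k. hnorm H (U (u k) \<ominus> m \<odot> u k) \<le> (1/8)^k"
  by metis
 \<comment> \<open>A multiple of u k is added only when the partial sum has too small an inner
   product with u k. In both cases that inner product has modulus at least 4^-k / 2
   afterwards.\<close>
 define c where "c w k = (if (1/4)^k / 2 \<le> cmod (cinner H w (u k)) then 0 else ((1/4)^k :: real))" for w k
 define W where "W = rec_nat \<zero> (\<lambda>k w. w \<oplus> complex_of_real (c w k) \<odot> u k)"
 have W0: "W 0 = \<zero>" and WS: "W (Suc k) = W k \<oplus> complex_of_real (c (W k) k) \<odot> u k" for k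
  by (simp_all add: W_def)
 have Wc [simp]: "W k \<in> carrier H" for k
  by (induction k) (simp_all add: W0 WS u(1))
 have cb: "0 \<le> c w k" "c w k \<le> (1/4)^k" for w k by (auto simp: c_def)
 have tail: "hnorm H (W (k + n) \<ominus> W k) \<le> 4/3 * ((1/4)^k - (1/4)^(k + n))" for k n
 proof (induction n)
  case (Suc n)
  have "W (Suc (k + n)) \<ominus> W (k + n) = complex_of_real (c (W (k + n)) (k + n)) \<odot> u (k + n)"
   by (rule vec_eqI) (use u(1) in \<open>simp_all add: WS\<close>)
  then have "hnorm H (W (Suc (k + n)) \<ominus> W (k + n)) \<le> (1/4)^(k + n)"
   using cb[of "W (k + n)" "k + n"] u(1,2) by simp
  moreover have "hnorm H (W (Suc (k + n)) \<ominus> W k) \<le> hnorm H (W (Suc (k + n)) \<ominus> W (k + n)) + hnorm H (W (k + n) \<ominus> W k)"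
   by (rule hnorm_triangle_dist) simp_all
  ultimately show ?case using Suc by (simp add: algebra_simps)
 qed (simp add: a_minus_def r_neg)
 have tail': "hnorm H (W (k + n) \<ominus> W k) \<le> 4/3 * (1/4)^k" for k n
 proof -
  have "(0::real) \<le> (1/4)^(k + n)" by simp
  then have "4/3 * ((1/4)^k - (1/4)^(k + n)) \<le> 4/3 * ((1/4)^k :: real)" by simp
  then show ?thesis using tail[of k n] by linarith
 qed
 obtain w where w: "w \<in> carrier H" "(\<lambda>n. hnorm H (W n \<ominus> w)) \<longlonglongrightarrow> 0"
 proof (rule Cauchy_convergent[of W])
  fix e :: real assume e: "e > 0"
  have "\<exists>N. (1/4::real)^N < e / 4" using e by (intro real_arch_pow_inv) auto
  then obtain N where N: "(1/4::real)^N < e / 4" by blast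
  have "hnorm H (W p \<ominus> W q) < e" if "p \<ge> N" "q \<ge> N" for p q
  proof -
   have "hnorm H (W p \<ominus> W N) \<le> 4/3 * (1/4)^N" "hnorm H (W q \<ominus> W N) \<le> 4/3 * (1/4)^N"
    using tail'[of N "p - N"] tail'[of N "q - N"] that by simp_all
   moreover have "hnorm H (W p \<ominus> W q) \<le> hnorm H (W p \<ominus> W N) + hnorm H (W N \<ominus> W q)"
    by (rule hnorm_triangle_dist) simp_all
   moreover have "hnorm H (W N \<ominus> W q) = hnorm H (W q \<ominus> W N)" by (rule hnorm_minus_commute) simp_all
   ultimately show ?thesis using N e by linarith
  qed
  then show "\<exists>N. \<forall>p\<ge>N. \<forall>q\<ge>N. hnorm H (W p \<ominus> W q) < e" by blast
 qed simp
 \<comment> \<open>All later terms together have norm at most 4^-k / 3, which leaves 1/2 - 1/3 = 1/6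
   of 4^-k.\<close>
 have low: "(1/4)^k / 6 \<le> cmod (cinner H w (u k))" for k
 proof -
  have "(1/4)^k / 2 \<le> cmod (cinner H (W (Suc k)) (u k))"
  proof (cases "(1/4)^k / 2 \<le> cmod (cinner H (W k) (u k))")
   case True
   then have "c (W k) k = 0" by (simp add: c_def)
   then show ?thesis using True u(1) by (simp add: WS)
  next
   case False
   then have ck: "c (W k) k = (1/4)^k" by (simp add: c_def)
   have "cinner H (W (Suc k)) (u k) = cinner H (W k) (u k) + complex_of_real ((1/4)^k)"
    using u(1,2) by (simp add: WS ck cinner_self[OF u(1)] del: of_real_power of_real_divide)
   moreover have "cmod (complex_of_real ((1/4)^k)) = (1/4)^k"
    by (simp only: norm_of_real) simp
   ultimately show ?thesis
    using norm_diff_ineq[of "complex_of_real ((1/4)^k)" "cinner H (W k) (u k)"] False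
    by (simp only: add.commute)
  qed
  moreover have "hnorm H (w \<ominus> W (Suc k)) \<le> 4/3 * (1/4)^Suc k"
  proof (rule tendsto_lowerbound)
   show "(\<lambda>n. 4/3 * (1/4)^Suc k + hnorm H (W n \<ominus> w)) \<longlonglongrightarrow> 4/3 * (1/4)^Suc k"
    using tendsto_add[OF tendsto_const w(2), of "4/3 * (1/4)^Suc k"] by simp
   show "\<forall>\<^sub>F n in sequentially. hnorm H (w \<ominus> W (Suc k)) \<le> 4/3 * (1/4)^Suc k + hnorm H (W n \<ominus> w)"
   proof (rule eventually_sequentiallyI[of "Suc k"])
    fix n assume "Suc k \<le> n"
    then have "hnorm H (W n \<ominus> W (Suc k)) \<le> 4/3 * (1/4)^Suc k"
     using tail'[of "Suc k" "n - Suc k"] by simp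
    moreover have "hnorm H (w \<ominus> W (Suc k)) \<le> hnorm H (w \<ominus> W n) + hnorm H (W n \<ominus> W (Suc k))"
     by (rule hnorm_triangle_dist) (simp_all add: w(1))
    moreover have "hnorm H (w \<ominus> W n) = hnorm H (W n \<ominus> w)"
     by (rule hnorm_minus_commute) (simp_all add: w(1))
    ultimately show "hnorm H (w \<ominus> W (Suc k)) \<le> 4/3 * (1/4)^Suc k + hnorm H (W n \<ominus> w)" by linarith
   qed
  qed simp
  moreover have "cmod (cinner H (W (Suc k)) (u k)) \<le> cmod (cinner H w (u k)) + hnorm H (w \<ominus> W (Suc k))"
  proof -
   have "cmod (cinner H (w \<ominus> W (Suc k)) (u k)) \<le> hnorm H (w \<ominus> W (Suc k))"
    using Cauchy_Schwarz[of "w \<ominus> W (Suc k)" "u k"] w(1) u(1,2) by simp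
   moreover have "cinner H (w \<ominus> W (Suc k)) (u k) = cinner H w (u k) - cinner H (W (Suc k)) (u k)"
    using w(1) u(1) by simp
   ultimately show ?thesis
    using norm_triangle_sub[of "cinner H (W (Suc k)) (u k)" "cinner H w (u k)"]
    by (simp add: norm_minus_commute)
  qed
  ultimately have "(1/4)^k / 2 \<le> cmod (cinner H w (u k)) + 4/3 * (1/4)^Suc k" by linarith
  then show ?thesis by simp
 qed
 obtain y z where yz: "y \<in> carrier H" "z \<in> carrier H" "w = A z \<ominus> B y" using onto[OF w(1)] by blast
 \<comment> \<open>Moving R - l and U - m across the inner product leaves their adjoints at u k,
   which by normality are as small as the operators themselves at u k.\<close>
 have up: "cmod (cinner H w (u k)) \<le> (hnorm H z + hnorm H y) * (1/8)^k" for k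
 proof -
  have "cinner H w (u k) = cinner H z (adj H R (u k) \<ominus> cnj l \<odot> u k) - cinner H y (adj H U (u k) \<ominus> cnj m \<odot> u k)"
   unfolding yz(3) using yz(1,2) u(1) Rc Uc by (simp add: Ax Bx)
  then have "cmod (cinner H w (u k)) \<le> cmod (cinner H z (adj H R (u k) \<ominus> cnj l \<odot> u k))
    + cmod (cinner H y (adj H U (u k) \<ominus> cnj m \<odot> u k))"
   by (simp only: norm_triangle_ineq4)
  also have "\<dots> \<le> hnorm H z * hnorm H (adj H R (u k) \<ominus> cnj l \<odot> u k) + hnorm H y * hnorm H (adj H U (u k) \<ominus> cnj m \<odot> u k)"
   by (intro add_mono Cauchy_Schwarz) (use yz u(1) in auto)
  also have "\<dots> \<le> hnorm H z * (1/8)^k + hnorm H y * (1/8)^k"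
   using u yz by (intro add_mono mult_left_mono)
    (simp_all add: hnorm_adj_shift_normal[OF R] hnorm_adj_shift_normal[OF U])
  finally show ?thesis by (simp add: distrib_right)
 qed
 define K where "K = 6 * (hnorm H z + hnorm H y)"
 have "2 ^ k \<le> K" for k :: nat
 proof -
  have "(1/4)^k \<le> K * (1/8)^k" using low[of k] up[of k] unfolding K_def by linarith
  then have "8 ^ k * (1/4)^k \<le> 8 ^ k * (K * (1/8)^k)" by (intro mult_left_mono) auto
  moreover have "8 ^ k * (1/4)^k = (2::real) ^ k" by (simp add: power_mult_distrib[symmetric])
  moreover have "8 ^ k * (K * (1/8)^k) = K" by (simp add: power_divide)
  ultimately show ?thesis by simp
 qed
 moreover obtain k :: nat where "K < 2 ^ k" using real_arch_pow[of 2 K] by auto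
 ultimately show False by (meson not_le)
qed

text \<open>For the converse, divide by a square root w of m. The equation for l makes l / w a real
  number r in [-2, 2], and z1, z2 are w times r/2 + i s and r/2 - i s with s = sqrt (1 - r^2 /
  4).\<close>

lemma in_bGamma_iff: "(l, m) \<in> b\<Gamma> \<longleftrightarrow> cmod m = 1 \<and> l = cnj l * m \<and> cmod l \<le> 2"
proof
 assume "(l, m) \<in> b\<Gamma>"
 then obtain z1 z2 where z: "l = z1 + z2" "m = z1 * z2" "cmod z1 = 1" "cmod z2 = 1"
  by (auto simp: b\<Gamma>_def)
 have c: "cnj z1 * z1 = 1" "cnj z2 * z2 = 1"
  using z(3,4) complex_norm_square[of z1] complex_norm_square[of z2] by (simp_all add: mult.commute)
 have "cnj l * m = (cnj z1 * z1) * z2 + (cnj z2 * z2) * z1" by (simp add: z algebra_simps)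
 then show "cmod m = 1 \<and> l = cnj l * m \<and> cmod l \<le> 2"
  using z c norm_triangle_ineq[of z1 z2] by (simp add: norm_mult)
next
 assume *: "cmod m = 1 \<and> l = cnj l * m \<and> cmod l \<le> 2"
 define w where "w = csqrt m"
 have w2: "w * w = m" unfolding w_def by (metis power2_csqrt power2_eq_square)
 have wn: "cmod w = 1" using * w2 by (metis norm_csqrt real_sqrt_one w_def)
 have ww: "cnj w * w = 1" using wn complex_norm_square[of w] by (simp add: mult.commute)
 define r where "r = Re (l * cnj w)"
 have "l * cnj w = cnj l * (w * w) * cnj w" using * w2 by simp
 also have "\<dots> = cnj l * w * (cnj w * w)" by (simp add: mult_ac)
 also have "\<dots> = cnj (l * cnj w)" by (simp add: ww)
 finally have "l * cnj w = complex_of_real r" by (simp add: r_def complex_eq_iff)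
 then have "l * (cnj w * w) = complex_of_real r * w" by (simp add: mult.assoc[symmetric])
 then have l: "l = complex_of_real r * w" by (simp add: ww)
 have "\<bar>r\<bar> \<le> 2" using * l wn by (simp add: norm_mult)
 then have r2: "r * r \<le> 4" using abs_le_square_iff[of r 2] by (simp add: power2_eq_square)
 define s where "s = sqrt (1 - r * r / 4)"
 have s: "s * s = 1 - r * r / 4" unfolding s_def using r2 by simp
 define z1 where "z1 = w * Complex (r/2) s"
 define z2 where "z2 = w * Complex (r/2) (- s)"
 have "z1 + z2 = w * (Complex (r/2) s + Complex (r/2) (- s))" by (simp add: z1_def z2_def distrib_left)
 also have "Complex (r/2) s + Complex (r/2) (- s) = complex_of_real r" by (simp add: complex_eq_iff)
 finally have "l = z1 + z2" by (simp add: l mult.commute)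
 moreover have "m = z1 * z2"
 proof -
  have "z1 * z2 = (w * w) * (Complex (r/2) s * Complex (r/2) (- s))" by (simp add: z1_def z2_def mult_ac)
  also have "Complex (r/2) s * Complex (r/2) (- s) = 1" using s by (simp add: complex_eq_iff)
  finally show ?thesis by (simp add: w2)
 qed
 moreover have "cmod z1 = 1" "cmod z2 = 1"
 proof -
  have "cmod (Complex (r/2) s) = 1" "cmod (Complex (r/2) (- s)) = 1"
   using s by (simp_all add: cmod_def power2_eq_square)
  then show "cmod z1 = 1" "cmod z2 = 1" by (simp_all only: z1_def z2_def norm_mult wn mult_1)
 qed
 ultimately show "(l, m) \<in> b\<Gamma>" unfolding b\<Gamma>_def by blast
qed

lemma unitary_hnorm:
 assumes "U \<in> \<B> H" "adj H U \<otimes>\<^bsub>BL H\<^esub> U = \<one>\<^bsub>BL H\<^esub>" "x \<in> carrier H"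
 shows "hnorm H (U x) = hnorm H x"
proof (rule power2_eq_imp_eq)
 note [simp] = bop_rules[OF assms(1)]
 have "adj H U (U x) = x" using fun_cong[OF assms(2), of x] assms(3) by simp
 moreover have "cinner H (U x) (U x) = cinner H x (adj H U (U x))" using assms by (simp del: bop_closed)
 ultimately show "(hnorm H (U x))\<^sup>2 = (hnorm H x)\<^sup>2" using assms(3) by (simp add: hnorm_sq)
qed (use assms in \<open>simp_all add: bop_closed\<close>)

end

lemma nonpos_if_le_eps:
 fixes a C :: real
 assumes "\<And>e. e > 0 \<Longrightarrow> a \<le> C * e"
 shows "a \<le> 0"
proof (rule ccontr)
 assume "\<not> a \<le> 0"
 then have a: "a > 0" by simp
 define e where "e = a / (2 * (\<bar>C\<bar> + 1))"
 have e: "e > 0" using a by (simp add: e_def)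
 have "C * e \<le> (\<bar>C\<bar> + 1) * e" using e by (intro mult_right_mono) auto
 also have "\<dots> = a / 2" unfolding e_def by (simp add: divide_simps)
 finally show False using assms[OF e] a by linarith
qed

context hilbert_space
begin

lemma minus_zero [simp]: "x \<in> carrier H \<Longrightarrow> x \<ominus> \<zero> = x"
 by (rule vec_eqI) simp_all

text \<open>This is \<open>approx_eigenvalue_step\<close> for V^* V with q = 0. The second half of
  its conclusion makes a dominate <V^* V x, x> on unit vectors, so V = 0 follows as soon as a = 0 is
  known.\<close>

lemma square_approx_eigenvalue:
 assumes V: "V \<in> \<B> H" and ne: "\<exists>x\<in>carrier H. x \<noteq> \<zero>"
 shows "\<exists>a::real. (\<forall>e>0. \<exists>x\<in>carrier H. hnorm H x = 1 \<and>
   hnorm H ((adj H V \<otimes>\<^bsub>BL H\<^esub> V) x \<ominus> complex_of_real a \<odot> x) \<le> e) \<and> (\<forall>x\<in>carrier H. (hnorm H (V x))\<^sup>2 \<le> a * (hnorm H x)\<^sup>2)"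
proof -
 let ?Z = "adj H V \<otimes>\<^bsub>BL H\<^esub> V"
 note [simp] = bop_rules[OF V] bop_rules[OF adj_closed[OF V]]
 have unit: "hnorm H (complex_of_real (1 / hnorm H x) \<odot> x) = 1" if "x \<in> carrier H" "x \<noteq> \<zero>" for x
  using that by (simp add: norm_divide)
 obtain x0 where x0: "x0 \<in> carrier H" "x0 \<noteq> \<zero>" using ne by blast
 have "\<exists>a::real. (\<forall>e>0. \<exists>x\<in>carrier H. hnorm H x = 1 \<and> 0 \<le> e \<and> hnorm H (?Z x \<ominus> complex_of_real a \<odot> x) \<le> e)
  \<and> (\<forall>r. (\<forall>e>0. \<exists>x\<in>carrier H. hnorm H x = 1 \<and> 0 \<le> (e::real) \<and> r \<le> Re (cinner H (?Z x) x)) \<longrightarrow> r \<le> a)"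
 proof (rule approx_eigenvalue_step[where M = 0 and q = "\<lambda>_. 0" and A = ?Z])
  show "adj H ?Z = ?Z" using V by (simp add: adj_mult)
  show "\<exists>x\<in>carrier H. hnorm H x = 1 \<and> 0 \<le> e" if "e > 0" for e :: real
   using unit[OF x0] x0 that by (intro bexI[of _ "complex_of_real (1 / hnorm H x0) \<odot> x0"]) auto
 qed (use V in auto)
 then obtain a :: real where a: "\<And>e. e > 0 \<Longrightarrow> \<exists>x\<in>carrier H. hnorm H x = 1 \<and> 0 \<le> e \<and> hnorm H (?Z x \<ominus> complex_of_real a \<odot> x) \<le> e"
  and ub: "\<And>r. (\<And>e. e > 0 \<Longrightarrow> \<exists>x\<in>carrier H. hnorm H x = 1 \<and> (0::real) \<le> e \<and> r \<le> Re (cinner H (?Z x) x)) \<Longrightarrow> r \<le> a"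
  by blast
 have u: "(hnorm H (V x))\<^sup>2 \<le> a" if x: "x \<in> carrier H" "hnorm H x = 1" for x
 proof (rule ub)
  fix e :: real assume "e > 0"
  have "Re (cinner H (?Z x) x) = (hnorm H (V x))\<^sup>2" using x V by (simp add: hnorm_sq)
  then show "\<exists>y\<in>carrier H. hnorm H y = 1 \<and> 0 \<le> e \<and> (hnorm H (V x))\<^sup>2 \<le> Re (cinner H (?Z y) y)"
   using x \<open>e > 0\<close> by (intro bexI[of _ x]) auto
 qed
 have "(hnorm H (V x))\<^sup>2 \<le> a * (hnorm H x)\<^sup>2" if x: "x \<in> carrier H" for x
 proof (cases "x = \<zero>")
  case False
  then have n: "hnorm H x > 0" using hnorm_nonneg[OF x] hnorm_eq_0[OF x] by linarith
  have "(hnorm H (V (complex_of_real (1 / hnorm H x) \<odot> x)))\<^sup>2 \<le> a"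
   by (rule u) (use x unit[OF x False] in auto)
  moreover have "(hnorm H (V (complex_of_real (1 / hnorm H x) \<odot> x)))\<^sup>2 = (hnorm H (V x))\<^sup>2 / (hnorm H x)\<^sup>2"
   using x n by (simp add: norm_divide power_divide)
  moreover have "0 < (hnorm H x)\<^sup>2" using n by simp
  ultimately show ?thesis by (simp only: pos_divide_le_eq)
 qed simp
 then show ?thesis using a by (intro exI[of _ a]) auto
qed

lemma approx_eigenvalue_commuting:
 assumes R: "normal_op H R" and U: "normal_op H U" and c: "R \<otimes>\<^bsub>BL H\<^esub> U = U \<otimes>\<^bsub>BL H\<^esub> R"
  and ap: "\<And>e. e > 0 \<Longrightarrow> \<exists>x\<in>carrier H. hnorm H x = 1 \<and> hnorm H (U x \<ominus> m \<odot> x) \<le> e"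
 shows "\<exists>l. \<forall>e>0. \<exists>x\<in>carrier H. hnorm H x = 1 \<and> hnorm H (U x \<ominus> m \<odot> x) \<le> e \<and> hnorm H (R x \<ominus> l \<odot> x) \<le> e"
proof (rule approx_eigenvalue_normal[OF R, where M = "op_norm H R"])
 have Rc: "R \<in> \<B> H" and Uc: "U \<in> \<B> H" using R U by (auto simp: normal_op_def)
 note [simp] = bop_rules[OF Rc] bop_rules[OF Uc] bop_rules[OF adj_closed[OF Rc]] bop_rules[OF adj_closed[OF Uc]]
 have c': "adj H U \<otimes>\<^bsub>BL H\<^esub> adj H R = adj H R \<otimes>\<^bsub>BL H\<^esub> adj H U"
  using adj_mult[OF Rc Uc] adj_mult[OF Uc Rc] unfolding c by simp
 show "hnorm H (U (R x) \<ominus> m \<odot> R x) \<le> op_norm H R * hnorm H (U x \<ominus> m \<odot> x)" if "x \<in> carrier H" for x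
  by (rule hnorm_shift_commute[OF Uc Rc c[symmetric] that])
 \<comment> \<open>U^* commutes with R^*, and by normality the defect of U at m equals the defect of
   U^* at the conjugate value. So the seminorm is controlled under R^* as it is under R.\<close>
 show "hnorm H (U (adj H R x) \<ominus> m \<odot> adj H R x) \<le> op_norm H R * hnorm H (U x \<ominus> m \<odot> x)" if x: "x \<in> carrier H" for x
  using hnorm_shift_commute[OF adj_closed[OF Uc] adj_closed[OF Rc] c' x, of "cnj m"]
   hnorm_adj_shift_normal[OF U, of "adj H R x" m] hnorm_adj_shift_normal[OF U x, of m] x Rc by simp
 show "0 \<le> op_norm H R" using Rc by simp
 show "0 \<le> hnorm H (U x \<ominus> m \<odot> x)" if "x \<in> carrier H" for x using that by simp
 show "\<exists>x\<in>carrier H. hnorm H x = 1 \<and> hnorm H (U x \<ominus> m \<odot> x) \<le> e" if "e > 0" for e by (rule ap[OF that])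
qed (rule hnorm_shift_add hnorm_shift_smult; use U in \<open>simp add: normal_op_def\<close>)+

text \<open>Serves to identify the approximate eigenvalue a of V^* V with the value computed from
  the joint approximate eigenvalue of R and U: the two differ by at most (C + 1) e for every
  e.\<close>

lemma approx_eigenvalue_fixed:
 assumes "\<And>e. e > 0 \<Longrightarrow> \<exists>x\<in>carrier H. hnorm H x = 1 \<and> hnorm H (z x \<ominus> a \<odot> x) \<le> e \<and> hnorm H (z x \<ominus> b \<odot> x) \<le> C * e"
  and z: "\<And>x. x \<in> carrier H \<Longrightarrow> z x \<in> carrier H"
 shows "a = b"
proof -
 have "cmod (a - b) \<le> (C + 1) * e" if e: "e > 0" for e
 proof -
  obtain x where x: "x \<in> carrier H" "hnorm H x = 1" "hnorm H (z x \<ominus> a \<odot> x) \<le> e" "hnorm H (z x \<ominus> b \<odot> x) \<le> C * e"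
   using assms(1)[OF e] by blast
  have "(z x \<ominus> b \<odot> x) \<ominus> (z x \<ominus> a \<odot> x) = (a - b) \<odot> x"
   by (rule vec_eqI) (use x z in \<open>simp_all add: left_diff_distrib\<close>)
  then have "cmod (a - b) = hnorm H ((z x \<ominus> b \<odot> x) \<ominus> (z x \<ominus> a \<odot> x))" using x by simp
  also have "\<dots> \<le> C * e + e"
   using hnorm_triangle_minus[of "z x \<ominus> b \<odot> x" "z x \<ominus> a \<odot> x"] x z[OF x(1)] by simp
  finally show ?thesis by (simp add: distrib_right)
 qed
 then have "cmod (a - b) \<le> 0" by (rule nonpos_if_le_eps)
 then show ?thesis by simp
qed

text \<open>Put V = U^* U - 1. There are approximate eigenvectors of V^* V at its top value a that
  are also approximate eigenvectors of U, at some m. As m is the second coordinate of a point of the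
  joint spectrum, |m| = 1; hence V nearly vanishes on these vectors, a = 0 and V = 0.\<close>

lemma Gamma_unitary_unitary:
 assumes G: "\<Gamma>_unitary H R U"
 shows "adj H U \<otimes>\<^bsub>BL H\<^esub> U = \<one>\<^bsub>BL H\<^esub>"
proof (cases "\<exists>x\<in>carrier H. x \<noteq> \<zero>")
 \<comment> \<open>The zero space has no unit vectors, so approximate eigenvectors are available
   only in the other case.\<close>
 case False
 have Uc: "U \<in> \<B> H" using G by (simp add: \<Gamma>_unitary_def normal_op_def)
 show ?thesis
 proof (rule bop_eqI)
  fix x assume x: "x \<in> carrier H"
  have "(adj H U \<otimes>\<^bsub>BL H\<^esub> U) x = \<zero>" "\<one>\<^bsub>BL H\<^esub> x = \<zero>"
   using False x bop_closed[OF BL_mult_closed[OF adj_closed[OF Uc] Uc] x] by (blast, simp)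
  then show "(adj H U \<otimes>\<^bsub>BL H\<^esub> U) x = \<one>\<^bsub>BL H\<^esub> x" by simp
 qed (use Uc in auto)
next
 case True
 have R: "normal_op H R" and U: "normal_op H U" and c: "R \<otimes>\<^bsub>BL H\<^esub> U = U \<otimes>\<^bsub>BL H\<^esub> R"
  and sp: "joint_spectrum H R U \<subseteq> b\<Gamma>"
  using G unfolding \<Gamma>_unitary_def commuting_ops_def by blast+
 have Rc: "R \<in> \<B> H" and Uc: "U \<in> \<B> H" using R U by (auto simp: normal_op_def)
 have nU: "adj H U \<otimes>\<^bsub>BL H\<^esub> U = U \<otimes>\<^bsub>BL H\<^esub> adj H U" using U by (simp add: normal_op_def)
 define V where "V = adj H U \<otimes>\<^bsub>BL H\<^esub> U \<ominus>\<^bsub>BL H\<^esub> \<one>\<^bsub>BL H\<^esub>"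
 have V: "V \<in> \<B> H" using Uc by (simp add: V_def)
 note [simp] = bop_rules[OF Rc] bop_rules[OF Uc] bop_rules[OF adj_closed[OF Rc]] bop_rules[OF adj_closed[OF Uc]]
  bop_rules[OF V] bop_rules[OF adj_closed[OF V]]
 have Vx: "V x = adj H U (U x) \<ominus> x" if "x \<in> carrier H" for x using that Uc by (simp add: V_def)
 have Va: "adj H V = V" using Uc by (simp add: V_def adj_minus adj_mult)
 have VU: "V \<otimes>\<^bsub>BL H\<^esub> U = U \<otimes>\<^bsub>BL H\<^esub> V"
  by (rule commuteI) (use V Uc commuteD[OF nU] in \<open>simp_all add: Vx\<close>)
 have VUa: "V \<otimes>\<^bsub>BL H\<^esub> adj H U = adj H U \<otimes>\<^bsub>BL H\<^esub> V"
  by (rule commuteI) (use V Uc commuteD[OF nU] in \<open>simp_all add: Vx\<close>)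
 define Z where "Z = adj H V \<otimes>\<^bsub>BL H\<^esub> V"
 have Z: "Z \<in> \<B> H" using V by (simp add: Z_def)
 have ZT: "Z \<otimes>\<^bsub>BL H\<^esub> T = T \<otimes>\<^bsub>BL H\<^esub> Z" if "V \<otimes>\<^bsub>BL H\<^esub> T = T \<otimes>\<^bsub>BL H\<^esub> V" "T \<in> \<B> H" for T
  unfolding Z_def Va using that V by (metis BL.m_assoc)
 obtain a :: real where a: "\<And>e. e > 0 \<Longrightarrow> \<exists>x\<in>carrier H. hnorm H x = 1 \<and> hnorm H (Z x \<ominus> complex_of_real a \<odot> x) \<le> e"
  and aV: "\<And>x. x \<in> carrier H \<Longrightarrow> (hnorm H (V x))\<^sup>2 \<le> a * (hnorm H x)\<^sup>2"
  using square_approx_eigenvalue[OF V True] unfolding Z_def by blast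
 have "\<exists>m. \<forall>e>0. \<exists>x\<in>carrier H. hnorm H x = 1 \<and> hnorm H (Z x \<ominus> complex_of_real a \<odot> x) \<le> e \<and> hnorm H (U x \<ominus> m \<odot> x) \<le> e"
 proof (rule approx_eigenvalue_normal[OF U, where M = "op_norm H U"])
  fix x assume x: "x \<in> carrier H"
  show "hnorm H (Z (U x) \<ominus> complex_of_real a \<odot> U x) \<le> op_norm H U * hnorm H (Z x \<ominus> complex_of_real a \<odot> x)"
   by (rule hnorm_shift_commute[OF Z Uc ZT[OF VU Uc] x])
  show "hnorm H (Z (adj H U x) \<ominus> complex_of_real a \<odot> adj H U x) \<le> op_norm H U * hnorm H (Z x \<ominus> complex_of_real a \<odot> x)"
   using hnorm_shift_commute[OF Z adj_closed[OF Uc] ZT[OF VUa adj_closed[OF Uc]] x] Uc by simp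
  show "0 \<le> hnorm H (Z x \<ominus> complex_of_real a \<odot> x)" using x Z by (simp add: bop_closed[OF Z])
 next
  show "\<exists>x\<in>carrier H. hnorm H x = 1 \<and> hnorm H (Z x \<ominus> complex_of_real a \<odot> x) \<le> e" if "e > 0" for e by (rule a[OF that])
  show "0 \<le> op_norm H U" using Uc by simp
 qed (rule hnorm_shift_add[OF Z] hnorm_shift_smult[OF Z]; assumption)+
 then obtain m where m: "\<And>e. e > 0 \<Longrightarrow>
  \<exists>x\<in>carrier H. hnorm H x = 1 \<and> hnorm H (Z x \<ominus> complex_of_real a \<odot> x) \<le> e \<and> hnorm H (U x \<ominus> m \<odot> x) \<le> e" by blast
 \<comment> \<open>At this stage R is not known to commute with Z, because it is not known to
   commute with U^*. So l is sought for R and U alone, and only m is shared with Z.\<close>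
 then have "\<And>e. e > 0 \<Longrightarrow> \<exists>x\<in>carrier H. hnorm H x = 1 \<and> hnorm H (U x \<ominus> m \<odot> x) \<le> e" by blast
 from approx_eigenvalue_commuting[OF R U c this] obtain l where
  l: "\<And>e. e > 0 \<Longrightarrow> \<exists>x\<in>carrier H. hnorm H x = 1 \<and> hnorm H (U x \<ominus> m \<odot> x) \<le> e \<and> hnorm H (R x \<ominus> l \<odot> x) \<le> e"
  by blast
 have "(l, m) \<in> joint_spectrum H R U"
  by (rule approx_eigenvalue_imp_spectrum[OF R U]) (use l in blast)
 then have m1: "cmod m = 1" using sp in_bGamma_iff by blast
 then have mm: "m * cnj m = 1" using complex_norm_square[of m] by simp
 have "complex_of_real a = 0"
 proof (rule approx_eigenvalue_fixed[where z = Z and C = "op_norm H V * (op_norm H U + 1)"])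
  fix e :: real assume "e > 0"
  then obtain x where x: "x \<in> carrier H" "hnorm H x = 1" "hnorm H (Z x \<ominus> complex_of_real a \<odot> x) \<le> e" "hnorm H (U x \<ominus> m \<odot> x) \<le> e"
   using m by blast
  have "V x = adj H U (U x \<ominus> m \<odot> x) \<oplus> m \<odot> (adj H U x \<ominus> cnj m \<odot> x)"
   by (rule vec_eqI) (use x mm in \<open>simp_all add: Vx right_diff_distrib mult.assoc[symmetric]\<close>)
  then have "hnorm H (V x) \<le> hnorm H (adj H U (U x \<ominus> m \<odot> x)) + hnorm H (m \<odot> (adj H U x \<ominus> cnj m \<odot> x))"
   using x hnorm_triangle[of "adj H U (U x \<ominus> m \<odot> x)" "m \<odot> (adj H U x \<ominus> cnj m \<odot> x)"] by simp
  also have "hnorm H (m \<odot> (adj H U x \<ominus> cnj m \<odot> x)) = hnorm H (U x \<ominus> m \<odot> x)"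
   using x m1 hnorm_adj_shift_normal[OF U x(1), of m] by simp
  also have "hnorm H (adj H U (U x \<ominus> m \<odot> x)) \<le> op_norm H U * hnorm H (U x \<ominus> m \<odot> x)"
   using op_norm_bound[OF adj_closed[OF Uc], of "U x \<ominus> m \<odot> x"] x Uc by simp
  also have "op_norm H U * hnorm H (U x \<ominus> m \<odot> x) + hnorm H (U x \<ominus> m \<odot> x) = (op_norm H U + 1) * hnorm H (U x \<ominus> m \<odot> x)"
   by (simp add: distrib_right)
  also have "\<dots> \<le> (op_norm H U + 1) * e" using x(4) Uc by (intro mult_left_mono) auto
  finally have Vb: "hnorm H (V x) \<le> (op_norm H U + 1) * e" by simp
  have "hnorm H (Z x) \<le> op_norm H V * hnorm H (V x)"
   using op_norm_bound[OF adj_closed[OF V], of "V x"] x V by (simp add: Z_def)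
  also have "\<dots> \<le> op_norm H V * ((op_norm H U + 1) * e)" using Vb V by (intro mult_left_mono) auto
  finally have "hnorm H (Z x \<ominus> 0 \<odot> x) \<le> op_norm H V * (op_norm H U + 1) * e"
   using x bop_closed[OF Z x(1)] by (simp add: mult.assoc)
  then show "\<exists>x\<in>carrier H. hnorm H x = 1 \<and> hnorm H (Z x \<ominus> complex_of_real a \<odot> x) \<le> e \<and>
    hnorm H (Z x \<ominus> 0 \<odot> x) \<le> op_norm H V * (op_norm H U + 1) * e"
   using x by (intro bexI[of _ x] conjI)
 qed (rule bop_closed[OF Z])
 then have "hnorm H (V x) = 0" if "x \<in> carrier H" for x using aV[OF that] by simp
 then have V0: "V x = \<zero>" if "x \<in> carrier H" for x using that by simp
 show ?thesis
 proof (rule bop_eqI)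
  fix x assume x: "x \<in> carrier H"
  have "adj H U (U x) = x" using V0[OF x] Vx[OF x] x minus_eq_zero_iff[of "adj H U (U x)" x] by simp
  then show "(adj H U \<otimes>\<^bsub>BL H\<^esub> U) x = \<one>\<^bsub>BL H\<^esub> x" using x by simp
 qed (use Uc in auto)
qed

end

section \<open>The identities satisfied by a \<Gamma>-unitary\<close>

context hilbert_space
begin

text \<open>The unitary case of Fuglede's theorem: T U^* = U^* U T U^* = U^* T U U^* = U^*
  T.\<close>

lemma unitary_commute_adj:
 assumes U: "U \<in> \<B> H" and T: "T \<in> \<B> H"
  and u: "adj H U \<otimes>\<^bsub>BL H\<^esub> U = \<one>\<^bsub>BL H\<^esub>" "U \<otimes>\<^bsub>BL H\<^esub> adj H U = \<one>\<^bsub>BL H\<^esub>"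
  and c: "T \<otimes>\<^bsub>BL H\<^esub> U = U \<otimes>\<^bsub>BL H\<^esub> T"
 shows "T \<otimes>\<^bsub>BL H\<^esub> adj H U = adj H U \<otimes>\<^bsub>BL H\<^esub> T"
proof (rule commuteI[OF T adj_closed[OF U]])
 note [simp] = bop_rules[OF U] bop_rules[OF T] bop_rules[OF adj_closed[OF U]]
 fix x assume x: "x \<in> carrier H"
 have "adj H U (U (T (adj H U x))) = T (adj H U x)" using fun_cong[OF u(1), of "T (adj H U x)"] x by simp
 moreover have "U (T (adj H U x)) = T (U (adj H U x))" using commuteD[OF c, of "adj H U x"] x by simp
 moreover have "U (adj H U x) = x" using fun_cong[OF u(2), of x] x by simp
 ultimately show "T (adj H U x) = adj H U (T x)" by simp
qed

lemma Gamma_unitaryD: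
 assumes G: "\<Gamma>_unitary H R U"
 shows "R \<in> \<B> H" "U \<in> \<B> H" "R \<otimes>\<^bsub>BL H\<^esub> U = U \<otimes>\<^bsub>BL H\<^esub> R"
  "adj H U \<otimes>\<^bsub>BL H\<^esub> U = \<one>\<^bsub>BL H\<^esub>" "U \<otimes>\<^bsub>BL H\<^esub> adj H U = \<one>\<^bsub>BL H\<^esub>"
  "R = adj H R \<otimes>\<^bsub>BL H\<^esub> U" "op_norm H R \<le> 2"
proof -
 have R: "normal_op H R" and U: "normal_op H U" and c: "R \<otimes>\<^bsub>BL H\<^esub> U = U \<otimes>\<^bsub>BL H\<^esub> R"
  and sp: "joint_spectrum H R U \<subseteq> b\<Gamma>"
  using G unfolding \<Gamma>_unitary_def commuting_ops_def by blast+
 show Rc: "R \<in> \<B> H" and Uc: "U \<in> \<B> H" using R U by (auto simp: normal_op_def)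
 show "R \<otimes>\<^bsub>BL H\<^esub> U = U \<otimes>\<^bsub>BL H\<^esub> R" by (rule c)
 show u1: "adj H U \<otimes>\<^bsub>BL H\<^esub> U = \<one>\<^bsub>BL H\<^esub>" by (rule Gamma_unitary_unitary[OF G])
 then show u2: "U \<otimes>\<^bsub>BL H\<^esub> adj H U = \<one>\<^bsub>BL H\<^esub>" using U by (simp add: normal_op_def)
 note [simp] = bop_rules[OF Rc] bop_rules[OF Uc] bop_rules[OF adj_closed[OF Rc]] bop_rules[OF adj_closed[OF Uc]]
 have cRR: "adj H R \<otimes>\<^bsub>BL H\<^esub> R = R \<otimes>\<^bsub>BL H\<^esub> adj H R" using R by (simp add: normal_op_def)
 have cRUa: "R \<otimes>\<^bsub>BL H\<^esub> adj H U = adj H U \<otimes>\<^bsub>BL H\<^esub> R" by (rule unitary_commute_adj[OF Uc Rc u1 u2 c])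
 have cRaUa: "adj H R \<otimes>\<^bsub>BL H\<^esub> adj H U = adj H U \<otimes>\<^bsub>BL H\<^esub> adj H R"
  using adj_mult[OF Rc Uc] adj_mult[OF Uc Rc] unfolding c by simp
 have cRaU: "adj H R \<otimes>\<^bsub>BL H\<^esub> U = U \<otimes>\<^bsub>BL H\<^esub> adj H R"
  using adj_mult[OF Rc adj_closed[OF Uc]] adj_mult[OF adj_closed[OF Uc] Rc] unfolding cRUa using Uc by simp
 \<comment> \<open>The same unit vectors serve V^* V at a value a that dominates ||V x||^2 and the
   pair (R, U) at a boundary point (l, m). Applied below to V = R - R^* U and to V = R.\<close>
 have joint: "\<exists>a l m. (l, m) \<in> b\<Gamma> \<and> (\<forall>x\<in>carrier H. (hnorm H (V x))\<^sup>2 \<le> a * (hnorm H x)\<^sup>2) \<and>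
  (\<forall>e>0. \<exists>x\<in>carrier H. hnorm H x = 1 \<and> hnorm H ((adj H V \<otimes>\<^bsub>BL H\<^esub> V) x \<ominus> complex_of_real a \<odot> x) \<le> e \<and>
   hnorm H (U x \<ominus> m \<odot> x) \<le> e \<and> hnorm H (R x \<ominus> l \<odot> x) \<le> e)"
  if V: "V \<in> \<B> H" and ne: "\<exists>x\<in>carrier H. x \<noteq> \<zero>"
   and VR: "V \<otimes>\<^bsub>BL H\<^esub> R = R \<otimes>\<^bsub>BL H\<^esub> V" "V \<otimes>\<^bsub>BL H\<^esub> adj H R = adj H R \<otimes>\<^bsub>BL H\<^esub> V"
   and VU: "V \<otimes>\<^bsub>BL H\<^esub> U = U \<otimes>\<^bsub>BL H\<^esub> V" "V \<otimes>\<^bsub>BL H\<^esub> adj H U = adj H U \<otimes>\<^bsub>BL H\<^esub> V" for V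
 proof -
  define Z where "Z = adj H V \<otimes>\<^bsub>BL H\<^esub> V"
  have Z: "Z \<in> \<B> H" using V by (simp add: Z_def)
  have ZT: "Z \<otimes>\<^bsub>BL H\<^esub> T = T \<otimes>\<^bsub>BL H\<^esub> Z"
   if "V \<otimes>\<^bsub>BL H\<^esub> T = T \<otimes>\<^bsub>BL H\<^esub> V" "V \<otimes>\<^bsub>BL H\<^esub> adj H T = adj H T \<otimes>\<^bsub>BL H\<^esub> V" "T \<in> \<B> H" for T
  proof -
   have "adj H V \<otimes>\<^bsub>BL H\<^esub> T = T \<otimes>\<^bsub>BL H\<^esub> adj H V"
    using adj_mult[OF V adj_closed[OF that(3)]] adj_mult[OF adj_closed[OF that(3)] V] that(3)
    unfolding that(2) by simp
   then show ?thesis unfolding Z_def using that(1,3) V by (metis BL.m_assoc adj_closed)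
  qed
  have ZR: "Z \<otimes>\<^bsub>BL H\<^esub> R = R \<otimes>\<^bsub>BL H\<^esub> Z" by (rule ZT[OF VR Rc])
  have ZRa: "Z \<otimes>\<^bsub>BL H\<^esub> adj H R = adj H R \<otimes>\<^bsub>BL H\<^esub> Z"
   by (rule ZT[OF VR(2) _ adj_closed[OF Rc]]) (simp add: VR(1) Rc)
  have ZU: "Z \<otimes>\<^bsub>BL H\<^esub> U = U \<otimes>\<^bsub>BL H\<^esub> Z" by (rule ZT[OF VU Uc])
  have ZUa: "Z \<otimes>\<^bsub>BL H\<^esub> adj H U = adj H U \<otimes>\<^bsub>BL H\<^esub> Z"
   by (rule ZT[OF VU(2) _ adj_closed[OF Uc]]) (simp add: VU(1) Uc)
  obtain a :: real where a: "\<And>e. e > 0 \<Longrightarrow> \<exists>x\<in>carrier H. hnorm H x = 1 \<and> hnorm H (Z x \<ominus> complex_of_real a \<odot> x) \<le> e"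
   and aV: "\<And>x. x \<in> carrier H \<Longrightarrow> (hnorm H (V x))\<^sup>2 \<le> a * (hnorm H x)\<^sup>2"
   using square_approx_eigenvalue[OF V ne] unfolding Z_def by blast
  let ?q = "\<lambda>x. hnorm H (Z x \<ominus> complex_of_real a \<odot> x)"
  have qn: "0 \<le> ?q x" if "x \<in> carrier H" for x using that by (simp add: bop_closed[OF Z])
  have "\<exists>m. \<forall>e>0. \<exists>x\<in>carrier H. hnorm H x = 1 \<and> ?q x \<le> e \<and> hnorm H (U x \<ominus> m \<odot> x) \<le> e"
  proof (rule approx_eigenvalue_normal[OF U, where M = "op_norm H U"])
   fix x assume x: "x \<in> carrier H"
   show "?q (U x) \<le> op_norm H U * ?q x" by (rule hnorm_shift_commute[OF Z Uc ZU x])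
   show "?q (adj H U x) \<le> op_norm H U * ?q x"
    using hnorm_shift_commute[OF Z adj_closed[OF Uc] ZUa x] Uc by simp
  next
   show "\<exists>x\<in>carrier H. hnorm H x = 1 \<and> ?q x \<le> e" if "e > 0" for e by (rule a[OF that])
   show "0 \<le> op_norm H U" using Uc by simp
   show "0 \<le> ?q x" if "x \<in> carrier H" for x by (rule qn[OF that])
  qed (rule hnorm_shift_add[OF Z] hnorm_shift_smult[OF Z]; assumption)+
  then obtain m where m: "\<And>e. e > 0 \<Longrightarrow> \<exists>x\<in>carrier H. hnorm H x = 1 \<and> ?q x \<le> e \<and> hnorm H (U x \<ominus> m \<odot> x) \<le> e"
   by blast
  \<comment> \<open>The sum of the two seminorms keeps both conditions found so far while R is
    treated.\<close>
  let ?q2 = "\<lambda>x. ?q x + hnorm H (U x \<ominus> m \<odot> x)"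
  have "\<exists>l. \<forall>e>0. \<exists>x\<in>carrier H. hnorm H x = 1 \<and> ?q2 x \<le> e \<and> hnorm H (R x \<ominus> l \<odot> x) \<le> e"
  proof (rule approx_eigenvalue_normal[OF R, where M = "op_norm H R"])
   fix x assume x: "x \<in> carrier H"
   show "?q2 (R x) \<le> op_norm H R * ?q2 x"
    using hnorm_shift_commute[OF Z Rc ZR x, of "complex_of_real a"] hnorm_shift_commute[OF Uc Rc c[symmetric] x, of m]
    unfolding distrib_left by linarith
   show "?q2 (adj H R x) \<le> op_norm H R * ?q2 x"
    using hnorm_shift_commute[OF Z adj_closed[OF Rc] ZRa x, of "complex_of_real a"]
     hnorm_shift_commute[OF Uc adj_closed[OF Rc] cRaU[symmetric] x, of m]
    unfolding distrib_left op_norm_adj[OF Rc] by linarith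
   show "0 \<le> ?q2 x" using qn[OF x] x by (intro add_nonneg_nonneg) simp_all
   fix y assume y: "y \<in> carrier H"
   show "?q2 (x \<oplus> y) \<le> ?q2 x + ?q2 y"
    using hnorm_shift_add[OF Z x y, of "complex_of_real a"] hnorm_shift_add[OF Uc x y, of m] by linarith
  next
   fix k x assume x: "x \<in> carrier H"
   show "?q2 (k \<odot> x) = cmod k * ?q2 x"
    unfolding hnorm_shift_smult[OF Z x] hnorm_shift_smult[OF Uc x] by (simp add: distrib_left)
  next
   fix e :: real assume e: "e > 0"
   obtain x where "x \<in> carrier H" "hnorm H x = 1" "?q x \<le> e/2" "hnorm H (U x \<ominus> m \<odot> x) \<le> e/2"
    using m[of "e/2"] e by auto
   then show "\<exists>x\<in>carrier H. hnorm H x = 1 \<and> ?q2 x \<le> e" by (intro bexI[of _ x]) auto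
  qed (use Rc in simp)
  then obtain l where l: "\<And>e. e > 0 \<Longrightarrow> \<exists>x\<in>carrier H. hnorm H x = 1 \<and> ?q2 x \<le> e \<and> hnorm H (R x \<ominus> l \<odot> x) \<le> e"
   by blast
  have l': "\<exists>x\<in>carrier H. hnorm H x = 1 \<and> ?q x \<le> e \<and> hnorm H (U x \<ominus> m \<odot> x) \<le> e \<and> hnorm H (R x \<ominus> l \<odot> x) \<le> e"
   if e: "e > 0" for e
  proof -
   obtain x where x: "x \<in> carrier H" "hnorm H x = 1" "?q2 x \<le> e" "hnorm H (R x \<ominus> l \<odot> x) \<le> e"
    using l[OF e] by blast
   moreover have "0 \<le> hnorm H (U x \<ominus> m \<odot> x)" using x by simp
   ultimately show ?thesis using qn[OF x(1)] by (intro bexI[of _ x] conjI) linarith+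
  qed
  have "(l, m) \<in> joint_spectrum H R U"
   by (rule approx_eigenvalue_imp_spectrum[OF R U]) (use l' in blast)
  then have "(l, m) \<in> b\<Gamma>" using sp by blast
  then show ?thesis using aV l' unfolding Z_def[symmetric] by blast
 qed
 show "R = adj H R \<otimes>\<^bsub>BL H\<^esub> U"
 proof (cases "\<exists>x\<in>carrier H. x \<noteq> \<zero>")
  case False
  show ?thesis
  proof (rule bop_eqI)
   fix x assume x: "x \<in> carrier H"
   have "R x = \<zero>" "adj H R (U x) = \<zero>" using False bop_closed[OF Rc x] bop_closed[OF adj_closed[OF Rc] bop_closed[OF Uc x]] by blast+
   then show "R x = (adj H R \<otimes>\<^bsub>BL H\<^esub> U) x" using x by simp
  qed (use Rc Uc in auto)
 next
  case True
  define V where "V = R \<ominus>\<^bsub>BL H\<^esub> adj H R \<otimes>\<^bsub>BL H\<^esub> U"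
  have V: "V \<in> \<B> H" using Rc Uc by (simp add: V_def)
  note [simp] = bop_rules[OF V] bop_rules[OF adj_closed[OF V]]
  have Vx: "V x = R x \<ominus> adj H R (U x)" if "x \<in> carrier H" for x using that Rc Uc by (simp add: V_def)
  note cs = commuteD[OF cRR] commuteD[OF cRUa] commuteD[OF cRaUa] commuteD[OF cRaU] commuteD[OF c]
  have uu: "adj H U (U x) = U (adj H U x)" if "x \<in> carrier H" for x
   using commuteD[of "adj H U" U x] that u1 u2 by simp
  have "\<exists>a l m. (l, m) \<in> b\<Gamma> \<and> (\<forall>x\<in>carrier H. (hnorm H (V x))\<^sup>2 \<le> a * (hnorm H x)\<^sup>2) \<and>
  (\<forall>e>0. \<exists>x\<in>carrier H. hnorm H x = 1 \<and> hnorm H ((adj H V \<otimes>\<^bsub>BL H\<^esub> V) x \<ominus> complex_of_real a \<odot> x) \<le> e \<and>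
   hnorm H (U x \<ominus> m \<odot> x) \<le> e \<and> hnorm H (R x \<ominus> l \<odot> x) \<le> e)"
  proof (rule joint[OF V True])
   show "V \<otimes>\<^bsub>BL H\<^esub> R = R \<otimes>\<^bsub>BL H\<^esub> V" by (rule commuteI) (use V Rc in \<open>simp_all add: Vx cs[symmetric]\<close>)
   show "V \<otimes>\<^bsub>BL H\<^esub> adj H R = adj H R \<otimes>\<^bsub>BL H\<^esub> V"
    by (rule commuteI) (use V Rc in \<open>simp_all add: Vx cs(1) cs(4)\<close>)
   show "V \<otimes>\<^bsub>BL H\<^esub> U = U \<otimes>\<^bsub>BL H\<^esub> V" by (rule commuteI) (use V Uc in \<open>simp_all add: Vx cs(4) cs(5)\<close>)
   show "V \<otimes>\<^bsub>BL H\<^esub> adj H U = adj H U \<otimes>\<^bsub>BL H\<^esub> V"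
    by (rule commuteI) (use V Uc in \<open>simp_all add: Vx cs(2) cs(3)[symmetric] uu[symmetric]\<close>)
  qed
  then obtain a l m where lm: "(l, m) \<in> b\<Gamma>" and aV: "\<And>x. x \<in> carrier H \<Longrightarrow> (hnorm H (V x))\<^sup>2 \<le> a * (hnorm H x)\<^sup>2"
   and ap: "\<And>e. e > 0 \<Longrightarrow> \<exists>x\<in>carrier H. hnorm H x = 1 \<and> hnorm H ((adj H V \<otimes>\<^bsub>BL H\<^esub> V) x \<ominus> complex_of_real a \<odot> x) \<le> e \<and>
   hnorm H (U x \<ominus> m \<odot> x) \<le> e \<and> hnorm H (R x \<ominus> l \<odot> x) \<le> e" by blast
  have ml: "cmod m = 1" "l = m * cnj l" using lm unfolding in_bGamma_iff by (auto simp: mult.commute)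
  have "complex_of_real a = 0"
  proof (rule approx_eigenvalue_fixed[where z = "adj H V \<otimes>\<^bsub>BL H\<^esub> V" and C = "op_norm H V * (op_norm H R + 2)"])
   fix e :: real assume "e > 0"
   then obtain x where x: "x \<in> carrier H" "hnorm H x = 1"
    "hnorm H ((adj H V \<otimes>\<^bsub>BL H\<^esub> V) x \<ominus> complex_of_real a \<odot> x) \<le> e"
    "hnorm H (U x \<ominus> m \<odot> x) \<le> e" "hnorm H (R x \<ominus> l \<odot> x) \<le> e" using ap by blast
   let ?p = "R x \<ominus> l \<odot> x" and ?r = "adj H R (U x \<ominus> m \<odot> x)" and ?s = "m \<odot> (adj H R x \<ominus> cnj l \<odot> x)"
   \<comment> \<open>On these vectors V acts approximately as multiplication by l - m cnj l, which
     is zero at a boundary point.\<close>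
   have "V x = ?p \<ominus> (?r \<oplus> ?s)"
    by (rule vec_eqI) (use x ml(2)[symmetric] in \<open>simp_all add: Vx right_diff_distrib mult.assoc[symmetric]\<close>)
   then have "hnorm H (V x) \<le> hnorm H ?p + hnorm H (?r \<oplus> ?s)"
    using x hnorm_triangle_minus[of ?p "?r \<oplus> ?s"] by simp
   moreover have "hnorm H (?r \<oplus> ?s) \<le> hnorm H ?r + hnorm H ?s" by (rule hnorm_triangle) (use x in auto)
   moreover have "hnorm H ?s \<le> e"
    using x ml(1) hnorm_adj_shift_normal[OF R x(1), of l] by simp
   moreover have "hnorm H ?r \<le> op_norm H R * e"
   proof -
    have "hnorm H ?r \<le> op_norm H R * hnorm H (U x \<ominus> m \<odot> x)"
     using op_norm_bound[OF adj_closed[OF Rc], of "U x \<ominus> m \<odot> x"] x Rc by simp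
    also have "\<dots> \<le> op_norm H R * e" using x Rc by (intro mult_left_mono) auto
    finally show ?thesis .
   qed
   ultimately have Vb: "hnorm H (V x) \<le> (op_norm H R + 2) * e" using x(5) by (simp add: distrib_right)
   have "hnorm H ((adj H V \<otimes>\<^bsub>BL H\<^esub> V) x) \<le> op_norm H V * hnorm H (V x)"
    using op_norm_bound[OF adj_closed[OF V], of "V x"] x V by simp
   also have "\<dots> \<le> op_norm H V * ((op_norm H R + 2) * e)" using Vb V by (intro mult_left_mono) auto
   finally have "hnorm H ((adj H V \<otimes>\<^bsub>BL H\<^esub> V) x \<ominus> 0 \<odot> x) \<le> op_norm H V * (op_norm H R + 2) * e"
    using x V by (simp add: mult.assoc)
   then show "\<exists>x\<in>carrier H. hnorm H x = 1 \<and> hnorm H ((adj H V \<otimes>\<^bsub>BL H\<^esub> V) x \<ominus> complex_of_real a \<odot> x) \<le> e \<and>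
     hnorm H ((adj H V \<otimes>\<^bsub>BL H\<^esub> V) x \<ominus> 0 \<odot> x) \<le> op_norm H V * (op_norm H R + 2) * e"
    using x by (intro bexI[of _ x] conjI)
  qed (use V in simp)
  then have "hnorm H (V x) = 0" if "x \<in> carrier H" for x using aV[OF that] by simp
  then have V0: "V x = \<zero>" if "x \<in> carrier H" for x using that by simp
  show ?thesis
  proof (rule bop_eqI)
   fix x assume x: "x \<in> carrier H"
   have "R x = adj H R (U x)" using V0[OF x] Vx[OF x] x minus_eq_zero_iff[of "R x" "adj H R (U x)"] by simp
   then show "R x = (adj H R \<otimes>\<^bsub>BL H\<^esub> U) x" using x by simp
  qed (use Rc Uc in auto)
 qed
 show "op_norm H R \<le> 2"
 proof (cases "\<exists>x\<in>carrier H. x \<noteq> \<zero>")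
  case False
  show ?thesis
  proof (rule op_norm_le)
   fix x assume x: "x \<in> carrier H"
   have "R x = \<zero>" using False bop_closed[OF Rc x] by blast
   then show "hnorm H (R x) \<le> 2 * hnorm H x" using x by simp
  qed simp
 next
  case True
  \<comment> \<open>For V = R the top value a is |l|^2, and |l| \<le> 2 at a boundary point.\<close>
  from joint[OF Rc True refl cRR[symmetric] c cRUa]
  obtain a l m where lm: "(l, m) \<in> b\<Gamma>" and aR: "\<And>x. x \<in> carrier H \<Longrightarrow> (hnorm H (R x))\<^sup>2 \<le> a * (hnorm H x)\<^sup>2"
   and ap: "\<And>e. e > 0 \<Longrightarrow> \<exists>x\<in>carrier H. hnorm H x = 1 \<and> hnorm H ((adj H R \<otimes>\<^bsub>BL H\<^esub> R) x \<ominus> complex_of_real a \<odot> x) \<le> e \<and>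
   hnorm H (U x \<ominus> m \<odot> x) \<le> e \<and> hnorm H (R x \<ominus> l \<odot> x) \<le> e" by blast
  have l2: "cmod l \<le> 2" using lm unfolding in_bGamma_iff by simp
  have "complex_of_real a = l * cnj l"
  proof (rule approx_eigenvalue_fixed[where z = "adj H R \<otimes>\<^bsub>BL H\<^esub> R" and C = "op_norm H R + 2"])
   fix e :: real assume "e > 0"
   then obtain x where x: "x \<in> carrier H" "hnorm H x = 1"
    "hnorm H ((adj H R \<otimes>\<^bsub>BL H\<^esub> R) x \<ominus> complex_of_real a \<odot> x) \<le> e" "hnorm H (R x \<ominus> l \<odot> x) \<le> e" using ap by blast
   let ?r = "adj H R (R x \<ominus> l \<odot> x)" and ?s = "l \<odot> (adj H R x \<ominus> cnj l \<odot> x)"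
   have "(adj H R \<otimes>\<^bsub>BL H\<^esub> R) x \<ominus> (l * cnj l) \<odot> x = ?r \<oplus> ?s"
    by (rule vec_eqI) (use x in \<open>simp_all add: right_diff_distrib mult.assoc[symmetric]\<close>)
   then have "hnorm H ((adj H R \<otimes>\<^bsub>BL H\<^esub> R) x \<ominus> (l * cnj l) \<odot> x) \<le> hnorm H ?r + hnorm H ?s"
    using x hnorm_triangle[of ?r ?s] by simp
   moreover have "hnorm H ?s \<le> 2 * e"
   proof -
    have "hnorm H ?s = cmod l * hnorm H (R x \<ominus> l \<odot> x)"
     using x hnorm_adj_shift_normal[OF R x(1), of l] by simp
    also have "\<dots> \<le> 2 * e" using x l2 by (intro mult_mono) auto
    finally show ?thesis .
   qed
   moreover have "hnorm H ?r \<le> op_norm H R * e"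
   proof -
    have "hnorm H ?r \<le> op_norm H R * hnorm H (R x \<ominus> l \<odot> x)"
     using op_norm_bound[OF adj_closed[OF Rc], of "R x \<ominus> l \<odot> x"] x Rc by simp
    also have "\<dots> \<le> op_norm H R * e" using x Rc by (intro mult_left_mono) auto
    finally show ?thesis .
   qed
   ultimately have "hnorm H ((adj H R \<otimes>\<^bsub>BL H\<^esub> R) x \<ominus> (l * cnj l) \<odot> x) \<le> (op_norm H R + 2) * e"
    by (simp add: distrib_right)
   then show "\<exists>x\<in>carrier H. hnorm H x = 1 \<and> hnorm H ((adj H R \<otimes>\<^bsub>BL H\<^esub> R) x \<ominus> complex_of_real a \<odot> x) \<le> e \<and>
     hnorm H ((adj H R \<otimes>\<^bsub>BL H\<^esub> R) x \<ominus> (l * cnj l) \<odot> x) \<le> (op_norm H R + 2) * e"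
    using x by (intro bexI[of _ x] conjI)
  qed (use Rc in simp)
  then have "a = (cmod l)\<^sup>2" unfolding complex_norm_square[symmetric] by (simp only: of_real_eq_iff)
  then have a4: "a \<le> 2\<^sup>2" using power_mono[OF l2, of 2] by simp
  show ?thesis
  proof (rule op_norm_le)
   fix x assume x: "x \<in> carrier H"
   have "(hnorm H (R x))\<^sup>2 \<le> 2\<^sup>2 * (hnorm H x)\<^sup>2"
    using aR[OF x] mult_right_mono[OF a4, of "(hnorm H x)\<^sup>2"] by simp
   then have "(hnorm H (R x))\<^sup>2 \<le> (2 * hnorm H x)\<^sup>2" by (simp add: power_mult_distrib)
   then show "hnorm H (R x) \<le> 2 * hnorm H x" by (rule power2_le_imp_le) (use x in simp)
  qed simp
 qed
qed

end

section \<open>Exactness of the Koszul complex off the boundary, and recognition of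
  \<Gamma>-unitaries\<close>

context hilbert_space
begin

text \<open>Turns a lower bound for ||A x|| + ||B x|| into coercivity of A^* A + B^* B.\<close>

lemma hnorm_sum_bound_sq:
 fixes a b k n :: real
 assumes "k * n \<le> a + b" "0 \<le> k" "0 \<le> n"
 shows "k\<^sup>2 / 2 * n\<^sup>2 \<le> a\<^sup>2 + b\<^sup>2"
proof -
 have "(k * n)\<^sup>2 \<le> (a + b)\<^sup>2" using assms by (intro power_mono) auto
 moreover have "(a + b)\<^sup>2 \<le> 2 * (a\<^sup>2 + b\<^sup>2)"
  using zero_le_power2[of "a - b"] by (simp add: power2_diff power2_sum)
 ultimately show ?thesis by (simp add: power_mult_distrib)
qed

text \<open>If \<open>D = A\<^sup>* A + B\<^sup>* B\<close> is invertible, then \<open>D\<^sup>-\<^sup>1 A\<^sup>*\<close> and \<open>D\<^sup>-\<^sup>1 B\<^sup>*\<close> form a commuting left inverse of the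
 pair \<open>(A, B)\<close>, which contracts its Koszul complex.\<close>

lemma koszul_exact_if_bounded_below:
 assumes A: "A \<in> \<B> H" and B: "B \<in> \<B> H"
  and cAB: "A \<otimes>\<^bsub>BL H\<^esub> B = B \<otimes>\<^bsub>BL H\<^esub> A" and cAA: "adj H A \<otimes>\<^bsub>BL H\<^esub> A = A \<otimes>\<^bsub>BL H\<^esub> adj H A"
  and cBB: "adj H B \<otimes>\<^bsub>BL H\<^esub> B = B \<otimes>\<^bsub>BL H\<^esub> adj H B" and cABa: "A \<otimes>\<^bsub>BL H\<^esub> adj H B = adj H B \<otimes>\<^bsub>BL H\<^esub> A"
  and k: "k > 0" "\<And>x. x \<in> carrier H \<Longrightarrow> k * hnorm H x \<le> hnorm H (A x) + hnorm H (B x)"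
 shows "koszul_exact H A B"
proof -
 note [simp] = bop_rules[OF A] bop_rules[OF B] bop_rules[OF adj_closed[OF A]] bop_rules[OF adj_closed[OF B]]
 have cAaB: "adj H A \<otimes>\<^bsub>BL H\<^esub> B = B \<otimes>\<^bsub>BL H\<^esub> adj H A"
  using adj_mult[OF A adj_closed[OF B]] adj_mult[OF adj_closed[OF B] A] B unfolding cABa by simp
 note cs = commuteD[OF cAB] commuteD[OF cAA] commuteD[OF cBB] commuteD[OF cABa] commuteD[OF cAaB]
 define D where "D = adj H A \<otimes>\<^bsub>BL H\<^esub> A \<oplus>\<^bsub>BL H\<^esub> adj H B \<otimes>\<^bsub>BL H\<^esub> B"
 have D: "D \<in> \<B> H" using A B by (simp add: D_def)
 note [simp] = bop_rules[OF D]
 have Dx: "D x = adj H A (A x) \<oplus> adj H B (B x)" if "x \<in> carrier H" for x using that A B by (simp add: D_def)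
 have coerc: "k\<^sup>2 / 2 * (hnorm H x)\<^sup>2 \<le> Re (cinner H (D x) x)" if x: "x \<in> carrier H" for x
 proof -
  have "Re (cinner H (D x) x) = (hnorm H (A x))\<^sup>2 + (hnorm H (B x))\<^sup>2"
   using x A B by (simp add: Dx hnorm_sq)
  then show ?thesis using hnorm_sum_bound_sq[OF k(2)[OF x]] k(1) x by simp
 qed
 have surj: "\<exists>v\<in>carrier H. D v = w" if w: "w \<in> carrier H" for w
 proof (rule symmetric_coercive_surj[where B = "op_norm H D" and e = "k\<^sup>2 / 2"])
  show "cinner H (D x) y = cinner H x (D y)" if "x \<in> carrier H" "y \<in> carrier H" for x y
   using that A B by (simp add: Dx)
  show "hnorm H (D x) \<le> op_norm H D * hnorm H x" if "x \<in> carrier H" for x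
   by (rule op_norm_bound[OF D that])
  show "k\<^sup>2 / 2 * (hnorm H x)\<^sup>2 \<le> Re (cinner H (D x) x)" if "x \<in> carrier H" for x by (rule coerc[OF that])
  show "k\<^sup>2 / 2 > 0" using k(1) by simp
 qed (use w in simp_all)
 have inj: "x = \<zero>" if x: "x \<in> carrier H" "D x = \<zero>" for x
 proof -
  have "k\<^sup>2 / 2 * (hnorm H x)\<^sup>2 \<le> 0" using coerc[OF x(1)] x by simp
  then have "(hnorm H x)\<^sup>2 \<le> 0" using k(1) by (simp add: mult_le_0_iff)
  then show ?thesis using x(1) by simp
 qed
 have inj': "x = y" if "x \<in> carrier H" "y \<in> carrier H" "D x = D y" for x y
  using inj[of "x \<ominus> y"] that by simp
 show ?thesis
  unfolding koszul_exact_def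
 proof (intro conjI ballI impI)
  fix x assume x: "x \<in> carrier H" and 0: "A x = \<zero> \<and> B x = \<zero>"
  show "x = \<zero>" by (rule inj) (use x 0 in \<open>simp_all add: Dx\<close>)
 next
  fix y z assume y: "y \<in> carrier H" and z: "z \<in> carrier H" and "A z \<ominus> B y = \<zero>"
  then have e: "A z = B y" by simp
  \<comment> \<open>x is the inverse of D applied to A^* y + B^* z. As D commutes with A, and A z =
    B y, one gets D (A x) = A^* A y + B^* B y = D y; the argument for B x is the same.\<close>
  obtain x where x: "x \<in> carrier H" "D x = adj H A y \<oplus> adj H B z"
   using surj[of "adj H A y \<oplus> adj H B z"] y z by auto
  have DA: "D (A x) = A (D x)" and DB: "D (B x) = B (D x)"
   using x(1) by (simp_all add: Dx cs)
  have "y = A x"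
  proof (rule inj')
   have "A (adj H B z) = adj H B (B y)" using z cs(4)[of z] e by simp
   then show "D y = D (A x)" unfolding DA x(2) using y z by (simp add: Dx cs(2))
  qed (use x y in simp_all)
  moreover have "z = B x"
  proof (rule inj')
   have "adj H A (A z) = B (adj H A y)" using y cs(5)[of y] e by simp
   then show "D z = D (B x)" unfolding DB x(2) using y z by (simp add: Dx cs(3))
  qed (use x z in simp_all)
  ultimately show "\<exists>x\<in>carrier H. y = A x \<and> z = B x" using x(1) by blast
 next
  fix w assume w: "w \<in> carrier H"
  obtain v where v: "v \<in> carrier H" "D v = w" using surj[OF w] by blast
  \<comment> \<open>The minus sign in the last Koszul map (y, z) |-> A z - B y makes - B^* v the
    right choice for y.\<close>
  have "w = A (adj H A v) \<ominus> B (\<ominus> (adj H B v))"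
  proof -
   have "\<ominus> (adj H B v) = (- 1) \<odot> adj H B v" by (rule vec_eqI) (use v in simp_all)
   moreover have "\<ominus> (B (adj H B v)) = (- 1) \<odot> B (adj H B v)" by (rule vec_eqI) (use v in simp_all)
   ultimately have "B (\<ominus> (adj H B v)) = \<ominus> (B (adj H B v))" using v by simp
   then have "A (adj H A v) \<ominus> B (\<ominus> (adj H B v)) = A (adj H A v) \<oplus> B (adj H B v)"
    using v by (simp add: a_minus_def)
   also have "\<dots> = D v" using v by (simp add: Dx cs)
   finally show ?thesis using v by simp
  qed
  then show "\<exists>y\<in>carrier H. \<exists>z\<in>carrier H. w = A z \<ominus> B y"
   using v by (intro bexI[of _ "\<ominus> (adj H B v)"] bexI[of _ "adj H A v"]) simp_all
 qed
qed

lemma commute_shift: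
 assumes S: "S \<in> \<B> H" and T: "T \<in> \<B> H" and c: "S \<otimes>\<^bsub>BL H\<^esub> T = T \<otimes>\<^bsub>BL H\<^esub> S"
 shows "(S \<ominus>\<^bsub>BL H\<^esub> (a \<odot>\<^bsub>BL H\<^esub> \<one>\<^bsub>BL H\<^esub>)) \<otimes>\<^bsub>BL H\<^esub> (T \<ominus>\<^bsub>BL H\<^esub> (b \<odot>\<^bsub>BL H\<^esub> \<one>\<^bsub>BL H\<^esub>))
  = (T \<ominus>\<^bsub>BL H\<^esub> (b \<odot>\<^bsub>BL H\<^esub> \<one>\<^bsub>BL H\<^esub>)) \<otimes>\<^bsub>BL H\<^esub> (S \<ominus>\<^bsub>BL H\<^esub> (a \<odot>\<^bsub>BL H\<^esub> \<one>\<^bsub>BL H\<^esub>))"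
proof (rule commuteI)
 note [simp] = bop_rules[OF S] bop_rules[OF T]
 fix x assume x: "x \<in> carrier H"
 have ST: "S (T x) = T (S x)" by (rule commuteD[OF c x])
 show "(S \<ominus>\<^bsub>BL H\<^esub> (a \<odot>\<^bsub>BL H\<^esub> \<one>\<^bsub>BL H\<^esub>)) ((T \<ominus>\<^bsub>BL H\<^esub> (b \<odot>\<^bsub>BL H\<^esub> \<one>\<^bsub>BL H\<^esub>)) x)
  = (T \<ominus>\<^bsub>BL H\<^esub> (b \<odot>\<^bsub>BL H\<^esub> \<one>\<^bsub>BL H\<^esub>)) ((S \<ominus>\<^bsub>BL H\<^esub> (a \<odot>\<^bsub>BL H\<^esub> \<one>\<^bsub>BL H\<^esub>)) x)"
  by (rule vec_eqI) (use x S T ST in \<open>simp_all add: algebra_simps\<close>)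
qed (use S T in auto)

lemma Gamma_unitaryI:
 assumes R: "R \<in> \<B> H" and U: "U \<in> \<B> H" and c: "R \<otimes>\<^bsub>BL H\<^esub> U = U \<otimes>\<^bsub>BL H\<^esub> R"
  and u1: "adj H U \<otimes>\<^bsub>BL H\<^esub> U = \<one>\<^bsub>BL H\<^esub>" and u2: "U \<otimes>\<^bsub>BL H\<^esub> adj H U = \<one>\<^bsub>BL H\<^esub>"
  and RU: "R = adj H R \<otimes>\<^bsub>BL H\<^esub> U" and R2: "op_norm H R \<le> 2"
 shows "\<Gamma>_unitary H R U"
proof -
 note [simp] = bop_rules[OF R] bop_rules[OF U] bop_rules[OF adj_closed[OF R]] bop_rules[OF adj_closed[OF U]]
 have cRUa: "R \<otimes>\<^bsub>BL H\<^esub> adj H U = adj H U \<otimes>\<^bsub>BL H\<^esub> R" by (rule unitary_commute_adj[OF U R u1 u2 c])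
 have cRaU: "adj H R \<otimes>\<^bsub>BL H\<^esub> U = U \<otimes>\<^bsub>BL H\<^esub> adj H R"
  using adj_mult[OF R adj_closed[OF U]] adj_mult[OF adj_closed[OF U] R] unfolding cRUa using U by simp
 have Ra: "adj H R = adj H U \<otimes>\<^bsub>BL H\<^esub> R"
  using arg_cong[OF RU, of "adj H"] adj_mult[OF adj_closed[OF R] U] R by simp
 \<comment> \<open>R^* = U^* R, and R commutes with both factors.\<close>
 have nR: "adj H R \<otimes>\<^bsub>BL H\<^esub> R = R \<otimes>\<^bsub>BL H\<^esub> adj H R"
  unfolding Ra using cRUa R U by (metis BL.m_assoc adj_closed)
 have normR: "normal_op H R" and normU: "normal_op H U"
  using nR u1 u2 R U by (auto simp: normal_op_def)
 have spec: "koszul_exact H (R \<ominus>\<^bsub>BL H\<^esub> (l \<odot>\<^bsub>BL H\<^esub> \<one>\<^bsub>BL H\<^esub>)) (U \<ominus>\<^bsub>BL H\<^esub> (m \<odot>\<^bsub>BL H\<^esub> \<one>\<^bsub>BL H\<^esub>))"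
  if lm: "(l, m) \<notin> b\<Gamma>" for l m
 proof -
  define A where "A = R \<ominus>\<^bsub>BL H\<^esub> (l \<odot>\<^bsub>BL H\<^esub> \<one>\<^bsub>BL H\<^esub>)"
  define B where "B = U \<ominus>\<^bsub>BL H\<^esub> (m \<odot>\<^bsub>BL H\<^esub> \<one>\<^bsub>BL H\<^esub>)"
  have Ax: "A x = R x \<ominus> l \<odot> x" and Bx: "B x = U x \<ominus> m \<odot> x" if "x \<in> carrier H" for x
   using that R U by (simp_all add: A_def B_def)
  have Aa: "adj H A = adj H R \<ominus>\<^bsub>BL H\<^esub> (cnj l \<odot>\<^bsub>BL H\<^esub> \<one>\<^bsub>BL H\<^esub>)"
   and Ba: "adj H B = adj H U \<ominus>\<^bsub>BL H\<^esub> (cnj m \<odot>\<^bsub>BL H\<^esub> \<one>\<^bsub>BL H\<^esub>)"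
   using R U by (simp_all add: A_def B_def adj_minus adj_smult)
  have nU: "hnorm H (U x) = hnorm H x" if "x \<in> carrier H" for x by (rule unitary_hnorm[OF U u1 that])
  have bUx: "\<bar>1 - cmod m\<bar> * hnorm H x \<le> hnorm H (B x)" if x: "x \<in> carrier H" for x
  proof -
   have "\<bar>1 - cmod m\<bar> * hnorm H x = \<bar>hnorm H (U x) - hnorm H (m \<odot> x)\<bar>"
    using x nU[OF x] hnorm_nonneg[OF x] by (simp add: abs_mult[of "1 - cmod m", symmetric] left_diff_distrib abs_mult_pos)
   also have "\<dots> \<le> hnorm H (U x \<ominus> m \<odot> x)" by (rule abs_hnorm_diff_le) (use x in simp_all)
   finally show ?thesis by (simp add: Bx[OF x])
  qed
  have bRx: "(cmod l - 2) * hnorm H x \<le> hnorm H (A x)" if x: "x \<in> carrier H" for x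
  proof -
   have "hnorm H (R x) \<le> 2 * hnorm H x"
    using op_norm_bound[OF R x] mult_right_mono[OF R2 hnorm_nonneg[OF x]] by linarith
   moreover have "\<bar>hnorm H (R x) - hnorm H (l \<odot> x)\<bar> \<le> hnorm H (R x \<ominus> l \<odot> x)"
    by (rule abs_hnorm_diff_le) (use x in simp_all)
   ultimately show ?thesis using x by (simp add: Ax left_diff_distrib)
  qed
  \<comment> \<open>Because R = U R^*, the vector (cnj l m - l) x is a combination of (R - l) x, of
    U applied to the defect of R^* at cnj l, and of cnj l (U - m) x. Normality of R bounds the
    middle one by A x as well.\<close>
  have blx: "cmod (cnj l * m - l) * hnorm H x \<le> (2 + cmod l) * (hnorm H (A x) + hnorm H (B x))" if x: "x \<in> carrier H" for x
  proof -
   let ?a = "U (adj H R x \<ominus> cnj l \<odot> x)" and ?b = "cnj l \<odot> (U x \<ominus> m \<odot> x)"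
   have RUx: "R x = U (adj H R x)" using fun_cong[OF RU, of x] commuteD[OF cRaU x] x by simp
   have eq: "(cnj l * m - l) \<odot> x = (R x \<ominus> l \<odot> x) \<ominus> (?a \<oplus> ?b)"
    by (rule vec_eqI) (use x in \<open>simp_all add: RUx algebra_simps\<close>)
   have "cmod (cnj l * m - l) * hnorm H x = hnorm H ((cnj l * m - l) \<odot> x)" using x by simp
   also have "\<dots> = hnorm H ((R x \<ominus> l \<odot> x) \<ominus> (?a \<oplus> ?b))" by (simp only: eq)
   also have "\<dots> \<le> hnorm H (R x \<ominus> l \<odot> x) + hnorm H (?a \<oplus> ?b)"
    by (rule hnorm_triangle_minus) (use x in simp_all)
   also have "\<dots> \<le> hnorm H (R x \<ominus> l \<odot> x) + (hnorm H ?a + hnorm H ?b)"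
    using hnorm_triangle[of ?a ?b] x by simp
   also have "hnorm H ?a = hnorm H (A x)"
    using nU[of "adj H R x \<ominus> cnj l \<odot> x"] hnorm_adj_shift_normal[OF normR x, of l] x by (simp add: Ax)
   also have "hnorm H ?b = cmod l * hnorm H (B x)" using x by (simp add: Bx)
   also have "hnorm H (R x \<ominus> l \<odot> x) = hnorm H (A x)" using x by (simp add: Ax)
   also have "hnorm H (A x) + (hnorm H (A x) + cmod l * hnorm H (B x)) \<le> (2 + cmod l) * (hnorm H (A x) + hnorm H (B x))"
   proof -
    have "0 \<le> hnorm H (A x)" "0 \<le> hnorm H (B x)" using x by (simp_all add: Ax Bx)
    then have "0 \<le> cmod l * hnorm H (A x)" "0 \<le> 2 * hnorm H (B x)" by simp_all
    then show ?thesis by (simp add: algebra_simps)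
   qed
   finally show ?thesis .
  qed
  have nn: "0 \<le> hnorm H (A x)" "0 \<le> hnorm H (B x)" if "x \<in> carrier H" for x
   using that by (simp_all add: Ax Bx)
  have "\<exists>k>0. \<forall>x\<in>carrier H. k * hnorm H x \<le> hnorm H (A x) + hnorm H (B x)"
  proof -
   \<comment> \<open>Outside the boundary one of the three conditions of
     \<open>in_bGamma_iff\<close> fails, and each failure has its own lower bound k.\<close>
   consider "cmod m \<noteq> 1" | "cmod l > 2" | "cnj l * m \<noteq> l" using lm unfolding in_bGamma_iff by fastforce
   then show ?thesis
   proof cases
    case 1
    have "\<forall>x\<in>carrier H. \<bar>1 - cmod m\<bar> * hnorm H x \<le> hnorm H (A x) + hnorm H (B x)"
    proof
     fix x assume x: "x \<in> carrier H"
     show "\<bar>1 - cmod m\<bar> * hnorm H x \<le> hnorm H (A x) + hnorm H (B x)" using bUx[OF x] nn[OF x] by linarith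
    qed
    then show ?thesis using 1 by (intro exI[of _ "\<bar>1 - cmod m\<bar>"]) simp
   next
    case 2
    have "\<forall>x\<in>carrier H. (cmod l - 2) * hnorm H x \<le> hnorm H (A x) + hnorm H (B x)"
    proof
     fix x assume x: "x \<in> carrier H"
     show "(cmod l - 2) * hnorm H x \<le> hnorm H (A x) + hnorm H (B x)" using bRx[OF x] nn[OF x] by linarith
    qed
    then show ?thesis using 2 by (intro exI[of _ "cmod l - 2"]) simp
   next
    case 3
    have p: "0 < 2 + cmod l" by (simp add: add_pos_nonneg)
    have "\<forall>x\<in>carrier H. cmod (cnj l * m - l) / (2 + cmod l) * hnorm H x \<le> hnorm H (A x) + hnorm H (B x)"
    proof
     fix x assume x: "x \<in> carrier H"
     show "cmod (cnj l * m - l) / (2 + cmod l) * hnorm H x \<le> hnorm H (A x) + hnorm H (B x)"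
      using blx[OF x] p by (simp add: pos_divide_le_eq mult.commute)
    qed
    then show ?thesis using 3 p by (intro exI[of _ "cmod (cnj l * m - l) / (2 + cmod l)"]) simp
   qed
  qed
  then obtain k where k: "k > 0" "\<And>x. x \<in> carrier H \<Longrightarrow> k * hnorm H x \<le> hnorm H (A x) + hnorm H (B x)" by blast
  have "koszul_exact H A B"
  proof (rule koszul_exact_if_bounded_below[OF _ _ _ _ _ _ k])
   show "A \<in> \<B> H" "B \<in> \<B> H" using R U by (auto simp: A_def B_def)
   show "A \<otimes>\<^bsub>BL H\<^esub> B = B \<otimes>\<^bsub>BL H\<^esub> A" unfolding A_def B_def by (rule commute_shift[OF R U c])
   show "adj H A \<otimes>\<^bsub>BL H\<^esub> A = A \<otimes>\<^bsub>BL H\<^esub> adj H A"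
    unfolding Aa unfolding A_def by (rule commute_shift[OF adj_closed[OF R] R nR])
   show "adj H B \<otimes>\<^bsub>BL H\<^esub> B = B \<otimes>\<^bsub>BL H\<^esub> adj H B"
    unfolding Ba unfolding B_def by (rule commute_shift[OF adj_closed[OF U] U]) (simp add: u1 u2)
   show "A \<otimes>\<^bsub>BL H\<^esub> adj H B = adj H B \<otimes>\<^bsub>BL H\<^esub> A"
    unfolding Ba unfolding A_def by (rule commute_shift[OF R adj_closed[OF U] cRUa])
  qed
  then show ?thesis by (simp add: A_def B_def)
 qed
 then have "joint_spectrum H R U \<subseteq> b\<Gamma>" unfolding joint_spectrum_def by auto
 then show ?thesis
  unfolding \<Gamma>_unitary_def commuting_ops_def using normR normU c hilbert_space_axioms by auto
qed

end

section \<open>Star homomorphisms and isometric embeddings\<close>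

context hilbert_space
begin

lemma op_norm_less_ex:
 assumes "0 \<le> b" "b < op_norm H T"
 shows "\<exists>x\<in>carrier H. b * hnorm H x < hnorm H (T x)"
 using op_norm_le[OF assms(1), of T] assms(2) by (meson not_le)

text \<open>The partial sums E k of the Neumann series stay in A and converge there, since A is
  closed. It matters that the inverse lies in A, because a homomorphism defined on A is applied to
  it.\<close>

lemma Neumann_left_inverse:
 assumes A: "unital_star_subalgebra H A" and cl: "closedin (op_norm_topology H) A"
  and T: "T \<in> A" and r: "op_norm H T < 1"
 shows "\<exists>E\<in>A. E \<otimes>\<^bsub>BL H\<^esub> (\<one>\<^bsub>BL H\<^esub> \<ominus>\<^bsub>BL H\<^esub> T) = \<one>\<^bsub>BL H\<^esub>"
proof -
 note AD = unital_star_subalgebraD[OF A]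
 have Tc: "T \<in> \<B> H" using T AD(1) by blast
 define r where "r = op_norm H T"
 have r01: "0 \<le> r" "r < 1" using r Tc by (auto simp: r_def)
 define E where "E = rec_nat \<zero>\<^bsub>BL H\<^esub> (\<lambda>_ F. \<one>\<^bsub>BL H\<^esub> \<oplus>\<^bsub>BL H\<^esub> F \<otimes>\<^bsub>BL H\<^esub> T)"
 have E0: "E 0 = \<zero>\<^bsub>BL H\<^esub>" and ES: "E (Suc k) = \<one>\<^bsub>BL H\<^esub> \<oplus>\<^bsub>BL H\<^esub> E k \<otimes>\<^bsub>BL H\<^esub> T" for k
  by (simp_all add: E_def)
 have EA: "E k \<in> A" for k
  by (induction k) (simp_all add: E0 ES AD T)
 have Ec [simp]: "E k \<in> \<B> H" for k using EA AD(1) by blast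
 have diff: "op_norm H (E (Suc k) \<ominus>\<^bsub>BL H\<^esub> E k) \<le> r ^ k" for k
 proof (induction k)
  case 0
  have "E (Suc 0) \<ominus>\<^bsub>BL H\<^esub> E 0 = \<one>\<^bsub>BL H\<^esub>"
   by (rule bop_eqI) (use Tc in \<open>simp_all add: ES E0 a_minus_def bop_closed[OF Tc]\<close>)
  then show ?case using op_norm_one_le by simp
 next
  case (Suc k)
  have "E (Suc (Suc k)) \<ominus>\<^bsub>BL H\<^esub> E (Suc k) = (E (Suc k) \<ominus>\<^bsub>BL H\<^esub> E k) \<otimes>\<^bsub>BL H\<^esub> T"
  proof (rule bop_eqI)
   fix x assume x: "x \<in> carrier H"
   note [simp] = bop_rules[OF Tc] bop_rules[OF Ec]
   have e: "E (Suc j) x = x \<oplus> E j (T x)" for j using x Tc by (simp add: ES)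
   have "(E (Suc (Suc k)) \<ominus>\<^bsub>BL H\<^esub> E (Suc k)) x = (x \<oplus> E (Suc k) (T x)) \<ominus> (x \<oplus> E k (T x))"
    using x e[of "Suc k"] e[of k] by simp
   also have "\<dots> = E (Suc k) (T x) \<ominus> E k (T x)"
    by (rule vec_eqI) (use x in simp_all)
   finally show "(E (Suc (Suc k)) \<ominus>\<^bsub>BL H\<^esub> E (Suc k)) x = ((E (Suc k) \<ominus>\<^bsub>BL H\<^esub> E k) \<otimes>\<^bsub>BL H\<^esub> T) x"
    using x Tc by simp
  qed (use Tc in auto)
  then have "op_norm H (E (Suc (Suc k)) \<ominus>\<^bsub>BL H\<^esub> E (Suc k)) \<le> op_norm H (E (Suc k) \<ominus>\<^bsub>BL H\<^esub> E k) * r"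
   using op_norm_mult_le[of "E (Suc k) \<ominus>\<^bsub>BL H\<^esub> E k" T] Tc by (simp add: r_def)
  also have "\<dots> \<le> r ^ k * r" using Suc r01 by (intro mult_right_mono) auto
  finally show ?case by (simp add: mult.commute)
 qed
 have tail: "op_norm H (E (k + n) \<ominus>\<^bsub>BL H\<^esub> E k) \<le> r ^ k / (1 - r) - r ^ (k + n) / (1 - r)" for k n
 proof (induction n)
  case 0
  then show ?case by (simp add: a_minus_def BL.r_neg)
 next
  case (Suc n)
  have "op_norm H (E (k + Suc n) \<ominus>\<^bsub>BL H\<^esub> E k) \<le> op_norm H (E (Suc (k + n)) \<ominus>\<^bsub>BL H\<^esub> E (k + n)) + op_norm H (E (k + n) \<ominus>\<^bsub>BL H\<^esub> E k)"
   using op_norm_triangle_dist[of "E (Suc (k + n))" "E (k + n)" "E k"] by simp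
  also have "\<dots> \<le> r ^ (k + n) + (r ^ k / (1 - r) - r ^ (k + n) / (1 - r))"
   by (intro add_mono diff Suc)
  also have "\<dots> = r ^ k / (1 - r) - r ^ (k + Suc n) / (1 - r)"
  proof -
   have "r ^ (k + n) = r ^ (k + n) * (1 - r) / (1 - r)" using r01 by simp
   also have "\<dots> = r ^ (k + n) / (1 - r) - r ^ (k + Suc n) / (1 - r)"
    by (simp only: right_diff_distrib diff_divide_distrib mult_1_right add_Suc_right power_Suc mult.commute[of _ r])
   finally show ?thesis by linarith
  qed
  finally show ?case .
 qed
 have tail': "op_norm H (E (k + n) \<ominus>\<^bsub>BL H\<^esub> E k) \<le> r ^ k / (1 - r)" for k n
 proof -
  have "0 \<le> r ^ (k + n) / (1 - r)" using r01 by simp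
  then show ?thesis using tail[of k n] by linarith
 qed
 obtain L where L: "L \<in> \<B> H" "(\<lambda>n. op_norm H (E n \<ominus>\<^bsub>BL H\<^esub> L)) \<longlonglongrightarrow> 0"
 proof (rule op_Cauchy_convergent[of E])
  fix e :: real assume e: "e > 0"
  have "\<exists>N. r ^ N < e * (1 - r) / 2" using r01 e by (intro real_arch_pow_inv) auto
  then obtain N where N: "r ^ N / (1 - r) < e / 2" using r01 by (auto simp: pos_divide_less_eq)
  have "op_norm H (E p \<ominus>\<^bsub>BL H\<^esub> E q) < e" if "p \<ge> N" "q \<ge> N" for p q
  proof -
   have "op_norm H (E p \<ominus>\<^bsub>BL H\<^esub> E N) < e / 2" "op_norm H (E q \<ominus>\<^bsub>BL H\<^esub> E N) < e / 2"
   proof -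
    have "op_norm H (E p \<ominus>\<^bsub>BL H\<^esub> E N) \<le> r ^ N / (1 - r)" "op_norm H (E q \<ominus>\<^bsub>BL H\<^esub> E N) \<le> r ^ N / (1 - r)"
     using tail'[of N "p - N"] tail'[of N "q - N"] that by simp_all
    then show "op_norm H (E p \<ominus>\<^bsub>BL H\<^esub> E N) < e / 2" "op_norm H (E q \<ominus>\<^bsub>BL H\<^esub> E N) < e / 2"
     using N by linarith+
   qed
   moreover have "op_norm H (E p \<ominus>\<^bsub>BL H\<^esub> E q) \<le> op_norm H (E p \<ominus>\<^bsub>BL H\<^esub> E N) + op_norm H (E N \<ominus>\<^bsub>BL H\<^esub> E q)"
    by (rule op_norm_triangle_dist) simp_all
   moreover have "op_norm H (E N \<ominus>\<^bsub>BL H\<^esub> E q) = op_norm H (E q \<ominus>\<^bsub>BL H\<^esub> E N)"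
    by (rule op_norm_minus_commute) simp_all
   ultimately show ?thesis by linarith
  qed
  then show "\<exists>N. \<forall>p\<ge>N. \<forall>q\<ge>N. op_norm H (E p \<ominus>\<^bsub>BL H\<^esub> E q) < e" by blast
 qed simp
 have LA: "L \<in> A" using cl L EA unfolding closedin_op_norm_iff by blast
 note [simp] = bop_rules[OF Tc] bop_rules[OF Ec] bop_rules[OF L(1)]
 have Lim: "(\<lambda>n. hnorm H (E n y \<ominus> L y)) \<longlonglongrightarrow> 0" if y: "y \<in> carrier H" for y
 proof (rule squeeze_null)
  show "(\<lambda>n. op_norm H (E n \<ominus>\<^bsub>BL H\<^esub> L) * hnorm H y) \<longlonglongrightarrow> 0"
   using tendsto_mult[OF L(2) tendsto_const, of "hnorm H y"] by simp
  show "hnorm H (E n y \<ominus> L y) \<le> op_norm H (E n \<ominus>\<^bsub>BL H\<^esub> L) * hnorm H y" for n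
   using op_norm_bound[of "E n \<ominus>\<^bsub>BL H\<^esub> L" y] y L(1) by simp
 qed (use y in simp)
 have "L \<otimes>\<^bsub>BL H\<^esub> (\<one>\<^bsub>BL H\<^esub> \<ominus>\<^bsub>BL H\<^esub> T) = \<one>\<^bsub>BL H\<^esub>"
 proof (rule bop_eqI)
  fix x assume x: "x \<in> carrier H"
  have "L x = x \<oplus> L (T x)"
  proof (rule norm_limit_unique[of _ _ "\<lambda>n. E (Suc n) x"])
   show "(\<lambda>n. hnorm H (E (Suc n) x \<ominus> L x)) \<longlonglongrightarrow> 0" using Lim[OF x] by (rule LIMSEQ_Suc)
   have "E (Suc n) x \<ominus> (x \<oplus> L (T x)) = E n (T x) \<ominus> L (T x)" for n
    by (rule vec_eqI) (use x Tc in \<open>simp_all add: ES\<close>)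
   then show "(\<lambda>n. hnorm H (E (Suc n) x \<ominus> (x \<oplus> L (T x)))) \<longlonglongrightarrow> 0" using Lim[of "T x"] x by simp
  qed (use x in simp_all)
  have "L x \<ominus> L (T x) = x"
   by (rule vec_eqI) (use x arg_cong[OF \<open>L x = x \<oplus> L (T x)\<close>, of "\<lambda>v. cinner H v _"] in auto)
  then show "(L \<otimes>\<^bsub>BL H\<^esub> (\<one>\<^bsub>BL H\<^esub> \<ominus>\<^bsub>BL H\<^esub> T)) x = \<one>\<^bsub>BL H\<^esub> x" using x Tc by simp
 qed (use L Tc in auto)
 then show ?thesis using LA by blast
qed

end

section \<open>Contractivity of star homomorphisms\<close>

locale hilbert_pair = H: hilbert_space H + K: hilbert_space K for H :: "'a hilb" and K :: "'b hilb" (structure)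
begin

text \<open>If Q = \<phi> T had norm p > ||T||, then t = T^* T / p^2 would have norm below 1 and 1 -
  t a left inverse E in A. Applying \<phi> shows that 1 - Q^* Q / p^2 is bounded below, which fails
  at vectors where Q nearly attains its norm.\<close>

lemma star_hom_contractive:
 assumes A: "unital_star_subalgebra H A" and cl: "closedin (op_norm_topology H) A"
  and hom: "unital_star_hom H A K B \<phi>" and B: "B \<subseteq> \<B> K" and T: "T \<in> A"
 shows "op_norm K (\<phi> T) \<le> op_norm H T"
proof (rule ccontr)
 assume "\<not> op_norm K (\<phi> T) \<le> op_norm H T"
 then have lt: "op_norm H T < op_norm K (\<phi> T)" by simp
 note AD = H.unital_star_subalgebraD[OF A]
 have Tc: "T \<in> \<B> H" using T AD(1) by blast
 have h: "\<phi> \<in> ring_hom (subalg H A) (subalg K B)"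
  "\<And>c S. S \<in> A \<Longrightarrow> \<phi> (c \<odot>\<^bsub>BL H\<^esub> S) = c \<odot>\<^bsub>BL K\<^esub> \<phi> S" "\<And>S. S \<in> A \<Longrightarrow> \<phi> (adj H S) = adj K (\<phi> S)"
  using hom unfolding unital_star_hom_def by blast+
 have pB: "\<phi> S \<in> \<B> K" if "S \<in> A" for S
  using ring_hom_closed[OF h(1), of S] that B by auto
 have pm: "\<phi> (S \<otimes>\<^bsub>BL H\<^esub> V) = \<phi> S \<otimes>\<^bsub>BL K\<^esub> \<phi> V" if "S \<in> A" "V \<in> A" for S V
  using ring_hom_mult[OF h(1), of S V] that by simp
 have pa: "\<phi> (S \<oplus>\<^bsub>BL H\<^esub> V) = \<phi> S \<oplus>\<^bsub>BL K\<^esub> \<phi> V" if "S \<in> A" "V \<in> A" for S V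
  using ring_hom_add[OF h(1), of S V] that by simp
 have p1: "\<phi> \<one>\<^bsub>BL H\<^esub> = \<one>\<^bsub>BL K\<^esub>" using ring_hom_one[OF h(1)] by simp
 define p where "p = op_norm K (\<phi> T)"
 have s0: "0 \<le> op_norm H T" using Tc by simp
 have p0: "0 < p" using lt s0 by (simp add: p_def)
 define c where "c = complex_of_real (1 / p\<^sup>2)"
 have cn: "cmod c = 1 / p\<^sup>2" using p0 by (simp add: c_def norm_divide norm_power)
 define t where "t = c \<odot>\<^bsub>BL H\<^esub> (adj H T \<otimes>\<^bsub>BL H\<^esub> T)"
 have tA: "t \<in> A" unfolding t_def by (intro AD T)
 have tc: "t \<in> \<B> H" using tA AD(1) by blast
 have "op_norm H t < 1"
 proof -
  have "op_norm H t \<le> cmod c * op_norm H (adj H T \<otimes>\<^bsub>BL H\<^esub> T)"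
   unfolding t_def by (rule H.op_norm_smult_le) (use Tc in simp)
  also have "\<dots> \<le> cmod c * (op_norm H T * op_norm H T)"
   using H.op_norm_mult_le[of "adj H T" T] Tc by (intro mult_left_mono) simp_all
  also have "\<dots> = (op_norm H T)\<^sup>2 / p\<^sup>2" by (simp add: cn power2_eq_square)
  also have "\<dots> < 1" using power_strict_mono[OF lt s0, of 2] p0 by (simp add: p_def)
  finally show ?thesis .
 qed
 from H.Neumann_left_inverse[OF A cl tA this] obtain E where
  E: "E \<in> A" "E \<otimes>\<^bsub>BL H\<^esub> (\<one>\<^bsub>BL H\<^esub> \<ominus>\<^bsub>BL H\<^esub> t) = \<one>\<^bsub>BL H\<^esub>" by blast
 have mA: "\<one>\<^bsub>BL H\<^esub> \<ominus>\<^bsub>BL H\<^esub> t \<in> A" by (intro AD tA)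
 define Q where "Q = \<phi> T"
 have Q: "Q \<in> \<B> K" using pB[OF T] by (simp add: Q_def)
 note [simp] = K.bop_rules[OF Q] K.bop_rules[OF K.adj_closed[OF Q]]
 have ptx: "\<phi> t = c \<odot>\<^bsub>BL K\<^esub> (adj K Q \<otimes>\<^bsub>BL K\<^esub> Q)"
  unfolding t_def Q_def using T AD by (simp add: h(2,3) pm)
 have "\<phi> (\<one>\<^bsub>BL H\<^esub> \<ominus>\<^bsub>BL H\<^esub> t) = \<one>\<^bsub>BL K\<^esub> \<oplus>\<^bsub>BL K\<^esub> (- 1) \<odot>\<^bsub>BL K\<^esub> \<phi> t"
  using tA tc AD(2,5) by (simp add: H.BL_minus pa p1 h(2))
 then have pE: "\<phi> E \<otimes>\<^bsub>BL K\<^esub> (\<one>\<^bsub>BL K\<^esub> \<oplus>\<^bsub>BL K\<^esub> (- 1) \<odot>\<^bsub>BL K\<^esub> \<phi> t) = \<one>\<^bsub>BL K\<^esub>"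
  using arg_cong[OF E(2), of \<phi>] pm[OF E(1) mA] p1 by simp
 define e where "e = op_norm K (\<phi> E)"
 have e0: "0 \<le> e" using pB[OF E(1)] by (simp add: e_def)
 have low: "hnorm K x \<le> e * hnorm K (x \<ominus> c \<odot> adj K Q (Q x))" if x: "x \<in> carrier K" for x
 proof -
  have "\<phi> E (x \<ominus> c \<odot> adj K Q (Q x)) = x"
   using fun_cong[OF pE, of x] x Q by (simp add: ptx K.minus_eq_add_smult)
  then show ?thesis
   using K.op_norm_bound[OF pB[OF E(1)], of "x \<ominus> c \<odot> adj K Q (Q x)"] x by (simp add: e_def)
 qed
 \<comment> \<open>If Q attains its norm at x up to the factor sqrt (1 - d), then x - Q^* Q x / p^2
   has squared norm at most 2 d ||x||^2. With 2 d e^2 < 1 this contradicts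
   \<open>low\<close>.\<close>
 define d where "d = 1 / (2 * (e\<^sup>2 + 1))"
 have d: "0 < d" "d < 1" "e\<^sup>2 * (2 * d) < 1"
  by (auto simp: d_def divide_simps add_pos_nonneg) (smt (verit) zero_le_power2)+
 have "p * sqrt (1 - d) < p" using p0 d by (simp add: real_sqrt_lt_1_iff)
 then obtain x where x: "x \<in> carrier K" "p * sqrt (1 - d) * hnorm K x < hnorm K (Q x)"
  using K.op_norm_less_ex[of "p * sqrt (1 - d)" Q] p0 d unfolding p_def Q_def by auto
 have nx: "hnorm K x > 0"
 proof (rule ccontr)
  assume "\<not> hnorm K x > 0"
  then have "hnorm K x = 0" using K.hnorm_nonneg[OF x(1)] by linarith
  then have "x = \<zero>" using x(1) by simp
  then show False using x(2) by simp
 qed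
 have "(p * sqrt (1 - d) * hnorm K x)\<^sup>2 \<le> (hnorm K (Q x))\<^sup>2"
  using x p0 d by (intro power_mono) auto
 then have low2: "p\<^sup>2 * (1 - d) * (hnorm K x)\<^sup>2 \<le> (hnorm K (Q x))\<^sup>2" using d by (simp add: power_mult_distrib)
 define n where "n = (hnorm K x)\<^sup>2"
 have n0: "n > 0" using nx by (simp add: n_def)
 have r1: "Re (cinner K x (c \<odot> adj K Q (Q x))) = (hnorm K (Q x))\<^sup>2 / p\<^sup>2"
  using x(1) Q K.cinner_self[of "Q x"] by (simp add: c_def)
 have r2: "hnorm K (c \<odot> adj K Q (Q x)) \<le> hnorm K x"
 proof -
  have "hnorm K (adj K Q (Q x)) \<le> p * hnorm K (Q x)"
   using K.op_norm_bound[OF K.adj_closed[OF Q] K.bop_closed[OF Q x(1)]] K.op_norm_adj[OF Q]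
   by (simp add: p_def Q_def[symmetric])
  also have "\<dots> \<le> p * (p * hnorm K x)"
   using K.op_norm_bound[OF Q x(1)] p0 by (intro mult_left_mono) (auto simp: p_def Q_def)
  finally have "hnorm K (adj K Q (Q x)) / p\<^sup>2 \<le> hnorm K x" using p0 by (simp add: pos_divide_le_eq power2_eq_square mult_ac)
  then show ?thesis using x(1) by (simp add: cn)
 qed
 have "(hnorm K (x \<ominus> c \<odot> adj K Q (Q x)))\<^sup>2 = n - 2 * ((hnorm K (Q x))\<^sup>2 / p\<^sup>2) + (hnorm K (c \<odot> adj K Q (Q x)))\<^sup>2"
 proof -
  have "(hnorm K (x \<ominus> c \<odot> adj K Q (Q x)))\<^sup>2 = (hnorm K x)\<^sup>2
   - 2 * Re (cinner K x (c \<odot> adj K Q (Q x))) + (hnorm K (c \<odot> adj K Q (Q x)))\<^sup>2"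
   by (rule K.hnorm_minus_sq) (use x(1) in simp_all)
  then show ?thesis unfolding r1 n_def .
 qed
 also have "\<dots> \<le> n - 2 * ((1 - d) * n) + n"
 proof -
  have "(1 - d) * n \<le> (hnorm K (Q x))\<^sup>2 / p\<^sup>2" using low2 p0 by (simp add: pos_le_divide_eq n_def mult_ac)
  moreover have "(hnorm K (c \<odot> adj K Q (Q x)))\<^sup>2 \<le> n" unfolding n_def using r2 x(1) by (intro power_mono) simp_all
  ultimately show ?thesis by linarith
 qed
 also have "\<dots> = 2 * d * n" by (simp add: algebra_simps)
 finally have up: "(hnorm K (x \<ominus> c \<odot> adj K Q (Q x)))\<^sup>2 \<le> 2 * d * n" .
 have "n \<le> (e * hnorm K (x \<ominus> c \<odot> adj K Q (Q x)))\<^sup>2"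
  unfolding n_def using low[OF x(1)] nx by (intro power_mono) auto
 also have "\<dots> \<le> e\<^sup>2 * (2 * d * n)" using up by (simp add: power_mult_distrib mult_left_mono)
 also have "\<dots> = (e\<^sup>2 * (2 * d)) * n" by simp
 also have "\<dots> < 1 * n" using d(3) n0 by (intro mult_strict_right_mono) auto
 finally show False by simp
qed

end

section \<open>The embedding, its adjoint, and compression\<close>

locale isometric_pair = hilbert_pair H K for H :: "'a hilb" and K :: "'b hilb" (structure) +
 fixes J :: "'a \<Rightarrow> 'b"
 assumes J: "isometric_embedding H K J"
begin

lemma J_closed [simp]: "x \<in> carrier H \<Longrightarrow> J x \<in> carrier K"
 using J by (auto simp: isometric_embedding_def)

lemma J_add [simp]: "x \<in> carrier H \<Longrightarrow> y \<in> carrier H \<Longrightarrow> J (x \<oplus>\<^bsub>H\<^esub> y) = J x \<oplus> J y"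
 using J by (simp add: isometric_embedding_def)

lemma J_smult [simp]: "x \<in> carrier H \<Longrightarrow> J (c \<odot>\<^bsub>H\<^esub> x) = c \<odot> J x"
 using J by (simp add: isometric_embedding_def)

lemma cinner_J [simp]: "x \<in> carrier H \<Longrightarrow> y \<in> carrier H \<Longrightarrow> cinner K (J x) (J y) = cinner H x y"
 using J by (simp add: isometric_embedding_def)

lemma J_minus [simp]: "x \<in> carrier H \<Longrightarrow> y \<in> carrier H \<Longrightarrow> J (x \<ominus>\<^bsub>H\<^esub> y) = J x \<ominus> J y"
 by (simp add: H.minus_eq_add_smult K.minus_eq_add_smult)

lemma hnorm_J [simp]: "x \<in> carrier H \<Longrightarrow> hnorm K (J x) = hnorm H x"
 by (simp add: hnorm_def)

lemma J_zero [simp]: "J \<zero>\<^bsub>H\<^esub> = \<zero>"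
 using hnorm_J[of "\<zero>\<^bsub>H\<^esub>"] K.hnorm_eq_0[of "J \<zero>\<^bsub>H\<^esub>"] by simp

lemma J_inj: "x \<in> carrier H \<Longrightarrow> y \<in> carrier H \<Longrightarrow> J x = J y \<Longrightarrow> x = y"
proof -
 assume x: "x \<in> carrier H" and y: "y \<in> carrier H" and e: "J x = J y"
 have 0: "J x \<ominus> J y = \<zero>" by (subst K.minus_eq_zero_iff) (use x y e in simp_all)
 have "hnorm H (x \<ominus>\<^bsub>H\<^esub> y) = hnorm K (J x \<ominus> J y)" using hnorm_J[of "x \<ominus>\<^bsub>H\<^esub> y"] x y by simp
 then have "hnorm H (x \<ominus>\<^bsub>H\<^esub> y) = 0" by (simp only: 0 K.hnorm_zero)
 then show ?thesis using x y by simp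
qed

text \<open>The adjoint J^* of the embedding; \<open>adj\<close> is defined only for operators from
  a space to itself.\<close>

definition Jad :: "'b \<Rightarrow> 'a" where
 "Jad k = (SOME x. x \<in> carrier H \<and> (\<forall>h\<in>carrier H. cinner H x h = cinner K k (J h)))"

lemma Jad_ex:
 assumes k: "k \<in> carrier K"
 shows "\<exists>x. x \<in> carrier H \<and> (\<forall>h\<in>carrier H. cinner H x h = cinner K k (J h))"
proof -
 have "\<exists>x\<in>carrier H. \<forall>h\<in>carrier H. cinner K (J h) k = cinner H h x"
 proof (rule H.Riesz[where C = "hnorm K k"])
  fix h assume h: "h \<in> carrier H"
  show "cmod (cinner K (J h) k) \<le> hnorm K k * hnorm H h"
   using K.Cauchy_Schwarz[of "J h" k] k h by (simp add: mult.commute)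
 qed (use k in simp_all)
 then obtain x where x: "x \<in> carrier H" "\<And>h. h \<in> carrier H \<Longrightarrow> cinner K (J h) k = cinner H h x" by blast
 have "cinner H x h = cinner K k (J h)" if h: "h \<in> carrier H" for h
  using x(2)[OF h] H.cinner_commute[OF x(1) h] K.cinner_commute[OF k J_closed[OF h]] by simp
 then show ?thesis using x(1) by blast
qed

lemma Jad_closed [simp]: "k \<in> carrier K \<Longrightarrow> Jad k \<in> carrier H"
 using someI_ex[OF Jad_ex] unfolding Jad_def by blast

lemma cinner_Jad_left [simp]: "k \<in> carrier K \<Longrightarrow> h \<in> carrier H \<Longrightarrow> cinner H (Jad k) h = cinner K k (J h)"
 using someI_ex[OF Jad_ex] unfolding Jad_def by blast

lemma cinner_Jad_right [simp]:
 "k \<in> carrier K \<Longrightarrow> h \<in> carrier H \<Longrightarrow> cinner H h (Jad k) = cinner K (J h) k"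
 using H.cinner_commute[of h "Jad k"] K.cinner_commute[of "J h" k] by simp

lemma Jad_add [simp]: "x \<in> carrier K \<Longrightarrow> y \<in> carrier K \<Longrightarrow> Jad (x \<oplus> y) = Jad x \<oplus>\<^bsub>H\<^esub> Jad y"
 by (rule H.vec_eqI) simp_all

lemma Jad_minus [simp]: "x \<in> carrier K \<Longrightarrow> y \<in> carrier K \<Longrightarrow> Jad (x \<ominus> y) = Jad x \<ominus>\<^bsub>H\<^esub> Jad y"
 by (rule H.vec_eqI) simp_all

lemma Jad_smult [simp]: "x \<in> carrier K \<Longrightarrow> Jad (c \<odot> x) = c \<odot>\<^bsub>H\<^esub> Jad x"
 by (rule H.vec_eqI) simp_all

lemma Jad_J [simp]: "h \<in> carrier H \<Longrightarrow> Jad (J h) = h"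
 by (rule H.vec_eqI) simp_all

lemma hnorm_Jad_le:
 assumes k: "k \<in> carrier K"
 shows "hnorm H (Jad k) \<le> hnorm K k"
proof (cases "hnorm H (Jad k) = 0")
 case False
 then have p: "hnorm H (Jad k) > 0" using H.hnorm_nonneg[OF Jad_closed[OF k]] by linarith
 have "(hnorm H (Jad k))\<^sup>2 = Re (cinner K k (J (Jad k)))"
  using k cinner_Jad_left[OF k Jad_closed[OF k]] by (simp add: H.hnorm_sq del: cinner_Jad_right)
 also have "\<dots> \<le> hnorm K k * hnorm H (Jad k)"
  using K.Re_cinner_le[OF k J_closed[OF Jad_closed[OF k]]] k by simp
 finally show ?thesis using p by (simp add: power2_eq_square)
qed (use k in simp)

text \<open>J J^* projects orthogonally onto the image of H, so Pythagoras applies to ?a and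
  ?b.\<close>

lemma hnorm_Jad_best:
 assumes k: "k \<in> carrier K" and h: "h \<in> carrier H"
 shows "hnorm K (J (Jad k) \<ominus> k) \<le> hnorm K (J h \<ominus> k)"
proof -
 let ?a = "J h \<ominus> J (Jad k)" and ?b = "J (Jad k) \<ominus> k"
 have orth: "cinner K ?a ?b = 0"
  using k h cinner_Jad_right[of k h] cinner_Jad_right[of k "Jad k"] by (simp del: cinner_Jad_right cinner_Jad_left)
 have "?a \<oplus> ?b = J h \<ominus> k" by (rule K.minus_add_minus) (use k h in simp_all)
 then have "(hnorm K (J h \<ominus> k))\<^sup>2 = (hnorm K ?a)\<^sup>2 + (hnorm K ?b)\<^sup>2"
  using K.hnorm_add_sq[of ?a ?b] k h orth by simp
 then have "(hnorm K ?b)\<^sup>2 \<le> (hnorm K (J h \<ominus> k))\<^sup>2" by simp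
 then show ?thesis by (rule power2_le_imp_le) (use k h in simp)
qed

lemma orth_proj_J:
 assumes k: "k \<in> carrier K"
 shows "orth_proj K (J ` carrier H) k = J (Jad k)"
 unfolding orth_proj_def
proof (rule the_equality)
 show "J (Jad k) \<in> J ` carrier H \<and> (\<forall>z\<in>J ` carrier H. cinner K (k \<ominus> J (Jad k)) z = 0)"
  using k by auto
next
 fix y assume y: "y \<in> J ` carrier H \<and> (\<forall>z\<in>J ` carrier H. cinner K (k \<ominus> y) z = 0)"
 then obtain h where h: "h \<in> carrier H" "y = J h" by blast
 have "h = Jad k"
 proof (rule H.vec_eqI)
  fix z assume z: "z \<in> carrier H"
  have "cinner K (k \<ominus> J h) (J z) = 0" using y z unfolding h(2) by blast
  then show "cinner H h z = cinner H (Jad k) z" using h k z by simp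
 qed (use h k in simp_all)
 then show "y = J (Jad k)" using h by simp
qed

definition compress :: "('b \<Rightarrow> 'b) \<Rightarrow> 'a \<Rightarrow> 'a" where
 "compress Y = (\<lambda>h\<in>carrier H. Jad (Y (J h)))"

lemma compress_apply [simp]: "h \<in> carrier H \<Longrightarrow> compress Y h = Jad (Y (J h))"
 by (simp add: compress_def)

lemma hnorm_compress_le:
 assumes Y: "Y \<in> \<B> K" and h: "h \<in> carrier H"
 shows "hnorm H (compress Y h) \<le> op_norm K Y * hnorm H h"
 using hnorm_Jad_le[of "Y (J h)"] K.op_norm_bound[OF Y, of "J h"] h K.bop_closed[OF Y, of "J h"] by simp

lemma compress_closed [simp]:
 assumes Y: "Y \<in> \<B> K"
 shows "compress Y \<in> \<B> H"
proof -
 note [simp] = K.bop_rules[OF Y]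
 show ?thesis
  unfolding compress_def
  by (rule H.bop_restrictI[where b = "op_norm K Y"]) (use hnorm_compress_le[OF Y] in auto)
qed

lemma op_norm_compress_le: "Y \<in> \<B> K \<Longrightarrow> op_norm H (compress Y) \<le> op_norm K Y"
 by (rule H.op_norm_le) (use hnorm_compress_le in auto)

lemma compress_add:
 "S \<in> \<B> K \<Longrightarrow> T \<in> \<B> K \<Longrightarrow> compress (S \<oplus>\<^bsub>BL K\<^esub> T) = compress S \<oplus>\<^bsub>BL H\<^esub> compress T"
 by (rule H.bop_eqI) (simp_all add: K.bop_closed)

lemma compress_minus:
 "S \<in> \<B> K \<Longrightarrow> T \<in> \<B> K \<Longrightarrow> compress (S \<ominus>\<^bsub>BL K\<^esub> T) = compress S \<ominus>\<^bsub>BL H\<^esub> compress T"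
 by (rule H.bop_eqI) (simp_all add: K.bop_closed)

lemma compress_smult:
 "T \<in> \<B> K \<Longrightarrow> compress (c \<odot>\<^bsub>BL K\<^esub> T) = c \<odot>\<^bsub>BL H\<^esub> compress T"
 by (rule H.bop_eqI) (simp_all add: K.bop_closed)

lemma compress_one: "compress \<one>\<^bsub>BL K\<^esub> = \<one>\<^bsub>BL H\<^esub>"
 by (rule H.bop_eqI) simp_all

lemma compress_adj:
 assumes T: "T \<in> \<B> K"
 shows "adj H (compress T) = compress (adj K T)"
 by (rule H.adjI) (use T in \<open>simp_all add: K.bop_closed[OF T] K.bop_closed[OF K.adj_closed[OF T]]\<close>)

end

section \<open>Powers of commuting operators\<close>

text \<open>Multi-exponents are multisets. The operators are extended to total functions, which act as the
 identity for indices outside \<open>\<Lambda>\<close>, so that \<open>fold_mset\<close> applies.\<close>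

definition total_op :: "'a hilb \<Rightarrow> 'i set \<Rightarrow> ('i \<Rightarrow> 'a \<Rightarrow> 'a) \<Rightarrow> 'i \<Rightarrow> 'a \<Rightarrow> 'a" where
 "total_op H \<Lambda> P a x = (if a \<in> \<Lambda> \<and> x \<in> carrier H then P a x else x)"

definition mpow :: "'a hilb \<Rightarrow> 'i set \<Rightarrow> ('i \<Rightarrow> 'a \<Rightarrow> 'a) \<Rightarrow> 'i multiset \<Rightarrow> 'a \<Rightarrow> 'a" where
 "mpow H \<Lambda> P m x = fold_mset (total_op H \<Lambda> P) x m"

locale commuting_family = hilbert_space H for H :: "'a hilb" (structure) +
 fixes \<Lambda> :: "'i set" and P :: "'i \<Rightarrow> 'a \<Rightarrow> 'a"
 assumes P_closed: "a \<in> \<Lambda> \<Longrightarrow> P a \<in> \<B> H"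
  and P_commute: "a \<in> \<Lambda> \<Longrightarrow> b \<in> \<Lambda> \<Longrightarrow> P a \<otimes>\<^bsub>BL H\<^esub> P b = P b \<otimes>\<^bsub>BL H\<^esub> P a"
begin

lemma total_op_closed [simp]: "x \<in> carrier H \<Longrightarrow> total_op H \<Lambda> P a x \<in> carrier H"
 by (simp add: total_op_def bop_closed[OF P_closed])

lemma total_op_commute: "total_op H \<Lambda> P a (total_op H \<Lambda> P b x) = total_op H \<Lambda> P b (total_op H \<Lambda> P a x)"
proof (cases "a \<in> \<Lambda> \<and> b \<in> \<Lambda> \<and> x \<in> carrier H")
 case True
 then show ?thesis
  using commuteD[OF P_commute[of a b], of x] by (simp add: total_op_def bop_closed[OF P_closed])
qed (auto simp: total_op_def bop_closed[OF P_closed])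

sublocale tf: comp_fun_commute "total_op H \<Lambda> P"
 by standard (simp add: fun_eq_iff total_op_commute)

lemma mpow_empty [simp]: "mpow H \<Lambda> P {#} x = x"
 by (simp add: mpow_def)

lemma mpow_add_mset: "mpow H \<Lambda> P (add_mset a m) x = total_op H \<Lambda> P a (mpow H \<Lambda> P m x)"
 by (simp add: mpow_def)

lemma mpow_add_mset': "mpow H \<Lambda> P (add_mset a m) x = mpow H \<Lambda> P m (total_op H \<Lambda> P a x)"
 by (simp add: mpow_def tf.fold_mset_fun_left_comm)

lemma mpow_union: "mpow H \<Lambda> P (m + n) x = mpow H \<Lambda> P n (mpow H \<Lambda> P m x)"
 by (simp add: mpow_def tf.fold_mset_union)

lemma mpow_closed [simp]: "x \<in> carrier H \<Longrightarrow> mpow H \<Lambda> P m x \<in> carrier H"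
 by (induction m) (simp_all add: mpow_add_mset)

lemma mpow_add [simp]:
 "x \<in> carrier H \<Longrightarrow> y \<in> carrier H \<Longrightarrow> mpow H \<Lambda> P m (x \<oplus> y) = mpow H \<Lambda> P m x \<oplus> mpow H \<Lambda> P m y"
 by (induction m) (simp_all add: mpow_add_mset total_op_def bop_add[OF P_closed])

lemma mpow_smult [simp]: "x \<in> carrier H \<Longrightarrow> mpow H \<Lambda> P m (c \<odot> x) = c \<odot> mpow H \<Lambda> P m x"
 by (induction m) (simp_all add: mpow_add_mset total_op_def bop_smult[OF P_closed])

lemma mpow_minus [simp]:
 "x \<in> carrier H \<Longrightarrow> y \<in> carrier H \<Longrightarrow> mpow H \<Lambda> P m (x \<ominus> y) = mpow H \<Lambda> P m x \<ominus> mpow H \<Lambda> P m y"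
 by (simp add: minus_eq_add_smult)

lemma mpow_zero [simp]: "mpow H \<Lambda> P m \<zero> = \<zero>"
 using mpow_smult[of \<zero> m 0] by simp

lemma mpow_finsum:
 "f \<in> A \<rightarrow> carrier H \<Longrightarrow> mpow H \<Lambda> P m (finsum H f A) = finsum H (\<lambda>a. mpow H \<Lambda> P m (f a)) A"
proof (induction A rule: infinite_finite_induct)
 case (insert a A)
 have "f a \<in> carrier H" "f \<in> A \<rightarrow> carrier H" using insert.prems by auto
 moreover have "(\<lambda>a. mpow H \<Lambda> P m (f a)) \<in> A \<rightarrow> carrier H"
  by (rule funcsetI) (simp add: funcset_mem[OF calculation(2)])
 ultimately show ?case using insert by (simp add: finsum_insert)
qed simp_all

lemma mpow_filter: "mpow H \<Lambda> P m x = mpow H \<Lambda> P (filter_mset (\<lambda>a. a \<in> \<Lambda>) m) x"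
 by (induction m) (simp_all add: mpow_add_mset total_op_def)

lemma mpow_hnorm:
 assumes "\<And>a x. a \<in> \<Lambda> \<Longrightarrow> x \<in> carrier H \<Longrightarrow> hnorm H (P a x) = hnorm H x" "x \<in> carrier H"
 shows "hnorm H (mpow H \<Lambda> P m x) = hnorm H x"
 by (induction m) (simp_all add: mpow_add_mset total_op_def assms)

end

lemma mpow_intertwine:
 assumes "commuting_family H \<Lambda> P" "commuting_family K \<Lambda> Q"
  and T: "\<And>x. x \<in> carrier H \<Longrightarrow> T x \<in> carrier K"
   "\<And>a x. a \<in> \<Lambda> \<Longrightarrow> x \<in> carrier H \<Longrightarrow> T (P a x) = Q a (T x)"
  and x: "x \<in> carrier H"
 shows "T (mpow H \<Lambda> P m x) = mpow K \<Lambda> Q m (T x)"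
proof -
 interpret A: commuting_family H \<Lambda> P by fact
 interpret B: commuting_family K \<Lambda> Q by fact
 show ?thesis
  by (induction m) (simp_all add: A.mpow_add_mset B.mpow_add_mset total_op_def T x)
qed

text \<open>The filter of the multi-exponents directed by inclusion. With uncountably many indices
  no sequence of exponents is cofinal.\<close>

definition mset_top :: "'i multiset filter" where
 "mset_top = (INF m. principal {n. m \<subseteq># n})"

lemma eventually_mset_top: "eventually Q mset_top \<longleftrightarrow> (\<exists>m. \<forall>n. m \<subseteq># n \<longrightarrow> Q n)"
proof -
 have "eventually Q (INF m\<in>UNIV. principal {n. m \<subseteq># n}) \<longleftrightarrow> (\<exists>m\<in>UNIV. eventually Q (principal {n. m \<subseteq># n}))"
 proof (rule eventually_INF_base)
  fix a b :: "'a multiset"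
  have "principal {n. a + b \<subseteq># n} \<le> inf (principal {n. a \<subseteq># n}) (principal {n. b \<subseteq># n})"
   by (auto intro: subset_mset.order_trans[OF mset_subset_eq_add_left] subset_mset.order_trans[OF mset_subset_eq_add_right])
  then show "\<exists>x\<in>UNIV. principal {n. x \<subseteq># n} \<le> inf (principal {n. a \<subseteq># n}) (principal {n. b \<subseteq># n})" by blast
 qed simp
 then show ?thesis by (simp add: mset_top_def eventually_principal)
qed

lemma mset_top_neq_bot [simp]: "mset_top \<noteq> bot"
proof
 assume "mset_top = (bot :: 'a multiset filter)"
 then have "eventually (\<lambda>_. False) (mset_top :: 'a multiset filter)" by simp
 then show False unfolding eventually_mset_top by (meson subset_mset.order_refl)
qed

text \<open>Adding a fixed exponent does not change limits; this is why forms obtained as limits are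
  compatible with the U_a.\<close>

lemma filterlim_mset_top_add: "filterlim (\<lambda>n. m + n) mset_top mset_top"
 unfolding filterlim_iff eventually_mset_top
 by (meson mset_subset_eq_add_right subset_mset.order_trans)

lemma filterlim_mset_top_add_mset: "filterlim (\<lambda>n. add_mset a n) mset_top mset_top"
 using filterlim_mset_top_add[of "{#a#}"] by simp

section \<open>The minimal extension\<close>

text \<open>The spectral definitions enter only through the identities that
  \<open>Gamma_isometryD\<close> and \<open>Gamma_unitaryD\<close> extract from them.\<close>

locale gamma_extension = isometric_pair H K J
 for H :: "'a hilb" and K :: "'b hilb" (structure) and J :: "'a \<Rightarrow> 'b" +
 fixes \<Lambda> :: "'i set" and S P :: "'i \<Rightarrow> 'a \<Rightarrow> 'a" and R U :: "'i \<Rightarrow> 'b \<Rightarrow> 'b"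
 assumes S: "a \<in> \<Lambda> \<Longrightarrow> S a \<in> \<B> H" and P: "a \<in> \<Lambda> \<Longrightarrow> P a \<in> \<B> H"
  and P_iso: "a \<in> \<Lambda> \<Longrightarrow> adj H (P a) \<otimes>\<^bsub>BL H\<^esub> P a = \<one>\<^bsub>BL H\<^esub>"
  and S_P: "a \<in> \<Lambda> \<Longrightarrow> S a = adj H (S a) \<otimes>\<^bsub>BL H\<^esub> P a"
  and comm_H: "commuting_ops H (family_ops \<Lambda> S P)"
  and R: "a \<in> \<Lambda> \<Longrightarrow> R a \<in> \<B> K" and U: "a \<in> \<Lambda> \<Longrightarrow> U a \<in> \<B> K"
  and U_iso: "a \<in> \<Lambda> \<Longrightarrow> adj K (U a) \<otimes>\<^bsub>BL K\<^esub> U a = \<one>\<^bsub>BL K\<^esub>"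
  and U_coiso: "a \<in> \<Lambda> \<Longrightarrow> U a \<otimes>\<^bsub>BL K\<^esub> adj K (U a) = \<one>\<^bsub>BL K\<^esub>"
  and R_U: "a \<in> \<Lambda> \<Longrightarrow> R a = adj K (R a) \<otimes>\<^bsub>BL K\<^esub> U a"
  and comm_K: "commuting_ops K (family_ops \<Lambda> R U)"
  and RJ: "a \<in> \<Lambda> \<Longrightarrow> h \<in> carrier H \<Longrightarrow> R a (J h) = J (S a h)"
  and UJ: "a \<in> \<Lambda> \<Longrightarrow> h \<in> carrier H \<Longrightarrow> U a (J h) = J (P a h)"
  and minimal: "closed_subspace K M \<Longrightarrow> J ` carrier H \<subseteq> M \<Longrightarrow>
   (\<And>T. T \<in> family_ops \<Lambda> R U \<Longrightarrow> reducing K T M) \<Longrightarrow> M = carrier K"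
begin

lemma Sa: "a \<in> \<Lambda> \<Longrightarrow> adj H (S a) \<in> \<B> H" and Pa: "a \<in> \<Lambda> \<Longrightarrow> adj H (P a) \<in> \<B> H"
 and Ra: "a \<in> \<Lambda> \<Longrightarrow> adj K (R a) \<in> \<B> K" and Ua: "a \<in> \<Lambda> \<Longrightarrow> adj K (U a) \<in> \<B> K"
 by (simp_all add: S P R U)

lemmas op_simps = H.bop_rules[OF S] H.bop_rules[OF P] H.bop_rules[OF Sa] H.bop_rules[OF Pa]
 K.bop_rules[OF R] K.bop_rules[OF U] K.bop_rules[OF Ra] K.bop_rules[OF Ua]

declare op_simps [simp]

lemma family_H: "family_ops \<Lambda> S P \<subseteq> \<B> H" and family_K: "family_ops \<Lambda> R U \<subseteq> \<B> K"
 by (auto simp: family_ops_def S P R U)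

lemma commute_H:
 assumes "a \<in> \<Lambda>" "b \<in> \<Lambda>"
 shows "S a \<otimes>\<^bsub>BL H\<^esub> S b = S b \<otimes>\<^bsub>BL H\<^esub> S a" "S a \<otimes>\<^bsub>BL H\<^esub> P b = P b \<otimes>\<^bsub>BL H\<^esub> S a"
  "P a \<otimes>\<^bsub>BL H\<^esub> P b = P b \<otimes>\<^bsub>BL H\<^esub> P a"
 using comm_H assms unfolding commuting_ops_def family_ops_def by blast+

lemma commute_K:
 assumes "a \<in> \<Lambda>" "b \<in> \<Lambda>"
 shows "R a \<otimes>\<^bsub>BL K\<^esub> R b = R b \<otimes>\<^bsub>BL K\<^esub> R a" "R a \<otimes>\<^bsub>BL K\<^esub> U b = U b \<otimes>\<^bsub>BL K\<^esub> R a"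
  "U a \<otimes>\<^bsub>BL K\<^esub> U b = U b \<otimes>\<^bsub>BL K\<^esub> U a"
 using comm_K assms unfolding commuting_ops_def family_ops_def by blast+

sublocale HP: commuting_family H \<Lambda> P
 by unfold_locales (simp_all add: P commute_H)

sublocale KU: commuting_family K \<Lambda> U
 by unfold_locales (simp_all add: U commute_K)

abbreviation pP :: "'i multiset \<Rightarrow> 'a \<Rightarrow> 'a" where "pP \<equiv> mpow H \<Lambda> P"
abbreviation pU :: "'i multiset \<Rightarrow> 'b \<Rightarrow> 'b" where "pU \<equiv> mpow K \<Lambda> U"

lemma hnorm_U [simp]: "a \<in> \<Lambda> \<Longrightarrow> k \<in> carrier K \<Longrightarrow> hnorm K (U a k) = hnorm K k"
 by (rule K.unitary_hnorm[OF U U_iso])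

lemma hnorm_P [simp]: "a \<in> \<Lambda> \<Longrightarrow> h \<in> carrier H \<Longrightarrow> hnorm H (P a h) = hnorm H h"
 by (rule H.unitary_hnorm[OF P P_iso])

lemma hnorm_pU [simp]: "k \<in> carrier K \<Longrightarrow> hnorm K (pU m k) = hnorm K k"
 by (rule KU.mpow_hnorm) simp_all

lemma hnorm_pP [simp]: "h \<in> carrier H \<Longrightarrow> hnorm H (pP m h) = hnorm H h"
 by (rule HP.mpow_hnorm) simp_all

lemma adj_U_U [simp]: "a \<in> \<Lambda> \<Longrightarrow> k \<in> carrier K \<Longrightarrow> adj K (U a) (U a k) = k"
 using fun_cong[OF U_iso, of a k] by simp

lemma U_adj_U [simp]: "a \<in> \<Lambda> \<Longrightarrow> k \<in> carrier K \<Longrightarrow> U a (adj K (U a) k) = k"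
 using fun_cong[OF U_coiso, of a k] by simp

lemma adj_P_P [simp]: "a \<in> \<Lambda> \<Longrightarrow> h \<in> carrier H \<Longrightarrow> adj H (P a) (P a h) = h"
 using fun_cong[OF P_iso, of a h] by simp

lemma adj_S_P: "a \<in> \<Lambda> \<Longrightarrow> h \<in> carrier H \<Longrightarrow> adj H (S a) (P a h) = S a h"
 using fun_cong[OF S_P, of a h] by simp

text \<open>Reduces invariance and commutation for R^* to the same facts for R and U^*.\<close>

lemma adj_R_op: "a \<in> \<Lambda> \<Longrightarrow> adj K (R a) = adj K (U a) \<otimes>\<^bsub>BL K\<^esub> R a"
 using arg_cong[OF R_U, of a "adj K"] K.adj_mult[OF Ra U, of a a] R by simp

lemma adj_R: "a \<in> \<Lambda> \<Longrightarrow> k \<in> carrier K \<Longrightarrow> adj K (R a) k = adj K (U a) (R a k)"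
 using fun_cong[OF adj_R_op, of a k] by simp

lemma pU_J: "h \<in> carrier H \<Longrightarrow> pU m (J h) = J (pP m h)"
 by (rule mpow_intertwine[OF HP.commuting_family_axioms KU.commuting_family_axioms, symmetric])
   (simp_all add: UJ)

lemma pU_commute:
 assumes T: "T \<in> \<B> K" and c: "\<And>a. a \<in> \<Lambda> \<Longrightarrow> T \<otimes>\<^bsub>BL K\<^esub> U a = U a \<otimes>\<^bsub>BL K\<^esub> T" and k: "k \<in> carrier K"
 shows "T (pU m k) = pU m (T k)"
 by (rule mpow_intertwine[OF KU.commuting_family_axioms KU.commuting_family_axioms])
   (simp_all add: k K.bop_closed[OF T] K.commuteD[OF c])

lemma pP_commute:
 assumes T: "T \<in> \<B> H" and c: "\<And>a. a \<in> \<Lambda> \<Longrightarrow> T \<otimes>\<^bsub>BL H\<^esub> P a = P a \<otimes>\<^bsub>BL H\<^esub> T" and h: "h \<in> carrier H"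
 shows "T (pP m h) = pP m (T h)"
 by (rule mpow_intertwine[OF HP.commuting_family_axioms HP.commuting_family_axioms])
   (simp_all add: h H.bop_closed[OF T] H.commuteD[OF c])

lemma pU_adj_U: "a \<in> \<Lambda> \<Longrightarrow> k \<in> carrier K \<Longrightarrow> pU (add_mset a m) (adj K (U a) k) = pU m k"
 by (simp add: KU.mpow_add_mset' total_op_def)

text \<open>U^n is isometric and maps J h to J (P^n h), so an approximation found at the exponent m
  persists at all larger exponents.\<close>

lemma approx_J_mono:
 assumes "k \<in> carrier K" "h \<in> carrier H" "hnorm K (pU m k \<ominus> J h) \<le> e"
 shows "hnorm K (pU (m + n) k \<ominus> J (pP n h)) \<le> e"
proof -
 have "pU (m + n) k \<ominus> J (pP n h) = pU n (pU m k \<ominus> J h)"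
  using assms by (simp add: KU.mpow_union pU_J)
 moreover have "hnorm K (pU n (pU m k \<ominus> J h)) = hnorm K (pU m k \<ominus> J h)"
  by (rule hnorm_pU) (use assms in simp)
 ultimately show ?thesis using assms(3) by (simp only:)
qed

text \<open>The vectors that powers U^m bring arbitrarily close to the image of H form a closed
  subspace M that contains this image and reduces every R_a and U_a. Minimality of the extension
  gives M = K.\<close>

lemma approx_J:
 assumes "k \<in> carrier K" "e > 0"
 shows "\<exists>m. \<exists>h\<in>carrier H. hnorm K (pU m k \<ominus> J h) \<le> e"
proof -
 define M where "M = {k \<in> carrier K. \<forall>e>0. \<exists>m. \<exists>h\<in>carrier H. hnorm K (pU m k \<ominus> J h) \<le> e}"
 have MI: "k \<in> M" if "k \<in> carrier K" "\<And>e. e > 0 \<Longrightarrow> \<exists>m. \<exists>h\<in>carrier H. hnorm K (pU m k \<ominus> J h) \<le> e" for k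
  using that by (simp add: M_def)
 have MD: "\<exists>m. \<exists>h\<in>carrier H. hnorm K (pU m k \<ominus> J h) \<le> e" if "k \<in> M" "e > 0" for k e
  using that by (simp add: M_def)
 have Mc: "k \<in> carrier K" if "k \<in> M" for k using that by (simp add: M_def)
 have "closed_subspace K M"
 proof (rule K.closed_subspaceI)
  show "M \<subseteq> carrier K" using Mc by blast
  show "\<zero> \<in> M"
  proof (rule MI)
   fix e :: real assume "e > 0"
   then have "hnorm K (pU {#} \<zero> \<ominus> J \<zero>\<^bsub>H\<^esub>) \<le> e" by (simp add: a_minus_def)
   then show "\<exists>m. \<exists>h\<in>carrier H. hnorm K (pU m \<zero> \<ominus> J h) \<le> e" using H.M.zero_closed by blast
  qed simp
  show "x \<oplus> y \<in> M" if x: "x \<in> M" and y: "y \<in> M" for x y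
  proof (rule MI)
   fix e :: real assume e: "e > 0"
   obtain m h where mh: "h \<in> carrier H" "hnorm K (pU m x \<ominus> J h) \<le> e / 2" using MD[OF x, of "e/2"] e by auto
   obtain n g where ng: "g \<in> carrier H" "hnorm K (pU n y \<ominus> J g) \<le> e / 2" using MD[OF y, of "e/2"] e by auto
   \<comment> \<open>Both approximations are moved to the common exponent m + n.\<close>
   let ?a = "pU (m + n) x \<ominus> J (pP n h)" and ?b = "pU (n + m) y \<ominus> J (pP m g)"
   have "hnorm K ?a \<le> e / 2" "hnorm K ?b \<le> e / 2"
    using approx_J_mono[OF Mc[OF x] mh] approx_J_mono[OF Mc[OF y] ng] by auto
   moreover have "pU (m + n) (x \<oplus> y) \<ominus> J (pP n h \<oplus>\<^bsub>H\<^esub> pP m g) = ?a \<oplus> ?b"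
    by (rule K.vec_eqI) (use Mc[OF x] Mc[OF y] mh(1) ng(1) in \<open>simp_all add: add.commute[of n m]\<close>)
   moreover have "hnorm K (?a \<oplus> ?b) \<le> hnorm K ?a + hnorm K ?b"
    by (rule K.hnorm_triangle) (use Mc[OF x] Mc[OF y] mh(1) ng(1) in simp_all)
   ultimately have "hnorm K (pU (m + n) (x \<oplus> y) \<ominus> J (pP n h \<oplus>\<^bsub>H\<^esub> pP m g)) \<le> e" by simp
   then show "\<exists>m. \<exists>h\<in>carrier H. hnorm K (pU m (x \<oplus> y) \<ominus> J h) \<le> e"
    using mh(1) ng(1) by (intro exI[of _ "m + n"] bexI[of _ "pP n h \<oplus>\<^bsub>H\<^esub> pP m g"]) simp_all
  qed (use Mc[OF x] Mc[OF y] in simp)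
  show "c \<odot> x \<in> M" if x: "x \<in> M" for c x
  proof (rule MI)
   fix e :: real assume e: "e > 0"
   have p: "0 < cmod c + 1" by (simp add: add_nonneg_pos)
   obtain m h where mh: "h \<in> carrier H" "hnorm K (pU m x \<ominus> J h) \<le> e / (cmod c + 1)"
    using MD[OF x, of "e / (cmod c + 1)"] e p by auto
   have eq: "pU m (c \<odot> x) \<ominus> J (c \<odot>\<^bsub>H\<^esub> h) = c \<odot> (pU m x \<ominus> J h)"
    by (rule K.vec_eqI) (use Mc[OF x] mh(1) in \<open>simp_all add: right_diff_distrib\<close>)
   have "hnorm K (c \<odot> (pU m x \<ominus> J h)) = cmod c * hnorm K (pU m x \<ominus> J h)"
    using Mc[OF x] mh(1) by simp
   also have "\<dots> \<le> (cmod c + 1) * (e / (cmod c + 1))"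
    using mh Mc[OF x] p e by (intro mult_mono) auto
   also have "\<dots> = e" using p by simp
   finally have "hnorm K (pU m (c \<odot> x) \<ominus> J (c \<odot>\<^bsub>H\<^esub> h)) \<le> e" unfolding eq .
   then show "\<exists>m. \<exists>h\<in>carrier H. hnorm K (pU m (c \<odot> x) \<ominus> J h) \<le> e"
    using mh(1) by (intro exI[of _ m] bexI[of _ "c \<odot>\<^bsub>H\<^esub> h"]) simp_all
  qed (use Mc[OF x] in simp)
  show "l \<in> M" if x: "\<And>n. x n \<in> M" and l: "l \<in> carrier K" "(\<lambda>n. hnorm K (x n \<ominus> l)) \<longlonglongrightarrow> 0" for x l
  proof (rule MI)
   fix e :: real assume e: "e > 0"
   have "eventually (\<lambda>n. hnorm K (x n \<ominus> l) < e / 2) sequentially"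
    using order_tendstoD(2)[OF l(2), of "e/2"] e by simp
   then obtain n where n: "hnorm K (x n \<ominus> l) < e / 2" by (meson eventually_sequentially order_refl)
   obtain m h where mh: "h \<in> carrier H" "hnorm K (pU m (x n) \<ominus> J h) \<le> e / 2" using MD[OF x, of "e/2" n] e by auto
   have "hnorm K (pU m l \<ominus> J h) \<le> hnorm K (pU m l \<ominus> pU m (x n)) + hnorm K (pU m (x n) \<ominus> J h)"
    by (rule K.hnorm_triangle_dist) (use Mc[OF x] l(1) mh(1) in simp_all)
   also have "hnorm K (pU m l \<ominus> pU m (x n)) = hnorm K (x n \<ominus> l)"
    using Mc[OF x] l(1) hnorm_pU[of "l \<ominus> x n" m] by (simp add: K.hnorm_minus_commute)
   finally have "hnorm K (pU m l \<ominus> J h) \<le> e" using n mh(2) by simp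
   then show "\<exists>m. \<exists>h\<in>carrier H. hnorm K (pU m l \<ominus> J h) \<le> e" using mh(1) by blast
  qed (use l in simp)
 qed
 moreover have "J ` carrier H \<subseteq> M"
 proof
  fix k assume "k \<in> J ` carrier H"
  then obtain h where h: "h \<in> carrier H" "k = J h" by blast
  show "k \<in> M"
  proof (rule MI)
   fix e :: real assume "e > 0"
   then have "hnorm K (pU {#} k \<ominus> J h) \<le> e" using h by simp
   then show "\<exists>m. \<exists>h\<in>carrier H. hnorm K (pU m k \<ominus> J h) \<le> e" using h(1) by blast
  qed (use h in simp)
 qed
 moreover have MU: "U a k \<in> M" if a: "a \<in> \<Lambda>" and k: "k \<in> M" for a k
 proof (rule MI)
  fix e :: real assume e: "e > 0"
  obtain m h where mh: "h \<in> carrier H" "hnorm K (pU m k \<ominus> J h) \<le> e" using MD[OF k e] by auto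
  have "pU m (U a k) = U a (pU m k)"
   using pU_commute[OF U[OF a] commute_K(3)[OF a] Mc[OF k]] by simp
  then have "pU m (U a k) \<ominus> J (P a h) = U a (pU m k \<ominus> J h)"
   using a Mc[OF k] mh(1) by (simp add: UJ)
  moreover have "hnorm K (U a (pU m k \<ominus> J h)) = hnorm K (pU m k \<ominus> J h)"
   by (rule hnorm_U) (use a Mc[OF k] mh(1) in simp_all)
  ultimately have "hnorm K (pU m (U a k) \<ominus> J (P a h)) \<le> e" using mh(2) by (simp only:)
  then show "\<exists>m. \<exists>h\<in>carrier H. hnorm K (pU m (U a k) \<ominus> J h) \<le> e"
   using mh(1) a by (intro exI[of _ m] bexI[of _ "P a h"]) simp_all
 qed (use a Mc[OF k] in simp)
 moreover have MUa: "adj K (U a) k \<in> M" if a: "a \<in> \<Lambda>" and k: "k \<in> M" for a k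
 proof (rule MI)
  fix e :: real assume e: "e > 0"
  obtain m h where mh: "h \<in> carrier H" "hnorm K (pU m k \<ominus> J h) \<le> e" using MD[OF k e] by auto
  \<comment> \<open>One more factor U_a in the exponent cancels U_a^*.\<close>
  then have "hnorm K (pU (add_mset a m) (adj K (U a) k) \<ominus> J h) \<le> e" using pU_adj_U[OF a Mc[OF k]] by simp
  then show "\<exists>m. \<exists>h\<in>carrier H. hnorm K (pU m (adj K (U a) k) \<ominus> J h) \<le> e" using mh(1) by blast
 qed (use a Mc[OF k] in simp)
 moreover have MR: "R a k \<in> M" if a: "a \<in> \<Lambda>" and k: "k \<in> M" for a k
 proof (rule MI)
  fix e :: real assume e: "e > 0"
  define r where "r = op_norm K (R a) + 1"
  have r: "r > 0" "op_norm K (R a) \<le> r" using K.op_norm_nonneg[OF R[OF a]] by (auto simp: r_def)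
  obtain m h where mh: "h \<in> carrier H" "hnorm K (pU m k \<ominus> J h) \<le> e / r" using MD[OF k, of "e / r"] e r by auto
  have "pU m (R a k) = R a (pU m k)"
   using pU_commute[OF R[OF a] commute_K(2)[OF a] Mc[OF k]] by simp
  then have "pU m (R a k) \<ominus> J (S a h) = R a (pU m k \<ominus> J h)"
   using a Mc[OF k] mh(1) by (simp add: RJ)
  also have "hnorm K \<dots> \<le> op_norm K (R a) * hnorm K (pU m k \<ominus> J h)"
   by (rule K.op_norm_bound[OF R[OF a]]) (use Mc[OF k] mh(1) in simp)
  also have "\<dots> \<le> r * (e / r)" using r mh Mc[OF k] by (intro mult_mono) auto
  also have "\<dots> = e" using r by simp
  finally have "hnorm K (pU m (R a k) \<ominus> J (S a h)) \<le> e" .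
  then show "\<exists>m. \<exists>h\<in>carrier H. hnorm K (pU m (R a k) \<ominus> J h) \<le> e"
   using mh(1) a by (intro exI[of _ m] bexI[of _ "S a h"]) simp_all
 qed (use a Mc[OF k] in simp)
 ultimately have "M = carrier K"
 proof (intro minimal)
  fix T assume "T \<in> family_ops \<Lambda> R U"
  then obtain a where a: "a \<in> \<Lambda>" "T = R a \<or> T = U a" unfolding family_ops_def by blast
  have "adj K (R a) k \<in> M" if "k \<in> M" for k
   using MUa[OF a(1) MR[OF a(1) that]] adj_R[OF a(1) Mc[OF that]] by simp
  then show "reducing K T M" using a(2) MU[OF a(1)] MUa[OF a(1)] MR[OF a(1)] unfolding reducing_def by blast
 qed auto
 then show ?thesis using assms MD by blast
qed

text \<open>Closeness to H persists at larger exponents by \<open>approx_J_mono\<close>, and the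
  projection is at least as close as any other vector of H.\<close>

lemma proj_tendsto:
 assumes k: "k \<in> carrier K"
 shows "((\<lambda>m. hnorm K (J (Jad (pU m k)) \<ominus> pU m k)) \<longlongrightarrow> 0) mset_top"
proof (rule tendstoI)
 fix e :: real assume e: "e > 0"
 obtain m h where mh: "h \<in> carrier H" "hnorm K (pU m k \<ominus> J h) \<le> e / 2"
  using approx_J[OF k, of "e/2"] e by auto
 have "hnorm K (J (Jad (pU n k)) \<ominus> pU n k) < e" if n: "m \<subseteq># n" for n
 proof -
  obtain n' where n': "n = m + n'" using n by (meson mset_subset_eq_exists_conv)
  have "hnorm K (J (Jad (pU n k)) \<ominus> pU n k) \<le> hnorm K (J (pP n' h) \<ominus> pU n k)"
   by (rule hnorm_Jad_best) (use k mh(1) in simp_all)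
  also have "\<dots> = hnorm K (pU n k \<ominus> J (pP n' h))"
   by (rule K.hnorm_minus_commute) (use k mh(1) in simp_all)
  also have "\<dots> \<le> e / 2" unfolding n' by (rule approx_J_mono[OF k mh])
  finally show ?thesis using e by simp
 qed
 then show "\<forall>\<^sub>F m in mset_top. dist (hnorm K (J (Jad (pU m k)) \<ominus> pU m k)) 0 < e"
  unfolding eventually_mset_top using k by (intro exI[of _ m]) simp
qed

end

text \<open>Choose approximate limits for the errors 1 / (j + 1). Any two of the eventual properties
  hold at a common point because F is proper, so these values form a Cauchy sequence; its limit is
  the limit of f.\<close>

lemma filter_Cauchy_convergent:
 fixes f :: "'x \<Rightarrow> complex"
 assumes F: "F \<noteq> bot" and C: "\<And>e. e > 0 \<Longrightarrow> \<exists>l. eventually (\<lambda>n. dist (f n) l \<le> e) F"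
 shows "\<exists>l. (f \<longlongrightarrow> l) F"
proof -
 have "\<exists>l. eventually (\<lambda>n. dist (f n) l \<le> inverse (real (Suc j))) F" for j by (rule C) simp
 then obtain l where l: "\<And>j. eventually (\<lambda>n. dist (f n) (l j) \<le> inverse (real (Suc j))) F" by metis
 have d: "dist (l i) (l j) \<le> inverse (real (Suc i)) + inverse (real (Suc j))" for i j
 proof -
  have "eventually (\<lambda>n. dist (l i) (l j) \<le> inverse (real (Suc i)) + inverse (real (Suc j))) F"
   using l[of i] l[of j]
  proof eventually_elim
   case (elim n)
   then show ?case using dist_triangle2[of "l i" "l j" "f n"] by (simp add: dist_commute)
  qed
  then show ?thesis using F by simp
 qed
 have inv: "inverse (real (Suc m)) \<le> inverse (real (Suc N))" if "N \<le> m" for m N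
  using that by (simp add: le_imp_inverse_le)
 have "Cauchy l"
 proof (rule metric_CauchyI)
  fix e :: real assume e: "e > 0"
  obtain N where N: "inverse (real (Suc N)) < e / 2" using reals_Archimedean[of "e/2"] e by auto
  have "dist (l m) (l n) < e" if "m \<ge> N" "n \<ge> N" for m n
   using d[of m n] N inv[OF that(1)] inv[OF that(2)] by linarith
  then show "\<exists>M. \<forall>m\<ge>M. \<forall>n\<ge>M. dist (l m) (l n) < e" by blast
 qed
 then obtain L where L: "l \<longlonglongrightarrow> L" using Cauchy_convergent convergent_def by blast
 have "(f \<longlongrightarrow> L) F"
 proof (rule tendstoI)
  fix e :: real assume e: "e > 0"
  obtain N where N: "inverse (real (Suc N)) < e / 2" using reals_Archimedean[of "e/2"] e by auto
  obtain M where M: "\<And>m. m \<ge> M \<Longrightarrow> dist (l m) L < e / 2"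
   using metric_LIMSEQ_D[OF L, of "e/2"] e by auto
  define j where "j = max M N"
  have "N \<le> j" "M \<le> j" by (simp_all add: j_def)
  then have j: "dist (l j) L < e / 2" "inverse (real (Suc j)) < e / 2"
   using M[of j] inv[of N j] N by linarith+
  show "eventually (\<lambda>n. dist (f n) L < e) F"
   using l[of j]
  proof eventually_elim
   case (elim n)
   then show ?case using dist_triangle[of "f n" L "l j"] j by linarith
  qed
 qed
 then show ?thesis by blast
qed

context hilbert_space
begin

lemma linear_span_subset: "A \<subseteq> carrier H \<Longrightarrow> linear_span H A \<subseteq> carrier H"
 unfolding linear_span_def by (rule hull_minimal) (simp_all add: carrier_is_submodule)

lemma closed_linear_span_limit:
 assumes A: "A \<subseteq> carrier H" and x: "\<And>n. x n \<in> A" and l: "l \<in> carrier H" "(\<lambda>n. hnorm H (x n \<ominus> l)) \<longlonglongrightarrow> 0"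
 shows "l \<in> closed_linear_span H A"
proof -
 have s: "A \<subseteq> linear_span H A" unfolding linear_span_def by (rule hull_subset)
 have "linear_span H A \<subseteq> topspace (norm_topology H)"
  using linear_span_subset[OF A] by (simp add: norm_topology_def)
 then have "linear_span H A \<subseteq> closed_linear_span H A"
  unfolding closed_linear_span_def by (rule closure_of_subset)
 then have "x n \<in> closed_linear_span H A" for n using s x by blast
 moreover have "closedin (norm_topology H) (closed_linear_span H A)"
  unfolding closed_linear_span_def by (rule closedin_closure_of)
 ultimately show ?thesis using l unfolding closedin_norm_iff by blast
qed

lemma closed_linear_span_subset: "closed_linear_span H A \<subseteq> carrier H"
 unfolding closed_linear_span_def using closure_of_subset_topspace[of "norm_topology H"]
 by (simp add: norm_topology_def)

lemma int_pow_BL_closed: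
 assumes "U \<in> \<B> H" "V \<in> \<B> H" "U \<otimes>\<^bsub>BL H\<^esub> V = \<one>\<^bsub>BL H\<^esub>" "V \<otimes>\<^bsub>BL H\<^esub> U = \<one>\<^bsub>BL H\<^esub>"
 shows "U [^]\<^bsub>BL H\<^esub> (m::int) \<in> \<B> H"
proof -
 have "U \<in> Units (BL H)" using assms unfolding Units_def by blast
 then have "U [^]\<^bsub>BL H\<^esub> n \<in> Units (BL H)" for n :: nat by (rule BL.Units_pow_closed)
 then show ?thesis
  unfolding int_pow_def2 by (cases "m < 0") (simp_all only: if_True if_False BL.Units_inv_closed BL.Units_closed)
qed

lemma int_pow_BL_minus_one:
 assumes "U \<in> \<B> H" "V \<in> \<B> H" "U \<otimes>\<^bsub>BL H\<^esub> V = \<one>\<^bsub>BL H\<^esub>" "V \<otimes>\<^bsub>BL H\<^esub> U = \<one>\<^bsub>BL H\<^esub>"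
 shows "U [^]\<^bsub>BL H\<^esub> (- 1::int) = V"
 using assms BL.inv_char[OF assms] by (simp add: int_pow_def2)

lemma cinner_tendsto:
 assumes "\<And>m. x m \<in> carrier H" "\<And>m. y m \<in> carrier H" "\<And>m. x' m \<in> carrier H" "\<And>m. y' m \<in> carrier H"
  and dx: "((\<lambda>m. hnorm H (x m \<ominus> x' m)) \<longlongrightarrow> 0) F" and dy: "((\<lambda>m. hnorm H (y m \<ominus> y' m)) \<longlongrightarrow> 0) F"
  and bx: "\<And>m. hnorm H (x m) \<le> B" and by': "\<And>m. hnorm H (y' m) \<le> C"
 shows "((\<lambda>m. cinner H (x m) (y m) - cinner H (x' m) (y' m)) \<longlongrightarrow> 0) F"
proof (rule tendsto_norm_zero_cancel, rule squeeze_null)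
 have "((\<lambda>m. B * hnorm H (y m \<ominus> y' m) + hnorm H (x m \<ominus> x' m) * C) \<longlongrightarrow> B * 0 + 0 * C) F"
  by (intro tendsto_add tendsto_mult tendsto_const dx dy)
 then show "((\<lambda>m. B * hnorm H (y m \<ominus> y' m) + hnorm H (x m \<ominus> x' m) * C) \<longlongrightarrow> 0) F" by simp
 fix m
 have "cinner H (x m) (y m) - cinner H (x' m) (y' m) = cinner H (x m) (y m \<ominus> y' m) + cinner H (x m \<ominus> x' m) (y' m)"
  using assms(1-4) by simp
 also have "cmod \<dots> \<le> cmod (cinner H (x m) (y m \<ominus> y' m)) + cmod (cinner H (x m \<ominus> x' m) (y' m))"
  by (rule norm_triangle_ineq)
 also have "\<dots> \<le> hnorm H (x m) * hnorm H (y m \<ominus> y' m) + hnorm H (x m \<ominus> x' m) * hnorm H (y' m)"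
  by (rule add_mono; rule Cauchy_Schwarz) (use assms(1-4) in simp_all)
 also have "\<dots> \<le> B * hnorm H (y m \<ominus> y' m) + hnorm H (x m \<ominus> x' m) * C"
  by (rule add_mono; rule mult_right_mono mult_left_mono) (use assms(1-4) bx by' in simp_all)
 finally show "norm (cinner H (x m) (y m) - cinner H (x' m) (y' m)) \<le> B * hnorm H (y m \<ominus> y' m) + hnorm H (x m \<ominus> x' m) * C" .
qed simp

lemma vec_eqI_right:
 assumes "x \<in> carrier H" "y \<in> carrier H" "\<And>z. z \<in> carrier H \<Longrightarrow> cinner H z x = cinner H z y"
 shows "x = y"
proof (rule vec_eqI[OF assms(1,2)])
 fix z assume z: "z \<in> carrier H"
 show "cinner H x z = cinner H y z"
  using assms(3)[OF z] cinner_commute[OF assms(1) z] cinner_commute[OF assms(2) z] by simp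
qed

end

section \<open>The span of the words; operators that commute with the U_a\<close>

context gamma_extension
begin

lemma word_op_closed: "fst ` set w \<subseteq> \<Lambda> \<Longrightarrow> word_op K U w \<in> \<B> K"
proof (induction w)
 case (Cons p w)
 obtain a m where p: "p = (a, m)" by (cases p)
 have a: "a \<in> \<Lambda>" using Cons.prems p by simp
 have "U a [^]\<^bsub>BL K\<^esub> m \<in> \<B> K"
  by (rule K.int_pow_BL_closed[OF U[OF a] Ua[OF a] U_coiso[OF a] U_iso[OF a]])
 then show ?case using Cons by (simp add: word_op_def p)
qed (simp add: word_op_def)

lemma word_op_inverse:
 assumes "set l \<subseteq> \<Lambda>" "k \<in> carrier K"
 shows "word_op K U (map (\<lambda>a. (a, - 1)) l) (pU (mset l) k) = k"
 using assms
proof (induction l arbitrary: k)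
 case (Cons a l)
 have a: "a \<in> \<Lambda>" using Cons.prems by simp
 let ?w = "map (\<lambda>a. (a, - 1::int)) l"
 have w: "word_op K U ?w \<in> \<B> K" by (rule word_op_closed) (use Cons.prems in auto)
 have "word_op K U (map (\<lambda>a. (a, - 1)) (a # l)) = adj K (U a) \<otimes>\<^bsub>BL K\<^esub> word_op K U ?w"
  using K.int_pow_BL_minus_one[OF U[OF a] Ua[OF a] U_coiso[OF a] U_iso[OF a]] by (simp add: word_op_def)
 moreover have "pU (mset (a # l)) k = pU (mset l) (U a k)"
  using a Cons.prems by (simp add: KU.mpow_add_mset' total_op_def)
 moreover have "word_op K U ?w (pU (mset l) (U a k)) = U a k"
  by (rule Cons.IH) (use Cons.prems a in simp_all)
 ultimately show ?case using a Cons.prems by simp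
qed (simp add: word_op_def)

lemma word_op_inverse_hnorm:
 assumes "set l \<subseteq> \<Lambda>" "k \<in> carrier K"
 shows "hnorm K (word_op K U (map (\<lambda>a. (a, - 1)) l) k) \<le> hnorm K k"
 using assms
proof (induction l)
 case (Cons a l)
 have a: "a \<in> \<Lambda>" using Cons.prems by simp
 let ?w = "map (\<lambda>a. (a, - 1::int)) l"
 have w: "word_op K U ?w \<in> \<B> K" by (rule word_op_closed) (use Cons.prems in auto)
 have e: "word_op K U (map (\<lambda>a. (a, - 1)) (a # l)) = adj K (U a) \<otimes>\<^bsub>BL K\<^esub> word_op K U ?w"
  using K.int_pow_BL_minus_one[OF U[OF a] Ua[OF a] U_coiso[OF a] U_iso[OF a]] by (simp add: word_op_def)
 let ?v = "word_op K U ?w k"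
 have v: "?v \<in> carrier K" using K.bop_closed[OF w] Cons.prems by simp
 have "hnorm K (adj K (U a) ?v) = hnorm K (U a (adj K (U a) ?v))" using a v by (simp del: U_adj_U)
 also have "\<dots> = hnorm K ?v" using a v by simp
 also have "\<dots> \<le> hnorm K k" using Cons by simp
 finally show ?case unfolding e using Cons.prems by simp
qed (simp add: word_op_def)

text \<open>If U^m k is close to J h, then k is close to U^-m J h. So the vectors obtained from
  words with all exponents -1 are already dense.\<close>

lemma carrier_eq_span:
 "carrier K = closed_linear_span K {word_op K U w (J h) |w h. h \<in> carrier H \<and> fst ` set w \<subseteq> \<Lambda>}" (is "_ = closed_linear_span K ?A")
proof
 have A: "?A \<subseteq> carrier K" by (auto intro!: K.bop_closed[OF word_op_closed])
 show "carrier K \<subseteq> closed_linear_span K ?A"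
 proof
  fix k assume k: "k \<in> carrier K"
  have "\<exists>v\<in>?A. hnorm K (v \<ominus> k) \<le> inverse (real (Suc n))" for n
  proof -
   obtain m h where mh: "h \<in> carrier H" "hnorm K (pU m k \<ominus> J h) \<le> inverse (real (Suc n))"
    using approx_J[OF k, of "inverse (real (Suc n))"] by auto
   \<comment> \<open>Indices outside \<Lambda> act as the identity in \<open>pU\<close>, whereas a
     word must be over \<Lambda>.\<close>
   obtain l where l: "mset l = filter_mset (\<lambda>a. a \<in> \<Lambda>) m" by (metis ex_mset)
   have ls: "set l \<subseteq> \<Lambda>" using arg_cong[OF l, of set_mset] by auto
   let ?w = "map (\<lambda>a. (a, - 1::int)) l"
   have w: "word_op K U ?w \<in> \<B> K" by (rule word_op_closed) (use ls in auto)
   have e: "word_op K U ?w (pU m k) = k"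
    using word_op_inverse[OF ls k] KU.mpow_filter[of m k] l by simp
   have "word_op K U ?w (pU m k \<ominus> J h) = word_op K U ?w (pU m k) \<ominus> word_op K U ?w (J h)"
    by (rule K.bop_minus[OF w]) (use k mh in simp_all)
   then have "hnorm K (k \<ominus> word_op K U ?w (J h)) \<le> inverse (real (Suc n))"
    using word_op_inverse_hnorm[OF ls, of "pU m k \<ominus> J h"] mh k by (simp add: e)
   then have "hnorm K (word_op K U ?w (J h) \<ominus> k) \<le> inverse (real (Suc n))"
    using K.hnorm_minus_commute[of k "word_op K U ?w (J h)"] k K.bop_closed[OF w] mh(1) by simp
   moreover have "word_op K U ?w (J h) \<in> ?A"
    by (rule CollectI, rule exI[of _ ?w], rule exI[of _ h]) (use mh(1) ls in auto)
   ultimately show ?thesis by blast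
  qed
  then have "\<forall>n. \<exists>v. v \<in> ?A \<and> hnorm K (v \<ominus> k) \<le> inverse (real (Suc n))" by blast
  from choice[OF this] obtain v where v: "\<And>n. v n \<in> ?A"
   "\<And>n. hnorm K (v n \<ominus> k) \<le> inverse (real (Suc n))" by blast
  have vc: "v n \<in> carrier K" for n using v(1) A by blast
  show "k \<in> closed_linear_span K ?A"
  proof (rule K.closed_linear_span_limit[OF A v(1) k])
   show "(\<lambda>n. hnorm K (v n \<ominus> k)) \<longlonglongrightarrow> 0"
    by (rule squeeze_null[OF LIMSEQ_inverse_real_of_nat]) (use v(2) vc k in simp_all)
  qed
 qed
qed (rule K.closed_linear_span_subset)

text \<open>The condition that lets a vector be moved towards H by \<open>pU m\<close> without
  disturbing the action of Y.\<close>

definition commU :: "('b \<Rightarrow> 'b) set" where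
 "commU = {Y \<in> \<B> K. \<forall>a\<in>\<Lambda>. Y \<otimes>\<^bsub>BL K\<^esub> U a = U a \<otimes>\<^bsub>BL K\<^esub> Y}"

lemma commU_BL: "Y \<in> commU \<Longrightarrow> Y \<in> \<B> K"
 by (simp add: commU_def)

lemma commU_pU: "Y \<in> commU \<Longrightarrow> k \<in> carrier K \<Longrightarrow> Y (pU m k) = pU m (Y k)"
 by (rule pU_commute) (simp_all add: commU_def)

lemma commutant_commU: "Y \<in> commutant K (family_ops \<Lambda> R U) \<Longrightarrow> Y \<in> commU"
 by (auto simp: commutant_def commU_def family_ops_def)

lemma cinner_pU [simp]:
 assumes "x \<in> carrier K" "y \<in> carrier K"
 shows "cinner K (pU m x) (pU m y) = cinner K x y"
proof (induction m)
 case (add a m)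
 have "cinner K (U a (pU m x)) (U a (pU m y)) = cinner K (pU m x) (pU m y)" if a: "a \<in> \<Lambda>"
  using K.cinner_adj_right[OF U[OF a], of "pU m x" "U a (pU m y)"] K.cinner_adj_right[OF U[OF a], of "pU m x" "U a (pU m y)"]
   a assms by simp
 then show ?case using add assms by (simp add: KU.mpow_add_mset total_op_def)
qed simp

lemma hnorm_Jad_pU: "k \<in> carrier K \<Longrightarrow> hnorm H (Jad (pU m k)) \<le> hnorm K k"
 using hnorm_Jad_le[of "pU m k"] by simp

text \<open>Once U^m k and U^m k' are close to H, the expression is close to <Y U^m k, U^m k'>,
  which is <Y k, k'> for every m. In particular Y is determined by its compression.\<close>

lemma commU_cinner_tendsto:
 assumes Y: "Y \<in> commU" and k: "k \<in> carrier K" "k' \<in> carrier K"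
 shows "((\<lambda>m. cinner H (compress Y (Jad (pU m k))) (Jad (pU m k'))) \<longlongrightarrow> cinner K (Y k) k') mset_top"
proof -
 note Yc = commU_BL[OF Y]
 note [simp] = K.bop_rules[OF Yc]
 define x where "x m = Y (J (Jad (pU m k)))" for m
 define y where "y m = J (Jad (pU m k'))" for m
 have "((\<lambda>m. cinner K (x m) (y m) - cinner K (Y (pU m k)) (pU m k')) \<longlongrightarrow> 0) mset_top"
 proof (rule K.cinner_tendsto[where B = "op_norm K Y * hnorm K k" and C = "hnorm K k'"])
  have "((\<lambda>m. op_norm K Y * hnorm K (J (Jad (pU m k)) \<ominus> pU m k)) \<longlongrightarrow> 0) mset_top"
   using tendsto_mult[OF tendsto_const proj_tendsto[OF k(1)], of "op_norm K Y"] by simp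
  then show "((\<lambda>m. hnorm K (x m \<ominus> Y (pU m k))) \<longlongrightarrow> 0) mset_top"
  proof (rule squeeze_null)
   show "hnorm K (x m \<ominus> Y (pU m k)) \<le> op_norm K Y * hnorm K (J (Jad (pU m k)) \<ominus> pU m k)" for m
    using K.op_norm_bound[OF Yc, of "J (Jad (pU m k)) \<ominus> pU m k"] k by (simp add: x_def)
  qed (use k in \<open>simp add: x_def\<close>)
  show "((\<lambda>m. hnorm K (y m \<ominus> pU m k')) \<longlongrightarrow> 0) mset_top" unfolding y_def by (rule proj_tendsto[OF k(2)])
  show "hnorm K (x m) \<le> op_norm K Y * hnorm K k" for m
  proof -
   have "hnorm K (x m) \<le> op_norm K Y * hnorm H (Jad (pU m k))"
    using K.op_norm_bound[OF Yc, of "J (Jad (pU m k))"] k by (simp add: x_def)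
   also have "\<dots> \<le> op_norm K Y * hnorm K k" by (intro mult_left_mono hnorm_Jad_pU) (use Yc k in simp_all)
   finally show ?thesis .
  qed
 qed (use k in \<open>simp_all add: x_def y_def\<close>)
 moreover have "cinner K (Y (pU m k)) (pU m k') = cinner K (Y k) k'" for m
  using commU_pU[OF Y k(1)] k by simp
 moreover have "cinner H (compress Y (Jad (pU m k))) (Jad (pU m k')) = cinner K (x m) (y m)" for m
  using k by (simp add: x_def y_def del: cinner_Jad_right)
 ultimately show ?thesis by (simp add: LIM_zero_iff)
qed

lemma commU_eqI:
 assumes Y: "Y \<in> commU" "Z \<in> commU" and c: "compress Y = compress Z"
 shows "Y = Z"
proof (rule K.bop_cinner_eqI)
 fix x y assume x: "x \<in> carrier K" and y: "y \<in> carrier K"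
 show "cinner K (Y x) y = cinner K (Z x) y"
  by (rule tendsto_unique[OF mset_top_neq_bot commU_cinner_tendsto[OF Y(1) x y]])
    (use commU_cinner_tendsto[OF Y(2) x y] in \<open>simp only: c\<close>)
qed (use Y commU_BL in auto)

end

section \<open>Toeplitz operators, their lifts to K, and commutants\<close>

context gamma_extension
begin

text \<open>The matrix elements are what survives a passage to the limit of sesquilinear
  forms.\<close>

lemma Toeplitz_iff:
 "A \<in> Toeplitz_ops H \<Lambda> S P \<longleftrightarrow> A \<in> \<B> H \<and> (\<forall>a\<in>\<Lambda>. \<forall>x\<in>carrier H. \<forall>y\<in>carrier H.
  cinner H (A (P a x)) (S a y) = cinner H (A (S a x)) y \<and> cinner H (A (P a x)) (P a y) = cinner H (A x) y)"
 for A
proof (cases "A \<in> \<B> H")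
 case True
 note [simp] = H.bop_rules[OF True]
 have "adj H (S a) \<otimes>\<^bsub>BL H\<^esub> A \<otimes>\<^bsub>BL H\<^esub> P a = A \<otimes>\<^bsub>BL H\<^esub> S a \<longleftrightarrow>
   (\<forall>x\<in>carrier H. \<forall>y\<in>carrier H. cinner H (A (P a x)) (S a y) = cinner H (A (S a x)) y)"
  if a: "a \<in> \<Lambda>" for a
 proof
  assume e: "adj H (S a) \<otimes>\<^bsub>BL H\<^esub> A \<otimes>\<^bsub>BL H\<^esub> P a = A \<otimes>\<^bsub>BL H\<^esub> S a"
  show "\<forall>x\<in>carrier H. \<forall>y\<in>carrier H. cinner H (A (P a x)) (S a y) = cinner H (A (S a x)) y"
  proof (intro ballI)
   fix x y assume x: "x \<in> carrier H" and y: "y \<in> carrier H"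
   have "adj H (S a) (A (P a x)) = A (S a x)" using fun_cong[OF e, of x] x a by simp
   then show "cinner H (A (P a x)) (S a y) = cinner H (A (S a x)) y"
    using H.cinner_adj_left[OF S[OF a], of "A (P a x)" y] a x y by simp
  qed
 next
  assume e: "\<forall>x\<in>carrier H. \<forall>y\<in>carrier H. cinner H (A (P a x)) (S a y) = cinner H (A (S a x)) y"
  show "adj H (S a) \<otimes>\<^bsub>BL H\<^esub> A \<otimes>\<^bsub>BL H\<^esub> P a = A \<otimes>\<^bsub>BL H\<^esub> S a"
   by (rule H.bop_cinner_eqI) (use e a True S P in simp_all)
 qed
 moreover have "adj H (P a) \<otimes>\<^bsub>BL H\<^esub> A \<otimes>\<^bsub>BL H\<^esub> P a = A \<longleftrightarrow>
   (\<forall>x\<in>carrier H. \<forall>y\<in>carrier H. cinner H (A (P a x)) (P a y) = cinner H (A x) y)"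
  if a: "a \<in> \<Lambda>" for a
 proof
  assume e: "adj H (P a) \<otimes>\<^bsub>BL H\<^esub> A \<otimes>\<^bsub>BL H\<^esub> P a = A"
  show "\<forall>x\<in>carrier H. \<forall>y\<in>carrier H. cinner H (A (P a x)) (P a y) = cinner H (A x) y"
  proof (intro ballI)
   fix x y assume x: "x \<in> carrier H" and y: "y \<in> carrier H"
   have "adj H (P a) (A (P a x)) = A x" using fun_cong[OF e, of x] x a by simp
   then show "cinner H (A (P a x)) (P a y) = cinner H (A x) y"
    using H.cinner_adj_left[OF P[OF a], of "A (P a x)" y] a x y by simp
  qed
 next
  assume e: "\<forall>x\<in>carrier H. \<forall>y\<in>carrier H. cinner H (A (P a x)) (P a y) = cinner H (A x) y"
  show "adj H (P a) \<otimes>\<^bsub>BL H\<^esub> A \<otimes>\<^bsub>BL H\<^esub> P a = A"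
   by (rule H.bop_cinner_eqI) (use e a True P in simp_all)
 qed
 ultimately show ?thesis using True unfolding Toeplitz_ops_def by blast
qed (simp add: Toeplitz_ops_def)

lemma Toeplitz_pP:
 assumes A: "A \<in> Toeplitz_ops H \<Lambda> S P" and x: "x \<in> carrier H" and y: "y \<in> carrier H"
 shows "cinner H (A (pP m x)) (pP m y) = cinner H (A x) y"
proof (induction m)
 case (add a m)
 have "cinner H (A (P a (pP m x))) (P a (pP m y)) = cinner H (A (pP m x)) (pP m y)" if "a \<in> \<Lambda>"
  using A that x y unfolding Toeplitz_iff by simp
 then show ?case using add x y by (simp add: HP.mpow_add_mset total_op_def)
qed simp

lemma approx_J_pair:
 assumes k: "k \<in> carrier K" "k' \<in> carrier K" and e: "e > 0"
 shows "\<exists>m. \<exists>h\<in>carrier H. \<exists>h'\<in>carrier H. hnorm K (pU m k \<ominus> J h) \<le> e \<and> hnorm K (pU m k' \<ominus> J h') \<le> e"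
proof -
 obtain m h where mh: "h \<in> carrier H" "hnorm K (pU m k \<ominus> J h) \<le> e" using approx_J[OF k(1) e] by auto
 obtain n g where ng: "g \<in> carrier H" "hnorm K (pU n k' \<ominus> J g) \<le> e" using approx_J[OF k(2) e] by auto
 have "hnorm K (pU (m + n) k \<ominus> J (pP n h)) \<le> e" by (rule approx_J_mono[OF k(1) mh])
 moreover have "hnorm K (pU (m + n) k' \<ominus> J (pP m g)) \<le> e"
  using approx_J_mono[OF k(2) ng, of m] by (simp add: add.commute)
 ultimately show ?thesis using mh(1) ng(1)
  by (intro exI[of _ "m + n"] bexI[of _ "pP n h"] bexI[of _ "pP m g"]) simp_all
qed

text \<open>If U^m k and U^m k' are within d of J h and J h', then at every larger exponent the two
  arguments of the form are within d of P^n h and P^n h', and there the Toeplitz identity keeps the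
  form constant at <A h, h'>.\<close>

lemma Toeplitz_form_converges:
 assumes A: "A \<in> Toeplitz_ops H \<Lambda> S P" and k: "k \<in> carrier K" "k' \<in> carrier K"
 shows "\<exists>l. ((\<lambda>m. cinner H (A (Jad (pU m k))) (Jad (pU m k'))) \<longlongrightarrow> l) mset_top"
proof (rule filter_Cauchy_convergent)
 have Ac: "A \<in> \<B> H" using A unfolding Toeplitz_iff by blast
 note [simp] = H.bop_rules[OF Ac]
 fix e :: real assume e: "e > 0"
 define N where "N = op_norm H A"
 have N: "N \<ge> 0" using Ac by (simp add: N_def)
 \<comment> \<open>The two error terms add up to d (C - 1). The bound d \<le> 1 is used for ||h||
   \<le> ||k|| + 1.\<close>
 define C where "C = N * (hnorm K k + hnorm K k' + 1) + 1"
 have "0 \<le> N * (hnorm K k + hnorm K k' + 1)" using N k by (intro mult_nonneg_nonneg) simp_all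
 then have C: "C > 0" by (simp add: C_def)
 define d where "d = min 1 (e / C)"
 have d: "d > 0" "d \<le> 1" "d \<le> e / C" using e C by (auto simp: d_def)
 have dC: "d * C \<le> e" using d(3) C by (simp add: pos_le_divide_eq)
 obtain m h h' where mh: "h \<in> carrier H" "h' \<in> carrier H" "hnorm K (pU m k \<ominus> J h) \<le> d"
  "hnorm K (pU m k' \<ominus> J h') \<le> d" using approx_J_pair[OF k d(1)] by blast
 have hn: "hnorm H h \<le> hnorm K k + 1"
  using K.hnorm_triangle_diff[of "J h" "pU m k"] K.hnorm_minus_commute[of "J h" "pU m k"] mh k d(2) by simp
 have "dist (cinner H (A (Jad (pU n k))) (Jad (pU n k'))) (cinner H (A h) h') \<le> e" if "m \<subseteq># n" for n
 proof -
  obtain n' where n': "n = m + n'" using \<open>m \<subseteq># n\<close> by (meson mset_subset_eq_exists_conv)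
  define u u' v v' where "u = Jad (pU n k)" and "u' = Jad (pU n k')" and "v = pP n' h" and "v' = pP n' h'"
  have c: "u \<in> carrier H" "u' \<in> carrier H" "v \<in> carrier H" "v' \<in> carrier H"
   using k mh by (simp_all add: u_def u'_def v_def v'_def)
  have uv: "hnorm H (u \<ominus>\<^bsub>H\<^esub> v) \<le> d"
  proof -
   have "u \<ominus>\<^bsub>H\<^esub> v = Jad (pU n k \<ominus> J (pP n' h))" using k mh by (simp add: u_def v_def)
   then show ?thesis
    using hnorm_Jad_le[of "pU n k \<ominus> J (pP n' h)"] approx_J_mono[OF k(1) mh(1,3), of n'] k mh by (simp add: n')
  qed
  have uv': "hnorm H (u' \<ominus>\<^bsub>H\<^esub> v') \<le> d"
  proof -
   have "u' \<ominus>\<^bsub>H\<^esub> v' = Jad (pU n k' \<ominus> J (pP n' h'))" using k mh by (simp add: u'_def v'_def)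
   then show ?thesis
    using hnorm_Jad_le[of "pU n k' \<ominus> J (pP n' h')"] approx_J_mono[OF k(2) mh(2,4), of n'] k mh by (simp add: n')
  qed
  have "cinner H (A h) h' = cinner H (A v) v'"
   unfolding v_def v'_def by (rule Toeplitz_pP[OF A mh(1,2), symmetric])
  then have "cinner H (A u) u' - cinner H (A h) h' = cinner H (A (u \<ominus>\<^bsub>H\<^esub> v)) u' + cinner H (A v) (u' \<ominus>\<^bsub>H\<^esub> v')"
   using c by simp
  also have "cmod \<dots> \<le> cmod (cinner H (A (u \<ominus>\<^bsub>H\<^esub> v)) u') + cmod (cinner H (A v) (u' \<ominus>\<^bsub>H\<^esub> v'))"
   by (rule norm_triangle_ineq)
  also have "\<dots> \<le> N * d * hnorm K k' + N * (hnorm K k + 1) * d"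
  proof (rule add_mono)
   have "cmod (cinner H (A (u \<ominus>\<^bsub>H\<^esub> v)) u') \<le> hnorm H (A (u \<ominus>\<^bsub>H\<^esub> v)) * hnorm H u'"
    by (rule H.Cauchy_Schwarz) (use c in simp_all)
   also have "\<dots> \<le> (N * d) * hnorm K k'"
   proof (rule mult_mono)
    have "hnorm H (A (u \<ominus>\<^bsub>H\<^esub> v)) \<le> N * hnorm H (u \<ominus>\<^bsub>H\<^esub> v)"
     unfolding N_def by (rule H.op_norm_bound[OF Ac]) (use c in simp)
    also have "\<dots> \<le> N * d" using uv N by (rule mult_left_mono)
    finally show "hnorm H (A (u \<ominus>\<^bsub>H\<^esub> v)) \<le> N * d" .
    show "hnorm H u' \<le> hnorm K k'" unfolding u'_def by (rule hnorm_Jad_pU[OF k(2)])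
   qed (use N d c in simp_all)
   finally show "cmod (cinner H (A (u \<ominus>\<^bsub>H\<^esub> v)) u') \<le> N * d * hnorm K k'" .
   have "cmod (cinner H (A v) (u' \<ominus>\<^bsub>H\<^esub> v')) \<le> hnorm H (A v) * hnorm H (u' \<ominus>\<^bsub>H\<^esub> v')"
    by (rule H.Cauchy_Schwarz) (use c in simp_all)
   also have "\<dots> \<le> (N * (hnorm K k + 1)) * d"
   proof (rule mult_mono)
    have "hnorm H (A v) \<le> N * hnorm H v" unfolding N_def by (rule H.op_norm_bound[OF Ac c(3)])
    also have "\<dots> \<le> N * (hnorm K k + 1)" using hn N mh(1) by (intro mult_left_mono) (simp_all add: v_def)
    finally show "hnorm H (A v) \<le> N * (hnorm K k + 1)" .
    show "hnorm H (u' \<ominus>\<^bsub>H\<^esub> v') \<le> d" by (rule uv')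
    show "0 \<le> N * (hnorm K k + 1)" using N k by (intro mult_nonneg_nonneg) simp_all
   qed (use c in simp)
   finally show "cmod (cinner H (A v) (u' \<ominus>\<^bsub>H\<^esub> v')) \<le> N * (hnorm K k + 1) * d" .
  qed
  also have "\<dots> = d * (C - 1)" by (simp add: C_def algebra_simps)
  also have "\<dots> \<le> e" using dC d(1) by (simp add: right_diff_distrib)
  finally show ?thesis by (simp add: dist_norm u_def u'_def)
 qed
 then show "\<exists>l. \<forall>\<^sub>F n in mset_top. dist (cinner H (A (Jad (pU n k))) (Jad (pU n k'))) l \<le> e"
  unfolding eventually_mset_top by blast
qed simp

text \<open>U^m k is asymptotically in the image of H, and there T acts as T0.\<close>

lemma Jad_intertwine_tendsto:
 assumes T: "T \<in> \<B> K" and T0: "\<And>h. h \<in> carrier H \<Longrightarrow> T0 h \<in> carrier H"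
  and TJ: "\<And>h. h \<in> carrier H \<Longrightarrow> T (J h) = J (T0 h)" and k: "k \<in> carrier K"
 shows "((\<lambda>m. hnorm H (Jad (T (pU m k)) \<ominus>\<^bsub>H\<^esub> T0 (Jad (pU m k)))) \<longlongrightarrow> 0) mset_top"
proof (rule squeeze_null)
 note [simp] = K.bop_rules[OF T]
 show "((\<lambda>m. op_norm K T * hnorm K (J (Jad (pU m k)) \<ominus> pU m k)) \<longlongrightarrow> 0) mset_top"
  using tendsto_mult[OF tendsto_const proj_tendsto[OF k], of "op_norm K T"] by simp
 fix m
 let ?v = "pU m k"
 have "Jad (T ?v) \<ominus>\<^bsub>H\<^esub> T0 (Jad ?v) = Jad (T (?v \<ominus> J (Jad ?v)))" using k T0 by (simp add: TJ)
 then have "hnorm H (Jad (T ?v) \<ominus>\<^bsub>H\<^esub> T0 (Jad ?v)) \<le> hnorm K (T (?v \<ominus> J (Jad ?v)))"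
  using hnorm_Jad_le[of "T (?v \<ominus> J (Jad ?v))"] k by (simp del: K.bop_minus[OF T])
 also have "\<dots> \<le> op_norm K T * hnorm K (?v \<ominus> J (Jad ?v))"
  by (rule K.op_norm_bound[OF T]) (use k in simp)
 finally show "hnorm H (Jad (T ?v) \<ominus>\<^bsub>H\<^esub> T0 (Jad ?v)) \<le> op_norm K T * hnorm K (J (Jad ?v) \<ominus> ?v)"
  using K.hnorm_minus_commute[of ?v "J (Jad ?v)"] k by simp
 show "0 \<le> hnorm H (Jad (T ?v) \<ominus>\<^bsub>H\<^esub> T0 (Jad ?v))" using k T0 by simp
qed

text \<open>The limit b of the forms <A J^* U^m k, J^* U^m k'> is bounded and sesquilinear on K, and
  Y is the operator representing it. On the image of H these forms are constant in m, so Y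
  compresses to A.\<close>

lemma Toeplitz_lift:
 assumes A: "A \<in> Toeplitz_ops H \<Lambda> S P"
 shows "\<exists>Y\<in>commutant K (family_ops \<Lambda> R U). compress Y = A \<and> op_norm K Y \<le> op_norm H A"
proof -
 have Ac: "A \<in> \<B> H" using A unfolding Toeplitz_iff by blast
 note [simp] = H.bop_rules[OF Ac]
 define N where "N = op_norm H A"
 have N: "N \<ge> 0" using Ac by (simp add: N_def)
 let ?f = "\<lambda>k k' m. cinner H (A (Jad (pU m k))) (Jad (pU m k'))"
 define b where "b k k' = Lim mset_top (?f k k')" for k k'
 have b: "(?f k k' \<longlongrightarrow> b k k') mset_top" if k: "k \<in> carrier K" "k' \<in> carrier K" for k k'
 proof -
  obtain l where l: "(?f k k' \<longlongrightarrow> l) mset_top" using Toeplitz_form_converges[OF A k] by blast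
  then show ?thesis unfolding b_def tendsto_Lim[OF mset_top_neq_bot l] .
 qed
 have b_unique: "b k k' = l" if "(?f k k' \<longlongrightarrow> l) mset_top" "k \<in> carrier K" "k' \<in> carrier K" for k k' l
  by (rule tendsto_unique[OF mset_top_neq_bot b[OF that(2,3)] that(1)])
 have b_add: "b (x \<oplus> y) z = b x z + b y z" if "x \<in> carrier K" "y \<in> carrier K" "z \<in> carrier K" for x y z
  by (rule b_unique) (use tendsto_add[OF b[OF that(1,3)] b[OF that(2,3)]] that in simp_all)
 have b_smult: "b (c \<odot> x) z = c * b x z" if "x \<in> carrier K" "z \<in> carrier K" for c x z
  by (rule b_unique) (use tendsto_mult[OF tendsto_const b[OF that], of c] that in simp_all)
 have b_add2: "b z (x \<oplus> y) = b z x + b z y" if "x \<in> carrier K" "y \<in> carrier K" "z \<in> carrier K" for x y z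
  by (rule b_unique) (use tendsto_add[OF b[OF that(3,1)] b[OF that(3,2)]] that in \<open>simp_all del: cinner_Jad_right\<close>)
 have b_smult2: "b z (c \<odot> x) = cnj c * b z x" if "x \<in> carrier K" "z \<in> carrier K" for c x z
  by (rule b_unique) (use tendsto_mult[OF tendsto_const b[OF that(2,1)], of "cnj c"] that in \<open>simp_all del: cinner_Jad_right\<close>)
 have b_bound: "cmod (b k k') \<le> N * hnorm K k' * hnorm K k" if k: "k \<in> carrier K" "k' \<in> carrier K" for k k'
 proof (rule Lim_norm_ubound[OF mset_top_neq_bot b[OF k]], rule always_eventually, rule allI)
  fix m
  have "cmod (?f k k' m) \<le> hnorm H (A (Jad (pU m k))) * hnorm H (Jad (pU m k'))"
   by (rule H.Cauchy_Schwarz) (use k in simp_all)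
  also have "\<dots> \<le> (N * hnorm K k) * hnorm K k'"
  proof (rule mult_mono)
   have "hnorm H (A (Jad (pU m k))) \<le> N * hnorm H (Jad (pU m k))"
    unfolding N_def by (rule H.op_norm_bound[OF Ac]) (use k in simp)
   also have "\<dots> \<le> N * hnorm K k" by (rule mult_left_mono[OF hnorm_Jad_pU[OF k(1)] N])
   finally show "hnorm H (A (Jad (pU m k))) \<le> N * hnorm K k" .
   show "hnorm H (Jad (pU m k')) \<le> hnorm K k'" by (rule hnorm_Jad_pU[OF k(2)])
   show "0 \<le> N * hnorm K k" using N k by simp
  qed (use k in simp)
  finally show "cmod (?f k k' m) \<le> N * hnorm K k' * hnorm K k" by (simp add: mult_ac)
 qed
 have "\<exists>z. z \<in> carrier K \<and> (\<forall>k\<in>carrier K. b k k' = cinner K k z)" if k': "k' \<in> carrier K" for k'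
 proof -
  have "\<exists>z\<in>carrier K. \<forall>k\<in>carrier K. b k k' = cinner K k z"
   by (rule K.Riesz[where C = "N * hnorm K k'"]) (use k' b_add b_smult b_bound in simp_all)
  then show ?thesis by blast
 qed
 then obtain B where B: "\<And>k'. k' \<in> carrier K \<Longrightarrow> B k' \<in> carrier K"
  "\<And>k k'. k \<in> carrier K \<Longrightarrow> k' \<in> carrier K \<Longrightarrow> cinner K k (B k') = b k k'" by metis
 define B' where "B' = (\<lambda>k\<in>carrier K. B k)"
 have B'b: "hnorm K (B k) \<le> N * hnorm K k" if k: "k \<in> carrier K" for k
 proof (cases "hnorm K (B k) = 0")
  case True
  then show ?thesis using N k by simp
 next
  case False
  then have p: "hnorm K (B k) > 0" using K.hnorm_nonneg[OF B(1)[OF k]] by linarith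
  have "(hnorm K (B k))\<^sup>2 = Re (b (B k) k)" using B k by (simp add: K.hnorm_sq)
  also have "\<dots> \<le> N * hnorm K k * hnorm K (B k)"
   using b_bound[OF B(1)[OF k] k] complex_Re_le_cmod[of "b (B k) k"] by linarith
  finally show ?thesis using p by (simp add: power2_eq_square)
 qed
 have B': "B' \<in> \<B> K"
  unfolding B'_def
 proof (rule K.bop_restrictI[where b = N])
  show "B (x \<oplus> y) = B x \<oplus> B y" if "x \<in> carrier K" "y \<in> carrier K" for x y
   by (rule K.vec_eqI_right) (use that B b_add2 in simp_all)
  show "B (c \<odot> x) = c \<odot> B x" if "x \<in> carrier K" for c x
   by (rule K.vec_eqI_right) (use that B b_smult2 in simp_all)
 qed (use B B'b in simp_all)
 \<comment> \<open>Riesz represents b by its second argument, <k, B k'> = b k k'; passing to the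
   adjoint puts the operator on the first argument.\<close>
 define Y where "Y = adj K B'"
 have Y: "Y \<in> \<B> K" using B' by (simp add: Y_def)
 note [simp] = K.bop_rules[OF Y]
 have Yb: "cinner K (Y k) k' = b k k'" if "k \<in> carrier K" "k' \<in> carrier K" for k k'
  using that B' B(2) by (simp add: Y_def) (simp add: B'_def)
 have "op_norm K Y \<le> N"
  using K.op_norm_le[OF N, of B'] B'b B' by (simp add: Y_def B'_def)
 moreover have "compress Y = A"
 proof (rule H.bop_cinner_eqI)
  fix x y assume x: "x \<in> carrier H" and y: "y \<in> carrier H"
  have "b (J x) (J y) = cinner H (A x) y"
  proof (rule b_unique)
   have "?f (J x) (J y) = (\<lambda>m. cinner H (A x) y)"
    using Toeplitz_pP[OF A x y] x y by (simp add: pU_J)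
   then show "(?f (J x) (J y) \<longlongrightarrow> cinner H (A x) y) mset_top" by simp
  qed (use x y in simp_all)
  then show "cinner H (compress Y x) y = cinner H (A x) y" using x y by (simp add: Yb)
 qed (use Y Ac in simp_all)
 \<comment> \<open>The form for k and U_a^* k' at the exponent m + a equals the form for U_a k and
   k' at m, and the shift of the exponent leaves the limit unchanged.\<close>
 moreover have YU: "Y (U a k) = U a (Y k)" if a: "a \<in> \<Lambda>" and k: "k \<in> carrier K" for a k
 proof (rule K.vec_eqI)
  fix k' assume k': "k' \<in> carrier K"
  have "b (U a k) k' = b k (adj K (U a) k')"
  proof (rule b_unique)
   have "((\<lambda>m. ?f k (adj K (U a) k') (add_mset a m)) \<longlongrightarrow> b k (adj K (U a) k')) mset_top"
    by (rule filterlim_compose[OF b filterlim_mset_top_add_mset]) (use a k k' in simp_all)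
   moreover have "?f k (adj K (U a) k') (add_mset a m) = ?f (U a k) k' m" for m
    using a k k' by (simp add: pU_adj_U) (simp add: KU.mpow_add_mset' total_op_def)
   ultimately show "(?f (U a k) k' \<longlongrightarrow> b k (adj K (U a) k')) mset_top" by simp
  qed (use a k k' in simp_all)
  then show "cinner K (Y (U a k)) k' = cinner K (U a (Y k)) k'"
   using a k k' U[OF a] by (simp add: Yb[symmetric])
 qed (use a k in simp_all)
 \<comment> \<open>In the limit J^* R and J^* U act on U^m k as S J^* and P J^* do. So S^* A P = A S
   passes to b (R k) k' = b (U k) (R k'), that is Y R = R^* Y U, and R^* Y U = R^* U Y = R
   Y.\<close>
 moreover have "Y (R a k) = R a (Y k)" if a: "a \<in> \<Lambda>" and k: "k \<in> carrier K" for a k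
 proof (rule K.vec_eqI)
  fix k' assume k': "k' \<in> carrier K"
  have Uk: "pU m (U a k) = U a (pU m k)" and Rk: "pU m (R a k) = R a (pU m k)" and Rk': "pU m (R a k') = R a (pU m k')" for m
   using pU_commute[OF U[OF a] commute_K(3)[OF a] k] pU_commute[OF R[OF a] commute_K(2)[OF a]] k k' by simp_all
  let ?u = "\<lambda>m. Jad (pU m k)" and ?u' = "\<lambda>m. Jad (pU m k')"
  have JU: "((\<lambda>m. hnorm H (Jad (U a (pU m k)) \<ominus>\<^bsub>H\<^esub> P a (?u m))) \<longlongrightarrow> 0) mset_top"
   by (rule Jad_intertwine_tendsto[OF U[OF a]]) (use a k in \<open>simp_all add: UJ\<close>)
  have JR: "((\<lambda>m. hnorm H (Jad (R a (pU m x)) \<ominus>\<^bsub>H\<^esub> S a (Jad (pU m x)))) \<longlongrightarrow> 0) mset_top"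
   if "x \<in> carrier K" for x
   by (rule Jad_intertwine_tendsto[OF R[OF a]]) (use a that in \<open>simp_all add: RJ\<close>)
  have Atend: "((\<lambda>m. hnorm H (A (x m) \<ominus>\<^bsub>H\<^esub> A (y m))) \<longlongrightarrow> 0) mset_top"
   if t: "((\<lambda>m. hnorm H (x m \<ominus>\<^bsub>H\<^esub> y m)) \<longlongrightarrow> 0) mset_top" and c: "\<And>m. x m \<in> carrier H" "\<And>m. y m \<in> carrier H"
   for x y :: "'c multiset \<Rightarrow> 'a"
  proof (rule squeeze_null)
   show "((\<lambda>m. N * hnorm H (x m \<ominus>\<^bsub>H\<^esub> y m)) \<longlongrightarrow> 0) mset_top"
    using tendsto_mult[OF tendsto_const t, of N] by simp
   show "hnorm H (A (x m) \<ominus>\<^bsub>H\<^esub> A (y m)) \<le> N * hnorm H (x m \<ominus>\<^bsub>H\<^esub> y m)" for m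
    using H.op_norm_bound[OF Ac, of "x m \<ominus>\<^bsub>H\<^esub> y m"] c by (simp add: N_def)
  qed (use c in simp)
  have bound: "hnorm H (A x) \<le> N * C" if "x \<in> carrier H" "hnorm H x \<le> C" for x C
   using order_trans[OF H.op_norm_bound[OF Ac that(1)] mult_left_mono[OF that(2), of "op_norm H A"]] N by (simp add: N_def)
  have nP: "hnorm H (Jad (U a (pU m k))) \<le> hnorm K k" for m
   using hnorm_Jad_le[of "U a (pU m k)"] a k by simp
  have nS: "hnorm H (S a (?u' m)) \<le> op_norm H (S a) * hnorm K k'" for m
   by (rule order_trans[OF H.op_norm_bound[OF S[OF a]] mult_left_mono[OF hnorm_Jad_pU[OF k']]]) (use k' S[OF a] in simp_all)
  have nR: "hnorm H (Jad (R a (pU m k))) \<le> op_norm K (R a) * hnorm K k" for m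
   using hnorm_Jad_le[of "R a (pU m k)"] K.op_norm_bound[OF R[OF a], of "pU m k"] a k by simp
  have l1: "((\<lambda>m. ?f (U a k) (R a k') m - cinner H (A (P a (?u m))) (S a (?u' m))) \<longlongrightarrow> 0) mset_top"
   unfolding Uk Rk'
  proof (rule H.cinner_tendsto[where B = "N * hnorm K k" and C = "op_norm H (S a) * hnorm K k'"])
   show "((\<lambda>m. hnorm H (A (Jad (U a (pU m k))) \<ominus>\<^bsub>H\<^esub> A (P a (?u m)))) \<longlongrightarrow> 0) mset_top"
    by (rule Atend[OF JU]) (use a k in simp_all)
   show "((\<lambda>m. hnorm H (Jad (R a (pU m k')) \<ominus>\<^bsub>H\<^esub> S a (?u' m))) \<longlongrightarrow> 0) mset_top" by (rule JR[OF k'])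
   show "hnorm H (A (Jad (U a (pU m k)))) \<le> N * hnorm K k" for m by (rule bound[OF _ nP]) (use a k in simp)
  qed (use a k k' nS in simp_all)
  have l2: "((\<lambda>m. ?f (R a k) k' m - cinner H (A (S a (?u m))) (?u' m)) \<longlongrightarrow> 0) mset_top"
   unfolding Rk
  proof (rule H.cinner_tendsto[where B = "N * (op_norm K (R a) * hnorm K k)" and C = "hnorm K k'"])
   show "((\<lambda>m. hnorm H (A (Jad (R a (pU m k))) \<ominus>\<^bsub>H\<^esub> A (S a (?u m)))) \<longlongrightarrow> 0) mset_top"
    by (rule Atend[OF JR[OF k]]) (use a k in simp_all)
   have "?u' m \<ominus>\<^bsub>H\<^esub> ?u' m = \<zero>\<^bsub>H\<^esub>" for m by (subst H.minus_eq_zero_iff) (use k' in simp_all)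
   then show "((\<lambda>m. hnorm H (?u' m \<ominus>\<^bsub>H\<^esub> ?u' m)) \<longlongrightarrow> 0) mset_top" by simp
   show "hnorm H (A (Jad (R a (pU m k)))) \<le> N * (op_norm K (R a) * hnorm K k)" for m by (rule bound[OF _ nR]) (use a k in simp)
   show "hnorm H (?u' m) \<le> hnorm K k'" for m by (rule hnorm_Jad_pU[OF k'])
  qed (use a k k' in simp_all)
  have "\<forall>x\<in>carrier H. \<forall>y\<in>carrier H. cinner H (A (P a x)) (S a y) = cinner H (A (S a x)) y"
   using A a unfolding Toeplitz_iff by blast
  note q = this[rule_format]
  have tt: "cinner H (A (P a (?u m))) (S a (?u' m)) = cinner H (A (S a (?u m))) (?u' m)" for m
   by (rule q) (use k k' in simp_all)
  have "b (R a k) k' = b (U a k) (R a k')"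
  proof (rule b_unique)
   have "((\<lambda>m. ?f (U a k) (R a k') m - (?f (U a k) (R a k') m - cinner H (A (P a (?u m))) (S a (?u' m)))
     + (?f (R a k) k' m - cinner H (A (S a (?u m))) (?u' m))) \<longlongrightarrow> b (U a k) (R a k') - 0 + 0) mset_top"
    by (intro tendsto_add tendsto_diff l1 l2 b) (use a k k' in simp_all)
   then show "(?f (R a k) k' \<longlongrightarrow> b (U a k) (R a k')) mset_top" by (simp only: tt) simp
  qed (use a k k' in simp_all)
  then have "cinner K (Y (R a k)) k' = cinner K (Y (U a k)) (R a k')" using a k k' by (simp add: Yb)
  also have "\<dots> = cinner K (adj K (R a) (Y (U a k))) k'" using a k k' R[OF a] by simp
  also have "adj K (R a) (Y (U a k)) = R a (Y k)"
   using YU[OF a k] fun_cong[OF R_U[OF a], of "Y k"] a k by simp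
  finally show "cinner K (Y (R a k)) k' = cinner K (R a (Y k)) k'" .
 qed (use a k in simp_all)
 ultimately show ?thesis
  unfolding N_def commutant_def family_ops_def
  by (intro bexI[of _ Y]) (auto intro!: K.commuteI simp: Y R U)
qed

lemma commutant_adj:
 assumes Y: "Y \<in> commutant K (family_ops \<Lambda> R U)" and a: "a \<in> \<Lambda>"
 shows "Y \<otimes>\<^bsub>BL K\<^esub> R a = R a \<otimes>\<^bsub>BL K\<^esub> Y" "Y \<otimes>\<^bsub>BL K\<^esub> U a = U a \<otimes>\<^bsub>BL K\<^esub> Y"
  "Y \<otimes>\<^bsub>BL K\<^esub> adj K (U a) = adj K (U a) \<otimes>\<^bsub>BL K\<^esub> Y" "Y \<otimes>\<^bsub>BL K\<^esub> adj K (R a) = adj K (R a) \<otimes>\<^bsub>BL K\<^esub> Y"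
proof -
 have Yc: "Y \<in> \<B> K" using Y by (simp add: commutant_def)
 show 1: "Y \<otimes>\<^bsub>BL K\<^esub> R a = R a \<otimes>\<^bsub>BL K\<^esub> Y" and 2: "Y \<otimes>\<^bsub>BL K\<^esub> U a = U a \<otimes>\<^bsub>BL K\<^esub> Y"
  using Y a unfolding commutant_def family_ops_def by blast+
 show 3: "Y \<otimes>\<^bsub>BL K\<^esub> adj K (U a) = adj K (U a) \<otimes>\<^bsub>BL K\<^esub> Y"
  by (rule K.unitary_commute_adj[OF U[OF a] Yc U_iso[OF a] U_coiso[OF a] 2])
 show "Y \<otimes>\<^bsub>BL K\<^esub> adj K (R a) = adj K (R a) \<otimes>\<^bsub>BL K\<^esub> Y"
  unfolding adj_R_op[OF a] using 1 3 Yc R[OF a] Ua[OF a] by (metis K.BL.m_assoc)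
qed

text \<open>P J-transports to U and S to R, so the two Toeplitz identities reduce to U^* Y U = Y and
  R^* Y U = Y R. Both follow by moving Y past U and using U^* U = 1 and R^* U = R.\<close>

lemma compress_Toeplitz:
 assumes Y: "Y \<in> commutant K (family_ops \<Lambda> R U)"
 shows "compress Y \<in> Toeplitz_ops H \<Lambda> S P"
 unfolding Toeplitz_iff
proof (intro conjI ballI)
 have Yc: "Y \<in> \<B> K" using Y by (simp add: commutant_def)
 note [simp] = K.bop_rules[OF Yc]
 show "compress Y \<in> \<B> H" using Yc by simp
 fix a x y assume a: "a \<in> \<Lambda>" and x: "x \<in> carrier H" and y: "y \<in> carrier H"
 have YU: "Y (U a (J x)) = U a (Y (J x))" and YR: "Y (R a (J x)) = R a (Y (J x))"
  using K.commuteD[OF commutant_adj(2)[OF Y a]] K.commuteD[OF commutant_adj(1)[OF Y a]] x by simp_all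
 have "cinner H (compress Y (P a x)) (P a y) = cinner K (Y (U a (J x))) (U a (J y))"
  using a x y by (simp add: UJ)
 also have "\<dots> = cinner K (adj K (U a) (U a (Y (J x)))) (J y)"
  unfolding YU using a x y K.cinner_adj_left[OF U[OF a], of "U a (Y (J x))" "J y"] by simp
 also have "\<dots> = cinner H (compress Y x) y" using a x y by simp
 finally show "cinner H (compress Y (P a x)) (P a y) = cinner H (compress Y x) y" .
 have "cinner H (compress Y (P a x)) (S a y) = cinner K (Y (U a (J x))) (R a (J y))"
  using a x y by (simp add: UJ RJ)
 also have "\<dots> = cinner K (adj K (R a) (U a (Y (J x)))) (J y)"
  unfolding YU using a x y K.cinner_adj_left[OF R[OF a], of "U a (Y (J x))" "J y"] by simp
 also have "adj K (R a) (U a (Y (J x))) = Y (R a (J x))"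
  unfolding YR using fun_cong[OF R_U[OF a], of "Y (J x)"] a x by simp
 also have "cinner K (Y (R a (J x))) (J y) = cinner H (compress Y (S a x)) y" using a x y by (simp add: RJ)
 finally show "cinner H (compress Y (P a x)) (S a y) = cinner H (compress Y (S a x)) y" .
qed

text \<open>P^* A P = P^* P A = A and S^* A P = S^* P A = S A = A S.\<close>

lemma commutant_subset_Toeplitz:
 assumes A: "A \<in> commutant H (family_ops \<Lambda> S P)"
 shows "A \<in> Toeplitz_ops H \<Lambda> S P"
 unfolding Toeplitz_iff
proof (intro conjI ballI)
 show Ac: "A \<in> \<B> H" using A by (simp add: commutant_def)
 note [simp] = H.bop_rules[OF Ac]
 fix a x y assume a: "a \<in> \<Lambda>" and x: "x \<in> carrier H" and y: "y \<in> carrier H"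
 have AP: "A (P a x) = P a (A x)" and AS: "A (S a x) = S a (A x)"
  using A a x unfolding commutant_def family_ops_def by (auto intro!: H.commuteD)
 show "cinner H (A (P a x)) (P a y) = cinner H (A x) y"
  using a x y H.cinner_adj_left[OF P[OF a], of "P a (A x)" y] by (simp add: AP)
 show "cinner H (A (P a x)) (S a y) = cinner H (A (S a x)) y"
  using a x y H.cinner_adj_left[OF S[OF a], of "P a (A x)" y] by (simp add: AP AS adj_S_P)
qed

text \<open>A is Toeplitz, so it has a lift Y of the same norm. Y extends A because the form that
  defines Y, taken at J h and k, is constantly <J A h, k>; uniqueness holds because Y is determined
  by its compression. The other direction is restriction to H, where J is injective.\<close>

theorem commutant_iff:
 assumes A: "A \<in> \<B> H"
 shows "A \<in> commutant H (family_ops \<Lambda> S P) \<longleftrightarrow>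
  (\<exists>!Y. Y \<in> \<B> K \<and> extends_op H J Y A \<and> op_norm K Y = op_norm H A \<and> Y \<in> commutant K (family_ops \<Lambda> R U))"
proof
 assume c: "A \<in> commutant H (family_ops \<Lambda> S P)"
 note [simp] = H.bop_rules[OF A]
 obtain Y where Y: "Y \<in> commutant K (family_ops \<Lambda> R U)" "compress Y = A" "op_norm K Y \<le> op_norm H A"
  using Toeplitz_lift[OF commutant_subset_Toeplitz[OF c]] by blast
 have Yc: "Y \<in> \<B> K" using Y(1) by (simp add: commutant_def)
 note [simp] = K.bop_rules[OF Yc]
 have AP: "A \<otimes>\<^bsub>BL H\<^esub> P a = P a \<otimes>\<^bsub>BL H\<^esub> A" if "a \<in> \<Lambda>" for a
  using c that unfolding commutant_def family_ops_def by blast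
 have "extends_op H J Y A"
  unfolding extends_op_def
 proof
  fix h assume h: "h \<in> carrier H"
  show "Y (J h) = J (A h)"
  proof (rule K.vec_eqI)
   fix k assume k: "k \<in> carrier K"
   have "cinner H (compress Y (Jad (pU m (J h)))) (Jad (pU m k)) = cinner K (J (A h)) k" for m
   proof -
    have "cinner H (A (Jad (pU m (J h)))) (Jad (pU m k)) = cinner H (pP m (A h)) (Jad (pU m k))"
     using pP_commute[OF A AP h] h by (simp add: pU_J)
    also have "\<dots> = cinner K (pU m (J (A h))) (pU m k)" using h k by (simp add: pU_J del: cinner_pU)
    also have "\<dots> = cinner K (J (A h)) k" using h k by simp
    finally show ?thesis unfolding Y(2) .
   qed
   then show "cinner K (Y (J h)) k = cinner K (J (A h)) k"
    using tendsto_unique[OF mset_top_neq_bot commU_cinner_tendsto[OF commutant_commU[OF Y(1)] J_closed[OF h] k]] by simp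
  qed (use h in simp_all)
 qed
 moreover have "op_norm K Y = op_norm H A" using Y(3) op_norm_compress_le[OF Yc] Y(2) by simp
 ultimately show "\<exists>!Y. Y \<in> \<B> K \<and> extends_op H J Y A \<and> op_norm K Y = op_norm H A \<and> Y \<in> commutant K (family_ops \<Lambda> R U)"
 proof (intro ex1I[of _ Y] conjI)
  fix Z assume Z: "Z \<in> \<B> K \<and> extends_op H J Z A \<and> op_norm K Z = op_norm H A \<and> Z \<in> commutant K (family_ops \<Lambda> R U)"
  have "compress Z = A"
   by (rule H.bop_eqI) (use Z A in \<open>simp_all add: extends_op_def\<close>)
  then show "Z = Y" using commU_eqI commutant_commU Y Z by metis
 qed (use Y Yc in auto)
next
 assume "\<exists>!Y. Y \<in> \<B> K \<and> extends_op H J Y A \<and> op_norm K Y = op_norm H A \<and> Y \<in> commutant K (family_ops \<Lambda> R U)"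
 then obtain Y where Y: "Y \<in> \<B> K" "extends_op H J Y A" "Y \<in> commutant K (family_ops \<Lambda> R U)" by blast
 note [simp] = K.bop_rules[OF Y(1)] H.bop_rules[OF A]
 have YJ: "Y (J h) = J (A h)" if "h \<in> carrier H" for h using Y(2) that by (simp add: extends_op_def)
 have AP: "A \<otimes>\<^bsub>BL H\<^esub> P a = P a \<otimes>\<^bsub>BL H\<^esub> A" if a: "a \<in> \<Lambda>" for a
 proof (rule H.commuteI[OF A P[OF a]])
  fix h assume h: "h \<in> carrier H"
  have "J (A (P a h)) = J (P a (A h))"
   using K.commuteD[OF commutant_adj(2)[OF Y(3) a], of "J h"] a h by (simp add: UJ YJ)
  then show "A (P a h) = P a (A h)" by (rule J_inj[rotated 2]) (use a h in simp_all)
 qed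
 have AS: "A \<otimes>\<^bsub>BL H\<^esub> S a = S a \<otimes>\<^bsub>BL H\<^esub> A" if a: "a \<in> \<Lambda>" for a
 proof (rule H.commuteI[OF A S[OF a]])
  fix h assume h: "h \<in> carrier H"
  have "J (A (S a h)) = J (S a (A h))"
   using K.commuteD[OF commutant_adj(1)[OF Y(3) a], of "J h"] a h by (simp add: RJ YJ)
  then show "A (S a h) = S a (A h)" by (rule J_inj[rotated 2]) (use a h in simp_all)
 qed
 show "A \<in> commutant H (family_ops \<Lambda> S P)"
  using A AP AS unfolding commutant_def family_ops_def by blast
qed

lemma commutant_vN:
 "Y \<in> commutant K (vN_algebra K (family_ops \<Lambda> R U)) \<longleftrightarrow> Y \<in> commutant K (family_ops \<Lambda> R U)"
proof
 have "family_ops \<Lambda> R U \<subseteq> vN_algebra K (family_ops \<Lambda> R U)" unfolding vN_algebra_def by (rule hull_subset)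
 then show "Y \<in> commutant K (vN_algebra K (family_ops \<Lambda> R U)) \<Longrightarrow> Y \<in> commutant K (family_ops \<Lambda> R U)"
  unfolding commutant_def by blast
next
 assume Y: "Y \<in> commutant K (family_ops \<Lambda> R U)"
 show "Y \<in> commutant K (vN_algebra K (family_ops \<Lambda> R U))"
 proof (rule K.commutant_vN_algebra[OF family_K])
  show "Y \<in> \<B> K" using Y by (simp add: commutant_def)
  fix T assume "T \<in> family_ops \<Lambda> R U"
  then obtain a where "a \<in> \<Lambda>" "T = R a \<or> T = U a" unfolding family_ops_def by blast
  then show "Y \<otimes>\<^bsub>BL K\<^esub> T = T \<otimes>\<^bsub>BL K\<^esub> Y" "Y \<otimes>\<^bsub>BL K\<^esub> adj K T = adj K T \<otimes>\<^bsub>BL K\<^esub> Y"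
   using commutant_adj[OF Y] by metis+
 qed
qed

theorem Toeplitz_iff_compression:
 assumes A: "A \<in> \<B> H"
 shows "A \<in> Toeplitz_ops H \<Lambda> S P \<longleftrightarrow> (\<exists>Y\<in>commutant K (vN_algebra K (family_ops \<Lambda> R U)).
  \<forall>h\<in>carrier H. J (A h) = orth_proj K (J ` carrier H) (Y (J h)))"
proof
 assume "A \<in> Toeplitz_ops H \<Lambda> S P"
 then obtain Y where Y: "Y \<in> commutant K (family_ops \<Lambda> R U)" "compress Y = A" using Toeplitz_lift by blast
 have Yc: "Y \<in> \<B> K" using Y(1) by (simp add: commutant_def)
 have "J (A h) = orth_proj K (J ` carrier H) (Y (J h))" if h: "h \<in> carrier H" for h
  using h K.bop_closed[OF Yc, of "J h"] by (simp add: orth_proj_J Y(2)[symmetric])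
 then show "\<exists>Y\<in>commutant K (vN_algebra K (family_ops \<Lambda> R U)). \<forall>h\<in>carrier H. J (A h) = orth_proj K (J ` carrier H) (Y (J h))"
  using Y(1) by (intro bexI[of _ Y]) (simp_all add: commutant_vN)
next
 assume "\<exists>Y\<in>commutant K (vN_algebra K (family_ops \<Lambda> R U)). \<forall>h\<in>carrier H. J (A h) = orth_proj K (J ` carrier H) (Y (J h))"
 then obtain Y where Y: "Y \<in> commutant K (family_ops \<Lambda> R U)"
  "\<And>h. h \<in> carrier H \<Longrightarrow> J (A h) = orth_proj K (J ` carrier H) (Y (J h))" by (auto simp: commutant_vN)
 have Yc: "Y \<in> \<B> K" using Y(1) by (simp add: commutant_def)
 have "A = compress Y"
 proof (rule H.bop_eqI)
  fix h assume h: "h \<in> carrier H"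
  have "J (A h) = J (Jad (Y (J h)))" using Y(2)[OF h] orth_proj_J[of "Y (J h)"] K.bop_closed[OF Yc, of "J h"] h by simp
  then have "A h = Jad (Y (J h))" by (rule J_inj[rotated 2]) (use h H.bop_closed[OF A] K.bop_closed[OF Yc] in simp_all)
  then show "A h = compress Y h" using h by simp
 qed (use A Yc in simp_all)
 then show "A \<in> Toeplitz_ops H \<Lambda> S P" using compress_Toeplitz[OF Y(1)] by simp
qed

end

section \<open>The short exact sequence\<close>

context hilbert_space
begin

lemma finsum_minus:
 assumes "f \<in> A \<rightarrow> carrier H" "g \<in> A \<rightarrow> carrier H"
 shows "finsum H f A \<ominus> finsum H g A = finsum H (\<lambda>a. f a \<ominus> g a) A"
proof (rule vec_eqI)
 have fg: "(\<lambda>a. f a \<ominus> g a) \<in> A \<rightarrow> carrier H" using assms by (auto simp: Pi_iff)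
 show "finsum H (\<lambda>a. f a \<ominus> g a) A \<in> carrier H" using fg by (rule finsum_closed)
 show c: "finsum H f A \<ominus> finsum H g A \<in> carrier H" using assms by simp
 fix z assume z: "z \<in> carrier H"
 have "(\<Sum>a\<in>A. cinner H (f a \<ominus> g a) z) = (\<Sum>a\<in>A. cinner H (f a) z - cinner H (g a) z)"
  by (rule sum.cong) (use assms z in \<open>auto simp: Pi_iff\<close>)
 then show "cinner H (finsum H f A \<ominus> finsum H g A) z = cinner H (finsum H (\<lambda>a. f a \<ominus> g a) A) z"
  using assms z fg by (simp add: cinner_finsum_left sum_subtractf)
qed

text \<open>A real supremum is meaningful only over a bounded set; the row sums of the entry norms
  give a crude bound.\<close>

lemma matrix_norm_bdd:
 fixes n :: nat
 assumes M: "\<And>i j. i < n \<Longrightarrow> j < n \<Longrightarrow> M i j \<in> \<B> H"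
 shows "bdd_above ((\<lambda>x. sqrt (\<Sum>i<n. (hnorm H (finsum H (\<lambda>j. M i j (x j)) {..<n}))\<^sup>2)) `
  {x \<in> {..<n} \<rightarrow>\<^sub>E carrier H. (\<Sum>j<n. (hnorm H (x j))\<^sup>2) \<le> 1})"
proof (rule bdd_aboveI2)
 fix x assume "x \<in> {x \<in> {..<n} \<rightarrow>\<^sub>E carrier H. (\<Sum>j<n. (hnorm H (x j))\<^sup>2) \<le> 1}"
 then have x: "\<And>j. j < n \<Longrightarrow> x j \<in> carrier H" and s: "(\<Sum>j<n. (hnorm H (x j))\<^sup>2) \<le> 1" by auto
 have x1: "hnorm H (x j) \<le> 1" if j: "j < n" for j
 proof -
  have "(hnorm H (x j))\<^sup>2 \<le> (\<Sum>j<n. (hnorm H (x j))\<^sup>2)" by (rule member_le_sum) (use j in auto)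
  then have "(hnorm H (x j))\<^sup>2 \<le> 1\<^sup>2" using s by simp
  then show ?thesis by (rule power2_le_imp_le) simp
 qed
 have f: "(\<lambda>j. M i j (x j)) \<in> {..<n} \<rightarrow> carrier H" if "i < n" for i
  using bop_closed[OF M[OF that]] x by auto
 have "hnorm H (finsum H (\<lambda>j. M i j (x j)) {..<n}) \<le> (\<Sum>j<n. op_norm H (M i j))" if i: "i < n" for i
 proof -
  have "hnorm H (finsum H (\<lambda>j. M i j (x j)) {..<n}) \<le> (\<Sum>j<n. hnorm H (M i j (x j)))"
   by (rule hnorm_finsum_le[OF f[OF i]])
  also have "\<dots> \<le> (\<Sum>j<n. op_norm H (M i j))"
  proof (rule sum_mono)
   fix j assume "j \<in> {..<n}"
   then have j: "j < n" by simp
   show "hnorm H (M i j (x j)) \<le> op_norm H (M i j)" by (rule hnorm_le_op_norm[OF M[OF i j] x[OF j] x1[OF j]])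
  qed
  finally show ?thesis .
 qed
 then have "(\<Sum>i<n. (hnorm H (finsum H (\<lambda>j. M i j (x j)) {..<n}))\<^sup>2) \<le> (\<Sum>i<n. (\<Sum>j<n. op_norm H (M i j))\<^sup>2)"
  by (intro sum_mono power_mono) (use finsum_closed[OF f] in auto)
 then show "sqrt (\<Sum>i<n. (hnorm H (finsum H (\<lambda>j. M i j (x j)) {..<n}))\<^sup>2) \<le> sqrt (\<Sum>i<n. (\<Sum>j<n. op_norm H (M i j))\<^sup>2)"
  by (rule real_sqrt_le_mono)
qed

lemma matrix_norm_domain_nonempty: "{x \<in> {..<n} \<rightarrow>\<^sub>E carrier H. (\<Sum>j<n. (hnorm H (x j))\<^sup>2) \<le> 1} \<noteq> {}"
proof -
 have "(\<lambda>j\<in>{..<n}. \<zero>) \<in> {x \<in> {..<n} \<rightarrow>\<^sub>E carrier H. (\<Sum>j<n. (hnorm H (x j))\<^sup>2) \<le> 1}" by simp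
 then show ?thesis by blast
qed

end

section \<open>Matrix norms of compressions; asymptotic limits of operators on H\<close>

context gamma_extension
begin

lemma Jad_finsum: "f \<in> A \<rightarrow> carrier K \<Longrightarrow> Jad (finsum K f A) = finsum H (\<lambda>a. Jad (f a)) A"
proof (rule H.vec_eqI)
 assume f: "f \<in> A \<rightarrow> carrier K"
 have Jf: "(\<lambda>a. Jad (f a)) \<in> A \<rightarrow> carrier H"
  by (rule funcsetI) (simp add: funcset_mem[OF f])
 show "Jad (finsum K f A) \<in> carrier H" using f by simp
 show "finsum H (\<lambda>a. Jad (f a)) A \<in> carrier H" using Jf by simp
 fix z assume z: "z \<in> carrier H"
 have "(\<Sum>a\<in>A. cinner H (Jad (f a)) z) = (\<Sum>a\<in>A. cinner K (f a) (J z))"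
  by (rule sum.cong) (use funcset_mem[OF f] z in simp_all)
 then show "cinner H (Jad (finsum K f A)) z = cinner H (finsum H (\<lambda>a. Jad (f a)) A) z"
  using f Jf z by (simp add: H.cinner_finsum_left K.cinner_finsum_left)
qed

text \<open>Since the operators \<open>U\<close> commute with the matrix entries, a vector of \<open>K\<close> may be shifted
 arbitrarily close to \<open>H\<close> without changing its norm or that of its image.\<close>

lemma matrix_norm_compress:
 assumes M: "\<And>i j. i < n \<Longrightarrow> j < n \<Longrightarrow> M i j \<in> commU"
 shows "matrix_norm H n (\<lambda>i j. compress (M i j)) = matrix_norm K n M"
proof -
 have Mc: "M i j \<in> \<B> K" if "i < n" "j < n" for i j by (rule commU_BL[OF M[OF that]])
 let ?DH = "{x \<in> {..<n} \<rightarrow>\<^sub>E carrier H. (\<Sum>j<n. (hnorm H (x j))\<^sup>2) \<le> 1}"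
 let ?DK = "{x \<in> {..<n} \<rightarrow>\<^sub>E carrier K. (\<Sum>j<n. (hnorm K (x j))\<^sup>2) \<le> 1}"
 let ?fH = "\<lambda>x. sqrt (\<Sum>i<n. (hnorm H (finsum H (\<lambda>j. compress (M i j) (x j)) {..<n}))\<^sup>2)"
 let ?fK = "\<lambda>x. sqrt (\<Sum>i<n. (hnorm K (finsum K (\<lambda>j. M i j (x j)) {..<n}))\<^sup>2)"
 have bK: "bdd_above (?fK ` ?DK)" by (rule K.matrix_norm_bdd) (rule Mc)
 have bH: "bdd_above (?fH ` ?DH)" by (rule H.matrix_norm_bdd) (use Mc in simp)
 have fs: "(\<lambda>j. M i j (x j)) \<in> {..<n} \<rightarrow> carrier K" if "i < n" "\<And>j. j < n \<Longrightarrow> x j \<in> carrier K" for i x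
  using K.bop_closed[OF Mc[OF that(1)]] that(2) by auto
 have red: "finsum H (\<lambda>j. compress (M i j) (x j)) {..<n} = Jad (finsum K (\<lambda>j. M i j (J (x j))) {..<n})"
  if i: "i < n" and x: "\<And>j. j < n \<Longrightarrow> x j \<in> carrier H" for i x
 proof -
  have "finsum H (\<lambda>j. compress (M i j) (x j)) {..<n} = finsum H (\<lambda>j. Jad (M i j (J (x j)))) {..<n}"
   by (rule H.finsum_cong') (use x fs[OF i, of "\<lambda>j. J (x j)"] in \<open>auto simp: Pi_iff\<close>)
  also have "\<dots> = Jad (finsum K (\<lambda>j. M i j (J (x j))) {..<n})"
   by (rule Jad_finsum[symmetric]) (use x fs[OF i] in simp)
  finally show ?thesis .
 qed
 have "(SUP x\<in>?DH. ?fH x) \<le> (SUP x\<in>?DK. ?fK x)"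
 proof (rule cSUP_least[OF H.matrix_norm_domain_nonempty])
  fix x assume "x \<in> ?DH"
  then have x: "\<And>j. j < n \<Longrightarrow> x j \<in> carrier H" and s: "(\<Sum>j<n. (hnorm H (x j))\<^sup>2) \<le> 1" by auto
  define y where "y = (\<lambda>j\<in>{..<n}. J (x j))"
  have y: "y \<in> ?DK" using x s by (auto simp: y_def)
  have "hnorm H (finsum H (\<lambda>j. compress (M i j) (x j)) {..<n}) \<le> hnorm K (finsum K (\<lambda>j. M i j (y j)) {..<n})"
   if i: "i < n" for i
  proof -
   have "finsum K (\<lambda>j. M i j (y j)) {..<n} = finsum K (\<lambda>j. M i j (J (x j))) {..<n}"
    by (rule K.finsum_cong') (use fs[OF i, of "\<lambda>j. J (x j)"] x in \<open>auto simp: y_def\<close>)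
   then show ?thesis
    using red[OF i x] hnorm_Jad_le[of "finsum K (\<lambda>j. M i j (J (x j))) {..<n}"]
     K.finsum_closed[OF fs[OF i, of "\<lambda>j. J (x j)"]] x by simp
  qed
  moreover have "0 \<le> hnorm H (finsum H (\<lambda>j. compress (M i j) (x j)) {..<n})" if i: "i < n" for i
   using red[OF i x] K.finsum_closed[OF fs[OF i, of "\<lambda>j. J (x j)"]] x by simp
  ultimately have "?fH x \<le> ?fK y" by (intro real_sqrt_le_mono sum_mono power_mono) auto
  also have "\<dots> \<le> (SUP x\<in>?DK. ?fK x)" by (rule cSUP_upper[OF y bK])
  finally show "?fH x \<le> (SUP x\<in>?DK. ?fK x)" .
 qed
 moreover have "(SUP x\<in>?DK. ?fK x) \<le> (SUP x\<in>?DH. ?fH x)"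
 proof (rule cSUP_least[OF K.matrix_norm_domain_nonempty])
  fix x assume "x \<in> ?DK"
  then have x: "\<And>j. j < n \<Longrightarrow> x j \<in> carrier K" and s: "(\<Sum>j<n. (hnorm K (x j))\<^sup>2) \<le> 1" by auto
  \<comment> \<open>The components in H of the shifted vectors U^m x_j. They stay in the unit ball,
    and the norm of their image under the compressed matrix tends to that of the image of x under
    M.\<close>
  define y where "y m = (\<lambda>j\<in>{..<n}. Jad (pU m (x j)))" for m
  have yj: "y m j = Jad (pU m (x j))" if "j < n" for m j using that by (simp add: y_def)
  have yc: "y m j \<in> carrier H" if "j < n" for m j using that x by (simp add: yj)
  have yD: "y m \<in> ?DH" for m
  proof -
   have "(\<Sum>j<n. (hnorm H (y m j))\<^sup>2) \<le> (\<Sum>j<n. (hnorm K (x j))\<^sup>2)"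
   proof (rule sum_mono)
    fix j assume "j \<in> {..<n}"
    then have j: "j < n" by simp
    show "(hnorm H (y m j))\<^sup>2 \<le> (hnorm K (x j))\<^sup>2"
     unfolding yj[OF j] by (rule power_mono[OF hnorm_Jad_pU[OF x[OF j]]]) (use x[OF j] in simp)
   qed
   moreover have "y m \<in> {..<n} \<rightarrow>\<^sub>E carrier H" using x by (auto simp: y_def)
   ultimately show ?thesis using s by simp
  qed
  have lim: "((\<lambda>m. hnorm H (finsum H (\<lambda>j. compress (M i j) (y m j)) {..<n})) \<longlongrightarrow>
    hnorm K (finsum K (\<lambda>j. M i j (x j)) {..<n})) mset_top" if i: "i < n" for i
  proof -
   define s where "s = finsum K (\<lambda>j. M i j (x j)) {..<n}"
   define w where "w m = finsum K (\<lambda>j. M i j (J (y m j))) {..<n}" for m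
   have sc: "s \<in> carrier K" unfolding s_def by (rule K.finsum_closed[OF fs[OF i x]])
   have wc: "w m \<in> carrier K" for m unfolding w_def by (rule K.finsum_closed[OF fs[OF i]]) (use yc in simp)
   define E where "E m = (\<Sum>j<n. op_norm K (M i j) * hnorm K (J (Jad (pU m (x j))) \<ominus> pU m (x j)))" for m
   have E: "(E \<longlongrightarrow> 0) mset_top"
   proof -
    have "((\<lambda>m. \<Sum>j<n. op_norm K (M i j) * hnorm K (J (Jad (pU m (x j))) \<ominus> pU m (x j))) \<longlongrightarrow> (\<Sum>j<n. op_norm K (M i j) * 0)) mset_top"
     by (intro tendsto_sum tendsto_mult tendsto_const proj_tendsto) (use x in auto)
    then show ?thesis unfolding E_def by simp
   qed
   \<comment> \<open>The entries commute with U^m, so U^m s is the row applied to the vectors U^m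
     x_j; E collects the projection errors of the latter.\<close>
   have wE: "hnorm K (w m \<ominus> pU m s) \<le> E m" for m
   proof -
    have "pU m s = finsum K (\<lambda>j. pU m (M i j (x j))) {..<n}"
     unfolding s_def by (rule KU.mpow_finsum[OF fs[OF i x]])
    also have "\<dots> = finsum K (\<lambda>j. M i j (pU m (x j))) {..<n}"
     by (rule K.finsum_cong') (use commU_pU[OF M[OF i]] x fs[OF i, of "\<lambda>j. pU m (x j)"] in auto)
    finally have "w m \<ominus> pU m s = finsum K (\<lambda>j. M i j (J (y m j)) \<ominus> M i j (pU m (x j))) {..<n}"
     unfolding w_def using K.finsum_minus[OF fs[OF i] fs[OF i], of "\<lambda>j. J (y m j)" "\<lambda>j. pU m (x j)"] yc x by simp
    also have "hnorm K \<dots> \<le> (\<Sum>j<n. hnorm K (M i j (J (y m j)) \<ominus> M i j (pU m (x j))))"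
     by (rule K.hnorm_finsum_le) (use K.bop_closed[OF Mc[OF i]] yc x in auto)
    also have "\<dots> \<le> E m"
     unfolding E_def
    proof (rule sum_mono)
     fix j assume "j \<in> {..<n}"
     then have j: "j < n" by simp
     show "hnorm K (M i j (J (y m j)) \<ominus> M i j (pU m (x j))) \<le> op_norm K (M i j) * hnorm K (J (Jad (pU m (x j))) \<ominus> pU m (x j))"
      using K.op_norm_bound[OF Mc[OF i j], of "J (y m j) \<ominus> pU m (x j)"] K.bop_minus[OF Mc[OF i j], of "J (y m j)" "pU m (x j)"]
       yc[OF j] x[OF j] by (simp add: yj[OF j])
    qed
    finally show ?thesis .
   qed
   have "((\<lambda>m. hnorm H (Jad (w m)) - hnorm K s) \<longlongrightarrow> 0) mset_top"
   proof (rule tendsto_norm_zero_cancel, rule squeeze_null)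
    show "((\<lambda>m. E m + hnorm K (J (Jad (pU m s)) \<ominus> pU m s)) \<longlongrightarrow> 0) mset_top"
     using tendsto_add[OF E proj_tendsto[OF sc]] by simp
    fix m
    have "hnorm H (Jad (w m)) - hnorm K s = hnorm K (J (Jad (w m))) - hnorm K (pU m s)" using wc sc by simp
    then have "norm (hnorm H (Jad (w m)) - hnorm K s) \<le> hnorm K (J (Jad (w m)) \<ominus> pU m s)"
     using K.abs_hnorm_diff_le[of "J (Jad (w m))" "pU m s"] wc sc by simp
    also have "\<dots> \<le> hnorm K (J (Jad (w m)) \<ominus> J (Jad (pU m s))) + hnorm K (J (Jad (pU m s)) \<ominus> pU m s)"
     by (rule K.hnorm_triangle_dist) (use wc sc in simp_all)
    also have "hnorm K (J (Jad (w m)) \<ominus> J (Jad (pU m s))) = hnorm H (Jad (w m \<ominus> pU m s))"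
     using wc sc hnorm_J[of "Jad (w m) \<ominus>\<^bsub>H\<^esub> Jad (pU m s)"] by simp
    also have "\<dots> \<le> E m" using order_trans[OF hnorm_Jad_le wE] wc sc by simp
    finally show "norm (hnorm H (Jad (w m)) - hnorm K s) \<le> E m + hnorm K (J (Jad (pU m s)) \<ominus> pU m s)" by simp
   qed simp
   then have "((\<lambda>m. hnorm H (Jad (w m))) \<longlongrightarrow> hnorm K s) mset_top" by (simp add: LIM_zero_iff)
   moreover have "finsum H (\<lambda>j. compress (M i j) (y m j)) {..<n} = Jad (w m)" for m
    unfolding w_def by (rule red[OF i yc])
   ultimately show ?thesis by (simp add: s_def)
  qed
  have "((\<lambda>m. ?fH (y m)) \<longlongrightarrow> ?fK x) mset_top"
   by (intro tendsto_real_sqrt tendsto_sum tendsto_power lim) auto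
  then show "?fK x \<le> (SUP x\<in>?DH. ?fH x)"
  proof (rule tendsto_upperbound)
   show "\<forall>\<^sub>F m in mset_top. ?fH (y m) \<le> (SUP x\<in>?DH. ?fH x)"
    by (rule always_eventually, rule allI, rule cSUP_upper[OF yD bH])
  qed simp
 qed
 ultimately show ?thesis unfolding matrix_norm_def by (rule antisym)
qed

text \<open>\<open>sl A Y\<close> says that \<open>U\<^sup>-\<^sup>m J A J\<^sup>* U\<^sup>m\<close> tends to \<open>Y\<close> in the strong operator topology.\<close>

definition sl :: "('a \<Rightarrow> 'a) \<Rightarrow> ('b \<Rightarrow> 'b) \<Rightarrow> bool" where
 "sl A Y \<longleftrightarrow> (\<forall>h\<in>carrier H. ((\<lambda>m. hnorm K (J (A (pP m h)) \<ominus> Y (J (pP m h)))) \<longlongrightarrow> 0) mset_top)"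

text \<open>The difference is the projection error of U^m Y J h, which tends to 0.\<close>

lemma sl_compress:
 assumes Y: "Y \<in> commU"
 shows "sl (compress Y) Y"
 unfolding sl_def
proof
 fix h assume h: "h \<in> carrier H"
 note Yc = K.bop_closed[OF commU_BL[OF Y]]
 have "J (compress Y (pP m h)) \<ominus> Y (J (pP m h)) = J (Jad (pU m (Y (J h)))) \<ominus> pU m (Y (J h))" for m
  using h commU_pU[OF Y, of "J h" m] by (simp add: pU_J)
 then show "((\<lambda>m. hnorm K (J (compress Y (pP m h)) \<ominus> Y (J (pP m h)))) \<longlongrightarrow> 0) mset_top"
  using proj_tendsto[OF Yc[OF J_closed[OF h]]] by simp
qed

lemma sl_one: "sl \<one>\<^bsub>BL H\<^esub> \<one>\<^bsub>BL K\<^esub>"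
 by (simp add: sl_def)

lemma sl_add:
 assumes A: "A \<in> \<B> H" "B \<in> \<B> H" and Y: "Y \<in> \<B> K" "Z \<in> \<B> K"
  and s: "sl A Y" "sl B Z"
 shows "sl (A \<oplus>\<^bsub>BL H\<^esub> B) (Y \<oplus>\<^bsub>BL K\<^esub> Z)"
 unfolding sl_def
proof
 fix h assume h: "h \<in> carrier H"
 note [simp] = H.bop_rules[OF A(1)] H.bop_rules[OF A(2)] K.bop_rules[OF Y(1)] K.bop_rules[OF Y(2)]
 let ?a = "\<lambda>m. J (A (pP m h)) \<ominus> Y (J (pP m h))" and ?b = "\<lambda>m. J (B (pP m h)) \<ominus> Z (J (pP m h))"
 have "((\<lambda>m. hnorm K (?a m) + hnorm K (?b m)) \<longlongrightarrow> 0) mset_top"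
  using tendsto_add[of "\<lambda>m. hnorm K (?a m)" 0 mset_top "\<lambda>m. hnorm K (?b m)" 0] s h by (simp add: sl_def)
 then show "((\<lambda>m. hnorm K (J ((A \<oplus>\<^bsub>BL H\<^esub> B) (pP m h)) \<ominus> (Y \<oplus>\<^bsub>BL K\<^esub> Z) (J (pP m h)))) \<longlongrightarrow> 0) mset_top"
 proof (rule squeeze_null)
  fix m
  have "J ((A \<oplus>\<^bsub>BL H\<^esub> B) (pP m h)) \<ominus> (Y \<oplus>\<^bsub>BL K\<^esub> Z) (J (pP m h)) = ?a m \<oplus> ?b m"
   by (rule K.vec_eqI) (use h in simp_all)
  then show "hnorm K (J ((A \<oplus>\<^bsub>BL H\<^esub> B) (pP m h)) \<ominus> (Y \<oplus>\<^bsub>BL K\<^esub> Z) (J (pP m h))) \<le> hnorm K (?a m) + hnorm K (?b m)"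
   using K.hnorm_triangle[of "?a m" "?b m"] h by simp
 qed (use h in simp)
qed

lemma sl_smult:
 assumes A: "A \<in> \<B> H" and Y: "Y \<in> \<B> K" and s: "sl A Y"
 shows "sl (c \<odot>\<^bsub>BL H\<^esub> A) (c \<odot>\<^bsub>BL K\<^esub> Y)"
 unfolding sl_def
proof
 fix h assume h: "h \<in> carrier H"
 note [simp] = H.bop_rules[OF A] K.bop_rules[OF Y]
 let ?a = "\<lambda>m. J (A (pP m h)) \<ominus> Y (J (pP m h))"
 have "((\<lambda>m. cmod c * hnorm K (?a m)) \<longlongrightarrow> 0) mset_top"
  using tendsto_mult[OF tendsto_const, of "\<lambda>m. hnorm K (?a m)" 0 mset_top "cmod c"] s h by (simp add: sl_def)
 moreover have "J ((c \<odot>\<^bsub>BL H\<^esub> A) (pP m h)) \<ominus> (c \<odot>\<^bsub>BL K\<^esub> Y) (J (pP m h)) = c \<odot> ?a m" for m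
  by (rule K.vec_eqI) (use h in \<open>simp_all add: right_diff_distrib\<close>)
 ultimately show "((\<lambda>m. hnorm K (J ((c \<odot>\<^bsub>BL H\<^esub> A) (pP m h)) \<ominus> (c \<odot>\<^bsub>BL K\<^esub> Y) (J (pP m h)))) \<longlongrightarrow> 0) mset_top"
  using h by simp
qed

lemma sl_eventually:
 assumes "sl A Y" "h \<in> carrier H" "e > 0"
 shows "\<exists>m. \<forall>n. m \<subseteq># n \<longrightarrow> hnorm K (J (A (pP n h)) \<ominus> Y (J (pP n h))) < e"
 using order_tendstoD(2)[of "\<lambda>m. hnorm K (J (A (pP m h)) \<ominus> Y (J (pP m h)))" 0 mset_top e] assms
 unfolding sl_def eventually_mset_top by blast

lemma slI:
 assumes A: "A \<in> \<B> H" and Y: "Y \<in> \<B> K"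
  and e: "\<And>h e. h \<in> carrier H \<Longrightarrow> e > 0 \<Longrightarrow> \<exists>m. \<forall>n. m \<subseteq># n \<longrightarrow> hnorm K (J (A (pP n h)) \<ominus> Y (J (pP n h))) < e"
 shows "sl A Y"
 unfolding sl_def
proof (intro ballI tendstoI)
 fix h and e :: real assume h: "h \<in> carrier H" and "e > 0"
 then obtain m where "\<forall>n. m \<subseteq># n \<longrightarrow> hnorm K (J (A (pP n h)) \<ominus> Y (J (pP n h))) < e" using e by blast
 moreover have "0 \<le> hnorm K (J (A (pP n h)) \<ominus> Y (J (pP n h)))" for n
  using h H.bop_closed[OF A] K.bop_closed[OF Y] by simp
 ultimately show "\<forall>\<^sub>F m in mset_top. dist (hnorm K (J (A (pP m h)) \<ominus> Y (J (pP m h)))) 0 < e"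
  unfolding eventually_mset_top by (intro exI[of _ m]) simp
qed

text \<open>Because \<open>sl A Y\<close> only tests orbits P^n h0, the vector Z J h is first
  brought close to some J h0 by a shift m0. For n = m0 + n' the vector B P^n h is then close to P^n'
  h0, where A is close to Y.\<close>

lemma sl_mult:
 assumes A: "A \<in> \<B> H" and B: "B \<in> \<B> H" and Y: "Y \<in> \<B> K" and Z: "Z \<in> commU"
  and s: "sl A Y" "sl B Z"
 shows "sl (A \<otimes>\<^bsub>BL H\<^esub> B) (Y \<otimes>\<^bsub>BL K\<^esub> Z)"
proof (rule slI)
 note Zc = commU_BL[OF Z]
 note [simp] = H.bop_rules[OF A] H.bop_rules[OF B] K.bop_rules[OF Y] K.bop_rules[OF Zc]
 show "A \<otimes>\<^bsub>BL H\<^esub> B \<in> \<B> H" "Y \<otimes>\<^bsub>BL K\<^esub> Z \<in> \<B> K" using A B Y Zc by simp_all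
 fix h and e :: real assume h: "h \<in> carrier H" and e: "e > 0"
 define a where "a = op_norm H A"
 define y where "y = op_norm K Y"
 have ay: "0 \<le> a" "0 \<le> y" using A Y by (simp_all add: a_def y_def)
 \<comment> \<open>Keeps the total error 2 a d + e / 4 + y d below e.\<close>
 define d where "d = e / (4 * (a + y + 1))"
 have d: "d > 0" using e ay by (simp add: d_def)
 have "d * (a + y + 1) = e / 4" using ay by (simp add: d_def divide_simps)
 then have ad: "a * d + y * d + d = e / 4" by (simp add: algebra_simps)
 have ad0: "0 \<le> a * d" "0 \<le> y * d" using ay d by simp_all
 obtain m0 h0 where m0: "h0 \<in> carrier H" "hnorm K (pU m0 (Z (J h)) \<ominus> J h0) \<le> d"
  using approx_J[of "Z (J h)" d] d h by auto
 obtain m1 where m1: "\<And>n. m1 \<subseteq># n \<Longrightarrow> hnorm K (J (B (pP n h)) \<ominus> Z (J (pP n h))) < d"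
  using sl_eventually[OF s(2) h d] by blast
 obtain m2 where m2: "\<And>n. m2 \<subseteq># n \<Longrightarrow> hnorm K (J (A (pP n h0)) \<ominus> Y (J (pP n h0))) < e / 4"
  using sl_eventually[OF s(1) m0(1), of "e/4"] e by auto
 have "hnorm K (J ((A \<otimes>\<^bsub>BL H\<^esub> B) (pP n h)) \<ominus> (Y \<otimes>\<^bsub>BL K\<^esub> Z) (J (pP n h))) < e"
  if n: "m0 + (m1 + m2) \<subseteq># n" for n
 proof -
  obtain n'' where n'': "n = m0 + (m1 + m2) + n''" using n by (meson mset_subset_eq_exists_conv)
  define n' where "n' = m1 + m2 + n''"
  have nn: "n = m0 + n'" by (simp add: n'' n'_def add.assoc)
  have sub: "m1 \<subseteq># n" "m2 \<subseteq># n'" by (simp_all add: n'' n'_def subset_mset.add_increasing subset_mset.add_increasing2)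
  define u where "u = pP n h"
  define w where "w = pP n' h0"
  have c: "u \<in> carrier H" "w \<in> carrier H" using h m0 by (simp_all add: u_def w_def)
  have Zu: "Z (J u) = pU n (Z (J h))" using h commU_pU[OF Z, of "J h" n] by (simp add: u_def pU_J)
  have zw: "hnorm K (Z (J u) \<ominus> J w) \<le> d"
   unfolding Zu w_def nn by (rule approx_J_mono) (use h m0 in simp_all)
  have bz: "hnorm K (J (B u) \<ominus> Z (J u)) \<le> d" using m1[OF sub(1)] by (simp add: u_def)
  have bw: "hnorm K (J (B u) \<ominus> J w) \<le> d + d"
   using K.hnorm_triangle_dist[of "J (B u)" "Z (J u)" "J w"] c bz zw by simp
  have "J (A (B u)) \<ominus> J (A w) = J (A (B u \<ominus>\<^bsub>H\<^esub> w))" using c by simp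
  then have t1: "hnorm K (J (A (B u)) \<ominus> J (A w)) \<le> a * (d + d)"
  proof -
   assume "J (A (B u)) \<ominus> J (A w) = J (A (B u \<ominus>\<^bsub>H\<^esub> w))"
   then have "hnorm K (J (A (B u)) \<ominus> J (A w)) = hnorm H (A (B u \<ominus>\<^bsub>H\<^esub> w))"
    using hnorm_J[of "A (B u \<ominus>\<^bsub>H\<^esub> w)"] c by (simp only:) simp
   also have "\<dots> \<le> a * hnorm H (B u \<ominus>\<^bsub>H\<^esub> w)" unfolding a_def by (rule H.op_norm_bound[OF A]) (use c in simp)
   also have "hnorm H (B u \<ominus>\<^bsub>H\<^esub> w) = hnorm K (J (B u) \<ominus> J w)"
    using hnorm_J[of "B u \<ominus>\<^bsub>H\<^esub> w"] c by simp
   also have "a * hnorm K (J (B u) \<ominus> J w) \<le> a * (d + d)" using bw ay by (intro mult_left_mono)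
   finally show ?thesis .
  qed
  have t2: "hnorm K (J (A w) \<ominus> Y (J w)) < e / 4" using m2[OF sub(2)] by (simp add: w_def)
  have "hnorm K (Y (J w) \<ominus> Y (Z (J u))) \<le> y * hnorm K (J w \<ominus> Z (J u))"
   using K.op_norm_bound[OF Y, of "J w \<ominus> Z (J u)"] c by (simp add: y_def)
  also have "hnorm K (J w \<ominus> Z (J u)) = hnorm K (Z (J u) \<ominus> J w)"
   by (rule K.hnorm_minus_commute) (use c in simp_all)
  also have "y * hnorm K (Z (J u) \<ominus> J w) \<le> y * d" using zw ay by (intro mult_left_mono)
  finally have t3: "hnorm K (Y (J w) \<ominus> Y (Z (J u))) \<le> y * d" .
  have "hnorm K (J (A (B u)) \<ominus> Y (Z (J u))) \<le> hnorm K (J (A (B u)) \<ominus> J (A w)) + hnorm K (J (A w) \<ominus> Y (Z (J u)))"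
   by (rule K.hnorm_triangle_dist) (use c in simp_all)
  moreover have "hnorm K (J (A w) \<ominus> Y (Z (J u))) \<le> hnorm K (J (A w) \<ominus> Y (J w)) + hnorm K (Y (J w) \<ominus> Y (Z (J u)))"
   by (rule K.hnorm_triangle_dist) (use c in simp_all)
  ultimately have "hnorm K (J (A (B u)) \<ominus> Y (Z (J u))) < e"
   using t1 t2 t3 ad ad0 d e by (simp only: distrib_left)
  then show ?thesis using c by (simp add: u_def[symmetric])
 qed
 then show "\<exists>m. \<forall>n. m \<subseteq># n \<longrightarrow> hnorm K (J ((A \<otimes>\<^bsub>BL H\<^esub> B) (pP n h)) \<ominus> (Y \<otimes>\<^bsub>BL K\<^esub> Z) (J (pP n h))) < e" by blast
qed

text \<open>The norm of Y k equals that of Y U^m k. For large m the vector U^m k is close to J w for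
  some w in H with ||w|| \<le> ||k|| + e, and at J w the operator Y is close to A.\<close>

lemma sl_norm:
 assumes A: "A \<in> \<B> H" and Y: "Y \<in> commU" and s: "sl A Y"
 shows "op_norm K Y \<le> op_norm H A"
proof (rule K.op_norm_le)
 note Yc = commU_BL[OF Y]
 note [simp] = H.bop_rules[OF A] K.bop_rules[OF Yc]
 define a where "a = op_norm H A"
 define y where "y = op_norm K Y"
 have ay: "0 \<le> a" "0 \<le> y" using A Yc by (simp_all add: a_def y_def)
 fix k assume k: "k \<in> carrier K"
 have "hnorm K (Y k) - a * hnorm K k \<le> (a + 1 + y) * e" if e: "e > 0" for e
 proof -
  obtain m h where mh: "h \<in> carrier H" "hnorm K (pU m k \<ominus> J h) \<le> e" using approx_J[OF k e] by blast
  obtain n where n: "\<And>n'. n \<subseteq># n' \<Longrightarrow> hnorm K (J (A (pP n' h)) \<ominus> Y (J (pP n' h))) < e"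
   using sl_eventually[OF s mh(1) e] by blast
  define w where "w = pP n h"
  have w: "w \<in> carrier H" "hnorm H w = hnorm H h" using mh by (simp_all add: w_def)
  have sw: "hnorm K (J (A w) \<ominus> Y (J w)) < e" using n[of n] by (simp add: w_def)
  have "hnorm K (Y k) = hnorm K (Y (pU (m + n) k))" using commU_pU[OF Y k] k by simp
  also have "\<dots> \<le> hnorm K (Y (J w)) + hnorm K (Y (pU (m + n) k) \<ominus> Y (J w))"
   by (rule K.hnorm_triangle_diff) (use k w in simp_all)
  also have "hnorm K (Y (pU (m + n) k) \<ominus> Y (J w)) \<le> y * hnorm K (pU (m + n) k \<ominus> J w)"
   using K.op_norm_bound[OF Yc, of "pU (m + n) k \<ominus> J w"] k w by (simp add: y_def)
  also have "y * hnorm K (pU (m + n) k \<ominus> J w) \<le> y * e"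
   unfolding w_def by (intro mult_left_mono approx_J_mono[OF k mh] ay)
  also have "hnorm K (Y (J w)) \<le> hnorm K (J (A w)) + hnorm K (J (A w) \<ominus> Y (J w))"
   using K.hnorm_triangle_diff[of "Y (J w)" "J (A w)"] K.hnorm_minus_commute[of "Y (J w)" "J (A w)"] w by simp
  also have "hnorm K (J (A w)) \<le> a * hnorm H h"
   using H.op_norm_bound[OF A w(1)] w by (simp add: a_def)
  also have "a * hnorm H h \<le> a * (hnorm K k + e)"
  proof (rule mult_left_mono[OF _ ay(1)])
   have "hnorm K (J h) \<le> hnorm K (pU m k) + hnorm K (J h \<ominus> pU m k)"
    by (rule K.hnorm_triangle_diff) (use k mh in simp_all)
   then show "hnorm H h \<le> hnorm K k + e"
    using mh k K.hnorm_minus_commute[of "J h" "pU m k"] by simp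
  qed
  finally have "hnorm K (Y k) \<le> a * (hnorm K k + e) + hnorm K (J (A w) \<ominus> Y (J w)) + y * e" by simp
  then show ?thesis using sw by (simp add: algebra_simps)
 qed
 then have "hnorm K (Y k) - a * hnorm K k \<le> 0" by (rule nonpos_if_le_eps)
 then show "hnorm K (Y k) \<le> op_norm H A * hnorm K k" by (simp add: a_def)
qed (use A in simp)

lemma sl_limit:
 assumes A: "\<And>n. A n \<in> \<B> H" "B \<in> \<B> H" "(\<lambda>n. op_norm H (A n \<ominus>\<^bsub>BL H\<^esub> B)) \<longlonglongrightarrow> 0"
  and Y: "\<And>n. Y n \<in> \<B> K" "Z \<in> \<B> K" "(\<lambda>n. op_norm K (Y n \<ominus>\<^bsub>BL K\<^esub> Z)) \<longlonglongrightarrow> 0"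
  and s: "\<And>n. sl (A n) (Y n)"
 shows "sl B Z"
proof (rule slI[OF A(2) Y(2)])
 note [simp] = H.bop_rules[OF A(1)] H.bop_rules[OF A(2)] K.bop_rules[OF Y(1)] K.bop_rules[OF Y(2)]
 fix h and e :: real assume h: "h \<in> carrier H" and e: "e > 0"
 define d where "d = e / (3 * (hnorm H h + 1))"
 have hn: "0 \<le> hnorm H h" using h by simp
 then have d: "d > 0" using e by (simp add: d_def)
 have "d * (hnorm H h + 1) = e / 3" using hn by (simp add: d_def divide_simps)
 then have dh: "d * hnorm H h \<le> e / 3" using d by (simp add: distrib_left)
 obtain N1 where N1: "\<And>n. n \<ge> N1 \<Longrightarrow> op_norm H (A n \<ominus>\<^bsub>BL H\<^esub> B) < d"
  using order_tendstoD(2)[OF A(3) d] unfolding eventually_sequentially by blast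
 obtain N2 where N2: "\<And>n. n \<ge> N2 \<Longrightarrow> op_norm K (Y n \<ominus>\<^bsub>BL K\<^esub> Z) < d"
  using order_tendstoD(2)[OF Y(3) d] unfolding eventually_sequentially by blast
 define n where "n = max N1 N2"
 have n: "op_norm H (A n \<ominus>\<^bsub>BL H\<^esub> B) \<le> d" "op_norm K (Y n \<ominus>\<^bsub>BL K\<^esub> Z) \<le> d"
  using N1[of n] N2[of n] by (simp_all add: n_def less_imp_le)
 obtain m where m: "\<And>q. m \<subseteq># q \<Longrightarrow> hnorm K (J (A n (pP q h)) \<ominus> Y n (J (pP q h))) < e / 3"
  using sl_eventually[OF s h, of "e/3"] e by (metis divide_pos_pos zero_less_numeral)
 have "hnorm K (J (B (pP q h)) \<ominus> Z (J (pP q h))) < e" if q: "m \<subseteq># q" for q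
 proof -
  let ?u = "pP q h"
  have "hnorm K (J (B ?u) \<ominus> J (A n ?u)) = hnorm H ((A n \<ominus>\<^bsub>BL H\<^esub> B) ?u)"
   using hnorm_J[of "A n ?u \<ominus>\<^bsub>H\<^esub> B ?u"] h A K.hnorm_minus_commute[of "J (B ?u)" "J (A n ?u)"] by simp
  also have "\<dots> \<le> op_norm H (A n \<ominus>\<^bsub>BL H\<^esub> B) * hnorm H ?u" by (rule H.op_norm_bound) (use A h in simp_all)
  also have "\<dots> \<le> d * hnorm H h" using n(1) h by (simp add: mult_right_mono)
  finally have t1: "hnorm K (J (B ?u) \<ominus> J (A n ?u)) \<le> e / 3" using dh by linarith
  have "hnorm K (Y n (J ?u) \<ominus> Z (J ?u)) = hnorm K ((Y n \<ominus>\<^bsub>BL K\<^esub> Z) (J ?u))" using h Y by simp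
  also have "\<dots> \<le> op_norm K (Y n \<ominus>\<^bsub>BL K\<^esub> Z) * hnorm K (J ?u)" by (rule K.op_norm_bound) (use Y h in simp_all)
  also have "\<dots> \<le> d * hnorm H h" using n(2) h by (simp add: mult_right_mono)
  finally have t3: "hnorm K (Y n (J ?u) \<ominus> Z (J ?u)) \<le> e / 3" using dh by linarith
  have "hnorm K (J (B ?u) \<ominus> Z (J ?u)) \<le> hnorm K (J (B ?u) \<ominus> J (A n ?u)) + hnorm K (J (A n ?u) \<ominus> Z (J ?u))"
   by (rule K.hnorm_triangle_dist) (use h in simp_all)
  moreover have "hnorm K (J (A n ?u) \<ominus> Z (J ?u)) \<le> hnorm K (J (A n ?u) \<ominus> Y n (J ?u)) + hnorm K (Y n (J ?u) \<ominus> Z (J ?u))"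
   by (rule K.hnorm_triangle_dist) (use h in simp_all)
  ultimately show ?thesis using t1 t3 m[OF q] by linarith
 qed
 then show "\<exists>m. \<forall>q. m \<subseteq># q \<longrightarrow> hnorm K (J (B (pP q h)) \<ominus> Z (J (pP q h))) < e" by blast
qed

end

section \<open>The homomorphism \<open>pi0\<close>, its cross section and its kernel\<close>

context gamma_extension
begin

abbreviation CF :: "('a \<Rightarrow> 'a) set" where "CF \<equiv> Cstar H (family_ops \<Lambda> S P)"
abbreviation CG :: "('b \<Rightarrow> 'b) set" where "CG \<equiv> Cstar K (family_ops \<Lambda> R U)"

lemmas CF_star = H.Cstar_star_subalgebra[OF family_H]
lemmas CG_star = K.Cstar_star_subalgebra[OF family_K]
lemmas CF = H.unital_star_subalgebraD(2-)[OF CF_star]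
lemmas CG = K.unital_star_subalgebraD(2-)[OF CG_star]

lemma CF_BL [simp]: "A \<in> CF \<Longrightarrow> A \<in> \<B> H"
 using H.Cstar_subset[OF family_H] by blast

lemma CG_BL [simp]: "Y \<in> CG \<Longrightarrow> Y \<in> \<B> K"
 using K.Cstar_subset[OF family_K] by blast

lemma gens_CF: "a \<in> \<Lambda> \<Longrightarrow> S a \<in> CF" "a \<in> \<Lambda> \<Longrightarrow> P a \<in> CF"
 using H.Cstar_superset[of "family_ops \<Lambda> S P"] by (auto simp: family_ops_def)

lemma gens_CG: "a \<in> \<Lambda> \<Longrightarrow> R a \<in> CG" "a \<in> \<Lambda> \<Longrightarrow> U a \<in> CG"
 using K.Cstar_superset[of "family_ops \<Lambda> R U"] by (auto simp: family_ops_def)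

lemma family_commutant: "T \<in> family_ops \<Lambda> R U \<Longrightarrow> T \<in> commutant K (family_ops \<Lambda> R U)"
 using comm_K family_K unfolding commuting_ops_def commutant_def by blast

lemma commutant_commutes_CG:
 assumes Y: "Y \<in> commutant K (family_ops \<Lambda> R U)" and Z: "Z \<in> CG"
 shows "Y \<otimes>\<^bsub>BL K\<^esub> Z = Z \<otimes>\<^bsub>BL K\<^esub> Y"
proof (rule K.Cstar_commutes[OF family_K _ _ _ Z])
 show "Y \<in> \<B> K" using Y by (simp add: commutant_def)
 fix T assume "T \<in> family_ops \<Lambda> R U"
 then obtain a where "a \<in> \<Lambda>" "T = R a \<or> T = U a" unfolding family_ops_def by blast
 then show "Y \<otimes>\<^bsub>BL K\<^esub> T = T \<otimes>\<^bsub>BL K\<^esub> Y" "Y \<otimes>\<^bsub>BL K\<^esub> adj K T = adj K T \<otimes>\<^bsub>BL K\<^esub> Y"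
  using commutant_adj[OF Y] by metis+
qed

lemma CG_commutant: "Z \<in> CG \<Longrightarrow> Z \<in> commutant K (family_ops \<Lambda> R U)"
proof -
 assume Z: "Z \<in> CG"
 have "Z \<otimes>\<^bsub>BL K\<^esub> T = T \<otimes>\<^bsub>BL K\<^esub> Z" if "T \<in> family_ops \<Lambda> R U" for T
  by (rule commutant_commutes_CG[OF family_commutant[OF that] Z, symmetric])
 then show ?thesis using CG_BL[OF Z] unfolding commutant_def by blast
qed

lemma CG_commute: "Y \<in> CG \<Longrightarrow> Z \<in> CG \<Longrightarrow> Y \<otimes>\<^bsub>BL K\<^esub> Z = Z \<otimes>\<^bsub>BL K\<^esub> Y"
 by (rule commutant_commutes_CG[OF CG_commutant])

lemma CG_commU [simp]: "Y \<in> CG \<Longrightarrow> Y \<in> commU"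
 by (rule commutant_commU[OF CG_commutant])

lemma compress_U: "a \<in> \<Lambda> \<Longrightarrow> compress (U a) = P a"
 by (rule H.bop_eqI) (simp_all add: UJ U P)

lemma compress_R: "a \<in> \<Lambda> \<Longrightarrow> compress (R a) = S a"
 by (rule H.bop_eqI) (simp_all add: RJ R S)

lemma sl_minus:
 assumes "A \<in> \<B> H" "B \<in> \<B> H" "Y \<in> \<B> K" "Z \<in> \<B> K" "sl A Y" "sl B Z"
 shows "sl (A \<ominus>\<^bsub>BL H\<^esub> B) (Y \<ominus>\<^bsub>BL K\<^esub> Z)"
 unfolding H.BL_minus[OF assms(1,2)] K.BL_minus[OF assms(3,4)]
 by (rule sl_add) (use assms sl_smult in simp_all)

lemma op_norm_K_le_0:
 assumes T: "T \<in> \<B> K" and le: "op_norm K T \<le> 0"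
 shows "T = \<zero>\<^bsub>BL K\<^esub>"
proof (rule K.op_norm_eq_0[OF T])
 show "op_norm K T = 0" using K.op_norm_nonneg[OF T] le by linarith
qed

lemma sl_diff_norm:
 assumes "A \<in> \<B> H" "B \<in> \<B> H" "Y \<in> CG" "Z \<in> CG" "sl A Y" "sl B Z"
 shows "op_norm K (Y \<ominus>\<^bsub>BL K\<^esub> Z) \<le> op_norm H (A \<ominus>\<^bsub>BL H\<^esub> B)"
 by (rule sl_norm) (use assms CG sl_minus in simp_all)

lemma sl_unique:
 assumes "A \<in> \<B> H" "Y \<in> CG" "Z \<in> CG" "sl A Y" "sl A Z"
 shows "Y = Z"
proof -
 have "A \<ominus>\<^bsub>BL H\<^esub> A = \<zero>\<^bsub>BL H\<^esub>" using assms(1) H.BL.r_right_minus_eq[of A A] by simp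
 then have "op_norm K (Y \<ominus>\<^bsub>BL K\<^esub> Z) \<le> 0" using sl_diff_norm[OF assms(1,1,2,3,4,5)] by simp
 then have "Y \<ominus>\<^bsub>BL K\<^esub> Z = \<zero>\<^bsub>BL K\<^esub>"
  by (rule op_norm_K_le_0[OF CG_BL[OF CG(6)[OF assms(2,3)]]])
 then show ?thesis using assms(2,3) K.BL.r_right_minus_eq[of Y Z] by simp
qed

text \<open>Strong limits are in general not preserved by adjoints, so the limit of A^* is carried
  along to make D a star-algebra. D is closed because \<open>sl_diff_norm\<close> makes the limits
  of a convergent sequence of operators Cauchy.\<close>

lemma CF_sl:
 assumes A: "A \<in> CF"
 shows "\<exists>Y\<in>CG. sl A Y \<and> sl (adj H A) (adj K Y)"
proof -
 define D where "D = {A \<in> CF. \<exists>Y\<in>CG. sl A Y \<and> sl (adj H A) (adj K Y)}"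
 have DI: "A \<in> D" if "A \<in> CF" "Y \<in> CG" "sl A Y" "sl (adj H A) (adj K Y)" for A Y
  using that by (auto simp: D_def)
 have compr: "compress Y \<in> D" if "Y \<in> CG" "compress Y \<in> CF" for Y
  by (rule DI[OF that(2,1) sl_compress]) (use that CG sl_compress[of "adj K Y"] in \<open>simp_all add: compress_adj\<close>)
 have "CF \<subseteq> D"
 proof (rule H.Cstar_minimal)
  show "family_ops \<Lambda> S P \<subseteq> D"
  proof
   fix T assume "T \<in> family_ops \<Lambda> S P"
   then obtain a where a: "a \<in> \<Lambda>" "T = S a \<or> T = P a" unfolding family_ops_def by blast
   have "S a \<in> D" using compr[of "R a"] gens_CG[OF a(1)] gens_CF[OF a(1)] compress_R[OF a(1)] by simp
   moreover have "P a \<in> D" using compr[of "U a"] gens_CG[OF a(1)] gens_CF[OF a(1)] compress_U[OF a(1)] by simp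
   ultimately show "T \<in> D" using a(2) by blast
  qed
  show "unital_star_subalgebra H D"
  proof (rule H.unital_star_subalgebraI)
   show "D \<subseteq> \<B> H" by (auto simp: D_def)
   show "\<one>\<^bsub>BL H\<^esub> \<in> D" by (rule DI[OF CF(1) CG(1) sl_one]) (simp add: sl_one)
  next
   fix A B assume "A \<in> D" "B \<in> D"
   then obtain Y Z where A: "A \<in> CF" "B \<in> CF" and Y: "Y \<in> CG" "Z \<in> CG"
    and s: "sl A Y" "sl (adj H A) (adj K Y)" "sl B Z" "sl (adj H B) (adj K Z)" by (auto simp: D_def)
   show "A \<otimes>\<^bsub>BL H\<^esub> B \<in> D"
   proof (rule DI[OF CF(2)[OF A] CG(2)[OF Y]])
    show "sl (A \<otimes>\<^bsub>BL H\<^esub> B) (Y \<otimes>\<^bsub>BL K\<^esub> Z)" by (rule sl_mult) (use A Y s in simp_all)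
    have "sl (adj H B \<otimes>\<^bsub>BL H\<^esub> adj H A) (adj K Z \<otimes>\<^bsub>BL K\<^esub> adj K Y)"
     by (rule sl_mult) (use A Y s CG in simp_all)
    then show "sl (adj H (A \<otimes>\<^bsub>BL H\<^esub> B)) (adj K (Y \<otimes>\<^bsub>BL K\<^esub> Z))" using A Y by (simp add: H.adj_mult K.adj_mult)
   qed
   show "A \<oplus>\<^bsub>BL H\<^esub> B \<in> D"
   proof (rule DI[OF CF(3)[OF A] CG(3)[OF Y]])
    show "sl (A \<oplus>\<^bsub>BL H\<^esub> B) (Y \<oplus>\<^bsub>BL K\<^esub> Z)" by (rule sl_add) (use A Y s in simp_all)
    have "sl (adj H A \<oplus>\<^bsub>BL H\<^esub> adj H B) (adj K Y \<oplus>\<^bsub>BL K\<^esub> adj K Z)"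
     by (rule sl_add) (use A Y s in simp_all)
    then show "sl (adj H (A \<oplus>\<^bsub>BL H\<^esub> B)) (adj K (Y \<oplus>\<^bsub>BL K\<^esub> Z))" using A Y by (simp add: H.adj_add K.adj_add)
   qed
  next
   fix c A assume "A \<in> D"
   then obtain Y where A: "A \<in> CF" and Y: "Y \<in> CG" and s: "sl A Y" "sl (adj H A) (adj K Y)" by (auto simp: D_def)
   show "c \<odot>\<^bsub>BL H\<^esub> A \<in> D"
   proof (rule DI[OF CF(4)[OF A] CG(4)[OF Y]])
    show "sl (c \<odot>\<^bsub>BL H\<^esub> A) (c \<odot>\<^bsub>BL K\<^esub> Y)" by (rule sl_smult) (use A Y s in simp_all)
    have "sl (cnj c \<odot>\<^bsub>BL H\<^esub> adj H A) (cnj c \<odot>\<^bsub>BL K\<^esub> adj K Y)" by (rule sl_smult) (use A Y s in simp_all)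
    then show "sl (adj H (c \<odot>\<^bsub>BL H\<^esub> A)) (adj K (c \<odot>\<^bsub>BL K\<^esub> Y))" using A Y by (simp add: H.adj_smult K.adj_smult)
   qed
   show "adj H A \<in> D" by (rule DI[OF CF(5)[OF A] CG(5)[OF Y]]) (use A Y s in simp_all)
  qed
  show "closedin (op_norm_topology H) D"
   unfolding H.closedin_op_norm_iff
  proof (intro conjI allI impI)
   fix A B assume A: "\<forall>n. A n \<in> D" and B: "B \<in> \<B> H"
    and lim: "(\<lambda>n. op_norm H (A n \<ominus>\<^bsub>BL H\<^esub> B)) \<longlonglongrightarrow> 0"
   have Ac: "A n \<in> CF" for n using A by (auto simp: D_def)
   have "B \<in> CF" using H.Cstar_closed[OF family_H] Ac B lim unfolding H.closedin_op_norm_iff by blast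
   have "\<exists>Y. Y \<in> CG \<and> sl (A n) Y \<and> sl (adj H (A n)) (adj K Y)" for n using A by (auto simp: D_def)
   then obtain Y where Y: "\<And>n. Y n \<in> CG" "\<And>n. sl (A n) (Y n)" "\<And>n. sl (adj H (A n)) (adj K (Y n))" by metis
   have dist: "op_norm K (Y m \<ominus>\<^bsub>BL K\<^esub> Y n) \<le> op_norm H (A m \<ominus>\<^bsub>BL H\<^esub> B) + op_norm H (A n \<ominus>\<^bsub>BL H\<^esub> B)" for m n
    using sl_diff_norm[OF CF_BL[OF Ac] CF_BL[OF Ac] Y(1) Y(1) Y(2) Y(2), of m n]
     H.op_norm_triangle_dist[of "A m" B "A n"] H.op_norm_minus_commute[of B "A n"] Ac B by simp
   obtain Z where Z: "Z \<in> \<B> K" "(\<lambda>n. op_norm K (Y n \<ominus>\<^bsub>BL K\<^esub> Z)) \<longlonglongrightarrow> 0"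
   proof (rule K.op_Cauchy_convergent[of Y])
    fix e :: real assume e: "e > 0"
    obtain N where N: "\<And>n. n \<ge> N \<Longrightarrow> op_norm H (A n \<ominus>\<^bsub>BL H\<^esub> B) < e / 2"
     using order_tendstoD(2)[OF lim, of "e/2"] e unfolding eventually_sequentially by auto
    have "op_norm K (Y m \<ominus>\<^bsub>BL K\<^esub> Y n) < e" if "m \<ge> N" "n \<ge> N" for m n
     using dist[of m n] N[OF that(1)] N[OF that(2)] by linarith
    then show "\<exists>N. \<forall>m\<ge>N. \<forall>n\<ge>N. op_norm K (Y m \<ominus>\<^bsub>BL K\<^esub> Y n) < e" by blast
   qed (use Y(1) in simp)
   have "Z \<in> CG" using K.Cstar_closed[OF family_K] Y(1) Z unfolding K.closedin_op_norm_iff by blast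
   moreover have "sl B Z" by (rule sl_limit[OF _ B lim _ Z Y(2)]) (use Ac Y(1) in simp_all)
   moreover have "sl (adj H B) (adj K Z)"
   proof (rule sl_limit[OF _ _ _ _ _ _ Y(3)])
    show "(\<lambda>n. op_norm H (adj H (A n) \<ominus>\<^bsub>BL H\<^esub> adj H B)) \<longlonglongrightarrow> 0"
     using lim Ac B by (simp add: H.op_norm_diff_adj)
    show "(\<lambda>n. op_norm K (adj K (Y n) \<ominus>\<^bsub>BL K\<^esub> adj K Z)) \<longlonglongrightarrow> 0"
     using Z Y(1) by (simp add: K.op_norm_diff_adj)
   qed (use Ac B Y(1) Z in simp_all)
   ultimately show "B \<in> D" using \<open>B \<in> CF\<close> by (intro DI)
  qed (auto simp: D_def)
 qed
 then show ?thesis using A by (auto simp: D_def)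
qed

definition pi0 :: "('a \<Rightarrow> 'a) \<Rightarrow> ('b \<Rightarrow> 'b)" where
 "pi0 A = (THE Y. Y \<in> CG \<and> sl A Y)"

lemma pi0_eqI:
 assumes A: "A \<in> CF" and Y: "Y \<in> CG" "sl A Y"
 shows "pi0 A = Y"
 unfolding pi0_def
proof (rule the_equality)
 show "Y \<in> CG \<and> sl A Y" using Y by blast
 show "Z = Y" if "Z \<in> CG \<and> sl A Z" for Z
  by (rule sl_unique[OF CF_BL[OF A] conjunct1[OF that] Y(1) conjunct2[OF that] Y(2)])
qed

lemma pi0:
 assumes A: "A \<in> CF"
 shows "pi0 A \<in> CG" "sl A (pi0 A)" "pi0 (adj H A) = adj K (pi0 A)"
proof -
 obtain Y where Y: "Y \<in> CG" "sl A Y" "sl (adj H A) (adj K Y)" using CF_sl[OF A] by blast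
 have e: "pi0 A = Y" by (rule pi0_eqI[OF A Y(1,2)])
 show "pi0 A \<in> CG" "sl A (pi0 A)" using e Y by simp_all
 show "pi0 (adj H A) = adj K (pi0 A)" unfolding e by (rule pi0_eqI[OF CF(5)[OF A] CG(5)[OF Y(1)] Y(3)])
qed

lemma pi0_mult: "A \<in> CF \<Longrightarrow> B \<in> CF \<Longrightarrow> pi0 (A \<otimes>\<^bsub>BL H\<^esub> B) = pi0 A \<otimes>\<^bsub>BL K\<^esub> pi0 B"
 by (rule pi0_eqI) (use pi0 CF CG in \<open>simp_all add: sl_mult\<close>)

lemma pi0_add: "A \<in> CF \<Longrightarrow> B \<in> CF \<Longrightarrow> pi0 (A \<oplus>\<^bsub>BL H\<^esub> B) = pi0 A \<oplus>\<^bsub>BL K\<^esub> pi0 B"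
 by (rule pi0_eqI) (use pi0 CF CG in \<open>simp_all add: sl_add\<close>)

lemma pi0_smult: "A \<in> CF \<Longrightarrow> pi0 (c \<odot>\<^bsub>BL H\<^esub> A) = c \<odot>\<^bsub>BL K\<^esub> pi0 A"
 by (rule pi0_eqI) (use pi0 CF CG in \<open>simp_all add: sl_smult\<close>)

lemma pi0_minus: "A \<in> CF \<Longrightarrow> B \<in> CF \<Longrightarrow> pi0 (A \<ominus>\<^bsub>BL H\<^esub> B) = pi0 A \<ominus>\<^bsub>BL K\<^esub> pi0 B"
 by (rule pi0_eqI) (use pi0 CF CG in \<open>simp_all add: sl_minus\<close>)

lemma pi0_one: "pi0 \<one>\<^bsub>BL H\<^esub> = \<one>\<^bsub>BL K\<^esub>"
 by (rule pi0_eqI[OF CF(1) CG(1) sl_one])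

lemma pi0_norm: "A \<in> CF \<Longrightarrow> op_norm K (pi0 A) \<le> op_norm H A"
 by (rule sl_norm) (use pi0 in simp_all)

lemma pi0_compress: "Y \<in> CG \<Longrightarrow> compress Y \<in> CF \<Longrightarrow> pi0 (compress Y) = Y"
 by (rule pi0_eqI) (simp_all add: sl_compress)

lemma pi0_gens: "a \<in> \<Lambda> \<Longrightarrow> pi0 (P a) = U a" "a \<in> \<Lambda> \<Longrightarrow> pi0 (S a) = R a"
 using pi0_compress[of "U a"] pi0_compress[of "R a"] gens_CF[of a] gens_CG[of a] by (simp_all add: compress_U compress_R)

lemma pi0_hom: "unital_star_hom H CF K CG pi0"
 unfolding unital_star_hom_def
proof (intro conjI allI ballI ring_hom_memI)
 show "pi0 (c \<odot>\<^bsub>BL H\<^esub> T) = c \<odot>\<^bsub>BL K\<^esub> pi0 T" if "T \<in> CF" for c T by (rule pi0_smult[OF that])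
 show "pi0 (adj H T) = adj K (pi0 T)" if "T \<in> CF" for T by (rule pi0(3)[OF that])
qed (simp_all add: pi0 pi0_mult pi0_add pi0_one)

lemma Jad_adj_U: "a \<in> \<Lambda> \<Longrightarrow> k \<in> carrier K \<Longrightarrow> Jad (adj K (U a) k) = adj H (P a) (Jad k)"
 by (rule H.vec_eqI) (simp_all add: UJ U P)

lemma Jad_adj_R: "a \<in> \<Lambda> \<Longrightarrow> k \<in> carrier K \<Longrightarrow> Jad (adj K (R a) k) = adj H (S a) (Jad k)"
 by (rule H.vec_eqI) (simp_all add: RJ R S)

text \<open>Y commutes with U_a and U_a J = J P_a, so U_a reappears on the right as P_a. From J^*
  U_a^* = P_a^* J^* the adjoint stays on the left. The same holds for R_a and S_a.\<close>

lemma compress_mult_gens: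
 assumes a: "a \<in> \<Lambda>" and Y: "Y \<in> CG"
 shows "compress (U a \<otimes>\<^bsub>BL K\<^esub> Y) = compress Y \<otimes>\<^bsub>BL H\<^esub> P a" "compress (R a \<otimes>\<^bsub>BL K\<^esub> Y) = compress Y \<otimes>\<^bsub>BL H\<^esub> S a"
  "compress (adj K (U a) \<otimes>\<^bsub>BL K\<^esub> Y) = adj H (P a) \<otimes>\<^bsub>BL H\<^esub> compress Y"
  "compress (adj K (R a) \<otimes>\<^bsub>BL K\<^esub> Y) = adj H (S a) \<otimes>\<^bsub>BL H\<^esub> compress Y"
proof -
 note [simp] = K.bop_rules[OF CG_BL[OF Y]]
 have YU: "U a (Y (J h)) = Y (J (P a h))" and YR: "R a (Y (J h)) = Y (J (S a h))" if h: "h \<in> carrier H" for h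
  using K.commuteD[OF CG_commute[OF Y gens_CG(2)[OF a]], of "J h"] K.commuteD[OF CG_commute[OF Y gens_CG(1)[OF a]], of "J h"]
   h a by (simp_all add: UJ RJ)
 show "compress (U a \<otimes>\<^bsub>BL K\<^esub> Y) = compress Y \<otimes>\<^bsub>BL H\<^esub> P a"
  by (rule H.bop_eqI) (use a Y in \<open>simp_all add: YU U P\<close>)
 show "compress (R a \<otimes>\<^bsub>BL K\<^esub> Y) = compress Y \<otimes>\<^bsub>BL H\<^esub> S a"
  by (rule H.bop_eqI) (use a Y in \<open>simp_all add: YR R S\<close>)
 show "compress (adj K (U a) \<otimes>\<^bsub>BL K\<^esub> Y) = adj H (P a) \<otimes>\<^bsub>BL H\<^esub> compress Y"
  by (rule H.bop_eqI) (use a Y in \<open>simp_all add: Jad_adj_U U P\<close>)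
 show "compress (adj K (R a) \<otimes>\<^bsub>BL K\<^esub> Y) = adj H (S a) \<otimes>\<^bsub>BL H\<^esub> compress Y"
  by (rule H.bop_eqI) (use a Y in \<open>simp_all add: Jad_adj_R R S\<close>)
qed

lemma op_norm_compress_diff:
 "Y \<in> \<B> K \<Longrightarrow> Z \<in> \<B> K \<Longrightarrow>
  op_norm H (compress Y \<ominus>\<^bsub>BL H\<^esub> compress Z) \<le> op_norm K (Y \<ominus>\<^bsub>BL K\<^esub> Z)"
 using op_norm_compress_le[of "Y \<ominus>\<^bsub>BL K\<^esub> Z"] by (simp add: compress_minus)

text \<open>The Y whose compression lies in CF are not visibly closed under products. By
  \<open>compress_mult_gens\<close> they are closed under left multiplication by generators and
  their adjoints, which is what \<open>Cstar_left_induct\<close> asks for.\<close>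

lemma compress_CF:
 assumes Y: "Y \<in> CG"
 shows "compress Y \<in> CF"
proof -
 have "CG \<subseteq> {Y \<in> CG. compress Y \<in> CF}"
 proof (rule K.Cstar_left_induct[OF family_K])
  show "{Y \<in> CG. compress Y \<in> CF} \<subseteq> \<B> K" by auto
  show "\<one>\<^bsub>BL K\<^esub> \<in> {Y \<in> CG. compress Y \<in> CF}" using CF(1) CG(1) by (simp add: compress_one)
  show "Y \<oplus>\<^bsub>BL K\<^esub> Z \<in> {Y \<in> CG. compress Y \<in> CF}"
   if "Y \<in> {Y \<in> CG. compress Y \<in> CF}" "Z \<in> {Y \<in> CG. compress Y \<in> CF}" for Y Z
   using that CF CG by (simp add: compress_add)
  show "c \<odot>\<^bsub>BL K\<^esub> Y \<in> {Y \<in> CG. compress Y \<in> CF}" if "Y \<in> {Y \<in> CG. compress Y \<in> CF}" for c Y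
   using that CF CG by (simp add: compress_smult)
  show "closedin (op_norm_topology K) {Y \<in> CG. compress Y \<in> CF}"
   unfolding K.closedin_op_norm_iff
  proof (intro conjI allI impI)
   fix Y Z assume Y: "\<forall>n. Y n \<in> {Y \<in> CG. compress Y \<in> CF}" and Z: "Z \<in> \<B> K"
    and lim: "(\<lambda>n. op_norm K (Y n \<ominus>\<^bsub>BL K\<^esub> Z)) \<longlonglongrightarrow> 0"
   have "Z \<in> CG" using K.Cstar_closed[OF family_K] Y Z lim unfolding K.closedin_op_norm_iff by blast
   moreover have "(\<lambda>n. op_norm H (compress (Y n) \<ominus>\<^bsub>BL H\<^esub> compress Z)) \<longlonglongrightarrow> 0"
    by (rule squeeze_null[OF lim]) (use Y Z op_norm_compress_diff in simp_all)
   moreover have "\<forall>A L. (\<forall>n. A n \<in> CF) \<longrightarrow> L \<in> \<B> H \<longrightarrow>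
     (\<lambda>n. op_norm H (A n \<ominus>\<^bsub>BL H\<^esub> L)) \<longlonglongrightarrow> 0 \<longrightarrow> L \<in> CF"
    using H.Cstar_closed[OF family_H] unfolding H.closedin_op_norm_iff by blast
   from this[rule_format, OF _ compress_closed[OF Z] calculation(2)]
   have "compress Z \<in> CF" using Y by simp
   ultimately show "Z \<in> {Y \<in> CG. compress Y \<in> CF}" by simp
  qed auto
  fix T Y assume T: "T \<in> family_ops \<Lambda> R U" and Y: "Y \<in> {Y \<in> CG. compress Y \<in> CF}"
  then obtain a where a: "a \<in> \<Lambda>" "T = R a \<or> T = U a" unfolding family_ops_def by blast
  have Y': "Y \<in> CG" "compress Y \<in> CF" using Y by auto
  note g = gens_CF[OF a(1)] gens_CG[OF a(1)]
  have "U a \<otimes>\<^bsub>BL K\<^esub> Y \<in> {Y \<in> CG. compress Y \<in> CF}" "R a \<otimes>\<^bsub>BL K\<^esub> Y \<in> {Y \<in> CG. compress Y \<in> CF}"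
   "adj K (U a) \<otimes>\<^bsub>BL K\<^esub> Y \<in> {Y \<in> CG. compress Y \<in> CF}" "adj K (R a) \<otimes>\<^bsub>BL K\<^esub> Y \<in> {Y \<in> CG. compress Y \<in> CF}"
   using compress_mult_gens[OF a(1) Y'(1)] Y' g CF(2,5) CG(2,5) by simp_all
  then show "T \<otimes>\<^bsub>BL K\<^esub> Y \<in> {Y \<in> CG. compress Y \<in> CF}" "adj K T \<otimes>\<^bsub>BL K\<^esub> Y \<in> {Y \<in> CG. compress Y \<in> CF}"
   using a(2) by (elim disjE, simp_all only:)+
 qed
 then show ?thesis using Y by blast
qed

lemma compress_CF_Toeplitz: "Y \<in> CG \<Longrightarrow> compress Y \<in> CF \<inter> Toeplitz_ops H \<Lambda> S P"
 using compress_CF compress_Toeplitz[OF CG_commutant] by blast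

text \<open>A star homomorphism of C*-algebras is automatically continuous, so it is determined by its
 values on the generators.\<close>

lemma pi0_unique:
 assumes hom: "unital_star_hom H CF K CG \<pi>" and g: "\<And>a. a \<in> \<Lambda> \<Longrightarrow> \<pi> (P a) = U a \<and> \<pi> (S a) = R a" and A: "A \<in> CF"
 shows "\<pi> A = pi0 A"
proof -
 have h: "\<pi> \<in> ring_hom (subalg H CF) (subalg K CG)"
  "\<And>c T. T \<in> CF \<Longrightarrow> \<pi> (c \<odot>\<^bsub>BL H\<^esub> T) = c \<odot>\<^bsub>BL K\<^esub> \<pi> T" "\<And>T. T \<in> CF \<Longrightarrow> \<pi> (adj H T) = adj K (\<pi> T)"
  using hom unfolding unital_star_hom_def by blast+
 have pc: "\<pi> T \<in> CG" if "T \<in> CF" for T using ring_hom_closed[OF h(1), of T] that by simp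
 have pm: "\<pi> (T \<otimes>\<^bsub>BL H\<^esub> V) = \<pi> T \<otimes>\<^bsub>BL K\<^esub> \<pi> V" "\<pi> (T \<oplus>\<^bsub>BL H\<^esub> V) = \<pi> T \<oplus>\<^bsub>BL K\<^esub> \<pi> V" if "T \<in> CF" "V \<in> CF" for T V
  using ring_hom_mult[OF h(1), of T V] ring_hom_add[OF h(1), of T V] that by simp_all
 have p1: "\<pi> \<one>\<^bsub>BL H\<^esub> = \<one>\<^bsub>BL K\<^esub>" using ring_hom_one[OF h(1)] by simp
 have pmin: "\<pi> (T \<ominus>\<^bsub>BL H\<^esub> V) = \<pi> T \<ominus>\<^bsub>BL K\<^esub> \<pi> V" if "T \<in> CF" "V \<in> CF" for T V
  using that pc CF(4) by (simp add: H.BL_minus K.BL_minus pm h(2))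
 have contr: "op_norm K (\<pi> T) \<le> op_norm H T" if "T \<in> CF" for T
  by (rule star_hom_contractive[OF CF_star H.Cstar_closed[OF family_H] hom _ that]) auto
 have "CF \<subseteq> {A \<in> CF. \<pi> A = pi0 A}"
 proof (rule H.Cstar_minimal)
  show "family_ops \<Lambda> S P \<subseteq> {A \<in> CF. \<pi> A = pi0 A}"
   using g gens_CF pi0_gens by (auto simp: family_ops_def)
  show "unital_star_subalgebra H {A \<in> CF. \<pi> A = pi0 A}"
   by (rule H.unital_star_subalgebraI) (auto simp: CF p1 pm h pi0_one pi0_mult pi0_add pi0_smult pi0)
  show "closedin (op_norm_topology H) {A \<in> CF. \<pi> A = pi0 A}"
   unfolding H.closedin_op_norm_iff
  proof (intro conjI allI impI)
   fix A B assume A: "\<forall>n. A n \<in> {A \<in> CF. \<pi> A = pi0 A}" and B: "B \<in> \<B> H"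
    and lim: "(\<lambda>n. op_norm H (A n \<ominus>\<^bsub>BL H\<^esub> B)) \<longlonglongrightarrow> 0"
   have Ac: "A n \<in> CF" and Ap: "\<pi> (A n) = pi0 (A n)" for n using A by auto
   have BC: "B \<in> CF" using H.Cstar_closed[OF family_H] Ac B lim unfolding H.closedin_op_norm_iff by blast
   have "\<pi> B = pi0 B"
   proof (rule K.om.limitin_metric_unique)
    show "limitin K.om.mtopology (\<lambda>n. pi0 (A n)) (\<pi> B) sequentially"
    proof (subst K.limitin_op_norm_iff)
     show "(\<lambda>n. op_norm K (pi0 (A n) \<ominus>\<^bsub>BL K\<^esub> \<pi> B)) \<longlonglongrightarrow> 0"
     proof (rule squeeze_null[OF lim])
      show "op_norm K (pi0 (A n) \<ominus>\<^bsub>BL K\<^esub> \<pi> B) \<le> op_norm H (A n \<ominus>\<^bsub>BL H\<^esub> B)" for n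
       using contr[OF CF(6)[OF Ac BC]] pmin[OF Ac BC] Ap by metis
     qed (use pi0 pc Ac BC in simp)
    qed (use pi0 pc Ac BC in simp_all)
    show "limitin K.om.mtopology (\<lambda>n. pi0 (A n)) (pi0 B) sequentially"
    proof (subst K.limitin_op_norm_iff)
     show "(\<lambda>n. op_norm K (pi0 (A n) \<ominus>\<^bsub>BL K\<^esub> pi0 B)) \<longlonglongrightarrow> 0"
     proof (rule squeeze_null[OF lim])
      show "op_norm K (pi0 (A n) \<ominus>\<^bsub>BL K\<^esub> pi0 B) \<le> op_norm H (A n \<ominus>\<^bsub>BL H\<^esub> B)" for n
       using pi0_norm[OF CF(6)[OF Ac BC]] pi0_minus[OF Ac BC] by metis
     qed (use pi0 pc Ac BC in simp)
    qed (use pi0 pc Ac BC in simp_all)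
   qed simp
   then show "B \<in> {A \<in> CF. \<pi> A = pi0 A}" using BC by simp
  qed auto
 qed
 then show ?thesis using A by blast
qed

text \<open>D is an arbitrary closed ideal containing the commutators because the commutator ideal
  is the intersection of all of these. With Q T the defect of T, Q (V T) is V times Q T plus the
  failure of compression to be multiplicative at V, so only that failure has to be placed in
  D.\<close>

lemma kernel_subset_ideal:
 assumes D: "ideal D (subalg H CF)" "closedin (op_norm_topology H) D"
  and C: "{A \<otimes>\<^bsub>BL H\<^esub> B \<ominus>\<^bsub>BL H\<^esub> B \<otimes>\<^bsub>BL H\<^esub> A |A B. A \<in> CF \<inter> Toeplitz_ops H \<Lambda> S P \<and> B \<in> CF \<inter> Toeplitz_ops H \<Lambda> S P} \<subseteq> D"
  and A: "A \<in> CF"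
 shows "A \<ominus>\<^bsub>BL H\<^esub> compress (pi0 A) \<in> D"
proof -
 have Dc: "T \<in> \<B> H" if "T \<in> D" for T using D(2) that unfolding H.closedin_op_norm_iff by blast
 have D_add: "T \<oplus>\<^bsub>BL H\<^esub> V \<in> D" if "T \<in> D" "V \<in> D" for T V
  using additive_subgroup.a_closed[OF ideal.axioms(1)[OF D(1)] that] by simp
 have D_zero: "\<zero>\<^bsub>BL H\<^esub> \<in> D"
  using additive_subgroup.zero_closed[OF ideal.axioms(1)[OF D(1)]] by simp
 have D_left: "V \<otimes>\<^bsub>BL H\<^esub> T \<in> D" if "V \<in> CF" "T \<in> D" for T V
  using ideal.I_l_closed[OF D(1) that(2), of V] that(1) by simp
 \<comment> \<open>Ring ideals absorb scalars here because the multiples of the identity belong to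
   CF.\<close>
 have D_smult: "c \<odot>\<^bsub>BL H\<^esub> T \<in> D" if "T \<in> D" for c T
 proof -
  have "(c \<odot>\<^bsub>BL H\<^esub> \<one>\<^bsub>BL H\<^esub>) \<otimes>\<^bsub>BL H\<^esub> T = c \<odot>\<^bsub>BL H\<^esub> T"
   by (rule H.bop_eqI) (use Dc[OF that] in \<open>simp_all add: H.bop_closed[OF Dc[OF that]]\<close>)
  then show ?thesis using D_left[OF CF(4)[OF CF(1)] that, of c] by simp
 qed
 define Q where "Q T = T \<ominus>\<^bsub>BL H\<^esub> compress (pi0 T)" for T
 have cp: "compress (pi0 T) \<in> CF" "compress (pi0 T) \<in> \<B> H" "pi0 T \<in> \<B> K" if "T \<in> CF" for T
  using compress_CF[OF pi0(1)[OF that]] pi0(1)[OF that] by simp_all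
 have step: "V \<otimes>\<^bsub>BL H\<^esub> T \<in> {T \<in> CF. Q T \<in> D}"
  if V: "V \<in> CF" and T: "T \<in> {T \<in> CF. Q T \<in> D}"
   and d: "V \<otimes>\<^bsub>BL H\<^esub> compress (pi0 T) \<ominus>\<^bsub>BL H\<^esub> compress (pi0 V \<otimes>\<^bsub>BL K\<^esub> pi0 T) \<in> D" for V T
 proof -
  have T': "T \<in> CF" "Q T \<in> D" using T by auto
  note c = cp[OF T'(1)] cp[OF V] CF_BL[OF V] CF_BL[OF T'(1)]
  have c2: "compress (pi0 V \<otimes>\<^bsub>BL K\<^esub> pi0 T) \<in> \<B> H" using c by simp
  note b = H.bop_rules[OF CF_BL[OF V]] H.bop_rules[OF CF_BL[OF T'(1)]] H.bop_rules[OF c(2)] H.bop_closed[OF c2]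
  have "Q (V \<otimes>\<^bsub>BL H\<^esub> T) = V \<otimes>\<^bsub>BL H\<^esub> Q T \<oplus>\<^bsub>BL H\<^esub> (V \<otimes>\<^bsub>BL H\<^esub> compress (pi0 T) \<ominus>\<^bsub>BL H\<^esub> compress (pi0 V \<otimes>\<^bsub>BL K\<^esub> pi0 T))"
  proof (rule H.bop_cinner_eqI)
   show "Q (V \<otimes>\<^bsub>BL H\<^esub> T) \<in> \<B> H" unfolding Q_def pi0_mult[OF V T'(1)] using c c2 by simp
   show "V \<otimes>\<^bsub>BL H\<^esub> Q T \<oplus>\<^bsub>BL H\<^esub> (V \<otimes>\<^bsub>BL H\<^esub> compress (pi0 T) \<ominus>\<^bsub>BL H\<^esub> compress (pi0 V \<otimes>\<^bsub>BL K\<^esub> pi0 T)) \<in> \<B> H"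
    unfolding Q_def using c c2 by simp
   fix x y assume "x \<in> carrier H" "y \<in> carrier H"
   then show "cinner H (Q (V \<otimes>\<^bsub>BL H\<^esub> T) x) y = cinner H ((V \<otimes>\<^bsub>BL H\<^esub> Q T \<oplus>\<^bsub>BL H\<^esub> (V \<otimes>\<^bsub>BL H\<^esub> compress (pi0 T) \<ominus>\<^bsub>BL H\<^esub> compress (pi0 V \<otimes>\<^bsub>BL K\<^esub> pi0 T))) x) y"
    unfolding Q_def pi0_mult[OF V T'(1)] using c c2 b by (simp del: compress_apply)
  qed
  then show ?thesis using D_add[OF D_left[OF V T'(2)] d] CF(2)[OF V T'(1)] by simp
 qed
 have TO: "P a \<in> CF \<inter> Toeplitz_ops H \<Lambda> S P" "S a \<in> CF \<inter> Toeplitz_ops H \<Lambda> S P" if a: "a \<in> \<Lambda>" for a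
  using compress_CF_Toeplitz[OF gens_CG(2)[OF a]] compress_CF_Toeplitz[OF gens_CG(1)[OF a]] a
  by (simp_all add: compress_U compress_R)
 have zero: "T \<ominus>\<^bsub>BL H\<^esub> T \<in> D" if "T \<in> \<B> H" for T
 proof -
  have "T \<ominus>\<^bsub>BL H\<^esub> T = \<zero>\<^bsub>BL H\<^esub>" using that H.BL.r_right_minus_eq[of T T] by simp
  then show ?thesis using D_zero by (simp only:)
 qed
 have "CF \<subseteq> {T \<in> CF. Q T \<in> D}"
 proof (rule H.Cstar_left_induct[OF family_H])
  show "{T \<in> CF. Q T \<in> D} \<subseteq> \<B> H" by auto
  show "\<one>\<^bsub>BL H\<^esub> \<in> {T \<in> CF. Q T \<in> D}" using CF(1) zero by (simp add: Q_def pi0_one compress_one)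
 next
  fix T V assume "T \<in> {T \<in> CF. Q T \<in> D}" "V \<in> {T \<in> CF. Q T \<in> D}"
  then have T: "T \<in> CF" "Q T \<in> D" "V \<in> CF" "Q V \<in> D" by auto
  note c = cp[OF T(1)] cp[OF T(3)] CF_BL[OF T(1)] CF_BL[OF T(3)]
  note b = H.bop_closed[OF c(2)] H.bop_closed[OF c(5)] H.bop_closed[OF c(7)] H.bop_closed[OF c(8)]
  have "Q (T \<oplus>\<^bsub>BL H\<^esub> V) = Q T \<oplus>\<^bsub>BL H\<^esub> Q V"
   unfolding Q_def pi0_add[OF T(1,3)] compress_add[OF c(3,6)]
   by (rule H.bop_cinner_eqI) (use c b in \<open>simp_all del: compress_apply\<close>)
  then show "T \<oplus>\<^bsub>BL H\<^esub> V \<in> {T \<in> CF. Q T \<in> D}" using D_add[OF T(2,4)] CF(3)[OF T(1,3)] by simp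
 next
  fix k T assume "T \<in> {T \<in> CF. Q T \<in> D}"
  then have T: "T \<in> CF" "Q T \<in> D" by auto
  note c = cp[OF T(1)] CF_BL[OF T(1)]
  note b = H.bop_closed[OF c(2)] H.bop_closed[OF c(4)]
  have "Q (k \<odot>\<^bsub>BL H\<^esub> T) = k \<odot>\<^bsub>BL H\<^esub> Q T"
   unfolding Q_def pi0_smult[OF T(1)] compress_smult[OF c(3)]
   by (rule H.bop_cinner_eqI) (use c b in \<open>simp_all add: right_diff_distrib del: compress_apply\<close>)
  then show "k \<odot>\<^bsub>BL H\<^esub> T \<in> {T \<in> CF. Q T \<in> D}" using D_smult[OF T(2)] CF(4)[OF T(1)] by simp
 next
  fix V T assume V: "V \<in> family_ops \<Lambda> S P" and T: "T \<in> {T \<in> CF. Q T \<in> D}"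
  then obtain a where a: "a \<in> \<Lambda>" "V = S a \<or> V = P a" unfolding family_ops_def by blast
  have T': "T \<in> CF" using T by auto
  note Y = pi0(1)[OF T']
  note g = gens_CF[OF a(1)] gens_CG[OF a(1)]
  have "P a \<otimes>\<^bsub>BL H\<^esub> T \<in> {T \<in> CF. Q T \<in> D}"
  proof (rule step[OF g(2) T])
   \<comment> \<open>By \<open>compress_mult_gens\<close> this is the commutator of P_a with the
     compression of pi0 T, and both are Toeplitz operators in CF.\<close>
   show "P a \<otimes>\<^bsub>BL H\<^esub> compress (pi0 T) \<ominus>\<^bsub>BL H\<^esub> compress (pi0 (P a) \<otimes>\<^bsub>BL K\<^esub> pi0 T) \<in> D"
    unfolding pi0_gens[OF a(1)] compress_mult_gens[OF a(1) Y]
    using C TO(1)[OF a(1)] compress_CF_Toeplitz[OF Y] by blast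
  qed
  moreover have "S a \<otimes>\<^bsub>BL H\<^esub> T \<in> {T \<in> CF. Q T \<in> D}"
  proof (rule step[OF g(1) T])
   show "S a \<otimes>\<^bsub>BL H\<^esub> compress (pi0 T) \<ominus>\<^bsub>BL H\<^esub> compress (pi0 (S a) \<otimes>\<^bsub>BL K\<^esub> pi0 T) \<in> D"
    unfolding pi0_gens[OF a(1)] compress_mult_gens[OF a(1) Y]
    using C TO(2)[OF a(1)] compress_CF_Toeplitz[OF Y] by blast
  qed
  ultimately show "V \<otimes>\<^bsub>BL H\<^esub> T \<in> {T \<in> CF. Q T \<in> D}"
   using a(2) by (elim disjE) (simp_all only:)
  have "adj H (P a) \<otimes>\<^bsub>BL H\<^esub> T \<in> {T \<in> CF. Q T \<in> D}"
  proof (rule step[OF CF(5)[OF g(2)] T])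
   \<comment> \<open>At the adjoint of a generator compression is multiplicative, so the two terms
     coincide.\<close>
   show "adj H (P a) \<otimes>\<^bsub>BL H\<^esub> compress (pi0 T) \<ominus>\<^bsub>BL H\<^esub> compress (pi0 (adj H (P a)) \<otimes>\<^bsub>BL K\<^esub> pi0 T) \<in> D"
    unfolding pi0(3)[OF g(2)] pi0_gens[OF a(1)] compress_mult_gens[OF a(1) Y]
    by (rule zero) (use cp[OF T'] Pa[OF a(1)] in simp)
  qed
  moreover have "adj H (S a) \<otimes>\<^bsub>BL H\<^esub> T \<in> {T \<in> CF. Q T \<in> D}"
  proof (rule step[OF CF(5)[OF g(1)] T])
   show "adj H (S a) \<otimes>\<^bsub>BL H\<^esub> compress (pi0 T) \<ominus>\<^bsub>BL H\<^esub> compress (pi0 (adj H (S a)) \<otimes>\<^bsub>BL K\<^esub> pi0 T) \<in> D"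
    unfolding pi0(3)[OF g(1)] pi0_gens[OF a(1)] compress_mult_gens[OF a(1) Y]
    by (rule zero) (use cp[OF T'] Sa[OF a(1)] in simp)
  qed
  ultimately show "adj H V \<otimes>\<^bsub>BL H\<^esub> T \<in> {T \<in> CF. Q T \<in> D}"
   using a(2) by (elim disjE) (simp_all only:)
 next
  show "closedin (op_norm_topology H) {T \<in> CF. Q T \<in> D}"
   unfolding H.closedin_op_norm_iff
  proof (intro conjI allI impI)
   fix A B assume A: "\<forall>n. A n \<in> {T \<in> CF. Q T \<in> D}" and B: "B \<in> \<B> H"
    and lim: "(\<lambda>n. op_norm H (A n \<ominus>\<^bsub>BL H\<^esub> B)) \<longlonglongrightarrow> 0"
   have Ac: "A n \<in> CF" and AQ: "Q (A n) \<in> D" for n using A by auto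
   have BC: "B \<in> CF" using H.Cstar_closed[OF family_H] Ac B lim unfolding H.closedin_op_norm_iff by blast
   have Qc: "Q T \<in> \<B> H" if "T \<in> CF" for T unfolding Q_def using cp[OF that] that by simp
   \<comment> \<open>Q is Lipschitz with constant 2, since pi0 and compression are
     contractive.\<close>
   have lim2: "(\<lambda>n. op_norm H (Q (A n) \<ominus>\<^bsub>BL H\<^esub> Q B)) \<longlonglongrightarrow> 0"
   proof (rule squeeze_null)
    show "(\<lambda>n. 2 * op_norm H (A n \<ominus>\<^bsub>BL H\<^esub> B)) \<longlonglongrightarrow> 0"
     using tendsto_mult[OF tendsto_const lim, of 2] by simp
    fix n
    note c = cp[OF Ac[of n]] cp[OF BC] CF_BL[OF Ac[of n]] B
    note b = H.bop_closed[OF c(2)] H.bop_closed[OF c(5)] H.bop_closed[OF c(7)] H.bop_closed[OF B]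
    let ?d = "compress (pi0 (A n)) \<ominus>\<^bsub>BL H\<^esub> compress (pi0 B)"
    have eq: "Q (A n) \<ominus>\<^bsub>BL H\<^esub> Q B = (A n \<ominus>\<^bsub>BL H\<^esub> B) \<oplus>\<^bsub>BL H\<^esub> (- 1) \<odot>\<^bsub>BL H\<^esub> ?d"
     unfolding Q_def by (rule H.bop_cinner_eqI) (use c b in \<open>simp_all del: compress_apply\<close>)
    have "op_norm H ((A n \<ominus>\<^bsub>BL H\<^esub> B) \<oplus>\<^bsub>BL H\<^esub> (- 1) \<odot>\<^bsub>BL H\<^esub> ?d)
      \<le> op_norm H (A n \<ominus>\<^bsub>BL H\<^esub> B) + op_norm H ((- 1) \<odot>\<^bsub>BL H\<^esub> ?d)"
     by (rule H.op_norm_add_le) (use c in simp_all)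
    moreover have "op_norm H ((- 1) \<odot>\<^bsub>BL H\<^esub> ?d) \<le> op_norm H ?d"
     using H.op_norm_smult_le[of ?d "- 1"] c by simp
    moreover have "op_norm H ?d \<le> op_norm K (pi0 (A n) \<ominus>\<^bsub>BL K\<^esub> pi0 B)"
     by (rule op_norm_compress_diff[OF c(3,6)])
    moreover have "op_norm K (pi0 (A n) \<ominus>\<^bsub>BL K\<^esub> pi0 B) \<le> op_norm H (A n \<ominus>\<^bsub>BL H\<^esub> B)"
     unfolding pi0_minus[OF Ac BC, symmetric] by (rule pi0_norm[OF CF(6)[OF Ac BC]])
    ultimately show "op_norm H (Q (A n) \<ominus>\<^bsub>BL H\<^esub> Q B) \<le> 2 * op_norm H (A n \<ominus>\<^bsub>BL H\<^esub> B)"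
     unfolding eq by linarith
   qed (use Qc[OF Ac] Qc[OF BC] in simp)
   have "\<forall>A L. (\<forall>n. A n \<in> D) \<longrightarrow> L \<in> \<B> H \<longrightarrow>
     (\<lambda>n. op_norm H (A n \<ominus>\<^bsub>BL H\<^esub> L)) \<longlonglongrightarrow> 0 \<longrightarrow> L \<in> D"
    using D(2) unfolding H.closedin_op_norm_iff by blast
   from this[rule_format, OF AQ Qc[OF BC] lim2] show "B \<in> {T \<in> CF. Q T \<in> D}" using BC by simp
  qed auto
 qed
 then show ?thesis using A by (auto simp: Q_def)
qed

lemma subalg_ring: "ring (subalg H CF)" "ring (subalg K CG)"
 using H.BL.subring_is_ring K.BL.subring_is_ring CF_star CG_star by (simp_all add: unital_star_subalgebra_def)

text \<open>If pi0 A = 0, then A equals its own defect and lies in every closed ideal containing the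
  commutators. Conversely pi0 kills commutators because CG is commutative, and its kernel is a
  closed ideal.\<close>

lemma kernel_pi0: "a_kernel (subalg H CF) (subalg K CG) pi0 = commutator_ideal H \<Lambda> S P"
proof
 have ker: "a_kernel (subalg H CF) (subalg K CG) pi0 = {A \<in> CF. pi0 A = \<zero>\<^bsub>BL K\<^esub>}" by (simp add: a_kernel_def')
 let ?C = "{A \<otimes>\<^bsub>BL H\<^esub> B \<ominus>\<^bsub>BL H\<^esub> B \<otimes>\<^bsub>BL H\<^esub> A |A B. A \<in> CF \<inter> Toeplitz_ops H \<Lambda> S P \<and> B \<in> CF \<inter> Toeplitz_ops H \<Lambda> S P}"
 have comm: "commutator_ideal H \<Lambda> S P = closed_ideal H CF ?C"
  by (simp add: commutator_ideal_def Let_def)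
 show "a_kernel (subalg H CF) (subalg K CG) pi0 \<subseteq> commutator_ideal H \<Lambda> S P"
  unfolding comm closed_ideal_def hull_def
 proof (rule subsetI, rule InterI)
  fix A D assume A: "A \<in> a_kernel (subalg H CF) (subalg K CG) pi0"
   and D: "D \<in> {t. (ideal t (subalg H CF) \<and> closedin (op_norm_topology H) t) \<and> ?C \<subseteq> t}"
  have A': "A \<in> CF" "pi0 A = \<zero>\<^bsub>BL K\<^esub>" using A unfolding ker by auto
  have "A \<ominus>\<^bsub>BL H\<^esub> compress (pi0 A) \<in> D" by (rule kernel_subset_ideal[OF _ _ _ A'(1)]) (use D in blast)+
  moreover have "A \<ominus>\<^bsub>BL H\<^esub> compress (pi0 A) = A"
  proof (rule H.bop_cinner_eqI)
   fix x y assume "x \<in> carrier H" "y \<in> carrier H"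
   then show "cinner H ((A \<ominus>\<^bsub>BL H\<^esub> compress (pi0 A)) x) y = cinner H (A x) y"
    unfolding A'(2) using CF_BL[OF A'(1)] by (simp add: H.bop_closed[OF CF_BL[OF A'(1)]])
  qed (use CF_BL[OF A'(1)] A'(2) in simp_all)
  ultimately show "A \<in> D" by simp
 qed
 show "commutator_ideal H \<Lambda> S P \<subseteq> a_kernel (subalg H CF) (subalg K CG) pi0"
  unfolding comm closed_ideal_def
 proof (rule hull_minimal)
  show "?C \<subseteq> a_kernel (subalg H CF) (subalg K CG) pi0"
  proof
   fix T assume "T \<in> ?C"
   then obtain A B where T: "T = A \<otimes>\<^bsub>BL H\<^esub> B \<ominus>\<^bsub>BL H\<^esub> B \<otimes>\<^bsub>BL H\<^esub> A" and A: "A \<in> CF" and B: "B \<in> CF" by blast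
   have "pi0 T = pi0 A \<otimes>\<^bsub>BL K\<^esub> pi0 B \<ominus>\<^bsub>BL K\<^esub> pi0 B \<otimes>\<^bsub>BL K\<^esub> pi0 A"
    unfolding T using A B CF(2) by (simp add: pi0_minus pi0_mult)
   also have "\<dots> = \<zero>\<^bsub>BL K\<^esub>"
    using CG_commute[OF pi0(1)[OF A] pi0(1)[OF B]] pi0(1)[OF A] pi0(1)[OF B] by (subst K.BL.r_right_minus_eq) simp_all
   finally show "T \<in> a_kernel (subalg H CF) (subalg K CG) pi0" unfolding ker T using A B CF(2,6) by simp
  qed
  have "ideal (a_kernel (subalg H CF) (subalg K CG) pi0) (subalg H CF)"
   by (rule ring_hom_ring.kernel_is_ideal, rule ring_hom_ringI2[OF subalg_ring])
     (use pi0_hom in \<open>simp add: unital_star_hom_def\<close>)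
  moreover have "closedin (op_norm_topology H) {A \<in> CF. pi0 A = \<zero>\<^bsub>BL K\<^esub>}"
   unfolding H.closedin_op_norm_iff
  proof (intro conjI allI impI)
   fix A B assume A: "\<forall>n. A n \<in> {A \<in> CF. pi0 A = \<zero>\<^bsub>BL K\<^esub>}" and B: "B \<in> \<B> H"
    and lim: "(\<lambda>n. op_norm H (A n \<ominus>\<^bsub>BL H\<^esub> B)) \<longlonglongrightarrow> 0"
   have Ac: "A n \<in> CF" and A0: "pi0 (A n) = \<zero>\<^bsub>BL K\<^esub>" for n using A by auto
   have BC: "B \<in> CF" using H.Cstar_closed[OF family_H] Ac B lim unfolding H.closedin_op_norm_iff by blast
   have "op_norm K (pi0 B) \<le> op_norm H (A n \<ominus>\<^bsub>BL H\<^esub> B)" for n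
   proof -
    have "pi0 (B \<ominus>\<^bsub>BL H\<^esub> A n) = pi0 B"
     unfolding pi0_minus[OF BC Ac] A0
     by (rule K.bop_eqI) (use pi0(1)[OF BC] in \<open>simp_all add: K.bop_closed[OF CG_BL] K.minus_zero\<close>)
    then show ?thesis
     using pi0_norm[OF CF(6)[OF BC Ac]] H.op_norm_minus_commute[OF B CF_BL[OF Ac]] by metis
   qed
   then have "op_norm K (pi0 B) \<le> 0" by (intro tendsto_lowerbound[OF lim]) (auto intro: always_eventually)
   then have "pi0 B = \<zero>\<^bsub>BL K\<^esub>" by (rule op_norm_K_le_0[OF CG_BL[OF pi0(1)[OF BC]]])
   then show "B \<in> {A \<in> CF. pi0 A = \<zero>\<^bsub>BL K\<^esub>}" using BC by simp
  qed auto
  ultimately show "ideal (a_kernel (subalg H CF) (subalg K CG) pi0) (subalg H CF) \<and>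
   closedin (op_norm_topology H) (a_kernel (subalg H CF) (subalg K CG) pi0)" unfolding ker by blast
 qed
qed

lemma pi0_image: "pi0 ` CF = CG"
proof
 show "pi0 ` CF \<subseteq> CG" using pi0(1) by blast
 show "CG \<subseteq> pi0 ` CF"
 proof
  fix Y assume Y: "Y \<in> CG"
  have "Y = pi0 (compress Y)" by (rule pi0_compress[OF Y compress_CF[OF Y], symmetric])
  then show "Y \<in> pi0 ` CF" using compress_CF[OF Y] by blast
 qed
qed

lemma compress_completely_isometric: "completely_isometric_linear K CG H CF compress"
 unfolding completely_isometric_linear_def
proof (intro conjI allI impI ballI)
 show "compress \<in> CG \<rightarrow> CF" using compress_CF by blast
 show "matrix_norm H n (\<lambda>i j. compress (M i j)) = matrix_norm K n M" if "\<forall>i<n. \<forall>j<n. M i j \<in> CG" for n M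
  by (rule matrix_norm_compress) (use that in simp)
qed (simp_all add: compress_add compress_smult)

end

section \<open>Existence of the minimal extension\<close>

text \<open>A vector \<open>k\<close> of the extension space is encoded by the function which sends a multi-exponent
 \<open>m\<close> to the component of \<open>U\<^sup>m k\<close> in \<open>H\<close>. The map \<open>\<mu>\<close> only serves to carry the model into a
 prescribed type.\<close>

locale gamma_model = commuting_family H \<Lambda> P
 for H :: "'a hilb" (structure) and \<Lambda> :: "'i set" and P :: "'i \<Rightarrow> 'a \<Rightarrow> 'a" +
 fixes S :: "'i \<Rightarrow> 'a \<Rightarrow> 'a" and \<mu> :: "'w \<Rightarrow> 'i multiset"
 assumes P_iso: "a \<in> \<Lambda> \<Longrightarrow> adj H (P a) \<otimes>\<^bsub>BL H\<^esub> P a = \<one>\<^bsub>BL H\<^esub>"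
  and S_closed: "a \<in> \<Lambda> \<Longrightarrow> S a \<in> \<B> H"
  and S_P: "a \<in> \<Lambda> \<Longrightarrow> S a = adj H (S a) \<otimes>\<^bsub>BL H\<^esub> P a"
  and S_norm: "a \<in> \<Lambda> \<Longrightarrow> op_norm H (S a) \<le> 2"
  and S_commute: "a \<in> \<Lambda> \<Longrightarrow> b \<in> \<Lambda> \<Longrightarrow> S a \<otimes>\<^bsub>BL H\<^esub> S b = S b \<otimes>\<^bsub>BL H\<^esub> S a"
  and S_P_commute: "a \<in> \<Lambda> \<Longrightarrow> b \<in> \<Lambda> \<Longrightarrow> S a \<otimes>\<^bsub>BL H\<^esub> P b = P b \<otimes>\<^bsub>BL H\<^esub> S a"
  and surj_\<mu>: "surj \<mu>"
begin

lemma hnorm_P: "a \<in> \<Lambda> \<Longrightarrow> x \<in> carrier H \<Longrightarrow> hnorm H (P a x) = hnorm H x"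
 by (rule unitary_hnorm[OF P_closed P_iso])

lemma adj_P_P: "a \<in> \<Lambda> \<Longrightarrow> h \<in> carrier H \<Longrightarrow> adj H (P a) (P a h) = h"
 using fun_cong[OF P_iso, of a h] by simp

lemma hnorm_mpow: "x \<in> carrier H \<Longrightarrow> hnorm H (mpow H \<Lambda> P m x) = hnorm H x"
 by (rule mpow_hnorm) (rule hnorm_P)

text \<open>For F m = J^* U^m k the recursion is J^* U_a^* = P_a^* J^*, and the norms are bounded by
  that of k. An index outside \<Lambda> acts as the identity, so F must not depend on its
  multiplicity.\<close>

definition compatible :: "('i multiset \<Rightarrow> 'a) set" where
 "compatible = {F. (\<forall>m. F m \<in> carrier H) \<and>
   (\<forall>a m. F m = (if a \<in> \<Lambda> then adj H (P a) (F (add_mset a m)) else F (add_mset a m))) \<and>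
   (\<exists>b. \<forall>m. hnorm H (F m) \<le> b)}"

lemma compatibleD:
 assumes "F \<in> compatible"
 shows "F m \<in> carrier H" "a \<in> \<Lambda> \<Longrightarrow> adj H (P a) (F (add_mset a m)) = F m"
  "a \<notin> \<Lambda> \<Longrightarrow> F (add_mset a m) = F m" "\<exists>b. \<forall>m. hnorm H (F m) \<le> b"
proof -
 have F: "\<And>m. F m \<in> carrier H" "\<exists>b. \<forall>m. hnorm H (F m) \<le> b"
  "\<And>a m. F m = (if a \<in> \<Lambda> then adj H (P a) (F (add_mset a m)) else F (add_mset a m))"
  using assms unfolding compatible_def by blast+
 show "F m \<in> carrier H" "\<exists>b. \<forall>m. hnorm H (F m) \<le> b" by (rule F)+
 show "a \<in> \<Lambda> \<Longrightarrow> adj H (P a) (F (add_mset a m)) = F m" using F(3)[of m a] by (simp only: if_True)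
 show "a \<notin> \<Lambda> \<Longrightarrow> F (add_mset a m) = F m" using F(3)[of m a] by (simp only: if_False)
qed

lemma compatibleI:
 assumes "\<And>m. F m \<in> carrier H" "\<And>a m. a \<in> \<Lambda> \<Longrightarrow> adj H (P a) (F (add_mset a m)) = F m"
  "\<And>a m. a \<notin> \<Lambda> \<Longrightarrow> F (add_mset a m) = F m" "\<And>m. hnorm H (F m) \<le> b"
 shows "F \<in> compatible"
 using assms unfolding compatible_def by auto

lemma compatible_add:
 assumes F: "F \<in> compatible" and G: "G \<in> compatible"
 shows "(\<lambda>m. F m \<oplus> G m) \<in> compatible"
proof -
 obtain b c where b: "\<And>m. hnorm H (F m) \<le> b" and c: "\<And>m. hnorm H (G m) \<le> c"
  using compatibleD(4)[OF F] compatibleD(4)[OF G] by blast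
 note [simp] = compatibleD[OF F] compatibleD[OF G]
 show ?thesis
 proof (rule compatibleI)
  show "adj H (P a) (F (add_mset a m) \<oplus> G (add_mset a m)) = F m \<oplus> G m" if "a \<in> \<Lambda>" for a m
   using that by (simp add: bop_add[OF adj_closed[OF P_closed]])
  show "hnorm H (F m \<oplus> G m) \<le> b + c" for m
   using hnorm_triangle[OF compatibleD(1)[OF F] compatibleD(1)[OF G], of m m] b[of m] c[of m] by linarith
 qed simp_all
qed

lemma compatible_smult:
 assumes F: "F \<in> compatible"
 shows "(\<lambda>m. c \<odot> F m) \<in> compatible"
proof -
 obtain b where b: "\<And>m. hnorm H (F m) \<le> b" using compatibleD(4)[OF F] by blast
 note [simp] = compatibleD[OF F]
 show ?thesis
 proof (rule compatibleI)
  show "adj H (P a) (c \<odot> F (add_mset a m)) = c \<odot> F m" if "a \<in> \<Lambda>" for a m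
   using that by (simp add: bop_smult[OF adj_closed[OF P_closed]])
  show "hnorm H (c \<odot> F m) \<le> cmod c * b" for m
   using mult_left_mono[OF b[of m], of "cmod c"] by simp
 qed simp_all
qed

lemma compatible_zero: "(\<lambda>m. \<zero>) \<in> compatible"
 by (rule compatibleI[where b = 0]) (simp_all add: bop_zero[OF adj_closed[OF P_closed]])

lemma cinner_compatible_mpow:
 assumes F: "F \<in> compatible" and h: "h \<in> carrier H"
 shows "cinner H (F (m + n)) (mpow H \<Lambda> P n h) = cinner H (F m) h"
proof (induction n)
 case (add a n)
 have *: "F (m + add_mset a n) = F (add_mset a (m + n))" by simp
 show ?case
 proof (cases "a \<in> \<Lambda>")
  case True
  have "cinner H (F (add_mset a (m + n))) (P a (mpow H \<Lambda> P n h))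
    = cinner H (adj H (P a) (F (add_mset a (m + n)))) (mpow H \<Lambda> P n h)"
   by (rule cinner_adj_left[symmetric]) (use True h compatibleD(1)[OF F] P_closed in simp_all)
  then show ?thesis
   using True add compatibleD(2)[OF F] h unfolding * by (simp add: mpow_add_mset total_op_def)
 next
  case False
  then show ?thesis
   using add compatibleD(3)[OF F] unfolding * by (simp add: mpow_add_mset total_op_def)
 qed
qed (use h in simp)

text \<open>P^n F m is the projection of F (m + n) onto the range of the isometry P^n, so this is
  Pythagoras. It shows that ||F m|| increases with m, and that F is nearly an orbit of P once the
  norms are close to their limit.\<close>

lemma compatible_defect:
 assumes F: "F \<in> compatible"
 shows "(hnorm H (F (m + n) \<ominus> mpow H \<Lambda> P n (F m)))\<^sup>2 = (hnorm H (F (m + n)))\<^sup>2 - (hnorm H (F m))\<^sup>2"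
 using cinner_compatible_mpow[OF F compatibleD(1)[OF F], of m n m] compatibleD(1)[OF F]
 by (simp add: hnorm_minus_sq hnorm_mpow cinner_self)

lemma compatible_mono:
 assumes F: "F \<in> compatible"
 shows "m \<subseteq># n \<Longrightarrow> hnorm H (F m) \<le> hnorm H (F n)"
proof -
 assume "m \<subseteq># n"
 then obtain k where k: "n = m + k" by (auto simp: subset_mset.le_iff_add)
 have "(hnorm H (F m))\<^sup>2 \<le> (hnorm H (F n))\<^sup>2"
  using compatible_defect[OF F, of m k] zero_le_power2[of "hnorm H (F (m + k) \<ominus> mpow H \<Lambda> P k (F m))"]
  unfolding k by linarith
 then show ?thesis by (rule power2_le_imp_le) (simp add: compatibleD(1)[OF F])
qed

lemma hnorm_compatible_convergent:
 assumes F: "F \<in> compatible"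
 shows "\<exists>l. ((\<lambda>m. (hnorm H (F m))\<^sup>2) \<longlongrightarrow> l) mset_top"
proof -
 obtain b where b: "\<And>m. hnorm H (F m) \<le> b" using compatibleD(4)[OF F] by blast
 let ?f = "\<lambda>m. (hnorm H (F m))\<^sup>2"
 have bdd: "bdd_above (range ?f)"
  by (rule bdd_aboveI2[of _ _ "b\<^sup>2"]) (rule power_mono[OF b], simp add: compatibleD(1)[OF F])
 have "(?f \<longlongrightarrow> (SUP m. ?f m)) mset_top"
 proof (rule order_tendstoI)
  fix a assume "a < (SUP m. ?f m)"
  then obtain m where m: "a < ?f m" using less_cSUP_iff[OF _ bdd] by auto
  have "a < ?f n" if "m \<subseteq># n" for n
   using m power_mono[OF compatible_mono[OF F that] hnorm_nonneg[OF compatibleD(1)[OF F]], of 2] by linarith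
  then show "eventually (\<lambda>m. a < ?f m) mset_top" unfolding eventually_mset_top by blast
 next
  fix a assume "(SUP m. ?f m) < a"
  then have "?f m < a" for m using cSUP_upper[OF UNIV_I bdd, of m] by linarith
  then show "eventually (\<lambda>m. ?f m < a) mset_top" by (simp add: always_eventually)
 qed
 then show ?thesis by blast
qed

text \<open>Polarisation reduces this to the convergence of norms; the imaginary part is obtained
  afterwards by replacing G with i G.\<close>

lemma Re_cinner_compatible_convergent:
 assumes F: "F \<in> compatible" and G: "G \<in> compatible"
 shows "\<exists>l. ((\<lambda>m. Re (cinner H (F m) (G m))) \<longlongrightarrow> l) mset_top"
proof -
 note [simp] = compatibleD(1)[OF F] compatibleD(1)[OF G]
 obtain p q r where lim: "((\<lambda>m. (hnorm H (F m \<oplus> G m))\<^sup>2) \<longlongrightarrow> p) mset_top"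
  "((\<lambda>m. (hnorm H (F m))\<^sup>2) \<longlongrightarrow> q) mset_top" "((\<lambda>m. (hnorm H (G m))\<^sup>2) \<longlongrightarrow> r) mset_top"
  using hnorm_compatible_convergent[OF compatible_add[OF F G]] hnorm_compatible_convergent[OF F]
   hnorm_compatible_convergent[OF G] by blast
 have eq: "Re (cinner H (F m) (G m)) = ((hnorm H (F m \<oplus> G m))\<^sup>2 - (hnorm H (F m))\<^sup>2 - (hnorm H (G m))\<^sup>2) / 2" for m
  by (simp add: hnorm_add_sq)
 have "((\<lambda>m. ((hnorm H (F m \<oplus> G m))\<^sup>2 - (hnorm H (F m))\<^sup>2 - (hnorm H (G m))\<^sup>2) / 2) \<longlongrightarrow> (p - q - r) / 2) mset_top"
  by (intro tendsto_intros lim) simp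
 then show ?thesis unfolding eq by blast
qed

lemma cinner_compatible_convergent:
 assumes F: "F \<in> compatible" and G: "G \<in> compatible"
 shows "\<exists>l. ((\<lambda>m. cinner H (F m) (G m)) \<longlongrightarrow> l) mset_top"
proof -
 note [simp] = compatibleD(1)[OF F] compatibleD(1)[OF G]
 obtain p q where "((\<lambda>m. Re (cinner H (F m) (G m))) \<longlongrightarrow> p) mset_top"
  "((\<lambda>m. Re (cinner H (F m) (\<i> \<odot> G m))) \<longlongrightarrow> q) mset_top"
  using Re_cinner_compatible_convergent[OF F G] Re_cinner_compatible_convergent[OF F compatible_smult[OF G]]
  by blast
 from tendsto_Complex[OF this]
 have "((\<lambda>m. Complex (Re (cinner H (F m) (G m))) (Re (cinner H (F m) (\<i> \<odot> G m)))) \<longlongrightarrow> Complex p q) mset_top" .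
 moreover have "Complex (Re (cinner H (F m) (G m))) (Re (cinner H (F m) (\<i> \<odot> G m))) = cinner H (F m) (G m)" for m
  by (simp add: complex_eq_iff)
 ultimately show ?thesis by auto
qed

section \<open>The Hilbert space of compatible families\<close>

definition ev :: "('w \<Rightarrow> 'a) \<Rightarrow> 'i multiset \<Rightarrow> 'a" where
 "ev f m = f (inv_into UNIV \<mu> m)"

definition mk :: "('i multiset \<Rightarrow> 'a) \<Rightarrow> 'w \<Rightarrow> 'a" where
 "mk F w = F (\<mu> w)"

lemma ev_mk [simp]: "ev (mk F) = F"
 by (simp add: fun_eq_iff ev_def mk_def surj_f_inv_f[OF surj_\<mu>])

text \<open>For F m = J^* U^m k and G m = J^* U^m k' the limit of <F m, G m> has to be <k, k'>,
  because the vectors U^m k are to come arbitrarily close to H.\<close>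

definition model :: "('w \<Rightarrow> 'a) hilb" where
 "model = \<lparr>carrier = mk ` compatible, monoid.mult = (\<lambda>f g. f), one = mk (\<lambda>_. \<zero>),
   zero = mk (\<lambda>_. \<zero>), add = (\<lambda>f g w. f w \<oplus> g w), module.smult = (\<lambda>c f w. c \<odot> f w),
   cinner = (\<lambda>f g. Lim mset_top (\<lambda>m. cinner H (ev f m) (ev g m)))\<rparr>"

lemma model_carrier: "f \<in> carrier model \<longleftrightarrow> ev f \<in> compatible \<and> mk (ev f) = f"
proof
 assume "f \<in> carrier model"
 then obtain F where "f = mk F" "F \<in> compatible" by (auto simp: model_def)
 then show "ev f \<in> compatible \<and> mk (ev f) = f" by simp
next
 assume "ev f \<in> compatible \<and> mk (ev f) = f"
 then have "f \<in> mk ` compatible" by (metis imageI)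
 then show "f \<in> carrier model" by (simp add: model_def)
qed

lemma mk_closed: "F \<in> compatible \<Longrightarrow> mk F \<in> carrier model"
 by (simp add: model_carrier)

lemma ev_compatible: "f \<in> carrier model \<Longrightarrow> ev f \<in> compatible"
 by (simp add: model_carrier)

lemma ev_closed [simp]: "f \<in> carrier model \<Longrightarrow> ev f m \<in> carrier H"
 using compatibleD(1)[OF ev_compatible] by blast

lemma model_eqI: "f \<in> carrier model \<Longrightarrow> g \<in> carrier model \<Longrightarrow> (\<And>m. ev f m = ev g m) \<Longrightarrow> f = g"
 by (metis ext model_carrier)

lemma model_ops:
 "f \<oplus>\<^bsub>model\<^esub> g = (\<lambda>w. f w \<oplus> g w)" "c \<odot>\<^bsub>model\<^esub> f = (\<lambda>w. c \<odot> f w)" "\<zero>\<^bsub>model\<^esub> = mk (\<lambda>_. \<zero>)"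
 by (simp_all add: model_def)

lemma ev_model [simp]:
 "ev (f \<oplus>\<^bsub>model\<^esub> g) m = ev f m \<oplus> ev g m" "ev (c \<odot>\<^bsub>model\<^esub> f) m = c \<odot> ev f m" "ev \<zero>\<^bsub>model\<^esub> m = \<zero>"
 by (simp_all add: model_ops) (simp_all add: ev_def)

lemma model_add_closed: "f \<in> carrier model \<Longrightarrow> g \<in> carrier model \<Longrightarrow> f \<oplus>\<^bsub>model\<^esub> g \<in> carrier model"
proof -
 assume fg: "f \<in> carrier model" "g \<in> carrier model"
 have "mk (\<lambda>m. ev f m \<oplus> ev g m) \<in> carrier model"
  by (rule mk_closed[OF compatible_add]) (use fg in \<open>simp_all add: ev_compatible\<close>)
 moreover have "mk (\<lambda>m. ev f m \<oplus> ev g m) = f \<oplus>\<^bsub>model\<^esub> g"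
 proof
  fix w
  have "mk (ev f) w \<oplus> mk (ev g) w = f w \<oplus> g w" using fg by (simp add: model_carrier)
  then show "mk (\<lambda>m. ev f m \<oplus> ev g m) w = (f \<oplus>\<^bsub>model\<^esub> g) w" by (simp add: model_ops mk_def)
 qed
 ultimately show ?thesis by simp
qed

lemma model_smult_closed: "f \<in> carrier model \<Longrightarrow> c \<odot>\<^bsub>model\<^esub> f \<in> carrier model"
proof -
 assume f: "f \<in> carrier model"
 have "mk (\<lambda>m. c \<odot> ev f m) \<in> carrier model"
  by (rule mk_closed[OF compatible_smult]) (use f in \<open>simp_all add: ev_compatible\<close>)
 moreover have "mk (\<lambda>m. c \<odot> ev f m) = c \<odot>\<^bsub>model\<^esub> f"
 proof
  fix w
  have "c \<odot> mk (ev f) w = c \<odot> f w" using f by (simp add: model_carrier)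
  then show "mk (\<lambda>m. c \<odot> ev f m) w = (c \<odot>\<^bsub>model\<^esub> f) w" by (simp add: model_ops mk_def)
 qed
 ultimately show ?thesis by simp
qed

lemma model_zero_closed: "\<zero>\<^bsub>model\<^esub> \<in> carrier model"
 by (simp add: model_ops mk_closed compatible_zero)

lemma model_module: "Module.module complex_ring model"
proof (rule moduleI)
 note [simp] = model_add_closed model_smult_closed model_zero_closed
 show "cring complex_ring" by (rule cring_complex_ring)
 show "abelian_group model"
 proof (rule abelian_groupI)
  fix f assume f: "f \<in> carrier model"
  have "(- 1) \<odot>\<^bsub>model\<^esub> f \<oplus>\<^bsub>model\<^esub> f = \<zero>\<^bsub>model\<^esub>"
  proof (rule model_eqI)
   fix m
   have "ev f m \<oplus> (- 1) \<odot> ev f m = \<zero>"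
    using minus_eq_add_smult[OF ev_closed[OF f] ev_closed[OF f], of m m] f by simp
   then show "ev ((- 1) \<odot>\<^bsub>model\<^esub> f \<oplus>\<^bsub>model\<^esub> f) m = ev \<zero>\<^bsub>model\<^esub> m"
    using f a_comm[of "ev f m" "(- 1) \<odot> ev f m"] by simp
  qed (use f in simp_all)
  then show "\<exists>g\<in>carrier model. g \<oplus>\<^bsub>model\<^esub> f = \<zero>\<^bsub>model\<^esub>"
   using f by (intro bexI[of _ "(- 1) \<odot>\<^bsub>model\<^esub> f"]) simp_all
 qed (auto intro!: model_eqI simp: M.a_ac)
qed (auto intro!: model_eqI simp: model_add_closed model_smult_closed smult_l_distr[simplified] smult_r_distr)

interpretation MM: Module.module complex_ring model by (rule model_module)

lemma ev_minus [simp]: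
 assumes "f \<in> carrier model" "g \<in> carrier model"
 shows "ev (f \<ominus>\<^bsub>model\<^esub> g) m = ev f m \<ominus> ev g m"
proof -
 have "f \<ominus>\<^bsub>model\<^esub> g = f \<oplus>\<^bsub>model\<^esub> (- 1) \<odot>\<^bsub>model\<^esub> g"
  using MM.smult_l_minus[of 1 g] MM.smult_one[of g] assms by (simp add: a_minus_def)
 then show ?thesis using assms by (simp add: minus_eq_add_smult)
qed

lemma cinner_model_tendsto:
 assumes "f \<in> carrier model" "g \<in> carrier model"
 shows "((\<lambda>m. cinner H (ev f m) (ev g m)) \<longlongrightarrow> cinner model f g) mset_top"
proof -
 obtain l where l: "((\<lambda>m. cinner H (ev f m) (ev g m)) \<longlongrightarrow> l) mset_top"
  using cinner_compatible_convergent[OF ev_compatible ev_compatible] assms by blast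
 then have "cinner model f g = l" by (simp add: model_def tendsto_Lim)
 then show ?thesis using l by simp
qed

lemma cinner_model_eqI:
 assumes "f \<in> carrier model" "g \<in> carrier model" "((\<lambda>m. cinner H (ev f m) (ev g m)) \<longlongrightarrow> l) mset_top"
 shows "cinner model f g = l"
 by (rule tendsto_unique[OF mset_top_neq_bot cinner_model_tendsto assms(3)]) (use assms in simp_all)

lemma hnorm_model_tendsto:
 assumes "f \<in> carrier model"
 shows "((\<lambda>m. hnorm H (ev f m)) \<longlongrightarrow> hnorm model f) mset_top"
 unfolding hnorm_def by (intro tendsto_real_sqrt tendsto_Re cinner_model_tendsto assms)

lemma hnorm_ev_le:
 assumes "f \<in> carrier model"
 shows "hnorm H (ev f m) \<le> hnorm model f"
proof (rule tendsto_lowerbound[OF hnorm_model_tendsto[OF assms]])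
 show "eventually (\<lambda>n. hnorm H (ev f m) \<le> hnorm H (ev f n)) mset_top"
  unfolding eventually_mset_top using compatible_mono[OF ev_compatible[OF assms]] by blast
qed simp

lemma hnorm_model_le:
 assumes "f \<in> carrier model" "\<And>m. hnorm H (ev f m) \<le> b"
 shows "hnorm model f \<le> b"
 by (rule tendsto_upperbound[OF hnorm_model_tendsto[OF assms(1)]]) (simp_all add: assms(2))

lemma hnorm_model_nonneg: "f \<in> carrier model \<Longrightarrow> 0 \<le> hnorm model f"
 using order_trans[OF _ hnorm_ev_le, of 0 f "{#}"] by simp

lemma hdist_model:
 "f \<in> carrier model \<Longrightarrow> g \<in> carrier model \<Longrightarrow> hdist model f g = hnorm model (f \<ominus>\<^bsub>model\<^esub> g)"
 by (simp add: hdist_def)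

lemma hdist_model_tendsto:
 assumes "f \<in> carrier model" "g \<in> carrier model"
 shows "((\<lambda>m. hnorm H (ev f m \<ominus> ev g m)) \<longlongrightarrow> hdist model f g) mset_top"
 using hnorm_model_tendsto[of "f \<ominus>\<^bsub>model\<^esub> g"] assms by (simp add: hdist_model)

text \<open>Completeness is an assumption of \<open>hilbert_space\<close> and presupposes a metric.
  The metric axioms therefore come from limits of norms in H, before the locale is available for
  \<open>model\<close>.\<close>

lemma model_metric: "Metric_space (carrier model) (hdist model)"
proof
 show "0 \<le> hdist model f g" for f g
  by (simp add: hdist_def hnorm_model_nonneg)
 show "hdist model f g = hdist model g f" for f g
 proof (cases "f \<in> carrier model \<and> g \<in> carrier model")
  case True
  then have "((\<lambda>m. hnorm H (ev f m \<ominus> ev g m)) \<longlongrightarrow> hdist model g f) mset_top"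
   using hdist_model_tendsto[of g f] hnorm_minus_commute[of "ev f _" "ev g _"] by simp
  then show ?thesis
   using True tendsto_unique[OF mset_top_neq_bot hdist_model_tendsto[of f g]] by blast
 qed (auto simp: hdist_def)
 show "(hdist model f g = 0) = (f = g)" if fg: "f \<in> carrier model" "g \<in> carrier model" for f g
 proof
  assume 0: "hdist model f g = 0"
  show "f = g"
  proof (rule model_eqI[OF fg])
   fix m
   have "hnorm H (ev f m \<ominus> ev g m) \<le> 0"
    using hnorm_ev_le[of "f \<ominus>\<^bsub>model\<^esub> g" m] 0 fg by (simp add: hdist_model)
   then have "hnorm H (ev f m \<ominus> ev g m) = 0" using fg by (intro antisym) simp_all
   then show "ev f m = ev g m" using fg by simp
  qed
 next
  assume "f = g"
  then have "((\<lambda>m. 0) \<longlongrightarrow> hdist model f g) (mset_top :: 'i multiset filter)"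
   using hdist_model_tendsto[OF fg] fg iffD2[OF minus_eq_zero_iff, of "ev g _" "ev g _"] by simp
  then show "hdist model f g = 0" using tendsto_unique[OF mset_top_neq_bot tendsto_const] by metis
 qed
 show "hdist model f h \<le> hdist model f g + hdist model g h"
  if "f \<in> carrier model" "g \<in> carrier model" "h \<in> carrier model" for f g h
 proof (rule tendsto_le[OF mset_top_neq_bot])
  show "((\<lambda>m. hnorm H (ev f m \<ominus> ev g m) + hnorm H (ev g m \<ominus> ev h m)) \<longlongrightarrow> hdist model f g + hdist model g h) mset_top"
   by (intro tendsto_add hdist_model_tendsto that)
  show "((\<lambda>m. hnorm H (ev f m \<ominus> ev h m)) \<longlongrightarrow> hdist model f h) mset_top"
   by (intro hdist_model_tendsto that)
  show "eventually (\<lambda>m. hnorm H (ev f m \<ominus> ev h m) \<le> hnorm H (ev f m \<ominus> ev g m) + hnorm H (ev g m \<ominus> ev h m)) mset_top"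
   by (rule always_eventually, rule allI, rule hnorm_triangle_dist) (use that in simp_all)
 qed
qed

interpretation mm: Metric_space "carrier model" "hdist model" by (rule model_metric)

lemma hnorm_limit_le:
 assumes x: "\<And>n. x n \<in> carrier H" "l \<in> carrier H" "(\<lambda>n. hnorm H (x n \<ominus> l)) \<longlonglongrightarrow> 0" and y: "y \<in> carrier H"
  and le: "\<And>n. n \<ge> N \<Longrightarrow> hnorm H (y \<ominus> x n) \<le> b"
 shows "hnorm H (y \<ominus> l) \<le> b"
proof (rule tendsto_lowerbound)
 show "(\<lambda>n. b + hnorm H (x n \<ominus> l)) \<longlonglongrightarrow> b" using tendsto_add[OF tendsto_const x(3), of b] by simp
 show "eventually (\<lambda>n. hnorm H (y \<ominus> l) \<le> b + hnorm H (x n \<ominus> l)) sequentially"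
 proof (rule eventually_sequentiallyI)
  fix n assume "n \<ge> N"
  then show "hnorm H (y \<ominus> l) \<le> b + hnorm H (x n \<ominus> l)"
   using hnorm_triangle_dist[of y "x n" l] le[of n] x y by fastforce
 qed
qed simp

lemma tendsto_bop:
 assumes T: "T \<in> \<B> H" and x: "\<And>n. x n \<in> carrier H" "l \<in> carrier H" "(\<lambda>n. hnorm H (x n \<ominus> l)) \<longlonglongrightarrow> 0"
 shows "(\<lambda>n. hnorm H (T (x n) \<ominus> T l)) \<longlonglongrightarrow> 0"
proof (rule tendsto_sandwich[OF _ _ tendsto_const])
 note [simp] = bop_rules[OF T]
 show "(\<lambda>n. op_norm H T * hnorm H (x n \<ominus> l)) \<longlonglongrightarrow> 0" using tendsto_mult_left[OF x(3), of "op_norm H T"] by simp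
 show "eventually (\<lambda>n. hnorm H (T (x n) \<ominus> T l) \<le> op_norm H T * hnorm H (x n \<ominus> l)) sequentially"
  using op_norm_bound[OF T, of "x _ \<ominus> l"] x by simp
qed (use x in \<open>simp add: bop_closed[OF T]\<close>)

lemma hnorm_limit_unique:
 assumes x: "\<And>n. x n \<in> carrier H" and k: "k \<in> carrier H" "(\<lambda>n. hnorm H (x n \<ominus> k)) \<longlonglongrightarrow> 0"
  and l: "l \<in> carrier H" "(\<lambda>n. hnorm H (x n \<ominus> l)) \<longlonglongrightarrow> 0"
 shows "k = l"
proof -
 have "limitin hm.mtopology x k sequentially" "limitin hm.mtopology x l sequentially"
  using limitin_norm_iff[of x k] limitin_norm_iff[of x l] assms by blast+
 then show ?thesis by (rule hm.limitin_metric_unique) simp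
qed

text \<open>A Cauchy sequence is Cauchy at every m, uniformly, since ||ev f m|| \<le> ||f||. Its
  pointwise limit is compatible because the P_a^* are continuous, and uniformity gives convergence
  in norm through \<open>hnorm_model_le\<close>.\<close>

lemma model_complete: "mm.mcomplete"
 unfolding mm.mcomplete_def
proof (intro allI impI)
 fix \<sigma> assume "mm.MCauchy \<sigma>"
 then have \<sigma>: "\<sigma> n \<in> carrier model"
  and C: "e > 0 \<Longrightarrow> \<exists>N. \<forall>n n'. N \<le> n \<longrightarrow> N \<le> n' \<longrightarrow> hdist model (\<sigma> n) (\<sigma> n') < e" for n e
  unfolding mm.MCauchy_def by auto
 have C': "\<exists>N. \<forall>n\<ge>N. \<forall>n'\<ge>N. \<forall>m. hnorm H (ev (\<sigma> n) m \<ominus> ev (\<sigma> n') m) < e" if "e > 0" for e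
 proof -
  have "hnorm H (ev (\<sigma> n) m \<ominus> ev (\<sigma> n') m) \<le> hdist model (\<sigma> n) (\<sigma> n')" for n n' m
   using hnorm_ev_le[of "\<sigma> n \<ominus>\<^bsub>model\<^esub> \<sigma> n'" m] \<sigma> by (simp add: hdist_model)
  then show ?thesis using C[OF that] by (meson le_less_trans)
 qed
 have "\<exists>l. l \<in> carrier H \<and> (\<lambda>n. hnorm H (ev (\<sigma> n) m \<ominus> l)) \<longlonglongrightarrow> 0" for m
 proof -
  have "\<exists>N. \<forall>n\<ge>N. \<forall>n'\<ge>N. hnorm H (ev (\<sigma> n) m \<ominus> ev (\<sigma> n') m) < e" if "e > 0" for e
   using C'[OF that] by blast
  from Cauchy_convergent[OF _ this] show ?thesis using \<sigma> by (metis ev_closed)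
 qed
 then obtain F where F: "F m \<in> carrier H" "(\<lambda>n. hnorm H (ev (\<sigma> n) m \<ominus> F m)) \<longlonglongrightarrow> 0" for m
  by metis
 have close: "\<exists>N. \<forall>n\<ge>N. \<forall>m. hnorm H (ev (\<sigma> n) m \<ominus> F m) \<le> e" if e: "e > 0" for e
 proof -
  obtain N where N: "\<And>n n' m. n \<ge> N \<Longrightarrow> n' \<ge> N \<Longrightarrow> hnorm H (ev (\<sigma> n) m \<ominus> ev (\<sigma> n') m) < e"
   using C'[OF e] by blast
  have "hnorm H (ev (\<sigma> n) m \<ominus> F m) \<le> e" if n: "n \<ge> N" for n m
  proof (rule hnorm_limit_le[OF _ F])
   show "hnorm H (ev (\<sigma> n) m \<ominus> ev (\<sigma> n') m) \<le> e" if "n' \<ge> N" for n'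
    by (rule less_imp_le) (rule N[OF n that])
  qed (simp_all add: \<sigma>)
  then show ?thesis by blast
 qed
 have FC: "F \<in> compatible"
 proof -
  obtain n where n: "\<And>m. hnorm H (ev (\<sigma> n) m \<ominus> F m) \<le> 1" using close[of 1] by auto
  obtain b where b: "\<And>m. hnorm H (ev (\<sigma> n) m) \<le> b" using compatibleD(4)[OF ev_compatible[OF \<sigma>]] by blast
  show ?thesis
  proof (rule compatibleI)
   show "adj H (P a) (F (add_mset a m)) = F m" if a: "a \<in> \<Lambda>" for a m
   proof (rule hnorm_limit_unique)
    note PA = adj_closed[OF P_closed[OF a]]
    show "(\<lambda>n. hnorm H (ev (\<sigma> n) m \<ominus> adj H (P a) (F (add_mset a m)))) \<longlonglongrightarrow> 0"
     using tendsto_bop[OF PA, of "\<lambda>n. ev (\<sigma> n) (add_mset a m)" "F (add_mset a m)"] F \<sigma>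
      compatibleD(2)[OF ev_compatible[OF \<sigma>] a] by simp
    show "adj H (P a) (F (add_mset a m)) \<in> carrier H" by (rule bop_closed[OF PA F(1)])
   qed (simp_all add: F \<sigma>)
   show "F (add_mset a m) = F m" if a: "a \<notin> \<Lambda>" for a m
   proof (rule hnorm_limit_unique)
    show "(\<lambda>n. hnorm H (ev (\<sigma> n) (add_mset a m) \<ominus> F m)) \<longlonglongrightarrow> 0"
     using F(2)[of m] compatibleD(3)[OF ev_compatible[OF \<sigma>] a] by simp
   qed (simp_all add: F \<sigma>)
   show "hnorm H (F m) \<le> 1 + b" for m
    using n[of m] b[of m] hnorm_triangle_diff[of "F m" "ev (\<sigma> n) m"] hnorm_minus_commute[of "F m" "ev (\<sigma> n) m"]
     F(1)[of m] ev_closed[OF \<sigma>, of n m] by linarith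
  qed (rule F)
 qed
 have "limitin mm.mtopology \<sigma> (mk F) sequentially"
  unfolding mm.limitin_metric
 proof (intro conjI allI impI)
  show "mk F \<in> carrier model" by (rule mk_closed[OF FC])
  fix e :: real assume "e > 0"
  then obtain N where N: "\<And>n m. n \<ge> N \<Longrightarrow> hnorm H (ev (\<sigma> n) m \<ominus> F m) \<le> e / 2" using close[of "e/2"] by auto
  have "hdist model (\<sigma> n) (mk F) < e" if "n \<ge> N" for n
  proof -
   have "hnorm model (\<sigma> n \<ominus>\<^bsub>model\<^esub> mk F) \<le> e / 2"
    by (rule hnorm_model_le) (use N[OF that] \<sigma> mk_closed[OF FC] in simp_all)
   then show ?thesis using \<sigma> mk_closed[OF FC] \<open>e > 0\<close> by (simp add: hdist_model)
  qed
  then show "eventually (\<lambda>n. \<sigma> n \<in> carrier model \<and> hdist model (\<sigma> n) (mk F) < e) sequentially"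
   using \<sigma> by (intro eventually_sequentiallyI) blast
 qed
 then show "\<exists>f. limitin mm.mtopology \<sigma> f sequentially" by blast
qed

lemma model_hilbert: "hilbert_space model"
proof (intro hilbert_space.intro hilbert_space_axioms.intro)
 show "Module.module complex_ring model" by (rule model_module)
 fix f g h assume f: "f \<in> carrier model" and g: "g \<in> carrier model"
 { assume h: "h \<in> carrier model"
  have "((\<lambda>m. cinner H (ev f m) (ev h m) + cinner H (ev g m) (ev h m)) \<longlongrightarrow> cinner model f h + cinner model g h) mset_top"
   by (intro tendsto_add cinner_model_tendsto f g h)
  then show "cinner model (f \<oplus>\<^bsub>model\<^esub> g) h = cinner model f h + cinner model g h"
   using f g h by (intro cinner_model_eqI) simp_all }
 show "cinner model (c \<odot>\<^bsub>model\<^esub> f) g = c * cinner model f g" for c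
  using tendsto_mult_left[OF cinner_model_tendsto[OF f g], of c] f g by (intro cinner_model_eqI) simp_all
 have "((\<lambda>m. cnj (cinner H (ev g m) (ev f m))) \<longlongrightarrow> cnj (cinner model g f)) mset_top"
  by (intro tendsto_cnj cinner_model_tendsto f g)
 moreover have "cnj (cinner H (ev g m) (ev f m)) = cinner H (ev f m) (ev g m)" for m
  by (rule cinner_commute[symmetric]) (use f g in simp_all)
 ultimately show "cinner model f g = cnj (cinner model g f)"
  using f g by (intro cinner_model_eqI) simp_all
next
 fix f assume f: "f \<in> carrier model" "f \<noteq> \<zero>\<^bsub>model\<^esub>"
 then obtain m where "ev f m \<noteq> \<zero>" using model_eqI[OF f(1) model_zero_closed] by auto
 then have "0 < hnorm H (ev f m)"
  using hnorm_eq_0[OF ev_closed[OF f(1)], of m] hnorm_nonneg[OF ev_closed[OF f(1)], of m] by linarith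
 then have "0 < hnorm model f" using hnorm_ev_le[OF f(1), of m] by linarith
 then show "0 < Re (cinner model f f)" by (simp add: hnorm_def)
qed (rule model_complete)

sublocale M: hilbert_space model by (rule model_hilbert)

end

section \<open>The operators of the model and its minimality\<close>

context gamma_model
begin

text \<open>Commuting with every P_a^* is what preserves the recursion F m = P_a^* F (m + a) when T
  is applied pointwise.\<close>

definition adj_commutant :: "('a \<Rightarrow> 'a) set" where
 "adj_commutant = {T \<in> \<B> H. \<forall>a\<in>\<Lambda>. T \<otimes>\<^bsub>BL H\<^esub> adj H (P a) = adj H (P a) \<otimes>\<^bsub>BL H\<^esub> T}"

text \<open>U_a, R_a and both adjoints all have this form, so boundedness and commutation are proved
  once for it.\<close>

definition shift :: "('a \<Rightarrow> 'a) \<Rightarrow> 'i multiset \<Rightarrow> ('w \<Rightarrow> 'a) \<Rightarrow> 'w \<Rightarrow> 'a" where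
 "shift T n = (\<lambda>f\<in>carrier model. mk (\<lambda>m. T (ev f (n + m))))"

lemma adj_commutantD:
 assumes "T \<in> adj_commutant"
 shows "T \<in> \<B> H" "a \<in> \<Lambda> \<Longrightarrow> x \<in> carrier H \<Longrightarrow> adj H (P a) (T x) = T (adj H (P a) x)"
 using assms commuteD[of T "adj H (P a)" x] by (simp_all add: adj_commutant_def)

lemma adj_commutant_ops:
 shows one_adj_commutant: "\<one>\<^bsub>BL H\<^esub> \<in> adj_commutant"
  and adj_P_adj_commutant: "a \<in> \<Lambda> \<Longrightarrow> adj H (P a) \<in> adj_commutant"
  and adj_S_adj_commutant: "a \<in> \<Lambda> \<Longrightarrow> adj H (S a) \<in> adj_commutant"
proof -
 have "\<one>\<^bsub>BL H\<^esub> \<otimes>\<^bsub>BL H\<^esub> adj H (P b) = adj H (P b) \<otimes>\<^bsub>BL H\<^esub> \<one>\<^bsub>BL H\<^esub>" if "b \<in> \<Lambda>" for b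
  using adj_closed[OF P_closed[OF that]] by simp
 then show "\<one>\<^bsub>BL H\<^esub> \<in> adj_commutant" by (simp add: adj_commutant_def)
 assume a: "a \<in> \<Lambda>"
 have "adj H (P a) \<otimes>\<^bsub>BL H\<^esub> adj H (P b) = adj H (P b) \<otimes>\<^bsub>BL H\<^esub> adj H (P a)" if b: "b \<in> \<Lambda>" for b
  using adj_mult[OF P_closed[OF a] P_closed[OF b]] adj_mult[OF P_closed[OF b] P_closed[OF a]]
  unfolding P_commute[OF a b] by (rule trans[OF sym, rotated])
 then show "adj H (P a) \<in> adj_commutant" using adj_closed[OF P_closed[OF a]] by (simp add: adj_commutant_def)
 have "adj H (S a) \<otimes>\<^bsub>BL H\<^esub> adj H (P b) = adj H (P b) \<otimes>\<^bsub>BL H\<^esub> adj H (S a)" if b: "b \<in> \<Lambda>" for b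
  using adj_mult[OF S_closed[OF a] P_closed[OF b]] adj_mult[OF P_closed[OF b] S_closed[OF a]]
  unfolding S_P_commute[OF a b] by (rule trans[OF sym, rotated])
 then show "adj H (S a) \<in> adj_commutant" using adj_closed[OF S_closed[OF a]] by (simp add: adj_commutant_def)
qed

lemma shift_compatible:
 assumes T: "T \<in> adj_commutant" and F: "F \<in> compatible"
 shows "(\<lambda>m. T (F (n + m))) \<in> compatible"
proof -
 note TB = adj_commutantD(1)[OF T] and Fc = compatibleD(1)[OF F]
 obtain b where b: "\<And>m. hnorm H (F m) \<le> b" using compatibleD(4)[OF F] by blast
 show ?thesis
 proof (rule compatibleI)
  show "adj H (P a) (T (F (n + add_mset a m))) = T (F (n + m))" if a: "a \<in> \<Lambda>" for a m
   using adj_commutantD(2)[OF T a Fc] compatibleD(2)[OF F a] by simp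
  show "T (F (n + add_mset a m)) = T (F (n + m))" if a: "a \<notin> \<Lambda>" for a m
   using compatibleD(3)[OF F a] by simp
  show "hnorm H (T (F (n + m))) \<le> op_norm H T * b" for m
   using op_norm_bound[OF TB Fc, of "n + m"] mult_left_mono[OF b[of "n + m"] op_norm_nonneg[OF TB]] by linarith
 qed (rule bop_closed[OF TB Fc])
qed

lemma ev_shift [simp]: "f \<in> carrier model \<Longrightarrow> ev (shift T n f) m = T (ev f (n + m))"
 by (simp add: shift_def)

lemma shift_closed: "T \<in> adj_commutant \<Longrightarrow> f \<in> carrier model \<Longrightarrow> shift T n f \<in> carrier model"
 by (simp add: shift_def mk_closed shift_compatible ev_compatible)

lemma hnorm_shift_le:
 assumes T: "T \<in> adj_commutant" and f: "f \<in> carrier model"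
 shows "hnorm model (shift T n f) \<le> op_norm H T * hnorm model f"
proof (rule hnorm_model_le[OF shift_closed[OF T f]])
 fix m
 note TB = adj_commutantD(1)[OF T]
 have "hnorm H (T (ev f (n + m))) \<le> op_norm H T * hnorm H (ev f (n + m))"
  by (rule op_norm_bound[OF TB ev_closed[OF f]])
 also have "\<dots> \<le> op_norm H T * hnorm model f"
  by (rule mult_left_mono[OF hnorm_ev_le[OF f] op_norm_nonneg[OF TB]])
 finally show "hnorm H (ev (shift T n f) m) \<le> op_norm H T * hnorm model f" using f by simp
qed

lemma shift_BL: "T \<in> adj_commutant \<Longrightarrow> shift T n \<in> \<B> model"
proof (rule M.bopI[where b = "op_norm H T"])
 assume T: "T \<in> adj_commutant"
 note [simp] = shift_closed[OF T] bop_rules[OF adj_commutantD(1)[OF T]]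
 show "shift T n (f \<oplus>\<^bsub>model\<^esub> g) = shift T n f \<oplus>\<^bsub>model\<^esub> shift T n g"
  if "f \<in> carrier model" "g \<in> carrier model" for f g
  by (rule model_eqI) (use that in simp_all)
 show "shift T n (c \<odot>\<^bsub>model\<^esub> f) = c \<odot>\<^bsub>model\<^esub> shift T n f" if "f \<in> carrier model" for c f
  by (rule model_eqI) (use that in simp_all)
qed (simp_all add: shift_closed hnorm_shift_le, simp add: shift_def)

lemma op_norm_shift: "T \<in> adj_commutant \<Longrightarrow> op_norm model (shift T n) \<le> op_norm H T"
 by (rule M.op_norm_le) (simp_all add: adj_commutantD(1) hnorm_shift_le)

lemma shift_eqI:
 assumes "A \<in> \<B> model" "B \<in> \<B> model"
  "\<And>f m. f \<in> carrier model \<Longrightarrow> ev (A f) m = ev (B f) m"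
 shows "A = B"
 by (rule M.bop_eqI[OF assms(1,2)], rule model_eqI) (use assms M.bop_closed in blast)+

lemma shift_commute:
 assumes S: "A \<in> adj_commutant" and T: "B \<in> adj_commutant" and c: "A \<otimes>\<^bsub>BL H\<^esub> B = B \<otimes>\<^bsub>BL H\<^esub> A"
 shows "shift A n \<otimes>\<^bsub>BL model\<^esub> shift B k = shift B k \<otimes>\<^bsub>BL model\<^esub> shift A n"
proof (rule shift_eqI)
 fix f m assume f: "f \<in> carrier model"
 show "ev ((shift A n \<otimes>\<^bsub>BL model\<^esub> shift B k) f) m = ev ((shift B k \<otimes>\<^bsub>BL model\<^esub> shift A n) f) m"
  using commuteD[OF c ev_closed[OF f], of "n + (k + m)"] f
  by (simp add: shift_closed S T add.left_commute[of k n m])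
qed (intro M.BL_mult_closed shift_BL S T)+

definition modelU :: "'i \<Rightarrow> ('w \<Rightarrow> 'a) \<Rightarrow> 'w \<Rightarrow> 'a" where
 "modelU a = shift \<one>\<^bsub>BL H\<^esub> {#a#}"

text \<open>Dictated by R = R^* U and J^* R^* = S^* J^*, which give J^* U^m R k = S^* J^* U^(m + a)
  k.\<close>

definition modelR :: "'i \<Rightarrow> ('w \<Rightarrow> 'a) \<Rightarrow> 'w \<Rightarrow> 'a" where
 "modelR a = shift (adj H (S a)) {#a#}"

definition modelJ :: "'a \<Rightarrow> 'w \<Rightarrow> 'a" where
 "modelJ h = mk (\<lambda>m. mpow H \<Lambda> P m h)"

lemma modelU_BL: "modelU a \<in> \<B> model"
 by (simp add: modelU_def shift_BL one_adj_commutant)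

lemma modelR_BL: "a \<in> \<Lambda> \<Longrightarrow> modelR a \<in> \<B> model"
 by (simp add: modelR_def shift_BL adj_S_adj_commutant)

lemma ev_modelU: "f \<in> carrier model \<Longrightarrow> ev (modelU a f) m = ev f (add_mset a m)"
 by (simp add: modelU_def)

text \<open>At the exponent m + a the form of the claimed adjoint at f with g equals the form of f
  with U_a g at m, because P_a^* lowers the exponent of f. Shifting the exponent does not change the
  limit.\<close>

lemma adj_modelU:
 assumes a: "a \<in> \<Lambda>"
 shows "adj model (modelU a) = shift (adj H (P a)) {#}"
proof (rule M.adjI[OF modelU_BL shift_BL[OF adj_P_adj_commutant[OF a]]])
 fix f g assume f: "f \<in> carrier model" and g: "g \<in> carrier model"
 note PA = shift_closed[OF adj_P_adj_commutant[OF a]]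
 have *: "cinner H (ev (shift (adj H (P a)) {#} f) (add_mset a m)) (ev g (add_mset a m))
   = cinner H (ev f m) (ev (modelU a g) m)" for m
  using f g compatibleD(2)[OF ev_compatible[OF f] a, of m] by (simp add: ev_modelU)
 have "((\<lambda>m. cinner H (ev f m) (ev (modelU a g) m)) \<longlongrightarrow> cinner model (shift (adj H (P a)) {#} f) g) mset_top"
  using filterlim_compose[OF cinner_model_tendsto[OF PA[OF f, of "{#}"] g] filterlim_mset_top_add_mset[of a]]
  unfolding * .
 then show "cinner model (shift (adj H (P a)) {#} f) g = cinner model f (modelU a g)"
  by (rule cinner_model_eqI[OF f M.bop_closed[OF modelU_BL g], symmetric])
qed

lemma modelU_unitary:
 assumes a: "a \<in> \<Lambda>"
 shows "adj model (modelU a) \<otimes>\<^bsub>BL model\<^esub> modelU a = \<one>\<^bsub>BL model\<^esub>"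
  "modelU a \<otimes>\<^bsub>BL model\<^esub> adj model (modelU a) = \<one>\<^bsub>BL model\<^esub>"
proof -
 note PA = adj_P_adj_commutant[OF a]
 have UA: "shift (adj H (P a)) {#} \<in> \<B> model" by (rule shift_BL[OF PA])
 have *: "adj H (P a) (ev f (add_mset a m)) = ev f m" if "f \<in> carrier model" for f m
  using compatibleD(2)[OF ev_compatible[OF that] a] .
 show "adj model (modelU a) \<otimes>\<^bsub>BL model\<^esub> modelU a = \<one>\<^bsub>BL model\<^esub>"
  unfolding adj_modelU[OF a]
  by (rule shift_eqI) (simp_all add: UA modelU_BL M.bop_closed[OF modelU_BL] ev_modelU *)
 show "modelU a \<otimes>\<^bsub>BL model\<^esub> adj model (modelU a) = \<one>\<^bsub>BL model\<^esub>"
  unfolding adj_modelU[OF a]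
  by (rule shift_eqI) (simp_all add: UA modelU_BL M.bop_closed[OF UA] ev_modelU *)
qed

text \<open>By \<open>compatible_defect\<close> the square of this norm is a difference of two nets
  with the same limit.\<close>

lemma defect_tendsto:
 assumes a: "a \<in> \<Lambda>" and f: "f \<in> carrier model"
 shows "((\<lambda>m. hnorm H (ev f (add_mset a m) \<ominus> P a (ev f m))) \<longlongrightarrow> 0) mset_top"
proof -
 have "((\<lambda>m. (hnorm H (ev f (add_mset a m)))\<^sup>2 - (hnorm H (ev f m))\<^sup>2) \<longlongrightarrow> (hnorm model f)\<^sup>2 - (hnorm model f)\<^sup>2) mset_top"
  by (intro tendsto_intros hnorm_model_tendsto f
    filterlim_compose[OF hnorm_model_tendsto[OF f] filterlim_mset_top_add_mset[of a]])
 moreover have "(hnorm H (ev f (add_mset a m)))\<^sup>2 - (hnorm H (ev f m))\<^sup>2 = (hnorm H (ev f (add_mset a m) \<ominus> P a (ev f m)))\<^sup>2" for m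
  using compatible_defect[OF ev_compatible[OF f], of m "{#a#}"] a f by (simp add: mpow_add_mset total_op_def)
 ultimately have "((\<lambda>m. (hnorm H (ev f (add_mset a m) \<ominus> P a (ev f m)))\<^sup>2) \<longlongrightarrow> 0) mset_top" by simp
 from tendsto_real_sqrt[OF this] show ?thesis
  using f bop_closed[OF P_closed[OF a]] by simp
qed

text \<open>Taking adjoints in S = S^* P gives S^* = P^* S. The two forms, compared at m + a and m,
  then differ by the inner product of F (m + a) - P F m with a bounded net, which vanishes in the
  limit by \<open>defect_tendsto\<close>.\<close>

lemma adj_modelR:
 assumes a: "a \<in> \<Lambda>"
 shows "adj model (modelR a) = shift (adj H (S a)) {#}"
proof (rule M.adjI[OF modelR_BL[OF a] shift_BL[OF adj_S_adj_commutant[OF a]]])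
 note SA = adj_S_adj_commutant[OF a]
 note SaB = adj_closed[OF S_closed[OF a]]
 note [simp] = bop_rules[OF SaB] bop_rules[OF S_closed[OF a]] bop_rules[OF P_closed[OF a]]
 fix f g assume f: "f \<in> carrier model" and g: "g \<in> carrier model"
 note fg [simp] = f g
 let ?d = "\<lambda>m. ev f (add_mset a m) \<ominus> P a (ev f m)"
 have *: "cinner H (ev (shift (adj H (S a)) {#} f) (add_mset a m)) (ev g (add_mset a m)) - cinner H (ev f m) (ev (modelR a g) m)
   = cinner H (?d m) (S a (ev g (add_mset a m)))" for m
 proof -
  let ?x = "ev f (add_mset a m)" and ?y = "ev g (add_mset a m)"
  have SP: "adj H (S a) ?y = adj H (P a) (S a ?y)"
  proof -
   have "adj H (S a) = adj H (P a) \<otimes>\<^bsub>BL H\<^esub> S a"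
    using arg_cong[OF S_P[OF a], of "adj H"] adj_mult[OF SaB P_closed[OF a]] S_closed[OF a] by simp
   from fun_cong[OF this, of ?y] show ?thesis by simp
  qed
  have "cinner H (ev f m) (ev (modelR a g) m) = cinner H (ev f m) (adj H (P a) (S a ?y))"
   by (simp add: modelR_def SP)
  also have "\<dots> = cinner H (P a (ev f m)) (S a ?y)" using P_closed[OF a] by simp
  finally show ?thesis using S_closed[OF a] by simp
 qed
 have "((\<lambda>m. cinner H (?d m) (S a (ev g (add_mset a m)))) \<longlongrightarrow> 0) mset_top"
 proof (rule tendsto_norm_zero_cancel, rule tendsto_sandwich[OF _ _ tendsto_const])
  show "((\<lambda>m. hnorm H (?d m) * (op_norm H (S a) * hnorm model g)) \<longlongrightarrow> 0) mset_top"
   by (rule tendsto_mult_left_zero[OF defect_tendsto[OF a f]])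
  have "cmod (cinner H (?d m) (S a (ev g (add_mset a m)))) \<le> hnorm H (?d m) * (op_norm H (S a) * hnorm model g)" for m
  proof -
   have "hnorm H (S a (ev g (add_mset a m))) \<le> op_norm H (S a) * hnorm H (ev g (add_mset a m))"
    by (rule op_norm_bound[OF S_closed[OF a]]) simp
   also have "\<dots> \<le> op_norm H (S a) * hnorm model g"
    by (rule mult_left_mono[OF hnorm_ev_le[OF g] op_norm_nonneg[OF S_closed[OF a]]])
   finally have "hnorm H (?d m) * hnorm H (S a (ev g (add_mset a m))) \<le> hnorm H (?d m) * (op_norm H (S a) * hnorm model g)"
    by (rule mult_left_mono) simp
   moreover have "cmod (cinner H (?d m) (S a (ev g (add_mset a m)))) \<le> hnorm H (?d m) * hnorm H (S a (ev g (add_mset a m)))"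
    by (rule Cauchy_Schwarz) simp_all
   ultimately show ?thesis by linarith
  qed
  then show "eventually (\<lambda>m. cmod (cinner H (?d m) (S a (ev g (add_mset a m)))) \<le> hnorm H (?d m) * (op_norm H (S a) * hnorm model g)) mset_top"
   by simp
 qed simp
 then have "((\<lambda>m. cinner H (ev (shift (adj H (S a)) {#} f) (add_mset a m)) (ev g (add_mset a m))
   - cinner H (ev f m) (ev (modelR a g) m)) \<longlongrightarrow> 0) mset_top"
  unfolding * .
 moreover have "((\<lambda>m. cinner H (ev (shift (adj H (S a)) {#} f) (add_mset a m)) (ev g (add_mset a m))
   - cinner H (ev f m) (ev (modelR a g) m)) \<longlongrightarrow> cinner model (shift (adj H (S a)) {#} f) g - cinner model f (modelR a g)) mset_top"
  by (intro tendsto_diff cinner_model_tendsto f M.bop_closed[OF modelR_BL[OF a] g]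
    filterlim_compose[OF cinner_model_tendsto[OF shift_closed[OF SA f] g] filterlim_mset_top_add_mset])
 ultimately have "cinner model (shift (adj H (S a)) {#} f) g - cinner model f (modelR a g) = 0"
  using tendsto_unique[OF mset_top_neq_bot] by blast
 then show "cinner model (shift (adj H (S a)) {#} f) g = cinner model f (modelR a g)" by simp
qed

lemma model_commute:
 assumes a: "a \<in> \<Lambda>" and b: "b \<in> \<Lambda>"
 shows "modelR a \<otimes>\<^bsub>BL model\<^esub> modelR b = modelR b \<otimes>\<^bsub>BL model\<^esub> modelR a"
  "modelR a \<otimes>\<^bsub>BL model\<^esub> modelU b = modelU b \<otimes>\<^bsub>BL model\<^esub> modelR a"
  "modelU a \<otimes>\<^bsub>BL model\<^esub> modelU b = modelU b \<otimes>\<^bsub>BL model\<^esub> modelU a"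
proof -
 note SA = adj_S_adj_commutant[OF a] and SB = adj_S_adj_commutant[OF b]
 have "adj H (S a) \<otimes>\<^bsub>BL H\<^esub> adj H (S b) = adj H (S b) \<otimes>\<^bsub>BL H\<^esub> adj H (S a)"
  using adj_mult[OF S_closed[OF a] S_closed[OF b]] adj_mult[OF S_closed[OF b] S_closed[OF a]]
  unfolding S_commute[OF a b] by (rule trans[OF sym, rotated])
 from shift_commute[OF SA SB this]
 show "modelR a \<otimes>\<^bsub>BL model\<^esub> modelR b = modelR b \<otimes>\<^bsub>BL model\<^esub> modelR a" unfolding modelR_def .
 have "adj H (S a) \<otimes>\<^bsub>BL H\<^esub> \<one>\<^bsub>BL H\<^esub> = \<one>\<^bsub>BL H\<^esub> \<otimes>\<^bsub>BL H\<^esub> adj H (S a)"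
  using adj_closed[OF S_closed[OF a]] by simp
 from shift_commute[OF SA one_adj_commutant this]
 show "modelR a \<otimes>\<^bsub>BL model\<^esub> modelU b = modelU b \<otimes>\<^bsub>BL model\<^esub> modelR a" unfolding modelR_def modelU_def .
 show "modelU a \<otimes>\<^bsub>BL model\<^esub> modelU b = modelU b \<otimes>\<^bsub>BL model\<^esub> modelU a"
  unfolding modelU_def by (rule shift_commute[OF one_adj_commutant one_adj_commutant]) (rule refl)
qed

lemma model_Gamma_unitary:
 assumes a: "a \<in> \<Lambda>"
 shows "\<Gamma>_unitary model (modelR a) (modelU a)"
proof (rule M.Gamma_unitaryI[OF modelR_BL[OF a] modelU_BL model_commute(2)[OF a a] modelU_unitary[OF a]])
 note SA = adj_S_adj_commutant[OF a]
 show "modelR a = adj model (modelR a) \<otimes>\<^bsub>BL model\<^esub> modelU a"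
  unfolding adj_modelR[OF a]
  by (rule shift_eqI)
    (simp_all add: modelR_BL a shift_BL[OF SA] modelU_BL M.bop_closed[OF modelU_BL] ev_modelU, simp add: modelR_def)
 show "op_norm model (modelR a) \<le> 2"
  using op_norm_shift[OF SA, of "{#a#}"] S_norm[OF a] S_closed[OF a] by (simp add: modelR_def)
qed

lemma modelJ_compatible: "h \<in> carrier H \<Longrightarrow> (\<lambda>m. mpow H \<Lambda> P m h) \<in> compatible"
 by (rule compatibleI[where b = "hnorm H h"])
   (simp_all add: mpow_add_mset total_op_def adj_P_P hnorm_mpow)

lemma ev_modelJ [simp]: "ev (modelJ h) m = mpow H \<Lambda> P m h"
 by (simp add: modelJ_def)

lemma modelJ_closed: "h \<in> carrier H \<Longrightarrow> modelJ h \<in> carrier model"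
 by (simp add: modelJ_def mk_closed modelJ_compatible)

lemma modelJ_isometric: "isometric_embedding H model modelJ"
 unfolding isometric_embedding_def
proof (intro conjI ballI allI)
 show "modelJ \<in> carrier H \<rightarrow> carrier model" by (simp add: modelJ_closed)
 fix x assume x: "x \<in> carrier H"
 show "modelJ (c \<odot> x) = c \<odot>\<^bsub>model\<^esub> modelJ x" for c
  by (rule model_eqI) (simp_all add: x modelJ_closed)
 fix y assume y: "y \<in> carrier H"
 show "modelJ (x \<oplus> y) = modelJ x \<oplus>\<^bsub>model\<^esub> modelJ y"
  by (rule model_eqI) (simp_all add: x y modelJ_closed)
 show "cinner model (modelJ x) (modelJ y) = cinner H x y"
 proof (rule cinner_model_eqI[OF modelJ_closed[OF x] modelJ_closed[OF y]])
  have "cinner H (mpow H \<Lambda> P m x) (mpow H \<Lambda> P m y) = cinner H x y" for m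
   using cinner_compatible_mpow[OF modelJ_compatible[OF x] y, of "{#}" m] by simp
  then show "((\<lambda>m. cinner H (ev (modelJ x) m) (ev (modelJ y) m)) \<longlongrightarrow> cinner H x y) mset_top" by simp
 qed
qed

lemma model_extends:
 assumes a: "a \<in> \<Lambda>"
 shows "extends_op H modelJ (modelR a) (S a)" "extends_op H modelJ (modelU a) (P a)"
proof -
 note [simp] = bop_closed[OF P_closed[OF a]] bop_closed[OF S_closed[OF a]]
 have *: "adj H (S a) (mpow H \<Lambda> P (add_mset a m) h) = mpow H \<Lambda> P m (S a h)" if h: "h \<in> carrier H" for h m
 proof -
  have "adj H (S a) (P a (mpow H \<Lambda> P m h)) = S a (mpow H \<Lambda> P m h)"
   using fun_cong[OF S_P[OF a], of "mpow H \<Lambda> P m h"] h by simp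
  also have "\<dots> = mpow H \<Lambda> P m (S a h)"
   by (rule mpow_intertwine[OF commuting_family_axioms commuting_family_axioms])
     (simp_all add: h commuteD[OF S_P_commute[OF a]])
  finally show ?thesis using h a by (simp add: mpow_add_mset total_op_def)
 qed
 show "extends_op H modelJ (modelR a) (S a)"
  unfolding extends_op_def
 proof
  fix h assume h: "h \<in> carrier H"
  show "modelR a (modelJ h) = modelJ (S a h)"
  proof (rule model_eqI)
   show "ev (modelR a (modelJ h)) m = ev (modelJ (S a h)) m" for m
    using *[OF h, of m] by (simp add: modelR_def modelJ_closed h)
  qed (simp_all add: h modelJ_closed M.bop_closed[OF modelR_BL[OF a]])
 qed
 show "extends_op H modelJ (modelU a) (P a)"
  unfolding extends_op_def
 proof
  fix h assume h: "h \<in> carrier H"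
  show "modelU a (modelJ h) = modelJ (P a h)"
   by (rule model_eqI) (simp_all add: h a modelJ_closed M.bop_closed[OF modelU_BL] ev_modelU mpow_add_mset' total_op_def)
 qed
qed

sublocale MU: commuting_family model \<Lambda> modelU
 by unfold_locales (simp_all add: modelU_BL model_commute)

lemma ev_mpow_modelU: "f \<in> carrier model \<Longrightarrow> ev (mpow model \<Lambda> modelU n f) m = ev f (n + m)"
proof (induction n arbitrary: m)
 case (add a n)
 show ?case
 proof (cases "a \<in> \<Lambda>")
  case True
  then show ?thesis using add by (simp add: MU.mpow_add_mset total_op_def ev_modelU)
 next
  case False
  then show ?thesis
   using add compatibleD(3)[OF ev_compatible[OF add.prems] False] by (simp add: MU.mpow_add_mset total_op_def)
 qed
qed simp

text \<open>Once the squared norm of ev f m is within (e/2)^2 of its limit,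
  \<open>compatible_defect\<close> bounds the difference of U^m f and J (ev f m) at all exponents
  simultaneously.\<close>

lemma model_approx:
 assumes f: "f \<in> carrier model" and e: "e > 0"
 shows "\<exists>m. hnorm model (mpow model \<Lambda> modelU m f \<ominus>\<^bsub>model\<^esub> modelJ (ev f m)) < e"
proof -
 have "((\<lambda>m. (hnorm H (ev f m))\<^sup>2) \<longlongrightarrow> (hnorm model f)\<^sup>2) mset_top"
  by (intro tendsto_intros hnorm_model_tendsto f)
 then have "eventually (\<lambda>m. (hnorm model f)\<^sup>2 - (e / 2)\<^sup>2 < (hnorm H (ev f m))\<^sup>2) mset_top"
  by (rule order_tendstoD) (use e in simp)
 then obtain m where "\<forall>n. m \<subseteq># n \<longrightarrow> (hnorm model f)\<^sup>2 - (e / 2)\<^sup>2 < (hnorm H (ev f n))\<^sup>2"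
  unfolding eventually_mset_top by blast
 from this[rule_format, OF subset_mset.order_refl]
 have m: "(hnorm model f)\<^sup>2 - (hnorm H (ev f m))\<^sup>2 \<le> (e / 2)\<^sup>2" by linarith
 have "hnorm model (mpow model \<Lambda> modelU m f \<ominus>\<^bsub>model\<^esub> modelJ (ev f m)) \<le> e / 2"
 proof (rule hnorm_model_le)
  show "mpow model \<Lambda> modelU m f \<ominus>\<^bsub>model\<^esub> modelJ (ev f m) \<in> carrier model"
   using f by (simp add: modelJ_closed)
  fix n
  have "(hnorm H (ev f (m + n) \<ominus> mpow H \<Lambda> P n (ev f m)))\<^sup>2 \<le> (e / 2)\<^sup>2"
   using compatible_defect[OF ev_compatible[OF f], of m n] m
    power_mono[OF hnorm_ev_le[OF f, of "m + n"] hnorm_nonneg[OF ev_closed[OF f]], of 2] by linarith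
  then have "hnorm H (ev f (m + n) \<ominus> mpow H \<Lambda> P n (ev f m)) \<le> e / 2"
   by (rule power2_le_imp_le) (use e in simp)
  then show "hnorm H (ev (mpow model \<Lambda> modelU m f \<ominus>\<^bsub>model\<^esub> modelJ (ev f m)) n) \<le> e / 2"
   using f by (simp add: modelJ_closed ev_mpow_modelU)
 qed
 then show ?thesis using e by (intro exI[of _ m]) linarith
qed

text \<open>By \<open>model_approx\<close> every f is a limit of vectors U^-m J h. These lie in M,
  since M is invariant under the adjoints of the U_a, which are their inverses.\<close>

lemma model_minimal:
 assumes M: "closed_subspace model M" and J: "modelJ ` carrier H \<subseteq> M"
  and red: "\<And>T. T \<in> family_ops \<Lambda> modelR modelU \<Longrightarrow> reducing model T M"
 shows "M = carrier model"
proof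
 note MD = M.closed_subspaceD[OF M]
 show "M \<subseteq> carrier model" by (rule MD(1))
 have inverse: "\<exists>k\<in>M. mpow model \<Lambda> modelU m k = x" if "x \<in> M" for m x
  using that
 proof (induction m arbitrary: x)
  case (add a m)
  then obtain k where k: "k \<in> M" "mpow model \<Lambda> modelU m k = x" by blast
  then have kc: "k \<in> carrier model" using MD(1) by blast
  show ?case
  proof (cases "a \<in> \<Lambda>")
   case True
   then have "adj model (modelU a) k \<in> M"
    using red[of "modelU a"] k(1) unfolding family_ops_def reducing_def by blast
   moreover have "modelU a (adj model (modelU a) k) = k"
    using fun_cong[OF modelU_unitary(2)[OF True], of k] kc by simp
   moreover have "adj model (modelU a) k \<in> carrier model" using MD(1) calculation(1) by blast
   ultimately show ?thesis
    using k(2) True by (intro bexI[of _ "adj model (modelU a) k"]) (simp_all add: MU.mpow_add_mset' total_op_def)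
  next
   case False
   then show ?thesis using k by (intro bexI[of _ k]) (simp_all add: MU.mpow_add_mset' total_op_def)
  qed
 qed simp
 show "carrier model \<subseteq> M"
 proof
  fix f assume f: "f \<in> carrier model"
  have "\<forall>n. \<exists>k. k \<in> M \<and> hnorm model (k \<ominus>\<^bsub>model\<^esub> f) \<le> inverse (real (Suc n))"
  proof
   fix n
   obtain m where m: "hnorm model (mpow model \<Lambda> modelU m f \<ominus>\<^bsub>model\<^esub> modelJ (ev f m)) < inverse (real (Suc n))"
    using model_approx[OF f, of "inverse (real (Suc n))"] by auto
   obtain k where k: "k \<in> M" "mpow model \<Lambda> modelU m k = modelJ (ev f m)"
    using inverse[of "modelJ (ev f m)" m] J ev_closed[OF f] by blast
   have kc: "k \<in> carrier model" using MD(1) k(1) by blast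
   have "mpow model \<Lambda> modelU m (f \<ominus>\<^bsub>model\<^esub> k) = mpow model \<Lambda> modelU m f \<ominus>\<^bsub>model\<^esub> modelJ (ev f m)"
    using f kc k(2) by simp
   moreover have "hnorm model (mpow model \<Lambda> modelU m (f \<ominus>\<^bsub>model\<^esub> k)) = hnorm model (f \<ominus>\<^bsub>model\<^esub> k)"
    by (rule MU.mpow_hnorm) (use f kc M.unitary_hnorm[OF modelU_BL modelU_unitary(1)] in simp_all)
   ultimately have "hnorm model (f \<ominus>\<^bsub>model\<^esub> k) \<le> inverse (real (Suc n))" using m by simp
   then show "\<exists>k. k \<in> M \<and> hnorm model (k \<ominus>\<^bsub>model\<^esub> f) \<le> inverse (real (Suc n))"
    using k(1) M.hnorm_minus_commute[OF f kc] by metis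
  qed
  from choice[OF this] obtain v where v: "\<And>n. v n \<in> M" "\<And>n. hnorm model (v n \<ominus>\<^bsub>model\<^esub> f) \<le> inverse (real (Suc n))"
   by blast
  have vc: "v n \<in> carrier model" for n using v(1) MD(1) by blast
  show "f \<in> M"
  proof (rule MD(5)[OF v(1) f])
   show "(\<lambda>n. hnorm model (v n \<ominus>\<^bsub>model\<^esub> f)) \<longlonglongrightarrow> 0"
    by (rule tendsto_sandwich[OF _ _ tendsto_const LIMSEQ_inverse_real_of_nat]) (use v(2) vc f in simp_all)
  qed
 qed
qed

theorem model_extension: "minimal_\<Gamma>_unitary_extension H \<Lambda> S P model modelJ modelR modelU"
 unfolding minimal_\<Gamma>_unitary_extension_def
proof (intro conjI ballI allI impI)
 show "hilbert_space model" by (rule model_hilbert)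
 show "commuting_ops model (family_ops \<Lambda> modelR modelU)"
  unfolding commuting_ops_def family_ops_def using model_commute by fastforce
 show "M = carrier model" if "closed_subspace model M \<and> modelJ ` carrier H \<subseteq> M \<and>
   (\<forall>T\<in>family_ops \<Lambda> modelR modelU. reducing model T M)" for M
  by (rule model_minimal) (use that in auto)
qed (simp_all add: modelJ_isometric model_Gamma_unitary model_extends)

end

section \<open>From the spectral definitions to the locales, and the theorem\<close>

lemma Gamma_isometryD:
 assumes G: "\<Gamma>_isometry TYPE('n) H S P"
 shows "S \<in> \<B> H" "P \<in> \<B> H" "adj H P \<otimes>\<^bsub>BL H\<^esub> P = \<one>\<^bsub>BL H\<^esub>"
  "S = adj H S \<otimes>\<^bsub>BL H\<^esub> P" "op_norm H S \<le> 2"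
proof -
 obtain N :: "'n hilb" and J R U where N: "isometric_embedding H N J" "\<Gamma>_unitary N R U"
   "extends_op H J R S" "extends_op H J U P"
  using G unfolding \<Gamma>_isometry_def by blast
 interpret hilbert_space H using G unfolding \<Gamma>_isometry_def by blast
 interpret N: hilbert_space N using N(2) unfolding \<Gamma>_unitary_def by blast
 interpret isometric_pair H N J by unfold_locales (rule N(1))
 show S: "S \<in> \<B> H" and P: "P \<in> \<B> H" using G unfolding \<Gamma>_isometry_def by blast+
 note U = N.Gamma_unitaryD[OF N(2)]
 note [simp] = bop_rules[OF S] bop_rules[OF P] bop_rules[OF adj_closed[OF S]] bop_rules[OF adj_closed[OF P]]
  N.bop_rules[OF U(1)] N.bop_rules[OF U(2)]
 have RJ: "J (S h) = R (J h)" and UJ: "J (P h) = U (J h)" if "h \<in> carrier H" for h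
  using N(3,4) that unfolding extends_op_def by simp_all
 show "adj H P \<otimes>\<^bsub>BL H\<^esub> P = \<one>\<^bsub>BL H\<^esub>"
 proof (rule bop_cinner_eqI)
  fix x y assume x: "x \<in> carrier H" and y: "y \<in> carrier H"
  have "cinner H (P x) (P y) = cinner N (U (J x)) (U (J y))"
   using cinner_J[of "P x" "P y"] x y UJ by simp
  also have "\<dots> = cinner N ((adj N U \<otimes>\<^bsub>BL N\<^esub> U) (J x)) (J y)" using x y U(2) by simp
  also have "\<dots> = cinner H x y" unfolding U(4) using x y by simp
  finally show "cinner H ((adj H P \<otimes>\<^bsub>BL H\<^esub> P) x) y = cinner H (\<one>\<^bsub>BL H\<^esub> x) y" using x y P by simp
 qed (use P in simp_all)
 show "S = adj H S \<otimes>\<^bsub>BL H\<^esub> P"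
 proof (rule bop_cinner_eqI)
  fix x y assume x: "x \<in> carrier H" and y: "y \<in> carrier H"
  \<comment> \<open>The chain is <S x, y> = <R^* U J x, J y> = <U J x, R J y> = <P x, S y>.\<close>
  have "cinner H (S x) y = cinner N (R (J x)) (J y)"
   using cinner_J[of "S x" y] x y RJ by simp
  also have "R (J x) = (adj N R \<otimes>\<^bsub>BL N\<^esub> U) (J x)" by (rule fun_cong[OF U(6)])
  also have "cinner N \<dots> (J y) = cinner N (U (J x)) (R (J y))" using x y U(1) by simp
  also have "\<dots> = cinner H (P x) (S y)"
   using cinner_J[of "P x" "S y"] x y RJ UJ by simp
  finally show "cinner H (S x) y = cinner H ((adj H S \<otimes>\<^bsub>BL H\<^esub> P) x) y" using x y S by simp
 qed (use S P in simp_all)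
 show "op_norm H S \<le> 2"
 proof (rule op_norm_le)
  fix x assume x: "x \<in> carrier H"
  have "hnorm H (S x) = hnorm N (R (J x))" using hnorm_J[of "S x"] x RJ by simp
  also have "\<dots> \<le> op_norm N R * hnorm N (J x)" by (rule N.op_norm_bound[OF U(1)]) (use x in simp)
  also have "\<dots> \<le> 2 * hnorm N (J x)" by (rule mult_right_mono[OF U(7)]) (use x in simp)
  finally show "hnorm H (S x) \<le> 2 * hnorm H x" using x by simp
 qed simp
qed

lemma gamma_extensionI:
 assumes iso: "\<And>a. a \<in> \<Lambda> \<Longrightarrow> \<Gamma>_isometry TYPE('n) H (S a) (P a)"
  and H: "hilbert_space H" and comm: "commuting_ops H (family_ops \<Lambda> S P)"
  and ext: "minimal_\<Gamma>_unitary_extension H \<Lambda> S P K J R U"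
 shows "gamma_extension H K J \<Lambda> S P R U"
proof -
 have K: "hilbert_space K" and J: "isometric_embedding H K J"
  and RU: "\<And>a. a \<in> \<Lambda> \<Longrightarrow> \<Gamma>_unitary K (R a) (U a)" and cK: "commuting_ops K (family_ops \<Lambda> R U)"
  and e: "\<And>a. a \<in> \<Lambda> \<Longrightarrow> extends_op H J (R a) (S a)" "\<And>a. a \<in> \<Lambda> \<Longrightarrow> extends_op H J (U a) (P a)"
  and min: "\<And>M. closed_subspace K M \<Longrightarrow> J ` carrier H \<subseteq> M \<Longrightarrow>
   \<forall>T\<in>family_ops \<Lambda> R U. reducing K T M \<Longrightarrow> M = carrier K"
  using ext unfolding minimal_\<Gamma>_unitary_extension_def by blast+
 interpret hilbert_space H by (rule H)
 interpret K: hilbert_space K by (rule K)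
 interpret isometric_pair H K J by unfold_locales (rule J)
 show ?thesis
 proof unfold_locales
  fix a assume a: "a \<in> \<Lambda>"
  note G = Gamma_isometryD[OF iso[OF a]] and V = K.Gamma_unitaryD[OF RU[OF a]]
  show "S a \<in> \<B> H" "P a \<in> \<B> H" "adj H (P a) \<otimes>\<^bsub>BL H\<^esub> P a = \<one>\<^bsub>BL H\<^esub>"
   "S a = adj H (S a) \<otimes>\<^bsub>BL H\<^esub> P a" by (rule G)+
  show "R a \<in> \<B> K" "U a \<in> \<B> K" "adj K (U a) \<otimes>\<^bsub>BL K\<^esub> U a = \<one>\<^bsub>BL K\<^esub>"
   "U a \<otimes>\<^bsub>BL K\<^esub> adj K (U a) = \<one>\<^bsub>BL K\<^esub>" "R a = adj K (R a) \<otimes>\<^bsub>BL K\<^esub> U a" by (rule V)+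
  show "R a (J h) = J (S a h)" "U a (J h) = J (P a h)" if "h \<in> carrier H" for h
   using e[OF a] that unfolding extends_op_def by blast+
 next
  show "M = carrier K" if "closed_subspace K M" "J ` carrier H \<subseteq> M"
   "\<And>T. T \<in> family_ops \<Lambda> R U \<Longrightarrow> reducing K T M" for M
   by (rule min) (use that in blast)+
 qed (rule comm, rule cK)
qed

lemma minimal_extension_exists:
 fixes H :: "'h hilb" and \<Lambda> :: "'i set"
 assumes iso: "\<And>a. a \<in> \<Lambda> \<Longrightarrow> \<Gamma>_isometry TYPE('n) H (S a) (P a)"
  and H: "hilbert_space H" and comm: "commuting_ops H (family_ops \<Lambda> S P)"
 shows "\<exists>(K :: (('i \<times> int) list \<Rightarrow> 'h) hilb) J R U. minimal_\<Gamma>_unitary_extension H \<Lambda> S P K J R U"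
proof -
 interpret hilbert_space H by (rule H)
 have c: "S a \<otimes>\<^bsub>BL H\<^esub> S b = S b \<otimes>\<^bsub>BL H\<^esub> S a" "S a \<otimes>\<^bsub>BL H\<^esub> P b = P b \<otimes>\<^bsub>BL H\<^esub> S a"
  "P a \<otimes>\<^bsub>BL H\<^esub> P b = P b \<otimes>\<^bsub>BL H\<^esub> P a" if "a \<in> \<Lambda>" "b \<in> \<Lambda>" for a b
  using comm that unfolding commuting_ops_def family_ops_def by blast+
 \<comment> \<open>Sending a word to the multiset of its letters is surjective, which places the
   model in the required type of functions on words.\<close>
 let ?\<mu> = "\<lambda>w :: ('i \<times> int) list. mset (map fst w)"
 interpret gamma_model H \<Lambda> P S ?\<mu>
 proof unfold_locales
  fix a assume a: "a \<in> \<Lambda>"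
  note G = Gamma_isometryD[OF iso[OF a]]
  show "S a \<in> \<B> H" "P a \<in> \<B> H" "adj H (P a) \<otimes>\<^bsub>BL H\<^esub> P a = \<one>\<^bsub>BL H\<^esub>"
   "S a = adj H (S a) \<otimes>\<^bsub>BL H\<^esub> P a" "op_norm H (S a) \<le> 2" by (rule G)+
  fix b assume b: "b \<in> \<Lambda>"
  show "S a \<otimes>\<^bsub>BL H\<^esub> S b = S b \<otimes>\<^bsub>BL H\<^esub> S a" "S a \<otimes>\<^bsub>BL H\<^esub> P b = P b \<otimes>\<^bsub>BL H\<^esub> S a"
   "P a \<otimes>\<^bsub>BL H\<^esub> P b = P b \<otimes>\<^bsub>BL H\<^esub> P a" by (rule c[OF a b])+
 next
  show "surj ?\<mu>"
  proof (rule surjI[of _ "\<lambda>m. map (\<lambda>a. (a, 0)) (SOME l. mset l = m)"])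
   show "?\<mu> (map (\<lambda>a. (a, 0)) (SOME l. mset l = m)) = m" for m
    using someI_ex[OF ex_mset[of m]] by (simp add: comp_def)
  qed
 qed
 show ?thesis using model_extension by blast
qed

theorem theorem5:
  fixes H :: "'h hilb" and \<Lambda> :: "'i set" and S P :: "'i \<Rightarrow> 'h \<Rightarrow> 'h"
  assumes "hilbert_space H"
    and "\<And>\<alpha>. \<alpha> \<in> \<Lambda> \<Longrightarrow> \<Gamma>_isometry TYPE('n) H (S \<alpha>) (P \<alpha>)"
    and "commuting_ops H (family_ops \<Lambda> S P)"
  shows
    "(\<exists>(K :: (('i \<times> int) list \<Rightarrow> 'h) hilb) J R U.
        minimal_\<Gamma>_unitary_extension H \<Lambda> S P K J R U) \<and>
     (\<forall>(K :: 'k hilb) J R U. minimal_\<Gamma>_unitary_extension H \<Lambda> S P K J R U \<longrightarrow>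
        carrier K = closed_linear_span K
          {word_op K U w (J h) |w h. h \<in> carrier H \<and> fst ` set w \<subseteq> \<Lambda>} \<and>
        (\<forall>T\<in>carrier (BL H).
          T \<in> commutant H (family_ops \<Lambda> S P) \<longleftrightarrow>
          (\<exists>!Y. Y \<in> carrier (BL K) \<and> extends_op H J Y T \<and> op_norm K Y = op_norm H T \<and>
                Y \<in> commutant K (family_ops \<Lambda> R U))) \<and>
        (\<forall>T\<in>carrier (BL H).
          T \<in> Toeplitz_ops H \<Lambda> S P \<longleftrightarrow>
          (\<exists>Y\<in>commutant K (vN_algebra K (family_ops \<Lambda> R U)).
             \<forall>h\<in>carrier H. J (T h) = orth_proj K (J ` carrier H) (Y (J h)))) \<and>
        (let CF = Cstar H (family_ops \<Lambda> S P);
             CG = Cstar K (family_ops \<Lambda> R U);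
             canonical = (\<lambda>\<pi>. unital_star_hom H CF K CG \<pi> \<and>
                            (\<forall>\<alpha>\<in>\<Lambda>. \<pi> (P \<alpha>) = U \<alpha> \<and> \<pi> (S \<alpha>) = R \<alpha>))
         in \<exists>\<pi>\<^sub>0. canonical \<pi>\<^sub>0 \<and>
              (\<forall>\<pi>. canonical \<pi> \<longrightarrow> (\<forall>T\<in>CF. \<pi> T = \<pi>\<^sub>0 T)) \<and>
              a_kernel (subalg H CF) (subalg K CG) \<pi>\<^sub>0 = commutator_ideal H \<Lambda> S P \<and>
              \<pi>\<^sub>0 ` CF = CG \<and>
              (\<exists>\<rho>\<^sub>0. completely_isometric_linear K CG H CF \<rho>\<^sub>0 \<and>
                    (\<forall>T\<in>CG. \<pi>\<^sub>0 (\<rho>\<^sub>0 T) = T))))"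
proof (intro conjI allI impI)
 show "\<exists>(K :: (('i \<times> int) list \<Rightarrow> 'h) hilb) J R U. minimal_\<Gamma>_unitary_extension H \<Lambda> S P K J R U"
  by (rule minimal_extension_exists[OF assms(2,1,3)])
 \<comment> \<open>From here on K is any minimal extension in an arbitrary type, not just the
   model.\<close>
 fix K :: "'k hilb" and J R U
 assume "minimal_\<Gamma>_unitary_extension H \<Lambda> S P K J R U"
 from gamma_extensionI[OF assms(2,1,3) this] interpret gamma_extension H K J \<Lambda> S P R U .
 show "carrier K = closed_linear_span K
   {word_op K U w (J h) |w h. h \<in> carrier H \<and> fst ` set w \<subseteq> \<Lambda>}" by (rule carrier_eq_span)
 show "\<forall>T\<in>\<B> H. T \<in> commutant H (family_ops \<Lambda> S P) \<longleftrightarrow>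
   (\<exists>!Y. Y \<in> \<B> K \<and> extends_op H J Y T \<and> op_norm K Y = op_norm H T \<and>
    Y \<in> commutant K (family_ops \<Lambda> R U))"
  by (rule ballI) (rule commutant_iff)
 show "\<forall>T\<in>\<B> H. T \<in> Toeplitz_ops H \<Lambda> S P \<longleftrightarrow>
   (\<exists>Y\<in>commutant K (vN_algebra K (family_ops \<Lambda> R U)).
    \<forall>h\<in>carrier H. J (T h) = orth_proj K (J ` carrier H) (Y (J h)))"
  by (rule ballI) (rule Toeplitz_iff_compression)
 show "let CF = Cstar H (family_ops \<Lambda> S P);
      CG = Cstar K (family_ops \<Lambda> R U);
      canonical = (\<lambda>\<pi>. unital_star_hom H CF K CG \<pi> \<and>
             (\<forall>\<alpha>\<in>\<Lambda>. \<pi> (P \<alpha>) = U \<alpha> \<and> \<pi> (S \<alpha>) = R \<alpha>))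
    in \<exists>\<pi>\<^sub>0. canonical \<pi>\<^sub>0 \<and>
      (\<forall>\<pi>. canonical \<pi> \<longrightarrow> (\<forall>T\<in>CF. \<pi> T = \<pi>\<^sub>0 T)) \<and>
      a_kernel (subalg H CF) (subalg K CG) \<pi>\<^sub>0 = commutator_ideal H \<Lambda> S P \<and>
      \<pi>\<^sub>0 ` CF = CG \<and>
      (\<exists>\<rho>\<^sub>0. completely_isometric_linear K CG H CF \<rho>\<^sub>0 \<and>
         (\<forall>T\<in>CG. \<pi>\<^sub>0 (\<rho>\<^sub>0 T) = T))"
  unfolding Let_def
 proof (intro exI[of _ pi0] exI[of _ compress] conjI allI impI ballI)
  show "\<pi> T = pi0 T" if "unital_star_hom H CF K CG \<pi> \<and> (\<forall>\<alpha>\<in>\<Lambda>. \<pi> (P \<alpha>) = U \<alpha> \<and> \<pi> (S \<alpha>) = R \<alpha>)" "T \<in> CF" for \<pi> T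
   by (rule pi0_unique) (use that in auto)
  show "pi0 (compress T) = T" if "T \<in> CG" for T by (rule pi0_compress[OF that compress_CF[OF that]])
 qed (rule pi0_hom pi0_gens kernel_pi0 pi0_image compress_completely_isometric | assumption)+
qed

end
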